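(* Let $R$ be a ring with CL-FFRT, with integers $a\ge 0$, $b>0$ and notation fixed as in the context. Then the two functors $$\mathcal{D}\text{-mod}\longrightarrow \mathcal{D}^{(0)}\text{-}\Phi\text{-divmod},\qquad M\mapsto(\mathcal{C}^e(M),\alpha_e)_{e\ge 0},$$ $$\mathcal{D}^{(0)}\text{-}\Phi\text{-divmod}\longrightarrow\mathcal{D}\text{-mod},\qquad (M_e,\alpha_e)_{e\ge 0}\mapsto M_0,$$ described in the context are mutually inverse (up to natural isomorphism), and hence give a natural equivalence between the category of left $\mathcal{D}$-modules and the category of $\Phi$-divided left $\mathcal{D}^{(0)}$-modules.
   Context: Let $p$ be a prime. For a commutative ring $R$ of characteristic $p$, an $R$-module $M$ and $e\ge 0$, $F^e_*M$ denotes the abelian group $M$ with the $R$-module structure $x\cdot u=x^{p^e}u$. A commutative ring $R$ of characteristic $p$ is $F$-finite if it is Noetherian and $F_*R=F^1_*R$ is a finitely generated $R$-module. For a complete Noetherian local ring $S$ and a finitely generated $S$-module $M$, $\mathcal{J}(M)$ denotes the finite set of isomorphism classes of indecomposable $S$-modules occurring in the (Krull–Schmidt) decomposition of $M$ into indecomposables. A complete local $F$-finite ring $S$ has FFRT if $\bigcup_{e\ge 0}\mathcal{J}(F^e_*S)$ is finite. A ring $R$ has CL-FFRT if it is $F$-finite and for every prime $\mathfrak p\subseteq R$ the completion $\widehat{R}_{\mathfrak p}$ of the local ring $R_{\mathfrak p}$ has FFRT. Setup. $R$ is a ring with CL-FFRT, and integers $a\ge 0$, $b>0$ are fixed such that for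 every prime $\mathfrak p$ of $R$ one has $\mathcal{J}(F^a_*\widehat{R}_{\mathfrak p})=\mathcal{J}(F^{a+b}_*\widehat{R}_{\mathfrak p})=\mathcal{J}(F^{a+2b}_*\widehat{R}_{\mathfrak p})=\cdots$ (such integers exist). Write $F^{(e)}_*R:=F^{a+eb}_*R$ and $\mathcal{D}^{(e)}:=\operatorname{End}_R(F^{(e)}_*R)$. Each $\operatorname{Hom}_R(F^i_*R,F^j_*R)$ is regarded as a subset of $\operatorname{End}_{\mathbb Z}(R)$, so that composition makes sense; in particular $\mathcal{D}^{(0)}\subseteq\mathcal{D}^{(1)}\subseteq\cdots$. $\mathcal{D}$ is the ring of ($\mathbb{F}_p$-linear, Grothendieck) differential operators on $R$; since $R$ is $F$-finite, $\mathcal{D}=\bigcup_{e\ge0}\operatorname{End}_R(F^e_*R)=\bigcup_{e\ge0}\mathcal{D}^{(e)}$. For a ring $A$, $A$-mod is the category of left $A$-modules. Functors. For $e,s\ge 0$ let $\Phi^{s*}:\mathcal{D}^{(e)}\text{-mod}\to\mathcal{D}^{(e+s)}\text{-mod}$ be $\operatorname{Hom}_R(F^{(e)}_*R,F^{(e+s)}_*R)\otimes_{\mathcal{D}^{(e)}}(-)$ and $\mathcal{C}^s:\mathcal{D}^{(e+s)}\text{-mod}\to\mathcal{D}^{(e)}\text{-mod}$ be $\operatorname{Hom}_R(F^{(e+s)}_*R,F^{(e)}_*R)\otimes_{\mathcal{D}^{(e+s)}}(-)$, with $\Phi^*=\Phi^{1*}$, $\mathcal{C}=\mathcal{C}^1$.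 These are compatible, up to canonical isomorphism, with restriction of scalars along $\mathcal{D}^{(e)}\subseteq\mathcal{D}^{(e')}$ (e.g. $\theta\otimes d\mapsto\theta\circ d$ gives $\operatorname{Hom}_R(F^{(e)}_*R,F^{(0)}_*R)\otimes_{\mathcal{D}^{(e)}}\mathcal{D}^{(e+1)}\cong\operatorname{Hom}_R(F^{(e+1)}_*R,F^{(1)}_*R)$), and composition of maps induces canonical isomorphisms $\Phi^{t*}\circ\Phi^{s*}\cong\Phi^{(s+t)*}$, $\mathcal{C}^t\circ\mathcal{C}^s\cong\mathcal{C}^{s+t}$, $\Phi^{s*}\circ\mathcal{C}^s\cong\mathrm{id}$, $\mathcal{C}^s\circ\Phi^{s*}\cong\mathrm{id}$. $\Phi$-divided modules. A $\Phi$-divided left $\mathcal{D}^{(0)}$-module $(M_e,\alpha_e)_{e\ge0}$ consists of left $\mathcal{D}^{(0)}$-modules $M_0,M_1,\dots$ and, for each $e\ge0$, an isomorphism $\alpha_e:\Phi^*(M_{e+1})\to M_e$ of left $\mathcal{D}^{(0)}$-modules, where $\Phi^*(M_{e+1})$ is viewed as a $\mathcal{D}^{(0)}$-module by restriction from $\mathcal{D}^{(1)}$. A morphism $(M_e,\alpha_e)\to(N_e,\beta_e)$ is a family of $\mathcal{D}^{(0)}$-linear maps $\phi_e:M_e\to N_e$ with $\phi_e\circ\alpha_e=\beta_e\circ\Phi^*(\phi_{e+1})$ for all $e\ge 0$. This category is denoted $\mathcal{D}^{(0)}\text{-}\Phi\text{-divmod}$. The first functor. For a left $\mathcal{D}$-module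 $M$ and $e\ge0$, view $M$ as a $\mathcal{D}^{(e)}$-module and form the $\mathcal{D}^{(0)}$-module $\mathcal{C}^e(M)$; $\alpha_e:\Phi^*(\mathcal{C}^{e+1}(M))\to\mathcal{C}^e(M)$ is the canonical isomorphism $\Phi^*\mathcal{C}^{e+1}(M)\cong\Phi^*\mathcal{C}\,\mathcal{C}^e(M)\cong\mathcal{C}^e(M)$. A morphism $\phi$ is sent to $(\mathcal{C}^e(\phi))_{e}$. The second functor. Given $(M_e,\alpha_e)$, for each $e$ the map $\alpha_0\circ\Phi^*\alpha_1\circ\cdots\circ\Phi^{(e-1)*}\alpha_{e-1}$ is an isomorphism $\Phi^{e*}(M_e)\to M_0$, through which the left $\mathcal{D}^{(e)}$-module structure of $\Phi^{e*}(M_e)$ is transported to $M_0$; these structures are compatible as $e$ varies and make $M_0$ a left $\mathcal{D}$-module. A morphism $(\phi_e)_e$ is sent to $\phi_0$, which is $\mathcal{D}$-linear. *)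

theory Defs
  imports "HOL-Algebra.Algebra" "HOL-Library.Equipollence"
begin

section \<open>Linear maps, finite generation, Frobenius push-forward\<close>

text \<open>Maps between structures are extensional functions on the carrier, so that equality of
  functions is equality of maps.\<close>

definition additive_maps ::
  "('x, 'k) ring_scheme \<Rightarrow> ('y, 'l) ring_scheme \<Rightarrow> ('x \<Rightarrow> 'y) set" where
  "additive_maps M N =
     {f \<in> carrier M \<rightarrow>\<^sub>E carrier N.
        \<forall>x\<in>carrier M. \<forall>y\<in>carrier M. f (x \<oplus>\<^bsub>M\<^esub> y) = f x \<oplus>\<^bsub>N\<^esub> f y}"

definition lin_maps ::
  "('a, 'k) ring_scheme \<Rightarrow> ('a, 'x) module \<Rightarrow> ('a, 'y) module \<Rightarrow> ('x \<Rightarrow> 'y) set" where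
  "lin_maps A M N =
     {f \<in> additive_maps M N.
        \<forall>c\<in>carrier A. \<forall>x\<in>carrier M. f (c \<odot>\<^bsub>M\<^esub> x) = c \<odot>\<^bsub>N\<^esub> f x}"

definition lin_isos ::
  "('a, 'k) ring_scheme \<Rightarrow> ('a, 'x) module \<Rightarrow> ('a, 'y) module \<Rightarrow> ('x \<Rightarrow> 'y) set" where
  "lin_isos A M N = {f \<in> lin_maps A M N. bij_betw f (carrier M) (carrier N)}"

definition fin_gen_module :: "('a, 'k) ring_scheme \<Rightarrow> ('a, 'm) module \<Rightarrow> bool" where
  "fin_gen_module R M \<longleftrightarrow>
     (\<exists>B\<subseteq>carrier M. finite B \<and>
        (\<forall>m\<in>carrier M. \<exists>c\<in>B \<rightarrow> carrier R. m = (\<Oplus>\<^bsub>M\<^esub>v\<in>B. c v \<odot>\<^bsub>M\<^esub> v)))"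

definition has_characteristic :: "('a, 'k) ring_scheme \<Rightarrow> nat \<Rightarrow> bool" where
  "has_characteristic R p \<longleftrightarrow> (\<forall>n::nat. [n] \<cdot>\<^bsub>R\<^esub> \<one>\<^bsub>R\<^esub> = \<zero>\<^bsub>R\<^esub> \<longleftrightarrow> p dvd n)"

text \<open>\<open>F\<^sup>e\<^sub>*R\<close>: the additive group of \<open>R\<close> with \<open>x \<cdot> u = x\<^bsup>p\<^sup>e\<^esup> u\<close>.  (The fields \<open>mult\<close> and \<open>one\<close>
  of a \<open>module\<close> record play no role for modules.)\<close>

definition frob_push :: "('a, 'k) ring_scheme \<Rightarrow> nat \<Rightarrow> nat \<Rightarrow> ('a, 'a) module" where
  "frob_push R p e =
     \<lparr>carrier = carrier R, monoid.mult = monoid.mult R, one = one R, ring.zero = ring.zero R, add = add R,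
      smult = (\<lambda>x u. (x [^]\<^bsub>R\<^esub> (p ^ e)) \<otimes>\<^bsub>R\<^esub> u)\<rparr>"

definition F_finite :: "('a, 'k) ring_scheme \<Rightarrow> nat \<Rightarrow> bool" where
  "F_finite R p \<longleftrightarrow> noetherian_ring R \<and> fin_gen_module R (frob_push R p 1)"


section \<open>Krull--Schmidt classes and FFRT\<close>

definition internal_direct_sum ::
  "('a, 'k) ring_scheme \<Rightarrow> ('a, 'm) module \<Rightarrow> nat \<Rightarrow> (nat \<Rightarrow> 'm set) \<Rightarrow> bool" where
  "internal_direct_sum S M k N \<longleftrightarrow>
     (\<forall>i<k. submodule (N i) S M) \<and>
     (\<forall>x\<in>carrier M. \<exists>!f. f \<in> (\<Pi>\<^sub>E i\<in>{..<k}. N i) \<and> x = (\<Oplus>\<^bsub>M\<^esub>i\<in>{..<k}. f i))"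

definition indecomposable_module :: "('a, 'k) ring_scheme \<Rightarrow> ('a, 'm) module \<Rightarrow> bool" where
  "indecomposable_module S M \<longleftrightarrow>
     module S M \<and> carrier M \<noteq> {\<zero>\<^bsub>M\<^esub>} \<and>
     (\<forall>N N'. submodule N S M \<and> submodule N' S M \<and>
        N \<inter> N' = {\<zero>\<^bsub>M\<^esub>} \<and> N <+>\<^bsub>M\<^esub> N' = carrier M \<longrightarrow> N = {\<zero>\<^bsub>M\<^esub>} \<or> N' = {\<zero>\<^bsub>M\<^esub>})"

text \<open>Isomorphism classes are taken among modules whose elements have the type of those of the
  ambient module; this contains a copy of every direct summand.\<close>

definition iso_class :: "('a, 'k) ring_scheme \<Rightarrow> ('a, 'm) module \<Rightarrow> ('a, 'm) module set" where
  "iso_class S N = {L. module S L \<and> lin_isos S L N \<noteq> {}}"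

definition KS_classes :: "('a, 'k) ring_scheme \<Rightarrow> ('a, 'm) module \<Rightarrow> ('a, 'm) module set set" where
  "KS_classes S M =
     {iso_class S (M\<lparr>carrier := N i\<rparr>) | k N i.
        internal_direct_sum S M k N \<and>
        (\<forall>j<k. indecomposable_module S (M\<lparr>carrier := N j\<rparr>)) \<and> i < k}"

definition FFRT :: "('a, 'k) ring_scheme \<Rightarrow> nat \<Rightarrow> bool" where
  "FFRT S p \<longleftrightarrow> finite (\<Union>e. KS_classes S (frob_push S p e))"


section \<open>Localization and completion\<close>

definition fraction :: "('a, 'k) ring_scheme \<Rightarrow> 'a set \<Rightarrow> 'a \<Rightarrow> 'a \<Rightarrow> ('a \<times> 'a) set" where
  "fraction R U x s =
     {(y, t). y \<in> carrier R \<and> t \<in> U \<and>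
        (\<exists>u\<in>U. u \<otimes>\<^bsub>R\<^esub> (x \<otimes>\<^bsub>R\<^esub> t) = u \<otimes>\<^bsub>R\<^esub> (y \<otimes>\<^bsub>R\<^esub> s))}"

text \<open>In the ring operations the unions run over all representatives; as the classes involved
  all coincide, the union is that class.\<close>

definition localization :: "('a, 'k) ring_scheme \<Rightarrow> 'a set \<Rightarrow> ('a \<times> 'a) set ring" where
  "localization R U =
     \<lparr>carrier = {fraction R U x s | x s. x \<in> carrier R \<and> s \<in> U},
      monoid.mult = (\<lambda>V W. \<Union>v\<in>V. \<Union>w\<in>W.
               fraction R U (fst v \<otimes>\<^bsub>R\<^esub> fst w) (snd v \<otimes>\<^bsub>R\<^esub> snd w)),
      one = fraction R U \<one>\<^bsub>R\<^esub> \<one>\<^bsub>R\<^esub>,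
      ring.zero = fraction R U \<zero>\<^bsub>R\<^esub> \<one>\<^bsub>R\<^esub>,
      add = (\<lambda>V W. \<Union>v\<in>V. \<Union>w\<in>W.
               fraction R U (fst v \<otimes>\<^bsub>R\<^esub> snd w \<oplus>\<^bsub>R\<^esub> fst w \<otimes>\<^bsub>R\<^esub> snd v)
                 (snd v \<otimes>\<^bsub>R\<^esub> snd w))\<rparr>"

primrec ideal_power :: "('a, 'k) ring_scheme \<Rightarrow> 'a set \<Rightarrow> nat \<Rightarrow> 'a set" where
  "ideal_power S I 0 = carrier S"
| "ideal_power S I (Suc n) = I \<cdot>\<^bsub>S\<^esub> ideal_power S I n"

text \<open>The inverse limit of the rings \<open>S/I\<^sup>n\<close>.  The transition map sends a coset of \<open>I\<^bsup>n+1\<^esup>\<close> to the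
  unique coset of \<open>I\<^sup>n\<close> containing it.\<close>

definition adic_completion :: "('a, 'k) ring_scheme \<Rightarrow> 'a set \<Rightarrow> (nat \<Rightarrow> 'a set) ring" where
  "adic_completion S I =
     \<lparr>carrier = {x. \<forall>n. x n \<in> carrier (S Quot ideal_power S I n) \<and> x (Suc n) \<subseteq> x n},
      monoid.mult = (\<lambda>x y n. x n \<otimes>\<^bsub>S Quot ideal_power S I n\<^esub> y n),
      one = (\<lambda>n. \<one>\<^bsub>S Quot ideal_power S I n\<^esub>),
      ring.zero = (\<lambda>n. \<zero>\<^bsub>S Quot ideal_power S I n\<^esub>),
      add = (\<lambda>x y n. x n \<oplus>\<^bsub>S Quot ideal_power S I n\<^esub> y n)\<rparr>"

definition completed_local_ring ::
  "('a, 'k) ring_scheme \<Rightarrow> 'a set \<Rightarrow> (nat \<Rightarrow> ('a \<times> 'a) set set) ring" where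
  "completed_local_ring R P =
     adic_completion (localization R (carrier R - P))
       {fraction R (carrier R - P) x s | x s. x \<in> P \<and> s \<in> carrier R - P}"

definition CL_FFRT :: "('a, 'k) ring_scheme \<Rightarrow> nat \<Rightarrow> bool" where
  "CL_FFRT R p \<longleftrightarrow>
     F_finite R p \<and> (\<forall>P. primeideal P R \<longrightarrow> FFRT (completed_local_ring R P) p)"


section \<open>Rings of operators\<close>

definition op_add :: "('a, 'k) ring_scheme \<Rightarrow> ('a \<Rightarrow> 'a) \<Rightarrow> ('a \<Rightarrow> 'a) \<Rightarrow> 'a \<Rightarrow> 'a" where
  "op_add R \<theta> \<theta>' = (\<lambda>x\<in>carrier R. \<theta> x \<oplus>\<^bsub>R\<^esub> \<theta>' x)"

definition op_ring :: "('a, 'k) ring_scheme \<Rightarrow> ('a \<Rightarrow> 'a) set \<Rightarrow> ('a \<Rightarrow> 'a) ring" where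
  "op_ring R H =
     \<lparr>carrier = H, monoid.mult = compose (carrier R), one = (\<lambda>x\<in>carrier R. x),
      ring.zero = (\<lambda>x\<in>carrier R. \<zero>\<^bsub>R\<^esub>), add = op_add R\<rparr>"

text \<open>\<open>Hom\<^sub>R(F\<^bsup>(i)\<^esup>\<^sub>*R, F\<^bsup>(j)\<^esup>\<^sub>*R)\<close> with \<open>F\<^bsup>(e)\<^esup>\<^sub>*R = F\<^bsup>a+eb\<^esup>\<^sub>*R\<close>, a set of additive endomorphisms of \<open>R\<close>.\<close>

definition HomF ::
  "('a, 'k) ring_scheme \<Rightarrow> nat \<Rightarrow> nat \<Rightarrow> nat \<Rightarrow> nat \<Rightarrow> nat \<Rightarrow> ('a \<Rightarrow> 'a) set" where
  "HomF R p a b i j = lin_maps R (frob_push R p (a + i * b)) (frob_push R p (a + j * b))"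

abbreviation D_level ::
  "('a, 'k) ring_scheme \<Rightarrow> nat \<Rightarrow> nat \<Rightarrow> nat \<Rightarrow> nat \<Rightarrow> ('a \<Rightarrow> 'a) ring" where
  "D_level R p a b e \<equiv> op_ring R (HomF R p a b e e)"

text \<open>Grothendieck differential operators of order at most \<open>n\<close>.  Over the prime field, linear
  means additive.\<close>

definition op_commutator :: "('a, 'k) ring_scheme \<Rightarrow> ('a \<Rightarrow> 'a) \<Rightarrow> 'a \<Rightarrow> 'a \<Rightarrow> 'a" where
  "op_commutator R \<delta> r = (\<lambda>x\<in>carrier R. \<delta> (r \<otimes>\<^bsub>R\<^esub> x) \<ominus>\<^bsub>R\<^esub> r \<otimes>\<^bsub>R\<^esub> \<delta> x)"

primrec diff_ops_upto :: "('a, 'k) ring_scheme \<Rightarrow> nat \<Rightarrow> ('a \<Rightarrow> 'a) set" where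
  "diff_ops_upto R 0 =
     {\<delta> \<in> additive_maps R R. \<forall>r\<in>carrier R. op_commutator R \<delta> r = (\<lambda>x\<in>carrier R. \<zero>\<^bsub>R\<^esub>)}"
| "diff_ops_upto R (Suc n) =
     {\<delta> \<in> additive_maps R R. \<forall>r\<in>carrier R. op_commutator R \<delta> r \<in> diff_ops_upto R n}"

definition D_ring :: "('a, 'k) ring_scheme \<Rightarrow> ('a \<Rightarrow> 'a) ring" where
  "D_ring R = op_ring R (\<Union>n. diff_ops_upto R n)"

text \<open>The library locale \<open>module\<close> requires a commutative ring.\<close>

locale left_module = A?: ring A + M?: abelian_group M
  for A :: "('a, 'k) ring_scheme" (structure) and M :: "('a, 'm) module" (structure) +
  assumes smult_closed: "\<lbrakk>c \<in> carrier A; x \<in> carrier M\<rbrakk> \<Longrightarrow> c \<odot>\<^bsub>M\<^esub> x \<in> carrier M"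
    and smult_l_distr: "\<lbrakk>c \<in> carrier A; d \<in> carrier A; x \<in> carrier M\<rbrakk> \<Longrightarrow>
      (c \<oplus>\<^bsub>A\<^esub> d) \<odot>\<^bsub>M\<^esub> x = c \<odot>\<^bsub>M\<^esub> x \<oplus>\<^bsub>M\<^esub> d \<odot>\<^bsub>M\<^esub> x"
    and smult_r_distr: "\<lbrakk>c \<in> carrier A; x \<in> carrier M; y \<in> carrier M\<rbrakk> \<Longrightarrow>
      c \<odot>\<^bsub>M\<^esub> (x \<oplus>\<^bsub>M\<^esub> y) = c \<odot>\<^bsub>M\<^esub> x \<oplus>\<^bsub>M\<^esub> c \<odot>\<^bsub>M\<^esub> y"
    and smult_assoc: "\<lbrakk>c \<in> carrier A; d \<in> carrier A; x \<in> carrier M\<rbrakk> \<Longrightarrow>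
      (c \<otimes>\<^bsub>A\<^esub> d) \<odot>\<^bsub>M\<^esub> x = c \<odot>\<^bsub>M\<^esub> (d \<odot>\<^bsub>M\<^esub> x)"
    and smult_one: "x \<in> carrier M \<Longrightarrow> \<one>\<^bsub>A\<^esub> \<odot>\<^bsub>M\<^esub> x = x"


section \<open>Tensor products inside a fixed universe\<close>

text \<open>All modules have their elements in one type \<open>'u\<close>, the universe.  The tensor product
  \<open>H \<otimes>\<^sub>A M\<close> of a set of operators \<open>H\<close>, stable under right composition with \<open>A\<close>, with a left
  \<open>A\<close>-module \<open>M\<close> is the quotient of the free abelian group on \<open>H \<times> M\<close> by the usual relations.
  A coset is coded as an element of \<open>'u\<close> by choosing a representative and applying a chosen
  injection of formal sums into \<open>'u\<close>; the injection exists if \<open>'u\<close> is infinite and at least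
  as large as \<open>'a \<Rightarrow> 'a\<close>.\<close>

definition univ_code :: "('t \<Rightarrow>\<^sub>0 int) \<Rightarrow> 'u" where
  "univ_code = (SOME f. inj f)"

definition tensor_rels :: "('a, 'k) ring_scheme \<Rightarrow> ('a \<Rightarrow> 'a) set \<Rightarrow> ('a \<Rightarrow> 'a) set \<Rightarrow>
    ('a \<Rightarrow> 'a, 'u) module \<Rightarrow> ((('a \<Rightarrow> 'a) \<times> 'u) \<Rightarrow>\<^sub>0 int) set" where
  "tensor_rels R H A M =
     {frag_of (op_add R \<theta> \<theta>', m) - frag_of (\<theta>, m) - frag_of (\<theta>', m) | \<theta> \<theta>' m.
        \<theta> \<in> H \<and> \<theta>' \<in> H \<and> m \<in> carrier M} \<union>
     {frag_of (\<theta>, m \<oplus>\<^bsub>M\<^esub> m') - frag_of (\<theta>, m) - frag_of (\<theta>, m') | \<theta> m m'.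
        \<theta> \<in> H \<and> m \<in> carrier M \<and> m' \<in> carrier M} \<union>
     {frag_of (compose (carrier R) \<theta> d, m) - frag_of (\<theta>, d \<odot>\<^bsub>M\<^esub> m) | \<theta> d m.
        \<theta> \<in> H \<and> d \<in> A \<and> m \<in> carrier M}"

definition tensor_class :: "('a, 'k) ring_scheme \<Rightarrow> ('a \<Rightarrow> 'a) set \<Rightarrow> ('a \<Rightarrow> 'a) set \<Rightarrow>
    ('a \<Rightarrow> 'a, 'u) module \<Rightarrow> ((('a \<Rightarrow> 'a) \<times> 'u) \<Rightarrow>\<^sub>0 int) \<Rightarrow> 'u" where
  "tensor_class R H A M x =
     (let G = free_Abelian_group (H \<times> carrier M)
      in univ_code (SOME y. y \<in> generate G (tensor_rels R H A M) #>\<^bsub>G\<^esub> x))"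

definition tensor_rep :: "('a, 'k) ring_scheme \<Rightarrow> ('a \<Rightarrow> 'a) set \<Rightarrow> ('a \<Rightarrow> 'a) set \<Rightarrow>
    ('a \<Rightarrow> 'a, 'u) module \<Rightarrow> 'u \<Rightarrow> ((('a \<Rightarrow> 'a) \<times> 'u) \<Rightarrow>\<^sub>0 int)" where
  "tensor_rep R H A M u =
     (SOME x. x \<in> carrier (free_Abelian_group (H \<times> carrier M)) \<and> tensor_class R H A M x = u)"

definition pure_tensor :: "('a, 'k) ring_scheme \<Rightarrow> ('a \<Rightarrow> 'a) set \<Rightarrow> ('a \<Rightarrow> 'a) set \<Rightarrow>
    ('a \<Rightarrow> 'a, 'u) module \<Rightarrow> ('a \<Rightarrow> 'a) \<Rightarrow> 'u \<Rightarrow> 'u" where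
  "pure_tensor R H A M \<theta> m = tensor_class R H A M (frag_of (\<theta>, m))"

text \<open>Scalar multiplication is \<open>d \<cdot> (\<theta> \<otimes> m) = (d \<circ> \<theta>) \<otimes> m\<close>, for operators \<open>d\<close> preserving \<open>H\<close>
  under left composition.\<close>

definition op_tensor :: "('a, 'k) ring_scheme \<Rightarrow> ('a \<Rightarrow> 'a) set \<Rightarrow> ('a \<Rightarrow> 'a) set \<Rightarrow>
    ('a \<Rightarrow> 'a, 'u) module \<Rightarrow> ('a \<Rightarrow> 'a, 'u) module" where
  "op_tensor R H A M =
     \<lparr>carrier = tensor_class R H A M ` carrier (free_Abelian_group (H \<times> carrier M)),
      monoid.mult = (\<lambda>_ _. undefined), one = undefined,
      ring.zero = tensor_class R H A M 0,
      add = (\<lambda>u v. tensor_class R H A M (tensor_rep R H A M u + tensor_rep R H A M v)),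
      smult = (\<lambda>d u. tensor_class R H A M
        (frag_extend (\<lambda>(\<theta>, m). frag_of (compose (carrier R) d \<theta>, m)) (tensor_rep R H A M u)))\<rparr>"

text \<open>The additive map \<open>H \<otimes>\<^sub>A M \<rightarrow> N\<close> with \<open>\<theta> \<otimes> m \<mapsto> f \<theta> m\<close>, for a balanced biadditive \<open>f\<close>.\<close>

definition tensor_lift :: "('a, 'k) ring_scheme \<Rightarrow> ('a \<Rightarrow> 'a) set \<Rightarrow> ('a \<Rightarrow> 'a) set \<Rightarrow>
    ('a \<Rightarrow> 'a, 'u) module \<Rightarrow> ('a \<Rightarrow> 'a, 'u) module \<Rightarrow> (('a \<Rightarrow> 'a) \<Rightarrow> 'u \<Rightarrow> 'u) \<Rightarrow> 'u \<Rightarrow> 'u" where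
  "tensor_lift R H A M N f =
     (\<lambda>u\<in>carrier (op_tensor R H A M).
        let x = tensor_rep R H A M u
        in \<Oplus>\<^bsub>N\<^esub>t\<in>Poly_Mapping.keys x. [Poly_Mapping.lookup x t] \<cdot>\<^bsub>N\<^esub> f (fst t) (snd t))"


section \<open>The functors \<open>\<Phi>\<^bsup>s*\<^esup>\<close> and \<open>C\<^sup>s\<close>\<close>

text \<open>\<open>Hom\<^sub>R(F\<^bsup>(i)\<^esup>\<^sub>*R, F\<^bsup>(j)\<^esup>\<^sub>*R) \<otimes> M\<close> over \<open>D\<^bsup>(i)\<^esup>\<close>, a \<open>D\<^bsup>(j)\<^esup>\<close>-module.  Restriction of scalars along
  inclusions of operator rings leaves module records unchanged and is therefore invisible.\<close>

definition hom_tensor :: "('a, 'k) ring_scheme \<Rightarrow> nat \<Rightarrow> nat \<Rightarrow> nat \<Rightarrow> nat \<Rightarrow> nat \<Rightarrow>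
    ('a \<Rightarrow> 'a, 'u) module \<Rightarrow> ('a \<Rightarrow> 'a, 'u) module" where
  "hom_tensor R p a b i j M = op_tensor R (HomF R p a b i j) (HomF R p a b i i) M"

definition hom_pure :: "('a, 'k) ring_scheme \<Rightarrow> nat \<Rightarrow> nat \<Rightarrow> nat \<Rightarrow> nat \<Rightarrow> nat \<Rightarrow>
    ('a \<Rightarrow> 'a, 'u) module \<Rightarrow> ('a \<Rightarrow> 'a) \<Rightarrow> 'u \<Rightarrow> 'u" where
  "hom_pure R p a b i j M = pure_tensor R (HomF R p a b i j) (HomF R p a b i i) M"

definition hom_lift :: "('a, 'k) ring_scheme \<Rightarrow> nat \<Rightarrow> nat \<Rightarrow> nat \<Rightarrow> nat \<Rightarrow> nat \<Rightarrow>
    ('a \<Rightarrow> 'a, 'u) module \<Rightarrow> ('a \<Rightarrow> 'a, 'u) module \<Rightarrow> (('a \<Rightarrow> 'a) \<Rightarrow> 'u \<Rightarrow> 'u) \<Rightarrow> 'u \<Rightarrow> 'u" where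
  "hom_lift R p a b i j M N f = tensor_lift R (HomF R p a b i j) (HomF R p a b i i) M N f"

definition hom_tensor_map :: "('a, 'k) ring_scheme \<Rightarrow> nat \<Rightarrow> nat \<Rightarrow> nat \<Rightarrow> nat \<Rightarrow> nat \<Rightarrow>
    ('a \<Rightarrow> 'a, 'u) module \<Rightarrow> ('a \<Rightarrow> 'a, 'u) module \<Rightarrow> ('u \<Rightarrow> 'u) \<Rightarrow> 'u \<Rightarrow> 'u" where
  "hom_tensor_map R p a b i j M N \<phi> =
     hom_lift R p a b i j M (hom_tensor R p a b i j N)
       (\<lambda>\<theta> m. hom_pure R p a b i j N \<theta> (\<phi> m))"

text \<open>\<open>\<Phi>\<^bsup>s*\<^esup>\<close> on \<open>D\<^bsup>(e)\<^esup>\<close>-modules, and \<open>C\<^sup>s\<close> from \<open>D\<^bsup>(e+s)\<^esup>\<close>-modules to \<open>D\<^bsup>(e)\<^esup>\<close>-modules; the level \<open>e\<close> is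
  the last numeric argument.\<close>

abbreviation Phi_star where
  "Phi_star R p a b s e \<equiv> hom_tensor R p a b e (e + s)"

abbreviation Phi_star_map where
  "Phi_star_map R p a b s e \<equiv> hom_tensor_map R p a b e (e + s)"

abbreviation Cartier where
  "Cartier R p a b s e \<equiv> hom_tensor R p a b (e + s) e"

abbreviation Cartier_map where
  "Cartier_map R p a b s e \<equiv> hom_tensor_map R p a b (e + s) e"


section \<open>Categories\<close>

record ('o, 'h) category =
  obj :: "'o set"
  arr :: "'o \<Rightarrow> 'o \<Rightarrow> 'h set"
  ident :: "'o \<Rightarrow> 'h"
  arr_comp :: "'o \<Rightarrow> 'o \<Rightarrow> 'o \<Rightarrow> 'h \<Rightarrow> 'h \<Rightarrow> 'h" \<comment> \<open>\<open>arr_comp C V W Z g f\<close> is \<open>g \<circ> f : V \<rightarrow> W \<rightarrow> Z\<close>\<close>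

definition is_category :: "('o, 'h) category \<Rightarrow> bool" where
  "is_category C \<longleftrightarrow>
     (\<forall>V\<in>obj C. ident C V \<in> arr C V V) \<and>
     (\<forall>V\<in>obj C. \<forall>W\<in>obj C. \<forall>Z\<in>obj C. \<forall>f\<in>arr C V W. \<forall>g\<in>arr C W Z.
        arr_comp C V W Z g f \<in> arr C V Z) \<and>
     (\<forall>V\<in>obj C. \<forall>W\<in>obj C. \<forall>f\<in>arr C V W.
        arr_comp C V V W f (ident C V) = f \<and> arr_comp C V W W (ident C W) f = f) \<and>
     (\<forall>U\<in>obj C. \<forall>V\<in>obj C. \<forall>W\<in>obj C. \<forall>Z\<in>obj C.
        \<forall>f\<in>arr C U V. \<forall>g\<in>arr C V W. \<forall>h\<in>arr C W Z.
        arr_comp C U V Z (arr_comp C V W Z h g) f = arr_comp C U W Z h (arr_comp C U V W g f))"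

text \<open>A functor is given by its object map and its arrow maps.\<close>

type_synonym ('o, 'h, 'o', 'h') funct = "('o \<Rightarrow> 'o') \<times> ('o \<Rightarrow> 'o \<Rightarrow> 'h \<Rightarrow> 'h')"

definition is_functor ::
  "('o, 'h) category \<Rightarrow> ('o', 'h') category \<Rightarrow> ('o, 'h, 'o', 'h') funct \<Rightarrow> bool" where
  "is_functor C E F \<longleftrightarrow>
     (\<forall>V\<in>obj C. fst F V \<in> obj E) \<and>
     (\<forall>V\<in>obj C. \<forall>W\<in>obj C. \<forall>f\<in>arr C V W. snd F V W f \<in> arr E (fst F V) (fst F W)) \<and>
     (\<forall>V\<in>obj C. snd F V V (ident C V) = ident E (fst F V)) \<and>
     (\<forall>V\<in>obj C. \<forall>W\<in>obj C. \<forall>Z\<in>obj C. \<forall>f\<in>arr C V W. \<forall>g\<in>arr C W Z.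
        snd F V Z (arr_comp C V W Z g f) =
          arr_comp E (fst F V) (fst F W) (fst F Z) (snd F W Z g) (snd F V W f))"

definition id_functor :: "('o, 'h, 'o, 'h) funct" where
  "id_functor = (\<lambda>V. V, \<lambda>V W f. f)"

definition comp_functor :: "('o', 'h', 'o'', 'h'') funct \<Rightarrow> ('o, 'h, 'o', 'h') funct \<Rightarrow>
    ('o, 'h, 'o'', 'h'') funct" where
  "comp_functor G F =
     (\<lambda>V. fst G (fst F V), \<lambda>V W f. snd G (fst F V) (fst F W) (snd F V W f))"

definition iso_arr :: "('o, 'h) category \<Rightarrow> 'o \<Rightarrow> 'o \<Rightarrow> 'h \<Rightarrow> bool" where
  "iso_arr C V W f \<longleftrightarrow>
     f \<in> arr C V W \<and>
     (\<exists>g\<in>arr C W V. arr_comp C V W V g f = ident C V \<and> arr_comp C W V W f g = ident C W)"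

definition naturally_isomorphic :: "('o, 'h) category \<Rightarrow> ('o', 'h') category \<Rightarrow>
    ('o, 'h, 'o', 'h') funct \<Rightarrow> ('o, 'h, 'o', 'h') funct \<Rightarrow> bool" where
  "naturally_isomorphic C E F G \<longleftrightarrow>
     (\<exists>\<eta>. (\<forall>V\<in>obj C. iso_arr E (fst F V) (fst G V) (\<eta> V)) \<and>
        (\<forall>V\<in>obj C. \<forall>W\<in>obj C. \<forall>f\<in>arr C V W.
           arr_comp E (fst F V) (fst F W) (fst G W) (\<eta> W) (snd F V W f) =
           arr_comp E (fst F V) (fst G V) (fst G W) (snd G V W f) (\<eta> V)))"

definition mutually_inverse :: "('o, 'h) category \<Rightarrow> ('o', 'h') category \<Rightarrow>
    ('o, 'h, 'o', 'h') funct \<Rightarrow> ('o', 'h', 'o, 'h) funct \<Rightarrow> bool" where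
  "mutually_inverse C E F G \<longleftrightarrow>
     is_functor C E F \<and> is_functor E C G \<and>
     naturally_isomorphic C C (comp_functor G F) id_functor \<and>
     naturally_isomorphic E E (comp_functor F G) id_functor"

definition is_equivalence ::
  "('o, 'h) category \<Rightarrow> ('o', 'h') category \<Rightarrow> ('o, 'h, 'o', 'h') funct \<Rightarrow> bool" where
  "is_equivalence C E F \<longleftrightarrow>
     is_category C \<and> is_category E \<and> (\<exists>G. mutually_inverse C E F G)"

definition left_mod_cat ::
  "('d, 'k) ring_scheme \<Rightarrow> (('d, 'u) module, 'u \<Rightarrow> 'u) category" where
  "left_mod_cat A =
     \<lparr>obj = {M. left_module A M},
      arr = lin_maps A,
      ident = (\<lambda>M. \<lambda>x\<in>carrier M. x),
      arr_comp = (\<lambda>L M N g f. compose (carrier L) g f)\<rparr>"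

type_synonym ('a, 'u) divmod_data = "(nat \<Rightarrow> ('a \<Rightarrow> 'a, 'u) module) \<times> (nat \<Rightarrow> 'u \<Rightarrow> 'u)"

definition Phi_divmod_cat :: "('a, 'k) ring_scheme \<Rightarrow> nat \<Rightarrow> nat \<Rightarrow> nat \<Rightarrow>
    (('a, 'u) divmod_data, nat \<Rightarrow> 'u \<Rightarrow> 'u) category" where
  "Phi_divmod_cat R p a b =
     \<lparr>obj = {(M, \<alpha>). \<forall>e. left_module (D_level R p a b 0) (M e) \<and>
               \<alpha> e \<in> lin_isos (D_level R p a b 0) (Phi_star R p a b 1 0 (M (Suc e))) (M e)},
      arr = (\<lambda>(M, \<alpha>) (N, \<beta>).
               {\<phi>. \<forall>e. \<phi> e \<in> lin_maps (D_level R p a b 0) (M e) (N e) \<and>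
                  compose (carrier (Phi_star R p a b 1 0 (M (Suc e)))) (\<phi> e) (\<alpha> e) =
                  compose (carrier (Phi_star R p a b 1 0 (M (Suc e)))) (\<beta> e)
                    (Phi_star_map R p a b 1 0 (M (Suc e)) (N (Suc e)) (\<phi> (Suc e)))}),
      ident = (\<lambda>(M, \<alpha>) e. \<lambda>x\<in>carrier (M e). x),
      arr_comp = (\<lambda>(L, \<gamma>) (M, \<alpha>) (N, \<beta>) \<psi> \<phi>. \<lambda>e. compose (carrier (L e)) (\<psi> e) (\<phi> e))\<rparr>"


section \<open>The two functors\<close>

text \<open>For a \<open>D\<close>-module \<open>M\<close>, both \<open>\<Phi>\<^sup>*C\<^bsup>e+1\<^esup>(M)\<close> and \<open>C\<^sup>e(M)\<close> map isomorphically onto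
  \<open>Hom\<^sub>R(F\<^bsup>(e+1)\<^esup>\<^sub>*R, F\<^bsup>(1)\<^esup>\<^sub>*R) \<otimes> M\<close> (over \<open>D\<^bsup>(e+1)\<^esup>\<close>), by \<open>\<phi> \<otimes> (\<psi> \<otimes> m) \<mapsto> (\<phi> \<circ> \<psi>) \<otimes> m\<close> and \<open>\<theta> \<otimes> m \<mapsto> \<theta> \<otimes> m\<close>
  respectively.  The second is the compatibility of \<open>C\<^sup>e\<close> with restriction of scalars, and \<open>\<alpha>\<^sub>e\<close>
  is the first followed by the inverse of the second.\<close>

definition Cartier_compat :: "('a, 'k) ring_scheme \<Rightarrow> nat \<Rightarrow> nat \<Rightarrow> nat \<Rightarrow>
    ('a \<Rightarrow> 'a, 'u) module \<Rightarrow> nat \<Rightarrow> 'u \<Rightarrow> 'u" where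
  "Cartier_compat R p a b M e =
     hom_lift R p a b e 0 M (Cartier R p a b e 1 M) (hom_pure R p a b (Suc e) 1 M)"

definition Phi_Cartier_comp :: "('a, 'k) ring_scheme \<Rightarrow> nat \<Rightarrow> nat \<Rightarrow> nat \<Rightarrow>
    ('a \<Rightarrow> 'a, 'u) module \<Rightarrow> nat \<Rightarrow> 'u \<Rightarrow> 'u" where
  "Phi_Cartier_comp R p a b M e =
     hom_lift R p a b 0 1 (Cartier R p a b (Suc e) 0 M) (Cartier R p a b e 1 M)
       (\<lambda>\<phi>. hom_lift R p a b (Suc e) 0 M (Cartier R p a b e 1 M)
          (\<lambda>\<psi>. hom_pure R p a b (Suc e) 1 M (compose (carrier R) \<phi> \<psi>)))"

definition canonical_alpha :: "('a, 'k) ring_scheme \<Rightarrow> nat \<Rightarrow> nat \<Rightarrow> nat \<Rightarrow>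
    ('a \<Rightarrow> 'a, 'u) module \<Rightarrow> nat \<Rightarrow> 'u \<Rightarrow> 'u" where
  "canonical_alpha R p a b M e =
     compose (carrier (Phi_star R p a b 1 0 (Cartier R p a b (Suc e) 0 M)))
       (inv_into (carrier (Cartier R p a b e 0 M)) (Cartier_compat R p a b M e))
       (Phi_Cartier_comp R p a b M e)"

definition to_divmod :: "('a, 'k) ring_scheme \<Rightarrow> nat \<Rightarrow> nat \<Rightarrow> nat \<Rightarrow>
    (('a \<Rightarrow> 'a, 'u) module, 'u \<Rightarrow> 'u, ('a, 'u) divmod_data, nat \<Rightarrow> 'u \<Rightarrow> 'u) funct" where
  "to_divmod R p a b =
     (\<lambda>M. (\<lambda>e. Cartier R p a b e 0 M, canonical_alpha R p a b M),
      \<lambda>M N \<phi>. \<lambda>e. Cartier_map R p a b e 0 M N \<phi>)"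

text \<open>The canonical isomorphism from \<open>\<Phi>\<^bsup>j*\<^esup>(\<Phi>\<^sup>*N)\<close> to \<open>\<Phi>\<^bsup>(j+1)*\<^esup>N\<close> for a \<open>D\<^bsup>(0)\<^esup>\<close>-module \<open>N\<close>, where \<open>\<Phi>\<^sup>*N\<close>
  is restricted to \<open>D\<^bsup>(0)\<^esup>\<close>: \<open>\<theta> \<otimes> (\<phi> \<otimes> n) \<mapsto> (\<theta> \<circ> \<phi>) \<otimes> n\<close>.\<close>

definition Phi_comp :: "('a, 'k) ring_scheme \<Rightarrow> nat \<Rightarrow> nat \<Rightarrow> nat \<Rightarrow> nat \<Rightarrow>
    ('a \<Rightarrow> 'a, 'u) module \<Rightarrow> 'u \<Rightarrow> 'u" where
  "Phi_comp R p a b j N =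
     hom_lift R p a b 0 j (Phi_star R p a b 1 0 N) (Phi_star R p a b (Suc j) 0 N)
       (\<lambda>\<theta>. hom_lift R p a b 0 1 N (Phi_star R p a b (Suc j) 0 N)
          (\<lambda>\<phi>. hom_pure R p a b 0 (Suc j) N (compose (carrier R) \<theta> \<phi>)))"

text \<open>\<open>\<alpha>\<^sub>0 \<circ> \<Phi>\<^sup>*\<alpha>\<^sub>1 \<circ> \<dots> \<circ> \<Phi>\<^bsup>(e-1)*\<^esup>\<alpha>\<^bsub>e-1\<^esub> : \<Phi>\<^bsup>e*\<^esup>(M\<^sub>e) \<rightarrow> M\<^sub>0\<close>, beginning with \<open>\<Phi>\<^bsup>0*\<^esup>(M\<^sub>0) \<cong> M\<^sub>0\<close>.\<close>

primrec alpha_iter :: "('a, 'k) ring_scheme \<Rightarrow> nat \<Rightarrow> nat \<Rightarrow> nat \<Rightarrow>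
    ('a, 'u) divmod_data \<Rightarrow> nat \<Rightarrow> 'u \<Rightarrow> 'u" where
  "alpha_iter R p a b E 0 = hom_lift R p a b 0 0 (fst E 0) (fst E 0) (smult (fst E 0))"
| "alpha_iter R p a b E (Suc e) =
     compose (carrier (Phi_star R p a b (Suc e) 0 (fst E (Suc e))))
       (alpha_iter R p a b E e)
       (compose (carrier (Phi_star R p a b (Suc e) 0 (fst E (Suc e))))
         (Phi_star_map R p a b e 0 (Phi_star R p a b 1 0 (fst E (Suc e))) (fst E e) (snd E e))
         (inv_into (carrier (Phi_star R p a b e 0 (Phi_star R p a b 1 0 (fst E (Suc e)))))
           (Phi_comp R p a b e (fst E (Suc e)))))"

text \<open>An operator \<open>d \<in> D\<close> acts on \<open>M\<^sub>0\<close> by transport from \<open>\<Phi>\<^bsup>e*\<^esup>(M\<^sub>e)\<close>, for every \<open>e\<close> with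
  \<open>d \<in> D\<^bsup>(e)\<^esup>\<close>; compatibility says that the result does not depend on \<open>e\<close>.\<close>

definition transported_smult :: "('a, 'k) ring_scheme \<Rightarrow> nat \<Rightarrow> nat \<Rightarrow> nat \<Rightarrow>
    ('a, 'u) divmod_data \<Rightarrow> ('a \<Rightarrow> 'a) \<Rightarrow> 'u \<Rightarrow> 'u" where
  "transported_smult R p a b E d m =
     (THE y. \<forall>e. d \<in> HomF R p a b e e \<longrightarrow>
        y = alpha_iter R p a b E e
              (d \<odot>\<^bsub>Phi_star R p a b e 0 (fst E e)\<^esub>
                 inv_into (carrier (Phi_star R p a b e 0 (fst E e))) (alpha_iter R p a b E e) m))"

definition from_divmod :: "('a, 'k) ring_scheme \<Rightarrow> nat \<Rightarrow> nat \<Rightarrow> nat \<Rightarrow>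
    (('a, 'u) divmod_data, nat \<Rightarrow> 'u \<Rightarrow> 'u, ('a \<Rightarrow> 'a, 'u) module, 'u \<Rightarrow> 'u) funct" where
  "from_divmod R p a b =
     (\<lambda>E. (fst E 0)\<lparr>smult := transported_smult R p a b E\<rparr>,
      \<lambda>E E' \<phi>. \<phi> 0)"

end

theory Submission
 imports Defs
begin

text \<open>The key is that for all \<open>i\<close>, \<open>j\<close> the identity of \<open>F\<^bsup>(j)\<^esup>\<^sub>*R\<close> is a finite sum of maps
 \<open>g \<circ> h\<close> through \<open>F\<^bsup>(i)\<^esup>\<^sub>*R\<close>, so that \<open>Hom(F\<^bsup>(i)\<^esup>\<^sub>*R, F\<^bsup>(j)\<^esup>\<^sub>*R)\<close> gives a Morita equivalence.
 Over a completion \<open>S\<close> at a maximal ideal this holds because both modules decompose into the same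
 indecomposables. The maps over \<open>S\<close> are approximated by maps over \<open>R\<close> (Artin--Rees), and a Nakayama
 argument turns the approximate identity into one after multiplication by some \<open>s \<notin> P\<close>; the elements
 \<open>r\<close> for which \<open>r\<close> times the identity is such a sum form an ideal contained in no maximal ideal.
 Given this, a map out of a tensor product is injective as soon as it is compatible with composition of
 operators, which makes all canonical maps bijective. Finally, over an \<open>F\<close>-finite ring the
 differential operators are the maps linear over some \<open>R\<^bsup>p^e\<^esup>\<close>, since \<open>ad(x)\<^bsup>p^e\<^esup> = ad(x\<^bsup>p^e\<^esup>)\<close> in
 characteristic \<open>p\<close>.\<close>

text \<open>The completion \<open>S\<close> enters only through the locale \<open>adic_ring\<close>:
  a map from \<open>R\<close> with approximation, separation and completeness for a filtration
  \<open>Fil\<close>. All finiteness is taken from \<open>R\<close>: an ideal of \<open>S\<close>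
  that contains a power of the image of every element of \<open>P\<close> contains some
  \<open>Fil n\<close>, because this can be tested in the Noetherian ring \<open>R\<close>. This
  serves for the continuity of Frobenius-linear maps and for the existence of decompositions over
  \<open>S\<close>. The classes of summands are used in one way: each indecomposable summand of one
  push-forward is isomorphic to a summand of the other, so its projection factors through the other.
  On the categorical side, elements of a tensor product are codes of chosen representatives, so maps
  are compared on pure tensors only. Restriction of scalars changes the ring of a tensor product but
  not the module record. It is matched by the fact that an operator from level \<open>i\<close> to
  level \<open>j\<close> is also one from level \<open>i + k\<close> to level \<open>j + k\<close>;
  this inclusion and the trace identity carry all canonical isomorphisms.\<close>

abbreviation (input) car :: "('a, 'b) partial_object_scheme => 'a set" where "car == carrier"

\<comment> \<open>Lets a structure index follow a single subscript mark, so that a compound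
  structure such as \<open>\<^sub>(frob_push R p e)\<close> can stand at an operation.\<close>
syntax "_index" :: "logic => index" ("\<^sub>_" [1000] 1000)

section \<open>Submodules, generation and Noetherian modules\<close>

lemma (in abelian_group) add_minus_add_cancel:
 assumes "x : car G" "y : car G" "z : car G"
 shows "(x \<oplus> z) \<ominus> (y \<oplus> z) = x \<ominus> y"
proof -
 have "(x \<oplus> z) \<ominus> (y \<oplus> z) = (x \<ominus> y) \<oplus> (z \<ominus> z)"
  using assms by (simp add: a_minus_def minus_add a_ac)
 then show ?thesis using assms by (simp add: r_neg a_minus_def)
qed

lemma (in abelian_group) minus_add_add_cancel:
 assumes "x : car G" "y : car G" "z : car G"
 shows "(x \<ominus> y) \<oplus> (y \<oplus> z) = x \<oplus> z"
proof -
 have "(x \<ominus> y) \<oplus> (y \<oplus> z) = (x \<oplus> z) \<oplus> (y \<ominus> y)"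
  using assms by (simp add: a_minus_def a_ac)
 then show ?thesis using assms by (simp add: r_neg a_minus_def)
qed

lemma (in cring) idealI_simple:
 assumes "I <= car R" "\<zero> : I" "!!x y. x : I ==> y : I ==> x \<oplus> y : I"
  and "!!r x. r : car R ==> x : I ==> r \<otimes> x : I"
 shows "ideal I R"
proof (rule idealI)
 show "ring R" by (rule ring_axioms)
 show "subgroup I (add_monoid R)"
 proof (rule group.subgroupI)
  show "group (add_monoid R)" by (rule a_group)
  fix x assume x: "x : I"
  then have xc: "x : car R" using assms(1) by auto
  have "(\<ominus> \<one>) \<otimes> x : I" using x assms(4) by simp
  then have "\<ominus> x : I" using xc by (simp add: l_minus)
  then show "inv\<^sub>(add_monoid R) x : I" by (simp add: a_inv_def)
 qed (use assms in auto)
 show "!!a x. a : I ==> x : car R ==> x \<otimes> a : I" using assms by auto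
 show "!!a x. a : I ==> x : car R ==> a \<otimes> x : I"
 proof -
  fix a x assume "a : I" "x : car R"
  then show "a \<otimes> x : I" using assms(1) assms(4)[of x a] m_comm[of a x] by auto
 qed
qed

lemma (in module) submoduleI_simple:
 assumes "N <= car M" "\<zero>\<^sub>M : N" "!!x y. x : N ==> y : N ==> x \<oplus>\<^sub>M y : N"
  and "!!r x. r : car R ==> x : N ==> r \<odot>\<^sub>M x : N"
 shows "submodule N R M"
proof (rule submoduleI)
 fix x assume x: "x : N"
 then have xc: "x : car M" using assms(1) by auto
 have "(\<ominus> \<one>) \<odot>\<^sub>M x : N" using x assms(4) by simp
 then show "\<ominus>\<^sub>M x : N" using xc by (simp add: smult_l_minus)
qed (use assms in auto)

lemma (in module) submodule_zero: "submodule N R M ==> \<zero>\<^sub>M : N"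
 using subgroup.one_closed[OF submodule.axioms(1), of N R M] by simp

lemma (in module) submodule_minus:
 "submodule N R M ==> x : N ==> y : N ==> x \<ominus>\<^sub>M y : N"
 by (simp add: a_minus_def submoduleE)

lemma (in module) submodule_Inter:
 assumes "!!N. N : F ==> submodule N R M" "F \<noteq> {}"
 shows "submodule (\<Inter>F) R M"
proof (rule submoduleI_simple)
 obtain N where "N : F" using assms(2) by blast
 then show "\<Inter>F <= car M" using submoduleE(1)[OF assms(1)] by blast
 show "\<zero>\<^sub>M : \<Inter>F" using assms(1) submodule_zero by blast
 show "x \<oplus>\<^sub>M y : \<Inter>F" if "x : \<Inter>F" "y : \<Inter>F" for x y
  using submoduleE(5)[OF assms(1)] that by blast
 show "r \<odot>\<^sub>M x : \<Inter>F" if "r : car R" "x : \<Inter>F" for r x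
  using submoduleE(4)[OF assms(1)] that by blast
qed

lemma (in module) submodule_Int:
 "submodule N R M ==> submodule K R M ==> submodule (N \<inter> K) R M"
 using submodule_Inter[of "{N, K}"] by auto

lemma (in module) submodule_Union_chain:
 assumes "subset.chain {N. submodule N R M} C" "C \<noteq> {}"
 shows "submodule (\<Union>C) R M"
proof (rule submoduleI_simple)
 have sub: "!!N. N : C ==> submodule N R M" using assms(1) by (auto simp: subset.chain_def)
 show "\<Union>C <= car M" using sub submoduleE(1) by auto
 show "\<zero>\<^sub>M : \<Union>C" using assms(2) sub submodule_zero by auto
 show "r \<odot>\<^sub>M x : \<Union>C" if "r : car R" "x : \<Union>C" for r x
  using that sub submoduleE(4) by blast
 fix x y assume "x : \<Union>C" "y : \<Union>C"
 then obtain V W where "x : V" "V : C" "y : W" "W : C" by auto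
 moreover have "V <= W | W <= V" using assms(1) calculation by (auto simp: subset.chain_def)
 ultimately show "x \<oplus>\<^sub>M y : \<Union>C" using sub submoduleE(5) by (metis UnionI subsetD)
qed

text \<open>Finite generation is expressed through the submodules that contain \<open>B\<close>.
  Linear combinations would take a different shape for each action of \<open>R\<close> through
  Frobenius powers.\<close>

definition noeth_module :: "('a, 'k) ring_scheme => ('a, 'm, 'l) module_scheme => bool" where
 "noeth_module R M \<longleftrightarrow> (\<forall>N. submodule N R M \<longrightarrow>
  (\<exists>B. finite B & B <= N & (\<forall>K. submodule K R M & B <= K \<longrightarrow> N <= K)))"

text \<open>The union of a chain of submodules is a submodule. A finite generating set of it already
  lies in one member of the chain, which is then the whole union, so Zorn's lemma applies inside the
  family.\<close>

lemma (in module) noeth_module_maximal: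
 assumes noeth: "noeth_module R M" and sub: "!!N. N : F ==> submodule N R M" and ne: "F \<noteq> {}"
 shows "\<exists>W\<in>F. \<forall>V\<in>F. W <= V \<longrightarrow> V = W"
proof (rule subset_Zorn_nonempty[OF ne])
 fix C assume C: "C \<noteq> {}" "subset.chain F C"
 then have ch: "subset.chain {N. submodule N R M} C"
  using sub by (auto simp: subset.chain_def)
 have "submodule (\<Union>C) R M" by (rule submodule_Union_chain[OF ch C(1)])
 then obtain B where B: "finite B" "B <= \<Union>C" "!!K. submodule K R M ==> B <= K ==> \<Union>C <= K"
  using noeth unfolding noeth_module_def by meson
 obtain Z where Z: "Z : C" "B <= Z" using finite_subset_Union_chain[OF B(1,2) C(1) ch] by blast
 then have "\<Union>C <= Z" using B(3) ch by (auto simp: subset.chain_def)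
 then have "\<Union>C = Z" using Z by auto
 then show "\<Union>C : F" using Z C by (auto simp: subset.chain_def)
qed

definition span_module :: "('a, 'k) ring_scheme => ('a, 'm, 'l) module_scheme => 'm set => 'm set" where
 "span_module R M B = \<Inter>{K. submodule K R M & B <= K}"

context module begin

lemma span_submodule: "B <= car M ==> submodule (span_module R M B) R M"
 unfolding span_module_def
 by (rule submodule_Inter) (use carrier_is_submodule in auto)

lemma span_incl: "B <= span_module R M B"
 unfolding span_module_def by auto

lemma span_min: "submodule K R M ==> B <= K ==> span_module R M B <= K"
 unfolding span_module_def by auto

lemma submodule_add_cyclic:
 assumes L: "submodule L R M" and x: "x : car M"
 shows "submodule {l \<oplus>\<^sub>M r \<odot>\<^sub>M x | l r. l : L & r : car R} R M"
proof (rule submoduleI_simple)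
 have Lc: "!!l. l : L ==> l : car M" using submoduleE(1)[OF L] by auto
 show "{l \<oplus>\<^sub>M r \<odot>\<^sub>M x | l r. l : L & r : car R} <= car M" using Lc x by auto
 have "\<zero>\<^sub>M = \<zero>\<^sub>M \<oplus>\<^sub>M \<zero> \<odot>\<^sub>M x" using x by simp
 then show "\<zero>\<^sub>M : {l \<oplus>\<^sub>M r \<odot>\<^sub>M x | l r. l : L & r : car R}"
  using submodule_zero[OF L] by blast
next
 have Lc: "!!l. l : L ==> l : car M" using submoduleE(1)[OF L] by auto
 fix u v assume "u : {l \<oplus>\<^sub>M r \<odot>\<^sub>M x | l r. l : L & r : car R}"
  "v : {l \<oplus>\<^sub>M r \<odot>\<^sub>M x | l r. l : L & r : car R}"
 then obtain l r l' r' where e: "l : L" "l' : L" "r : car R" "r' : car R"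
  "u = l \<oplus>\<^sub>M r \<odot>\<^sub>M x" "v = l' \<oplus>\<^sub>M r' \<odot>\<^sub>M x" by auto
 have "u \<oplus>\<^sub>M v = (l \<oplus>\<^sub>M l') \<oplus>\<^sub>M (r \<oplus> r') \<odot>\<^sub>M x"
  using e Lc x by (simp add: smult_l_distr M.add.m_ac)
 then show "u \<oplus>\<^sub>M v : {l \<oplus>\<^sub>M r \<odot>\<^sub>M x | l r. l : L & r : car R}"
  using e submoduleE(5)[OF L] by blast
next
 have Lc: "!!l. l : L ==> l : car M" using submoduleE(1)[OF L] by auto
 fix s u assume s: "s : car R" and "u : {l \<oplus>\<^sub>M r \<odot>\<^sub>M x | l r. l : L & r : car R}"
 then obtain l r where e: "l : L" "r : car R" "u = l \<oplus>\<^sub>M r \<odot>\<^sub>M x" by auto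
 have "s \<odot>\<^sub>M u = s \<odot>\<^sub>M l \<oplus>\<^sub>M (s \<otimes> r) \<odot>\<^sub>M x"
  using e Lc x s by (simp add: smult_r_distr smult_assoc1)
 then show "s \<odot>\<^sub>M u : {l \<oplus>\<^sub>M r \<odot>\<^sub>M x | l r. l : L & r : car R}"
  using e s submoduleE(4)[OF L] by blast
qed

lemma span_insert:
 assumes "B <= car M" "x : car M"
 shows "span_module R M (insert x B) <=
  {l \<oplus>\<^sub>M r \<odot>\<^sub>M x | l r. l : span_module R M B & r : car R}"
proof (rule span_min)
 let ?L = "span_module R M B"
 have L: "submodule ?L R M" by (rule span_submodule[OF assms(1)])
 have Lc: "!!l. l : ?L ==> l : car M" using submoduleE(1)[OF L] by auto
 show "submodule {l \<oplus>\<^sub>M r \<odot>\<^sub>M x | l r. l : ?L & r : car R} R M"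
  by (rule submodule_add_cyclic[OF L assms(2)])
 have "x = \<zero>\<^sub>M \<oplus>\<^sub>M \<one> \<odot>\<^sub>M x" using assms by simp
 then have 1: "x : {l \<oplus>\<^sub>M r \<odot>\<^sub>M x | l r. l : ?L & r : car R}"
  using submodule_zero[OF L] by blast
 have "y = y \<oplus>\<^sub>M \<zero> \<odot>\<^sub>M x" if "y : ?L" for y using assms Lc[OF that] by simp
 then have "?L <= {l \<oplus>\<^sub>M r \<odot>\<^sub>M x | l r. l : ?L & r : car R}" by blast
 then show "insert x B <= {l \<oplus>\<^sub>M r \<odot>\<^sub>M x | l r. l : ?L & r : car R}"
  using 1 span_incl by blast
qed

text \<open>The Hilbert basis argument: a submodule of \<open>L + R x\<close> is generated by generators of its
 intersection with \<open>L\<close> and lifts of generators of its ideal of leading coefficients.\<close>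

lemma noeth_span:
 assumes nR: "noetherian_ring R" and "finite B" "B <= car M" "submodule N R M" "N <= span_module R M B"
 shows "\<exists>C. finite C & C <= N & (\<forall>K. submodule K R M & C <= K \<longrightarrow> N <= K)"
 using assms(2-5)
proof (induction arbitrary: N rule: finite_induct)
 case empty
 have "submodule {\<zero>\<^sub>M} R M" by (rule submoduleI_simple) auto
 then have "span_module R M {} <= {\<zero>\<^sub>M}" by (rule span_min) auto
 then have "N <= {\<zero>\<^sub>M}" using empty by auto
 then show ?case using submodule_zero by (intro exI[of _ "{}"]) auto
next
 case (insert x B)
 let ?L = "span_module R M B"
 have Bc: "B <= car M" and xc: "x : car M" using insert by auto
 have L: "submodule ?L R M" by (rule span_submodule[OF Bc])
 have Lc: "!!l. l : ?L ==> l : car M" using submoduleE(1)[OF L] by auto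
 define I where "I K = {r \<in> car R. \<exists>l\<in>?L. l \<oplus>\<^sub>M r \<odot>\<^sub>M x : K}" for K
 have I: "ideal (I K) R" if K: "submodule K R M" for K
 proof (rule idealI_simple)
  show "I K <= car R" by (auto simp: I_def)
  show "\<zero> : I K" using submodule_zero[OF L] submodule_zero[OF K] xc by (auto simp: I_def intro!: bexI[of _ "\<zero>\<^sub>M"])
 next
  fix r r' assume "r : I K" "r' : I K"
  then obtain l l' where e: "l : ?L" "l' : ?L" "r : car R" "r' : car R"
   "l \<oplus>\<^sub>M r \<odot>\<^sub>M x : K" "l' \<oplus>\<^sub>M r' \<odot>\<^sub>M x : K" by (auto simp: I_def)
  have "(l \<oplus>\<^sub>M l') \<oplus>\<^sub>M (r \<oplus> r') \<odot>\<^sub>M x = (l \<oplus>\<^sub>M r \<odot>\<^sub>M x) \<oplus>\<^sub>M (l' \<oplus>\<^sub>M r' \<odot>\<^sub>M x)"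
   using e Lc xc by (simp add: smult_l_distr M.add.m_ac)
  then have "(l \<oplus>\<^sub>M l') \<oplus>\<^sub>M (r \<oplus> r') \<odot>\<^sub>M x : K" using e submoduleE(5)[OF K] by simp
  then show "r \<oplus> r' : I K" using e submoduleE(5)[OF L] by (auto simp: I_def)
 next
  fix s r assume s: "s : car R" and "r : I K"
  then obtain l where e: "l : ?L" "r : car R" "l \<oplus>\<^sub>M r \<odot>\<^sub>M x : K" by (auto simp: I_def)
  have "s \<odot>\<^sub>M l \<oplus>\<^sub>M (s \<otimes> r) \<odot>\<^sub>M x = s \<odot>\<^sub>M (l \<oplus>\<^sub>M r \<odot>\<^sub>M x)"
   using e Lc xc s by (simp add: smult_r_distr smult_assoc1)
  then have "s \<odot>\<^sub>M l \<oplus>\<^sub>M (s \<otimes> r) \<odot>\<^sub>M x : K" using e s submoduleE(4)[OF K] by simp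
  then show "s \<otimes> r : I K" using e s submoduleE(4)[OF L] by (auto simp: I_def)
 qed
 obtain A where A: "A <= car R" "finite A" "I N = Idl A"
  using noetherian_ring.finetely_gen[OF nR I[OF insert.prems(2)]] by auto
 have "A <= I N" using A genideal_self by auto
 then have "\<forall>r\<in>A. \<exists>l. l : ?L & l \<oplus>\<^sub>M r \<odot>\<^sub>M x : N" by (auto simp: I_def)
 then obtain f where f: "!!r. r : A ==> f r : ?L & f r \<oplus>\<^sub>M r \<odot>\<^sub>M x : N" by metis
 have "submodule (N \<inter> ?L) R M" using submodule_Int L insert by auto
 from insert.IH[OF Bc this Int_lower2] obtain C
  where C': "finite C & C <= N \<inter> ?L & (\<forall>K. submodule K R M & C <= K \<longrightarrow> N \<inter> ?L <= K)" ..
 then have C: "finite C" "C <= N \<inter> ?L" by simp_all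
 have C3: "N \<inter> ?L <= K" if "submodule K R M" "C <= K" for K using C' that by (elim conjE allE impE) simp_all
 define D where "D = C \<union> (%r. f r \<oplus>\<^sub>M r \<odot>\<^sub>M x) ` A"
 have "finite D" "D <= N" using C A f by (auto simp: D_def)
 moreover have "N <= K" if K: "submodule K R M" "D <= K" for K
 proof
  fix n assume n: "n : N"
  then obtain l r where lr: "l : ?L" "r : car R" "n = l \<oplus>\<^sub>M r \<odot>\<^sub>M x"
   using insert.prems(3) span_insert[OF Bc xc] by blast
  \<comment> \<open>\<open>I\<close> is formed for \<open>K \<inter> N\<close> and not for
    \<open>K\<close>: the element with leading coefficient \<open>r\<close> found there lies in
    \<open>N\<close> as well, so its difference from \<open>n\<close> lies in
    \<open>N \<inter> ?L\<close>, which \<open>C\<close> generates.\<close>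
  have KN: "submodule (K \<inter> N) R M" using submodule_Int K insert by auto
  have "A <= I (K \<inter> N)"
  proof
   fix r assume r: "r : A"
   then have "f r \<oplus>\<^sub>M r \<odot>\<^sub>M x : K \<inter> N" using K(2) f by (auto simp: D_def)
   then show "r : I (K \<inter> N)" using f[OF r] r A(1) unfolding I_def by blast
  qed
  then have "Idl A <= I (K \<inter> N)" using I[OF KN] genideal_minimal by auto
  moreover have "r : I N" using n lr by (auto simp: I_def)
  ultimately have "r : I (K \<inter> N)" using A by auto
  then obtain l' where l': "l' : ?L" "l' \<oplus>\<^sub>M r \<odot>\<^sub>M x : K" "l' \<oplus>\<^sub>M r \<odot>\<^sub>M x : N" by (auto simp: I_def)
  have cc: "l : car M" "l' : car M" "r \<odot>\<^sub>M x : car M" using lr l' Lc xc by auto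
  have eq: "n \<ominus>\<^sub>M (l' \<oplus>\<^sub>M r \<odot>\<^sub>M x) = l \<ominus>\<^sub>M l'"
   unfolding lr(3) using cc by (simp add: M.add_minus_add_cancel)
  have "l \<ominus>\<^sub>M l' : N \<inter> ?L"
   using eq submodule_minus[OF insert.prems(2) n l'(3)] submodule_minus[OF L lr(1) l'(1)] by auto
  then have "l \<ominus>\<^sub>M l' : K" using C3[OF K(1)] K(2) by (auto simp: D_def)
  then have "(l \<ominus>\<^sub>M l') \<oplus>\<^sub>M (l' \<oplus>\<^sub>M r \<odot>\<^sub>M x) : K" using l' submoduleE(5)[OF K(1)] by auto
  moreover have "(l \<ominus>\<^sub>M l') \<oplus>\<^sub>M (l' \<oplus>\<^sub>M r \<odot>\<^sub>M x) = n"
   unfolding lr(3) using cc by (simp add: M.minus_add_add_cancel)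
  ultimately show "n : K" by simp
 qed
 ultimately show ?case by (intro exI[of _ D]) simp
qed

lemma fin_span_imp_noeth:
 assumes "noetherian_ring R" "finite B" "B <= car M"
  and "!!K. submodule K R M ==> B <= K ==> car M <= K"
 shows "noeth_module R M"
 unfolding noeth_module_def
proof (intro allI impI)
 fix N assume N: "submodule N R M"
 have "car M <= span_module R M B" using assms(4) span_submodule[OF assms(3)] span_incl by auto
 then show "\<exists>C. finite C & C <= N & (\<forall>K. submodule K R M & C <= K \<longrightarrow> N <= K)"
  using noeth_span[OF assms(1-3) N] submoduleE(1)[OF N] by auto
qed

end

section \<open>Characteristic p\<close>

context abelian_group
begin

lemma additive_zero:
 assumes "f : car G \<rightarrow> car G" "!!x y. x : car G ==> y : car G ==> f (x \<oplus> y) = f x \<oplus> f y"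
 shows "f \<zero> = \<zero>"
proof -
 have "f \<zero> \<oplus> f \<zero> = f \<zero>" using assms(2)[of \<zero> \<zero>] by simp
 moreover have "f \<zero> : car G" using assms(1) by auto
 ultimately show ?thesis by (metis add.r_cancel_one')
qed

lemma additive_add_pow:
 assumes "f : car G \<rightarrow> car G" "!!x y. x : car G ==> y : car G ==> f (x \<oplus> y) = f x \<oplus> f y"
  and "x : car G"
 shows "f (add_pow G (n::nat) x) = add_pow G n (f x)"
proof (induction n)
 case 0
 then show ?case using additive_zero[OF assms(1,2)] by simp
next
 case (Suc n)
 then show ?case using assms by (simp add: add.nat_pow_Suc)
qed

lemma additive_finsum:
 assumes "f : car G \<rightarrow> car G" "!!x y. x : car G ==> y : car G ==> f (x \<oplus> y) = f x \<oplus> f y"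
  and "finite S" "g : S \<rightarrow> car G"
 shows "f (finsum G g S) = finsum G (%i. f (g i)) S"
 using assms(3,4)
proof (induction rule: finite_induct)
 case empty
 then show ?case using additive_zero[OF assms(1,2)] by simp
next
 case (insert x F)
 have c: "g x : car G" "g : F \<rightarrow> car G" using insert by auto
 have c': "(%i. f (g i)) : F \<rightarrow> car G" using c assms(1) by auto
 have "f (finsum G g (insert x F)) = f (g x \<oplus> finsum G g F)" using insert c by (simp add: finsum_insert)
 also have "\<dots> = f (g x) \<oplus> f (finsum G g F)" using c by (simp add: assms(2))
 also have "\<dots> = finsum G (%i. f (g i)) (insert x F)"
  using insert c c' assms(1) by (simp add: finsum_insert Pi_iff)
 finally show ?case .
qed

text \<open>Stated for commuting additive operators instead of ring elements, so that it covers both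
  powers of elements of \<open>R\<close> and iterated commutators \<open>ad r\<close>.\<close>

lemma binomial_operators:
 assumes A: "A : car G \<rightarrow> car G" "!!x y. x : car G ==> y : car G ==> A (x \<oplus> y) = A x \<oplus> A y"
  and B: "B : car G \<rightarrow> car G" "!!x y. x : car G ==> y : car G ==> B (x \<oplus> y) = B x \<oplus> B y"
  and comm: "!!x. x : car G ==> A (B x) = B (A x)"
  and P: "!!x. x : car G ==> P x = A x \<oplus> B x"
  and u: "u : car G"
 shows "(P ^^ n) u = (\<Oplus>i\<in>{..n}. add_pow G (n choose i) ((A ^^ i) ((B ^^ (n - i)) u)))"
proof (induction n)
 case 0
 then show ?case using u by (simp add: finsum_0 del: atMost_0)
next
 case (Suc n)
 have Ai: "(A ^^ i) x : car G" "(B ^^ i) x : car G" if "x : car G" for i x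
  using that A(1) B(1) by (induction i) auto
 have cA: "B ((A ^^ i) x) = (A ^^ i) (B x)" if "x : car G" for i x
  using that by (induction i) (auto simp: Ai comm[symmetric])
 define t where "t i j = (A ^^ i) ((B ^^ j) u)" for i j
 have t: "t i j : car G" for i j using Ai u by (simp add: t_def)
 have At: "A (t i j) = t (Suc i) j" for i j by (simp add: t_def)
 have Bt: "B (t i j) = t i (Suc j)" for i j using cA Ai u by (simp add: t_def)
 have IH: "(P ^^ n) u = (\<Oplus>i\<in>{..n}. add_pow G (n choose i) (t i (n - i)))" using Suc by (simp add: t_def)
 \<comment> \<open>\<open>f\<close> and \<open>g\<close> are the two terms of Pascal's rule. The
   value of \<open>f\<close> at \<open>i = 0\<close> stands for the missing coefficient below
   \<open>n choose 0\<close> and lets both sums run over \<open>{..Suc n}\<close>.\<close>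
 define f where "f i = add_pow G (if i = 0 then 0 else n choose (i - 1)) (t i (Suc n - i))" for i
 define g where "g i = add_pow G (n choose i) (t i (Suc n - i))" for i
 have fc: "f i : car G" and gc: "g i : car G" for i unfolding f_def g_def using t by auto
 have 1: "A ((P ^^ n) u) = (\<Oplus>i\<in>{..Suc n}. f i)"
 proof -
  have "A ((P ^^ n) u) = (\<Oplus>i\<in>{..n}. A (add_pow G (n choose i) (t i (n - i))))"
   unfolding IH by (rule additive_finsum[OF A]) (auto simp: t)
  also have "\<dots> = (\<Oplus>i\<in>{..n}. f (Suc i))"
   using additive_add_pow[OF A] t by (simp add: f_def At)
  also have "\<dots> = (\<Oplus>i\<in>{..Suc n}. f i)"
   using fc t by (subst finsum_Suc2) (auto simp: f_def)
  finally show ?thesis .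
 qed
 have 2: "B ((P ^^ n) u) = (\<Oplus>i\<in>{..Suc n}. g i)"
 proof -
  have "B ((P ^^ n) u) = (\<Oplus>i\<in>{..n}. B (add_pow G (n choose i) (t i (n - i))))"
   unfolding IH by (rule additive_finsum[OF B]) (auto simp: t)
  also have "\<dots> = (\<Oplus>i\<in>{..n}. g i)"
   using additive_add_pow[OF B] t gc by (intro finsum_cong') (auto simp: g_def Bt Suc_diff_le)
  also have "\<dots> = (\<Oplus>i\<in>{..Suc n}. g i)"
   using gc t by (subst finsum_Suc) (auto simp: g_def binomial_eq_0)
  finally show ?thesis .
 qed
 have "(P ^^ n) u : car G" unfolding IH using t by simp
 then have "(P ^^ Suc n) u = (\<Oplus>i\<in>{..Suc n}. f i) \<oplus> (\<Oplus>i\<in>{..Suc n}. g i)"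
  using P 1 2 by simp
 also have "\<dots> = (\<Oplus>i\<in>{..Suc n}. f i \<oplus> g i)"
  using fc gc by (subst finsum_addf) auto
 also have "\<dots> = (\<Oplus>i\<in>{..Suc n}. add_pow G (Suc n choose i) (t i (Suc n - i)))"
 proof (rule finsum_cong')
  fix i assume "i : {..Suc n}"
  show "f i \<oplus> g i = add_pow G (Suc n choose i) (t i (Suc n - i))"
   using t by (cases i) (auto simp: f_def g_def add.nat_pow_mult)
 qed (use t in auto)
 finally show ?case by (simp add: t_def)
qed

text \<open>The binomial coefficients strictly between the two ends are multiples of
  \<open>p\<close>, and \<open>p\<close> kills the group.\<close>

lemma frobenius_operators:
 assumes A: "A : car G \<rightarrow> car G" "!!x y. x : car G ==> y : car G ==> A (x \<oplus> y) = A x \<oplus> A y"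
  and B: "B : car G \<rightarrow> car G" "!!x y. x : car G ==> y : car G ==> B (x \<oplus> y) = B x \<oplus> B y"
  and comm: "!!x. x : car G ==> A (B x) = B (A x)"
  and P: "!!x. x : car G ==> P x = A x \<oplus> B x"
  and u: "u : car G"
  and p: "Factorial_Ring.prime p" "!!x. x : car G ==> add_pow G p x = \<zero>"
 shows "(P ^^ p) u = (A ^^ p) u \<oplus> (B ^^ p) u"
proof -
 have Ai: "(A ^^ i) x : car G" "(B ^^ i) x : car G" if "x : car G" for i x
  using that A(1) B(1) by (induction i) auto
 define h where "h i = add_pow G (p choose i) ((A ^^ i) ((B ^^ (p - i)) u))" for i
 have hc: "h i : car G" for i unfolding h_def using Ai u by auto
 have p1: "p > 0" using p(1) prime_gt_0_nat by auto
 have h0: "h i = \<zero>" if "i \<noteq> 0" "i < p" for i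
 proof -
  have "p dvd (p choose i)" using that p(1) dvd_choose_prime[of i p] by simp
  then obtain k where "p choose i = p * k" by auto
  then have "h i = add_pow G k (add_pow G p ((A ^^ i) ((B ^^ (p - i)) u)))"
   unfolding h_def using Ai u by (simp add: add.nat_pow_pow)
  then show ?thesis using p(2) Ai u by simp
 qed
 have "(P ^^ p) u = (\<Oplus>i\<in>{..p}. h i)"
  unfolding h_def by (rule binomial_operators[OF A B comm P u])
 also have "\<dots> = (\<Oplus>i\<in>{0, p}. h i)"
  using h0 hc by (intro add.finprod_mono_neutral_cong_right) auto
 also have "\<dots> = h 0 \<oplus> h p" using p1 hc by (subst finsum_insert) auto
 finally show ?thesis using u Ai p1 by (simp add: h_def a_comm)
qed

end

text \<open>The characteristic is expressed by \<open>p\<close> times one being zero. Ring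
  homomorphisms preserve this, which makes the completions instances at once.\<close>

locale char_ring = cring R for R :: "('a, 'k) ring_scheme" (structure) and p :: nat +
 assumes prime_p: "Factorial_Ring.prime p" and char_one: "add_pow R p \<one> = \<zero>"
begin

lemma char_zero: "x : car R ==> add_pow R p x = \<zero>"
 using add_pow_ldistr[of \<one> x p] char_one by simp

lemma power_p_add:
 assumes "x : car R" "y : car R"
 shows "(x \<oplus> y) [^] p = x [^] p \<oplus> y [^] p"
proof -
 \<comment> \<open>Powers of \<open>z\<close> are read as iterates of the multiplication operator
   applied to one.\<close>
 have it: "(((\<otimes>) z) ^^ n) \<one> = z [^] n" if "z : car R" for z and n :: nat
  using that by (induction n) (auto simp: m_comm)
 have "(((\<otimes>) (x \<oplus> y)) ^^ p) \<one> = (((\<otimes>) x) ^^ p) \<one> \<oplus> (((\<otimes>) y) ^^ p) \<one>"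
  by (rule frobenius_operators) (use assms prime_p char_zero in \<open>auto simp: l_distr r_distr m_lcomm\<close>)
 then show ?thesis using it assms by simp
qed

lemma frob_add:
 assumes "x : car R" "y : car R"
 shows "(x \<oplus> y) [^] (p ^ e) = x [^] (p ^ e) \<oplus> y [^] (p ^ e)"
proof (induction e)
 case 0 then show ?case using assms by simp
next
 case (Suc e)
 have "(x \<oplus> y) [^] (p ^ Suc e) = ((x \<oplus> y) [^] (p ^ e)) [^] p"
  using assms by (simp add: nat_pow_pow mult.commute)
 also have "\<dots> = (x [^] (p ^ e)) [^] p \<oplus> (y [^] (p ^ e)) [^] p"
  using assms Suc power_p_add by simp
 finally show ?case using assms by (simp add: nat_pow_pow mult.commute)
qed

lemma frob_zero [simp]: "\<zero> [^] (p ^ e) = \<zero>"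
proof -
 have "p ^ e > 0" using prime_p prime_gt_0_nat by auto
 then show ?thesis by (simp add: nat_pow_zero)
qed

lemma frob_push_simps [simp]:
 "car (frob_push R p e) = car R" "\<zero>\<^sub>(frob_push R p e) = \<zero>" "add (frob_push R p e) = add R"
 "smult (frob_push R p e) = (%x u. (x [^] (p ^ e)) \<otimes> u)"
 by (auto simp: frob_push_def)

lemma frob_push_module: "module R (frob_push R p e)"
proof (rule moduleI)
 show "cring R" by (rule is_cring)
 show "abelian_group (frob_push R p e)"
 proof (rule abelian_groupI)
  fix x assume "x : car (frob_push R p e)"
  then show "\<exists>y\<in>car (frob_push R p e). y \<oplus>\<^sub>(frob_push R p e) x = \<zero>\<^sub>(frob_push R p e)"
   using l_neg[of x] by auto
 qed (auto simp: a_ac)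
qed (auto simp: frob_add l_distr r_distr m_assoc nat_pow_distrib)

lemma submodule_frob_iff:
 "submodule N R (frob_push R p e) \<longleftrightarrow> N <= car R & \<zero> : N & (\<forall>x\<in>N. \<forall>y\<in>N. x \<oplus> y : N) &
  (\<forall>r\<in>car R. \<forall>x\<in>N. r [^] (p ^ e) \<otimes> x : N)" (is "?l \<longleftrightarrow> ?r")
proof
 interpret M: module R "frob_push R p e" by (rule frob_push_module)
 { assume N: ?l
  from M.submoduleE(1,4,5)[OF N] M.submodule_zero[OF N] show ?r by simp }
 { assume ?r
  then show ?l by (intro M.submoduleI_simple) auto }
qed

end

section \<open>Ideals and Artin--Rees\<close>

lemma (in abelian_group) a_minus_zero: "x : car G ==> x \<ominus> \<zero> = x"
 using r_neg[OF zero_closed] l_zero[OF a_inv_closed[OF zero_closed]] by (simp add: a_minus_def)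

lemma (in noetherian_ring) ideal_maximal:
 assumes "!!I. I : F ==> ideal I R" "F \<noteq> {}"
 shows "\<exists>W\<in>F. \<forall>V\<in>F. W <= V \<longrightarrow> V = W"
proof (rule subset_Zorn_nonempty[OF assms(2)])
 fix C assume C: "C \<noteq> {}" "subset.chain F C"
 then have "subset.chain {I. ideal I R} C" using assms(1) by (auto simp: subset.chain_def)
 then have "\<Union>C : C" by (rule ideal_chain_is_trivial[OF C(1)])
 then show "\<Union>C : F" using C(2) by (auto simp: subset.chain_def)
qed

lemma (in noetherian_ring) ideal_maximalE:
 assumes "!!I. I : F ==> ideal I R" "A : F"
 obtains W where "W : F" "!!V. V : F ==> W <= V ==> V = W"
proof -
 have "\<exists>W\<in>F. \<forall>V\<in>F. W <= V \<longrightarrow> V = W"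
  by (rule ideal_maximal) (use assms in auto)
 then obtain W where "W : F" "\<forall>V\<in>F. W <= V \<longrightarrow> V = W" by (elim bexE)
 then show thesis using that by simp
qed

lemma (in module) noeth_module_maximalE:
 assumes "noeth_module R M" "!!N. N : F ==> submodule N R M" "A : F"
 obtains W where "W : F" "!!V. V : F ==> W <= V ==> V = W"
proof -
 have "\<exists>W\<in>F. \<forall>V\<in>F. W <= V \<longrightarrow> V = W"
  by (rule noeth_module_maximal) (use assms in auto)
 then obtain W where "W : F" "\<forall>V\<in>F. W <= V \<longrightarrow> V = W" by (elim bexE)
 then show thesis using that by simp
qed

context cring
begin

lemma ideal_props:
 assumes "ideal I R"
 shows "I <= car R" "\<zero> : I" "!!x y. x : I ==> y : I ==> x \<oplus> y : I"
  and "!!x y. x : I ==> y : I ==> x \<ominus> y : I"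
  and "!!x y. x : car R ==> y : I ==> x \<otimes> y : I"
  and "!!x y. x : car R ==> y : I ==> y \<otimes> x : I"
  and "!!x. x : I ==> \<ominus> x : I"
proof -
 interpret I: ideal I R by (rule assms)
 show "I <= car R" using I.Icarr by auto
 show "\<zero> : I" by simp
 show "x \<oplus> y : I" "x \<ominus> y : I" if "x : I" "y : I" for x y
  using that by (auto simp: a_minus_def)
 show "x \<otimes> y : I" "y \<otimes> x : I" if "x : car R" "y : I" for x y
  using that I.I_l_closed I.I_r_closed by auto
 show "\<ominus> x : I" if "x : I" for x using that by auto
qed

lemma colon_ideal:
 assumes "ideal J R" "A <= car R"
 shows "ideal {u \<in> car R. \<forall>a\<in>A. a \<otimes> u : J} R"
proof (rule idealI_simple)
 note J = ideal_props[OF assms(1)]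
 fix r u assume "r : car R" "u : {u \<in> car R. \<forall>a\<in>A. a \<otimes> u : J}"
 moreover have "a \<otimes> (r \<otimes> u) = r \<otimes> (a \<otimes> u)" if "a : A" "r : car R" "u : car R" for a
  using that assms(2) by (simp add: m_lcomm subset_iff)
 ultimately show "r \<otimes> u : {u \<in> car R. \<forall>a\<in>A. a \<otimes> u : J}"
  using J(5) by auto
qed (use assms ideal_props[OF assms(1)] in \<open>auto simp: r_distr subset_iff\<close>)

lemma colon_ideal_single:
 "ideal J R ==> b : car R ==> ideal {u \<in> car R. b \<otimes> u : J} R"
 using colon_ideal[of J "{b}"] by simp

lemma ideal_prod_min:
 assumes "ideal K R" "!!i j. i : I ==> j : J ==> i \<otimes> j : K"
 shows "I \<cdot>\<^sub>R J <= K"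
proof
 fix s assume "s : I \<cdot>\<^sub>R J"
 then show "s : K"
  by (induction rule: ideal_prod.induct) (auto simp: assms(2) ideal_props(3)[OF assms(1)])
qed

lemma ideal_power_ideal: "ideal I R ==> ideal (ideal_power R I n) R"
 by (induction n) (auto simp: oneideal ideal_prod_is_ideal)

lemma ideal_power_Suc_subset:
 assumes "ideal I R" shows "ideal_power R I (Suc n) <= ideal_power R I n"
 unfolding ideal_power.simps
 by (rule ideal_prod_min) (use ideal_power_ideal[OF assms] ideal_props(5)[OF ideal_power_ideal[OF assms]]
   ideal_props(1)[OF assms] in auto)

text \<open>One factor \<open>i\<close> is moved out by passing from \<open>K\<close> to the ideal
  of all \<open>u\<close> with \<open>i \<otimes> u\<close> in \<open>K\<close>. Products of
  elements thus test the inclusion, without an equation between products of ideal powers.\<close>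

lemma ideal_power_add_min:
 assumes I: "ideal I R" and K: "ideal K R"
  and "!!x y. x : ideal_power R I m ==> y : ideal_power R I n ==> x \<otimes> y : K"
 shows "ideal_power R I (m + n) <= K"
 using K assms(3)
proof (induction m arbitrary: K)
 case 0
 have "y : K" if y: "y : ideal_power R I n" for y
 proof -
  have "\<one> \<otimes> y : K" using y 0 by simp
  moreover have "y : car R" using y ideal_props(1)[OF ideal_power_ideal[OF I]] by blast
  ultimately show ?thesis by simp
 qed
 then show ?case by auto
next
 case (Suc m)
 show ?case
  unfolding add_Suc ideal_power.simps
 proof (rule ideal_prod_min[OF Suc.prems(1)])
  fix i j assume i: "i : I" and j: "j : ideal_power R I (m + n)"
  have ic: "i : car R" using i ideal_props(1)[OF I] by auto
  have "ideal_power R I (m + n) <= {u \<in> car R. i \<otimes> u : K}"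
  proof (rule Suc.IH)
   show "ideal {u \<in> car R. i \<otimes> u : K} R" by (rule colon_ideal_single[OF Suc.prems(1) ic])
   fix x y assume x: "x : ideal_power R I m" and y: "y : ideal_power R I n"
   have c: "x : car R" "y : car R" using x y ideal_props(1)[OF ideal_power_ideal[OF I]] by auto
   have "i \<otimes> x : ideal_power R I (Suc m)" using i x by (simp add: ideal_prod.prod)
   then have "i \<otimes> x \<otimes> y : K" using Suc.prems(2) y by blast
   then show "x \<otimes> y : {u \<in> car R. i \<otimes> u : K}" using c ic by (simp add: m_assoc)
  qed
  then show "i \<otimes> j : K" using j by auto
 qed
qed

lemma pow_mem_ideal_power: "ideal I R ==> x : I ==> x [^] n : ideal_power R I n"
proof (induction n)
 case (Suc n)
 then have "x \<otimes> x [^] n : ideal_power R I (Suc n)" by (simp add: ideal_prod.prod)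
 then show ?case using Suc ideal_props(1) by (metis nat_pow_Suc nat_pow_closed m_comm subsetD)
qed simp

end

text \<open>If \<open>J\<^sup>*\<close> is maximal among the ideals \<open>J'\<close> with \<open>I\<^sup>n J' <= J\<close> for some \<open>n\<close>, then an associated
 prime of \<open>J\<^sup>*\<close> would contain \<open>I\<close>, which allows \<open>J\<^sup>*\<close> to be enlarged unless it is the whole ring.\<close>

lemma nil_ideal_power:
 assumes cr: "cring R" and nR: "noetherian_ring R" and I: "ideal I R" and J: "ideal J R"
  and nil: "!!x. x : I ==> \<exists>k::nat. x [^]\<^sub>R k : J"
 shows "\<exists>n. ideal_power R I n <= J"
proof -
 interpret cring R by (rule cr)
 interpret noetherian_ring R by (rule nR)
 note Ic = ideal_props(1)[OF I]
 define F where "F = {J'. ideal J' R & J <= J' & (\<exists>n. \<forall>x\<in>ideal_power R I n. \<forall>y\<in>J'. x \<otimes>\<^sub>R y : J)}"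
 have "J : F" unfolding F_def using J ideal_props(5)[OF J] by (auto intro!: exI[of _ 0])
 moreover have "ideal W R" if "W : F" for W using that by (simp add: F_def)
 ultimately obtain M where M: "M : F" "!!V. V : F ==> M <= V ==> V = M"
  using ideal_maximalE[of F] by metis
 then have Mi: "ideal M R" and JM: "J <= M" by (auto simp: F_def)
 obtain n where n: "!!x y. x : ideal_power R I n ==> y : M ==> x \<otimes>\<^sub>R y : J" using M(1) by (auto simp: F_def)
 define c where "c b = {u \<in> car R. b \<otimes>\<^sub>R u : M}" for b
 have "\<one>\<^sub>R : M"
 proof (rule ccontr)
  assume one: "\<one>\<^sub>R \<notin> M"
  \<comment> \<open>The annihilators of the nonzero classes modulo \<open>M\<close>; a maximal one
    is an associated prime.\<close>
  define G where "G = {c b | b. b : car R & b \<notin> M}"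
  have "c \<one>\<^sub>R : G" using one by (auto simp: G_def)
  moreover have "ideal W R" if "W : G" for W using that colon_ideal_single[OF Mi] by (auto simp: G_def c_def)
  ultimately obtain W where W: "W : G" "!!V. V : G ==> W <= V ==> V = W"
   using ideal_maximalE[of G] by metis
  then obtain b where b: "b : car R" "b \<notin> M" "W = c b" by (auto simp: G_def)
  have xb: "b \<otimes>\<^sub>R x : M" if x: "x : I" for x
  proof (rule ccontr)
   assume not: "b \<otimes>\<^sub>R x \<notin> M"
   have xc: "x : car R" using x Ic by auto
   \<comment> \<open>A product of \<open>b\<close> with a power of \<open>x\<close> that is outside
     \<open>M\<close> has the same annihilator as \<open>b\<close>, by maximality. If the next power
     fell into \<open>M\<close>, then \<open>x\<close> would lie in \<open>c b\<close>.\<close>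
   have all: "b \<otimes>\<^sub>R x [^]\<^sub>R k \<notin> M" for k :: nat
   proof (induction k)
    case 0 then show ?case using b by simp
   next
    case (Suc k)
    let ?y = "b \<otimes>\<^sub>R x [^]\<^sub>R k"
    have yc: "?y : car R" using b xc by simp
    have "c ?y : G" using Suc yc by (auto simp: G_def)
    moreover have "c b <= c ?y"
    proof
     fix u assume "u : c b"
     then have u: "u : car R" "b \<otimes>\<^sub>R u : M" by (auto simp: c_def)
     then have "x [^]\<^sub>R k \<otimes>\<^sub>R (b \<otimes>\<^sub>R u) : M" using ideal_props(5)[OF Mi] xc by simp
     then show "u : c ?y" using u b xc by (simp add: c_def m_ac)
    qed
    ultimately have "c ?y = c b" using W b by auto
    show ?case
    proof
     assume "b \<otimes>\<^sub>R x [^]\<^sub>R Suc k : M"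
     then have "x : c ?y" using xc b by (simp add: c_def m_assoc)
     then show False using \<open>c ?y = c b\<close> not by (auto simp: c_def)
    qed
   qed
   obtain k :: nat where "x [^]\<^sub>R k : M" using nil[OF x] JM by auto
   then show False using all[of k] ideal_props(5)[OF Mi] b by blast
  qed
  \<comment> \<open>The enlarged ideal: one more factor from \<open>I\<close> carries
    \<open>N\<close> into \<open>M\<close>, so the exponent \<open>Suc n\<close> serves for
    \<open>N\<close>. It contains \<open>b\<close>, which \<open>M\<close> does not.\<close>
  define N where "N = {u \<in> car R. \<forall>a\<in>I. a \<otimes>\<^sub>R u : M}"
  have Ni: "ideal N R" unfolding N_def by (rule colon_ideal[OF Mi Ic])
  have MN: "M <= N" unfolding N_def using ideal_props(1,5)[OF Mi] Ic by auto
  have "x \<otimes>\<^sub>R y : J" if x: "x : ideal_power R I (Suc n)" and y: "y : N" for x y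
  proof -
   have yc: "y : car R" using y by (auto simp: N_def)
   have "ideal_power R I (Suc n) <= {u \<in> car R. y \<otimes>\<^sub>R u : J}"
    unfolding ideal_power.simps
   proof (rule ideal_prod_min)
    show "ideal {u \<in> car R. y \<otimes>\<^sub>R u : J} R" by (rule colon_ideal_single[OF J yc])
    fix i j assume i: "i : I" and j: "j : ideal_power R I n"
    have "i : car R" "j : car R" using i j Ic ideal_props(1)[OF ideal_power_ideal[OF I]] by auto
    moreover have "j \<otimes>\<^sub>R (i \<otimes>\<^sub>R y) : J" using n[OF j] y i by (auto simp: N_def)
    ultimately show "i \<otimes>\<^sub>R j : {u \<in> car R. y \<otimes>\<^sub>R u : J}" using yc by (simp add: m_ac)
   qed
   then show ?thesis using x yc m_comm by auto
  qed
  then have "N : F" using Ni MN JM unfolding F_def by blast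
  then have "N = M" using M(2) MN by auto
  moreover have "b : N" using xb b Ic by (auto simp: N_def m_comm subset_iff)
  ultimately show False using b by auto
 qed
 then have "ideal_power R I n <= J" using n ideal_props(1)[OF ideal_power_ideal[OF I, of n]] by (metis r_one subsetD subsetI)
 then show ?thesis ..
qed

text \<open>Take \<open>L\<close> maximal among the submodules that contain \<open>JP\<close> and
  meet \<open>P\<close> inside \<open>JP\<close>. For \<open>x\<close> in \<open>J\<close> some
  power of \<open>x\<close> carries the module into \<open>L\<close>, since adding the multiples of
  that power to \<open>L\<close> does not enlarge the intersection with \<open>P\<close> beyond
  \<open>JP\<close>.\<close>

lemma (in module) artin_rees_weak:
 assumes nM: "noeth_module R M" and J: "ideal J R" and P: "submodule P R M"
 defines "JP \<equiv> span_module R M {r \<odot>\<^sub>M y | r y. r : J & y : P}"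
 shows "\<exists>L. submodule L R M & L \<inter> P <= JP &
  (\<forall>x\<in>J. \<exists>k::nat. \<forall>q\<in>car M. (x [^] k) \<odot>\<^sub>M q : L)"
proof -
 have Jc: "J <= car R" using J R.ideal_props(1) by auto
 have Pc: "P <= car M" using submoduleE(1)[OF P] by auto
 have JPs: "submodule JP R M" unfolding JP_def by (rule span_submodule) (use Jc Pc in auto)
 have JPi: "r \<odot>\<^sub>M y : JP" if "r : J" "y : P" for r y
  unfolding JP_def by (rule subsetD[OF span_incl]) (use that in auto)
 define F where "F = {L. submodule L R M & JP <= L & L \<inter> P <= JP}"
 have "JP : F" using JPs by (auto simp: F_def)
 moreover have "submodule W R M" if "W : F" for W using that by (simp add: F_def)
 ultimately obtain L where L: "L : F" "!!V. V : F ==> L <= V ==> V = L"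
  using noeth_module_maximalE[OF nM, of F] by metis
 then have Ls: "submodule L R M" and LJ: "JP <= L" and LP: "L \<inter> P <= JP" by (auto simp: F_def)
 note LE = submoduleE[OF Ls]
 have "\<exists>k::nat. \<forall>q\<in>car M. (x [^] k) \<odot>\<^sub>M q : L" if x: "x : J" for x
 proof -
  have xc: "x : car R" using x Jc by auto
  \<comment> \<open>The elements that \<open>x [^] k\<close> carries into \<open>L\<close>. This
    growing chain is stationary from some \<open>k\<close> on, and that exponent is used for
    \<open>V\<close>.\<close>
  define C where "C k = {q \<in> car M. (x [^] k) \<odot>\<^sub>M q : L}" for k :: nat
  have Cs: "submodule (C k) R M" for k
  proof (rule submoduleI_simple)
   show "\<zero>\<^sub>M : C k" using submodule_zero[OF Ls] xc by (simp add: C_def)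
  next
   fix r q assume r: "r : car R" and "q : C k"
   then have q: "q : car M" "(x [^] k) \<odot>\<^sub>M q : L" by (auto simp: C_def)
   have "(x [^] k) \<odot>\<^sub>M (r \<odot>\<^sub>M q) = r \<odot>\<^sub>M ((x [^] k) \<odot>\<^sub>M q)"
    using r q xc by (simp flip: smult_assoc1 add: R.m_comm)
   then show "r \<odot>\<^sub>M q : C k" using r q LE(4) by (simp add: C_def)
  qed (use xc LE in \<open>auto simp: C_def smult_r_distr\<close>)
  have "submodule W R M" if "W : range C" for W using that Cs by auto
  moreover have "C 0 : range C" by simp
  ultimately obtain W where W: "W : range C" "!!V. V : range C ==> W <= V ==> V = W"
   using noeth_module_maximalE[OF nM, of "range C"] by metis
  then obtain k where k: "W = C k" by auto
  have "C k <= C (Suc k)"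
  proof
   fix q assume "q : C k"
   then have q: "q : car M" "(x [^] k) \<odot>\<^sub>M q : L" by (auto simp: C_def)
   then have "x \<odot>\<^sub>M ((x [^] k) \<odot>\<^sub>M q) : L" using LE(4) xc by simp
   moreover have "x \<odot>\<^sub>M ((x [^] k) \<odot>\<^sub>M q) = (x [^] Suc k) \<odot>\<^sub>M q"
    using q xc by (simp flip: smult_assoc1 add: R.m_comm)
   ultimately show "q : C (Suc k)" using q by (simp add: C_def)
  qed
  then have Ck: "C (Suc k) = C k" using W k by auto
  \<comment> \<open>\<open>V\<close> is the sum of \<open>L\<close> and the multiples of
    \<open>x [^] k\<close>.\<close>
  define V where "V = {u \<in> car M. \<exists>q\<in>car M. u \<ominus>\<^sub>M (x [^] k) \<odot>\<^sub>M q : L}"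
  have xk: "(x [^] k) \<odot>\<^sub>M q : car M" if "q : car M" for q using that xc by simp
  have Vs: "submodule V R M"
  proof (rule submoduleI_simple)
   show "\<zero>\<^sub>M : V" using submodule_minus[OF Ls submodule_zero[OF Ls] submodule_zero[OF Ls]] xc unfolding V_def
    by (intro CollectI conjI bexI[of _ "\<zero>\<^sub>M"]) auto
  next
   fix u v assume "u : V" "v : V"
   then obtain q r where e: "u : car M" "v : car M" "q : car M" "r : car M"
    "u \<ominus>\<^sub>M (x [^] k) \<odot>\<^sub>M q : L" "v \<ominus>\<^sub>M (x [^] k) \<odot>\<^sub>M r : L" by (auto simp: V_def)
   have "(u \<oplus>\<^sub>M v) \<ominus>\<^sub>M (x [^] k) \<odot>\<^sub>M (q \<oplus>\<^sub>M r) =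
    (u \<ominus>\<^sub>M (x [^] k) \<odot>\<^sub>M q) \<oplus>\<^sub>M (v \<ominus>\<^sub>M (x [^] k) \<odot>\<^sub>M r)"
    using e xc by (simp add: a_minus_def smult_r_distr M.minus_add M.a_ac)
   then show "u \<oplus>\<^sub>M v : V" using e LE(5) unfolding V_def by (intro CollectI conjI bexI[of _ "q \<oplus>\<^sub>M r"]) auto
  next
   fix r u assume r: "r : car R" and "u : V"
   then obtain q where e: "u : car M" "q : car M" "u \<ominus>\<^sub>M (x [^] k) \<odot>\<^sub>M q : L" by (auto simp: V_def)
   have "(r \<odot>\<^sub>M u) \<ominus>\<^sub>M (x [^] k) \<odot>\<^sub>M (r \<odot>\<^sub>M q) = r \<odot>\<^sub>M (u \<ominus>\<^sub>M (x [^] k) \<odot>\<^sub>M q)"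
   proof -
    have "(x [^] k) \<odot>\<^sub>M (r \<odot>\<^sub>M q) = r \<odot>\<^sub>M ((x [^] k) \<odot>\<^sub>M q)"
     using e r xc by (simp flip: smult_assoc1 add: R.m_comm)
    then show ?thesis using e r xc by (simp add: a_minus_def smult_r_distr smult_r_minus)
   qed
   then show "r \<odot>\<^sub>M u : V" using e r LE(4) unfolding V_def by (intro CollectI conjI bexI[of _ "r \<odot>\<^sub>M q"]) auto
  qed (auto simp: V_def)
  have LV: "L <= V"
  proof
   fix l assume l: "l : L"
   then show "l : V" using LE(1) xc M.a_minus_zero[of l] unfolding V_def
    by (intro CollectI conjI bexI[of _ "\<zero>\<^sub>M"]) auto
  qed
  \<comment> \<open>For \<open>z\<close> in \<open>P\<close> the product of \<open>x\<close> and
    \<open>z\<close> is in \<open>JP\<close>, hence in \<open>L\<close>. So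
    \<open>x [^] Suc k\<close> carries \<open>q\<close> into \<open>L\<close>, by stability
    \<open>x [^] k\<close> does too, and \<open>z\<close> itself lies in \<open>L\<close>.\<close>
  have "V \<inter> P <= JP"
  proof
   fix z assume "z : V \<inter> P"
   then obtain q where z: "z : P" "z : car M" "q : car M" "z \<ominus>\<^sub>M (x [^] k) \<odot>\<^sub>M q : L" by (auto simp: V_def)
   let ?w = "(x [^] k) \<odot>\<^sub>M q"
   have w: "?w : car M" using z xc by simp
   have 1: "x \<odot>\<^sub>M z : L" using JPi x z LJ by auto
   have 2: "x \<odot>\<^sub>M (z \<ominus>\<^sub>M ?w) : L" using z LE(4) xc by auto
   have "x \<odot>\<^sub>M ?w = x \<odot>\<^sub>M z \<ominus>\<^sub>M x \<odot>\<^sub>M (z \<ominus>\<^sub>M ?w)"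
    using z w xc by (simp add: a_minus_def smult_r_distr smult_r_minus M.minus_add M.minus_minus M.r_neg2)
   then have "x \<odot>\<^sub>M ?w : L" using submodule_minus[OF Ls 1 2] by simp
   moreover have "x \<odot>\<^sub>M ?w = (x [^] Suc k) \<odot>\<^sub>M q"
    using z xc by (simp flip: smult_assoc1 add: R.m_comm)
   ultimately have "q : C (Suc k)" using z by (simp add: C_def)
   then have "q : C k" using Ck by simp
   then have "?w : L" by (simp add: C_def)
   then have "(z \<ominus>\<^sub>M ?w) \<oplus>\<^sub>M ?w : L" using z LE(5) by auto
   moreover have "(z \<ominus>\<^sub>M ?w) \<oplus>\<^sub>M ?w = z" using z w by (simp add: a_minus_def M.a_assoc M.l_neg)
   ultimately show "z : JP" using LP z by auto
  qed
  then have "V = L" using Vs LV LJ L(2)[of V] by (auto simp: F_def)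
  moreover have "(x [^] k) \<odot>\<^sub>M q : V" if "q : car M" for q
   unfolding V_def using xk[OF that] that submodule_zero[OF Ls] by (auto simp: a_minus_def M.r_neg intro!: bexI[of _ q])
  ultimately show ?thesis by blast
 qed
 then show ?thesis using Ls LP by auto
qed

section \<open>Finite powers of a module\<close>

definition pow_module :: "('a, 'm, 'l) module_scheme => nat => ('a, nat => 'm) module" where
 "pow_module M n = \<lparr>carrier = {..<n} \<rightarrow>\<^sub>E car M, monoid.mult = (%_ _. undefined), one = undefined,
  ring.zero = (\<lambda>i\<in>{..<n}. \<zero>\<^sub>M), add = (%f g. \<lambda>i\<in>{..<n}. f i \<oplus>\<^sub>M g i),
  smult = (%r f. \<lambda>i\<in>{..<n}. r \<odot>\<^sub>M f i)\<rparr>"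

lemma pow_module_simps [simp]:
 "car (pow_module M n) = {..<n} \<rightarrow>\<^sub>E car M"
 "\<zero>\<^sub>(pow_module M n) = (\<lambda>i\<in>{..<n}. \<zero>\<^sub>M)"
 "f \<oplus>\<^sub>(pow_module M n) g = (\<lambda>i\<in>{..<n}. f i \<oplus>\<^sub>M g i)"
 "r \<odot>\<^sub>(pow_module M n) f = (\<lambda>i\<in>{..<n}. r \<odot>\<^sub>M f i)"
 by (auto simp: pow_module_def)

lemma (in module) pow_module_module: "module R (pow_module M n)"
proof (rule moduleI)
 show "cring R" by (rule R.is_cring)
 show "abelian_group (pow_module M n)"
 proof (rule abelian_groupI)
  fix f assume f: "f : car (pow_module M n)"
  then have "(\<lambda>i\<in>{..<n}. \<ominus>\<^sub>M f i) : car (pow_module M n)" by (auto simp: PiE_iff)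
  moreover have "(\<lambda>i\<in>{..<n}. \<ominus>\<^sub>M f i) \<oplus>\<^sub>(pow_module M n) f = \<zero>\<^sub>(pow_module M n)"
   using f by (auto simp: PiE_iff M.l_neg intro!: restrict_ext)
  ultimately show "\<exists>g\<in>car (pow_module M n). g \<oplus>\<^sub>(pow_module M n) f = \<zero>\<^sub>(pow_module M n)" by blast
 next
  fix f assume f: "f : car (pow_module M n)"
  then show "\<zero>\<^sub>(pow_module M n) \<oplus>\<^sub>(pow_module M n) f = f"
   by (auto simp: PiE_iff intro!: extensionalityI[of _ "{..<n}"])
 qed (auto simp: PiE_iff M.a_ac intro!: restrict_ext)
next
 fix f assume f: "f : car (pow_module M n)"
 then show "\<one> \<odot>\<^sub>(pow_module M n) f = f"
  by (auto simp: PiE_iff intro!: extensionalityI[of _ "{..<n}"])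
qed (auto simp: PiE_iff smult_l_distr smult_r_distr smult_assoc1 intro!: restrict_ext)

text \<open>A vector is the sum of its coordinate vectors, which are added one at a time.\<close>

lemma (in module) pow_module_partial_sums:
 assumes K: "submodule K R (pow_module M n)" and v: "v : car (pow_module M n)"
  and single: "!!k. k < n ==> (\<lambda>i\<in>{..<n}. if i = k then v k else \<zero>\<^sub>M) : K"
 shows "v : K"
proof -
 interpret P: module R "pow_module M n" by (rule pow_module_module)
 have vc: "v i : car M" if "i < n" for i using v that by (auto simp: PiE_iff)
 have "m \<le> n ==> (\<lambda>i\<in>{..<n}. if i < m then v i else \<zero>\<^sub>M) : K" for m
 proof (induction m)
  case 0
  show ?case using P.submodule_zero[OF K] by (simp add: restrict_def)
 next
  case (Suc m)
  have "(\<lambda>i\<in>{..<n}. if i < Suc m then v i else \<zero>\<^sub>M) =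
   (\<lambda>i\<in>{..<n}. if i < m then v i else \<zero>\<^sub>M) \<oplus>\<^sub>(pow_module M n) (\<lambda>i\<in>{..<n}. if i = m then v m else \<zero>\<^sub>M)"
   using vc Suc.prems by (auto intro!: restrict_ext simp: less_Suc_eq)
  moreover have "(\<lambda>i\<in>{..<n}. if i < m then v i else \<zero>\<^sub>M) : K" using Suc by (intro Suc.IH) simp
  moreover have "(\<lambda>i\<in>{..<n}. if i = m then v m else \<zero>\<^sub>M) : K" using Suc single[of m] by simp
  ultimately show ?case using P.submoduleE(5)[OF K] by (simp only:)
 qed
 from this[of n] have "(\<lambda>i\<in>{..<n}. if i < n then v i else \<zero>\<^sub>M) : K" by simp
 moreover have "(\<lambda>i\<in>{..<n}. if i < n then v i else \<zero>\<^sub>M) = v"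
  using v by (auto simp: PiE_iff intro!: extensionalityI[of _ "{..<n}"])
 ultimately show ?thesis by simp
qed

definition spans :: "('a, 'k) ring_scheme => ('a, 'm, 'l) module_scheme => 'm set => bool" where
 "spans R M B \<longleftrightarrow> finite B & B <= car M & (\<forall>K. submodule K R M & B <= K \<longrightarrow> car M <= K)"

lemma (in module) spans_noeth: "noetherian_ring R ==> spans R M B ==> noeth_module R M"
 unfolding spans_def by (rule fin_span_imp_noeth[of B]) auto

lemma (in module) spans_pow:
 assumes "spans R M B" shows "\<exists>C. spans R (pow_module M n) C"
proof -
 interpret P: module R "pow_module M n" by (rule pow_module_module)
 let ?e = "%k x. \<lambda>i\<in>{..<n}. if i = k then x else \<zero>\<^sub>M"
 define C where "C = (%(k, x). ?e k x) ` ({..<n} \<times> B)"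
 have B: "finite B" "B <= car M" "!!K. submodule K R M ==> B <= K ==> car M <= K"
  using assms by (auto simp: spans_def)
 have "finite C" using B by (auto simp: C_def)
 moreover have "C <= car (pow_module M n)" using B(2) by (auto simp: C_def PiE_iff extensional_def split: if_splits)
 moreover have "car (pow_module M n) <= K" if K: "submodule K R (pow_module M n)" "C <= K" for K
 proof
  fix v assume v: "v : car (pow_module M n)"
  show "v : K"
  proof (rule pow_module_partial_sums[OF K(1) v])
   fix k assume k: "k < n"
   \<comment> \<open>The preimage of \<open>K\<close> under the inclusion of coordinate
     \<open>k\<close>. It contains \<open>B\<close>, hence everything.\<close>
   have "submodule {x \<in> car M. ?e k x : K} R M"
   proof (rule submoduleI_simple)
    have "?e k \<zero>\<^sub>M = \<zero>\<^sub>(pow_module M n)" by (auto intro!: restrict_ext)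
    then show "\<zero>\<^sub>M : {x \<in> car M. ?e k x : K}" using P.submodule_zero[OF K(1)] by simp
   next
    fix x y assume "x : {x \<in> car M. ?e k x : K}" "y : {x \<in> car M. ?e k x : K}"
    then have xy: "x : car M" "y : car M" "?e k x \<oplus>\<^sub>(pow_module M n) ?e k y : K"
     using P.submoduleE(5)[OF K(1)] by blast+
    have "?e k x \<oplus>\<^sub>(pow_module M n) ?e k y = ?e k (x \<oplus>\<^sub>M y)" using xy(1,2) by (auto intro!: restrict_ext)
    then show "x \<oplus>\<^sub>M y : {x \<in> car M. ?e k x : K}" using xy by simp
   next
    fix r x assume r: "r : car R" and "x : {x \<in> car M. ?e k x : K}"
    then have xy: "x : car M" "r \<odot>\<^sub>(pow_module M n) ?e k x : K"
     using P.submoduleE(4)[OF K(1)] by blast+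
    have "r \<odot>\<^sub>(pow_module M n) ?e k x = ?e k (r \<odot>\<^sub>M x)" using xy(1) r by (auto intro!: restrict_ext)
    then show "r \<odot>\<^sub>M x : {x \<in> car M. ?e k x : K}" using xy r by simp
   qed auto
   moreover have "B <= {x \<in> car M. ?e k x : K}" using B(2) K(2) k by (auto simp: C_def)
   ultimately have "car M <= {x \<in> car M. ?e k x : K}" by (rule B(3))
   moreover have "v k : car M" using v k by (auto simp: PiE_iff)
   ultimately show "?e k (v k) : K" by blast
  qed
 qed
 ultimately show ?thesis unfolding spans_def by blast
qed

section \<open>Frobenius push-forwards of an F-finite ring\<close>

lemma (in module) submodule_finsum:
 assumes "submodule K R M" "finite S" "!!i. i : S ==> f i : K"
 shows "finsum M f S : K"
 using assms(2,3)
proof (induction rule: finite_induct)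
 case empty
 then show ?case using submodule_zero[OF assms(1)] by simp
next
 case (insert x F)
 have "f : insert x F \<rightarrow> car M" using insert submoduleE(1)[OF assms(1)] by auto
 then show ?case using insert submoduleE(5)[OF assms(1)] by (simp add: finsum_insert)
qed

lemma fin_gen_spans:
 assumes "module R M" "fin_gen_module R M" shows "\<exists>B. spans R M B"
proof -
 interpret module R M by (rule assms(1))
 obtain B where B: "B <= car M" "finite B"
  and g: "!!m. m : car M ==> \<exists>c\<in>B \<rightarrow> car R. m = (\<Oplus>\<^sub>M v\<in>B. c v \<odot>\<^sub>M v)"
  using assms(2) unfolding fin_gen_module_def by blast
 have "m : K" if K: "submodule K R M" "B <= K" and m: "m : car M" for m K
 proof -
  obtain c where c: "c : B \<rightarrow> car R" "m = (\<Oplus>\<^sub>M v\<in>B. c v \<odot>\<^sub>M v)" using g[OF m] by blast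
  show ?thesis unfolding c(2) using c(1) K submoduleE(4)[OF K(1)] B(2) by (intro submodule_finsum) auto
 qed
 then show ?thesis using B unfolding spans_def by blast
qed

context char_ring
begin

text \<open>The scalar \<open>r [^] (p ^ Suc e)\<close> is the \<open>p ^ e\<close>-th power of
  \<open>r [^] p\<close>. Hence the products \<open>y [^] (p ^ e) \<otimes> x\<close>, with
  \<open>y\<close> a generator of the first push-forward and \<open>x\<close> one of the
  push-forward at \<open>e\<close>, generate at \<open>Suc e\<close>.\<close>

lemma spans_frob_push:
 assumes "spans R (frob_push R p 1) B"
 shows "\<exists>C. spans R (frob_push R p e) C"
proof (induction e)
 case 0
 have "car R <= K" if K: "submodule K R (frob_push R p 0)" "{\<one>} <= K" for K
 proof
  fix x assume x: "x : car R"
  have "\<forall>r\<in>car R. \<forall>x\<in>K. r [^] (p ^ 0) \<otimes> x : K" using K(1) unfolding submodule_frob_iff by simp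
  then have "x [^] (p ^ 0) \<otimes> \<one> : K" using K(2) x by blast
  then show "x : K" using x by simp
 qed
 then have "spans R (frob_push R p 0) {\<one>}" by (auto simp: spans_def)
 then show ?case by blast
next
 case (Suc e)
 then obtain C where C: "finite C" "C <= car R"
  "!!K. submodule K R (frob_push R p e) ==> C <= K ==> car R <= K" by (auto simp: spans_def)
 have B: "finite B" "B <= car R"
  "!!K. submodule K R (frob_push R p 1) ==> B <= K ==> car R <= K" using assms by (auto simp: spans_def)
 define D where "D = (%(y, x). y [^] (p ^ e) \<otimes> x) ` (B \<times> C)"
 have Dc: "D <= car R" using B(2) C(2) by (auto simp: D_def)
 have "car R <= K" if K: "submodule K R (frob_push R p (Suc e))" "D <= K" for K
 proof -
  have K': "K <= car R" "\<zero> : K" "!!x y. x : K ==> y : K ==> x \<oplus> y : K"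
   "!!r x. r : car R ==> x : K ==> r [^] (p ^ Suc e) \<otimes> x : K"
   using K(1) unfolding submodule_frob_iff by auto
  \<comment> \<open>First the generator \<open>x\<close> is fixed and the coefficient varies: the
    admissible \<open>c\<close> form a submodule of the first push-forward that contains
    \<open>B\<close>.\<close>
  have 1: "c [^] (p ^ e) \<otimes> x : K" if c: "c : car R" and x: "x : C" for c x
  proof -
   have xc: "x : car R" using x C by auto
   have "submodule {c \<in> car R. c [^] (p ^ e) \<otimes> x : K} R (frob_push R p 1)"
    unfolding submodule_frob_iff
   proof (intro conjI ballI)
    show "{c : car R. c [^] (p ^ e) \<otimes> x : K} <= car R" by auto
    show "\<zero> : {c \<in> car R. c [^] (p ^ e) \<otimes> x : K}" using K'(2) xc by simp
    fix u v assume u: "u : {c \<in> car R. c [^] (p ^ e) \<otimes> x : K}"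
    { assume v: "v : {c \<in> car R. c [^] (p ^ e) \<otimes> x : K}"
     show "u \<oplus> v : {c \<in> car R. c [^] (p ^ e) \<otimes> x : K}"
      using u v K'(3) xc by (simp add: frob_add l_distr) }
   next
    fix r u assume u: "u : {c \<in> car R. c [^] (p ^ e) \<otimes> x : K}" and r: "r : car R"
    have "(r [^] (p ^ 1) \<otimes> u) [^] (p ^ e) \<otimes> x = r [^] (p ^ Suc e) \<otimes> (u [^] (p ^ e) \<otimes> x)"
     using r u xc by (simp add: nat_pow_distrib nat_pow_pow m_assoc)
    then show "r [^] (p ^ 1) \<otimes> u : {c \<in> car R. c [^] (p ^ e) \<otimes> x : K}"
     using r u K'(4) by simp
   qed
   moreover have "B <= {c \<in> car R. c [^] (p ^ e) \<otimes> x : K}"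
    using B(2) x K(2) by (auto simp: D_def)
   ultimately show ?thesis using B(3) c by blast
  qed
  \<comment> \<open>Then \<open>u\<close> varies. Quantifying over all \<open>c\<close> makes the
    set stable under \<open>p ^ e\<close>-th powers as scalars, which \<open>K\<close> itself need
    not respect.\<close>
  have "submodule {u \<in> car R. \<forall>c\<in>car R. c [^] (p ^ e) \<otimes> u : K} R (frob_push R p e)"
   unfolding submodule_frob_iff
  proof (intro conjI ballI)
   show "{u : car R. \<forall>c\<in>car R. c [^] (p ^ e) \<otimes> u : K} <= car R" by auto
   show "\<zero> : {u \<in> car R. \<forall>c\<in>car R. c [^] (p ^ e) \<otimes> u : K}" using K'(2) by simp
   fix u v assume u: "u : {u \<in> car R. \<forall>c\<in>car R. c [^] (p ^ e) \<otimes> u : K}"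
   { assume v: "v : {u \<in> car R. \<forall>c\<in>car R. c [^] (p ^ e) \<otimes> u : K}"
    show "u \<oplus> v : {u \<in> car R. \<forall>c\<in>car R. c [^] (p ^ e) \<otimes> u : K}"
     using u v K'(3) by (simp add: r_distr) }
  next
   fix r u assume u: "u : {u \<in> car R. \<forall>c\<in>car R. c [^] (p ^ e) \<otimes> u : K}" and r: "r : car R"
   have "c [^] (p ^ e) \<otimes> (r [^] (p ^ e) \<otimes> u) : K" if c: "c : car R" for c
   proof -
    have "c [^] (p ^ e) \<otimes> (r [^] (p ^ e) \<otimes> u) = (c \<otimes> r) [^] (p ^ e) \<otimes> u"
     using r u c by (simp add: nat_pow_distrib m_assoc)
    moreover have "c \<otimes> r : car R" using r c by simp
    ultimately show ?thesis using u by auto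
   qed
   then show "r [^] (p ^ e) \<otimes> u : {u \<in> car R. \<forall>c\<in>car R. c [^] (p ^ e) \<otimes> u : K}"
    using r u by simp
  qed
  moreover have "C <= {u \<in> car R. \<forall>c\<in>car R. c [^] (p ^ e) \<otimes> u : K}" using 1 C(2) by auto
  ultimately have *: "car R <= {u \<in> car R. \<forall>c\<in>car R. c [^] (p ^ e) \<otimes> u : K}" by (rule C(3))
  show ?thesis
  proof
   fix u assume u: "u : car R"
   then have "\<one> [^] (p ^ e) \<otimes> u : K" using * one_closed by blast
   then show "u : K" using u by simp
  qed
 qed
 moreover have "finite D" using B C by (auto simp: D_def)
 ultimately have "spans R (frob_push R p (Suc e)) D" using Dc by (auto simp: spans_def)
 then show ?case by blast
qed

text \<open>In \<open>artin_rees_weak\<close> the exponent depends on the element of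
  \<open>J\<close>. \<open>nil_ideal_power\<close> turns this into one exponent \<open>t\<close> for
  all of \<open>I\<close>, once the elements that multiply every vector into \<open>L\<close> are
  known to form an ideal.\<close>

lemma artin_rees_pow:
 assumes nR: "noetherian_ring R" and B: "spans R (frob_push R p e) B"
  and I: "ideal I R" and J: "ideal J R" and IJ: "!!x. x : I ==> \<exists>k::nat. x [^] k : J"
  and P: "submodule P R (pow_module (frob_push R p e) l)"
 shows "\<exists>t. \<forall>v\<in>P. (\<forall>i<l. v i : ideal_power R I t) \<longrightarrow>
  v : span_module R (pow_module (frob_push R p e) l)
   {r \<odot>\<^sub>(pow_module (frob_push R p e) l) y | r y. r : J & y : P}"
proof -
 let ?F = "frob_push R p e" let ?M = "pow_module ?F l"
 interpret F: module R ?F by (rule frob_push_module)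
 interpret M: module R ?M by (rule F.pow_module_module)
 have "noeth_module R ?M" using F.spans_pow[OF B, of l] M.spans_noeth[OF nR] by blast
 from M.artin_rees_weak[OF this J P] obtain L where L: "submodule L R ?M"
  and LP: "L \<inter> P <= span_module R ?M {r \<odot>\<^sub>?M  y | r y. r : J & y : P}"
  and nil: "!!x. x : J ==> \<exists>k::nat. \<forall>q\<in>car ?M. (x [^] k) \<odot>\<^sub>?M  q : L" by blast
 note LE = M.submoduleE[OF L]
 \<comment> \<open>Here \<open>c\<close> multiplies each coordinate directly, whereas the module
   action multiplies by a \<open>p ^ e\<close>-th power. The entries of a vector can then serve as
   the factors \<open>c\<close>.\<close>
 define Z where "Z = {c \<in> car R. \<forall>v\<in>car ?M. (\<lambda>i\<in>{..<l}. c \<otimes> v i) : L}"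
 have Zi: "ideal Z R"
 proof (rule idealI_simple)
  show "Z <= car R" by (auto simp: Z_def)
  have "(\<lambda>i\<in>{..<l}. \<zero> \<otimes> v i) = \<zero>\<^sub>?M " if "v : car ?M" for v
   using that by (auto simp: PiE_iff intro!: restrict_ext)
  then show "\<zero> : Z" using M.submodule_zero[OF L] by (auto simp: Z_def)
 next
  fix c d assume c: "c : Z" and d: "d : Z"
  have "(\<lambda>i\<in>{..<l}. (c \<oplus> d) \<otimes> v i) : L" if v: "v : car ?M" for v
  proof -
   have "(\<lambda>i\<in>{..<l}. (c \<oplus> d) \<otimes> v i) = (\<lambda>i\<in>{..<l}. c \<otimes> v i) \<oplus>\<^sub>?M  (\<lambda>i\<in>{..<l}. d \<otimes> v i)"
    using v c d by (auto simp: PiE_iff Z_def l_distr intro!: restrict_ext)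
   moreover have "(\<lambda>i\<in>{..<l}. c \<otimes> v i) : L" "(\<lambda>i\<in>{..<l}. d \<otimes> v i) : L"
    using c d v by (auto simp: Z_def)
   ultimately show ?thesis using LE(5) by (simp only:)
  qed
  then show "c \<oplus> d : Z" using c d by (simp add: Z_def)
 next
  fix r c assume r: "r : car R" and c: "c : Z"
  have "(\<lambda>i\<in>{..<l}. (r \<otimes> c) \<otimes> v i) : L" if v: "v : car ?M" for v
  proof -
   define w where "w = (\<lambda>i\<in>{..<l}. r \<otimes> v i)"
   have "w : car ?M" using v r by (auto simp: PiE_iff w_def)
   then have "(\<lambda>i\<in>{..<l}. c \<otimes> w i) : L" using c unfolding Z_def by blast
   moreover have "(\<lambda>i\<in>{..<l}. (r \<otimes> c) \<otimes> v i) = (\<lambda>i\<in>{..<l}. c \<otimes> w i)"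
    using v c r by (auto simp: PiE_iff Z_def m_ac w_def intro!: restrict_ext)
   ultimately show ?thesis by (simp only:)
  qed
  then show "r \<otimes> c : Z" using c r by (simp add: Z_def)
 qed
 have "\<exists>k::nat. x [^] k : Z" if x: "x : I" for x
 proof -
  have xc: "x : car R" using x ideal_props(1)[OF I] by auto
  obtain s :: nat where s: "x [^] s : J" using IJ[OF x] by blast
  obtain k :: nat where k: "!!q. q : car ?M ==> ((x [^] s) [^] k) \<odot>\<^sub>?M  q : L" using nil[OF s] by blast
  \<comment> \<open>The exponent: \<open>x [^] s\<close> is in \<open>J\<close>, its
    \<open>k\<close>-th power acts into \<open>L\<close>, and acting means multiplying by the
    \<open>p ^ e\<close>-th power.\<close>
  have "(\<lambda>i\<in>{..<l}. x [^] (s * k * p ^ e) \<otimes> v i) : L" if v: "v : car ?M" for v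
   using k[OF v] xc by (simp add: nat_pow_pow)
  then have "x [^] (s * k * p ^ e) : Z" using xc by (simp add: Z_def)
  then show ?thesis by blast
 qed
 from nil_ideal_power[OF is_cring nR I Zi this] obtain t where t: "ideal_power R I t <= Z" by blast
 have "v : L" if v: "v : P" and vi: "!!i. i < l ==> v i : ideal_power R I t" for v
 proof (rule F.pow_module_partial_sums[OF L])
  show vc: "v : car ?M" using v M.submoduleE(1)[OF P] by auto
  fix k assume k: "k < l"
  \<comment> \<open>As an element of \<open>Z\<close>, the entry \<open>v k\<close> multiplies the
    \<open>k\<close>-th unit vector into \<open>L\<close>.\<close>
  have "v k : Z" using vi[OF k] t by auto
  moreover have "(\<lambda>i\<in>{..<l}. if i = k then \<one> else \<zero>) : car ?M" by auto
  ultimately have "(\<lambda>i\<in>{..<l}. v k \<otimes> (\<lambda>i\<in>{..<l}. if i = k then \<one> else \<zero>) i) : L"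
   unfolding Z_def by blast
  moreover have "(\<lambda>i\<in>{..<l}. v k \<otimes> (\<lambda>i\<in>{..<l}. if i = k then \<one> else \<zero>) i) =
   (\<lambda>i\<in>{..<l}. if i = k then v k else \<zero>\<^sub>?F )"
   using vc k by (auto simp: PiE_iff intro!: restrict_ext)
  ultimately show "(\<lambda>i\<in>{..<l}. if i = k then v k else \<zero>\<^sub>?F ) : L" by (simp only:)
 qed
 then show ?thesis using LP by blast
qed

end

lemma (in abelian_group) minus_add_minus:
 assumes "x : car G" "y : car G" "z : car G"
 shows "(x \<ominus> z) \<oplus> (y \<ominus> x) = y \<ominus> z"
proof -
 have "(x \<ominus> z) \<oplus> (y \<ominus> x) = (y \<ominus> z) \<oplus> (x \<ominus> x)" using assms by (simp add: a_minus_def a_ac)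
 then show ?thesis using assms by (simp add: r_neg a_minus_def)
qed

section \<open>Complete local rings over a maximal ideal\<close>

primrec psum :: "('a, 'k) ring_scheme => (nat => 'a) => nat => 'a" where
 "psum R d 0 = \<zero>\<^sub>R"
| "psum R d (Suc m) = psum R d m \<oplus>\<^sub>R d m"

text \<open>The ideal \<open>I y\<^sub>1 + \<dots> + I y\<^sub>n\<close>, built along the list so
  that coefficient sequences can be chosen for one generator at a time.\<close>

primrec list_mult :: "('a, 'k) ring_scheme => 'a set => 'a list => 'a set" where
 "list_mult R I [] = {\<zero>\<^sub>R}"
| "list_mult R I (y # ys) = {c \<otimes>\<^sub>R y \<oplus>\<^sub>R d | c d. c : I & d : list_mult R I ys}"

context cring
begin

lemma psum_closed [simp]: "(!!i. d i : car R) ==> psum R d m : car R"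
 by (induction m) auto

lemma list_mult_ideal:
 assumes "ideal I R" "set ys <= car R"
 shows "ideal (list_mult R I ys) R"
 using assms(2)
proof (induction ys)
 case Nil
 then show ?case by (simp add: zeroideal)
next
 case (Cons y ys)
 note I = ideal_props[OF assms(1)]
 have yc: "y : car R" and D: "ideal (list_mult R I ys) R" using Cons by auto
 note D' = ideal_props[OF D]
 have Ic: "!!x. x : I ==> x : car R" and Dc: "!!x. x : list_mult R I ys ==> x : car R"
  using I(1) D'(1) by auto
 show ?case unfolding list_mult.simps
 proof (rule idealI_simple)
  show "{c \<otimes> y \<oplus> d | c d. c : I & d : list_mult R I ys} <= car R" using yc Ic Dc by auto
  have "\<zero> = \<zero> \<otimes> y \<oplus> \<zero>" using yc by simp
  then show "\<zero> : {c \<otimes> y \<oplus> d | c d. c : I & d : list_mult R I ys}" using I(2) D'(2) by blast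
 next
  fix u v assume "u : {c \<otimes> y \<oplus> d | c d. c : I & d : list_mult R I ys}" "v : {c \<otimes> y \<oplus> d | c d. c : I & d : list_mult R I ys}"
  then obtain c d c' d' where e: "c : I" "d : list_mult R I ys" "u = c \<otimes> y \<oplus> d"
   "c' : I" "d' : list_mult R I ys" "v = c' \<otimes> y \<oplus> d'" by auto
  have "u \<oplus> v = (c \<oplus> c') \<otimes> y \<oplus> (d \<oplus> d')" using e yc Ic Dc by (simp add: l_distr a_ac)
  then show "u \<oplus> v : {c \<otimes> y \<oplus> d | c d. c : I & d : list_mult R I ys}" using e I(3) D'(3) by blast
 next
  fix r u assume r: "r : car R" and "u : {c \<otimes> y \<oplus> d | c d. c : I & d : list_mult R I ys}"
  then obtain c d where e: "c : I" "d : list_mult R I ys" "u = c \<otimes> y \<oplus> d" by auto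
  have "r \<otimes> u = (r \<otimes> c) \<otimes> y \<oplus> (r \<otimes> d)" using e yc Ic Dc r by (simp add: r_distr m_assoc)
  then show "r \<otimes> u : {c \<otimes> y \<oplus> d | c d. c : I & d : list_mult R I ys}" using e r I(5) D'(5) by blast
 qed
qed

lemma list_mult_mem:
 assumes "ideal I R" "set ys <= car R" "x : I" "y : set ys"
 shows "x \<otimes> y : list_mult R I ys"
 using assms(2,4)
proof (induction ys)
 case (Cons z ys)
 have xc: "x : car R" using ideal_props(1)[OF assms(1)] assms(3) by auto
 have D: "ideal (list_mult R I ys) R" using list_mult_ideal[OF assms(1)] Cons by auto
 show ?case
 proof (cases "y : set ys")
  case True
  then have m: "x \<otimes> y : list_mult R I ys" using Cons by auto
  then have "x \<otimes> y : car R" using ideal_props(1)[OF D] by auto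
  then have "x \<otimes> y = \<zero> \<otimes> z \<oplus> x \<otimes> y" using Cons by auto
  then show ?thesis using m ideal_props(2)[OF assms(1)] unfolding list_mult.simps by blast
 next
  case False
  then have "x \<otimes> y = x \<otimes> z \<oplus> \<zero>" using Cons xc by auto
  then show ?thesis using ideal_props(2)[OF D] assms(3) unfolding list_mult.simps by blast
 qed
qed simp

text \<open>The generators of the power \<open>n\<close> stay fixed while their coefficients lie in
  ever higher powers, as the convergence of a series requires.\<close>

lemma ideal_power_list_mult:
 assumes I: "ideal I R" and ys: "set ys <= car R" "ideal_power R I n = genideal R (set ys)"
 shows "ideal_power R I (m + n) <= list_mult R (ideal_power R I m) ys"
proof (rule ideal_power_add_min[OF I])
 show D: "ideal (list_mult R (ideal_power R I m) ys) R"
  by (rule list_mult_ideal[OF ideal_power_ideal[OF I] ys(1)])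
 fix x y assume x: "x : ideal_power R I m" and y: "y : ideal_power R I n"
 have xc: "x : car R" using x ideal_props(1)[OF ideal_power_ideal[OF I]] by auto
 have "genideal R (set ys) <= {u \<in> car R. x \<otimes> u : list_mult R (ideal_power R I m) ys}"
  by (rule genideal_minimal[OF colon_ideal_single[OF D xc]])
   (use ys(1) list_mult_mem[OF ideal_power_ideal[OF I] ys(1) x] in auto)
 then show "x \<otimes> y : list_mult R (ideal_power R I m) ys" using y ys by auto
qed

lemma ideal_power_1: "ideal I R ==> ideal_power R I 1 <= I"
 using ideal_prod_min[of I I "car R"] ideal_props(6)[of I] by simp

end

text \<open>What is kept of the completion at a maximal ideal \<open>P\<close>. \<open>Fil n\<close>
  stands for the kernel of the projection to the \<open>n\<close>-th quotient; that it is generated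
  by the image of the \<open>n\<close>-th power of \<open>P\<close> is derived in
  \<open>Fil_min\<close>.\<close>

locale adic_ring = R: char_ring R p + S: char_ring S p
 for R :: "('a, 'k) ring_scheme" (structure) and S :: "('s, 'l) ring_scheme" and p :: nat +
 fixes P :: "'a set" and \<iota> :: "'a => 's" and Fil :: "nat => 's set"
 assumes noetherian: "noetherian_ring R" and maximal: "maximalideal P R"
  and hom: "\<iota> : ring_hom R S"
  and Fil_ideal: "ideal (Fil n) S" and Fil_decr: "Fil (Suc n) <= Fil n"
  and approx: "z : car S ==> \<exists>r\<in>car R. z \<ominus>\<^sub>S \<iota> r : Fil n"
  and Fil_iff: "r : car R ==> \<iota> r : Fil n \<longleftrightarrow> r : ideal_power R P n"
  and separated: "z : car S ==> (!!n. z : Fil n) ==> z = \<zero>\<^sub>S"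
  and complete: "(!!n. u n : car R) ==> (!!n. u (Suc n) \<ominus> u n : ideal_power R P n) ==>
   \<exists>z\<in>car S. \<forall>n. z \<ominus>\<^sub>S \<iota> (u n) : Fil n"
begin

sublocale \<iota>: ring_hom_cring R S \<iota>
 by (rule ring_hom_cringI[OF R.is_cring S.is_cring hom])

lemma P_ideal: "ideal P R"
 using maximal by (simp add: maximalideal_def)

lemmas Fil = S.ideal_props[OF Fil_ideal]
lemmas P_power = R.ideal_props[OF R.ideal_power_ideal[OF P_ideal]]

lemma Fil_mono: "m \<le> n ==> Fil n <= Fil m"
 by (induction n rule: dec_induct) (use Fil_decr in auto)

text \<open>The terms \<open>d m\<close> have coefficients in the \<open>m\<close>-th power of
  \<open>P\<close>. For each generator the partial sums of its coefficients converge in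
  \<open>S\<close>; the limits times the generators add up to an element of \<open>J\<close> to
  which the whole series converges.\<close>

lemma list_mult_lift:
 assumes "ideal J S" "set ys <= car R" "\<iota> ` set ys <= J"
  and "!!m. d m : list_mult R (ideal_power R P m) ys"
 shows "\<exists>w\<in>J. \<forall>m. w \<ominus>\<^sub>S \<iota> (psum R d m) : Fil m"
 using assms(2-4)
proof (induction ys arbitrary: d)
 case Nil
 then have d: "d m = \<zero>" for m by simp
 have ps: "psum R d m = \<zero>" for m by (induction m) (auto simp: d)
 have "\<zero>\<^sub>S \<ominus>\<^sub>S \<iota> (psum R d m) : Fil m" for m
  using ps Fil(2) by (simp add: a_minus_def)
 then show ?case using S.ideal_props(2)[OF assms(1)] by blast
next
 case (Cons y ys)
 have yc: "y : car R" "\<iota> y : J" using Cons.prems by auto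
 have "\<forall>m. \<exists>c d'. c : ideal_power R P m & d' : list_mult R (ideal_power R P m) ys & d m = c \<otimes> y \<oplus> d'"
  using Cons.prems(3) by auto
 then obtain c d' where cd: "!!m. c m : ideal_power R P m" "!!m. d' m : list_mult R (ideal_power R P m) ys"
  "!!m. d m = c m \<otimes> y \<oplus> d' m" by metis
 have ci: "c m : car R" for m using cd(1) P_power(1) by auto
 have ysc: "set ys <= car R" using Cons.prems by auto
 have di: "d' m : car R" for m
  using cd(2) R.ideal_props(1)[OF R.list_mult_ideal[OF R.ideal_power_ideal[OF P_ideal] ysc]] by blast
 obtain w' where w': "w' : J" "!!m. w' \<ominus>\<^sub>S \<iota> (psum R d' m) : Fil m"
  using Cons.IH[OF ysc _ cd(2)] Cons.prems(2) by auto
 have "psum R c (Suc m) \<ominus> psum R c m = c m" for m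
  using ci R.psum_closed[of c m] by (simp add: a_minus_def R.a_ac R.r_neg1 R.r_neg)
 then obtain v where v: "v : car S" "!!m. v \<ominus>\<^sub>S \<iota> (psum R c m) : Fil m"
  using complete[of "psum R c"] ci cd(1) by auto
 have ps: "psum R d m = psum R c m \<otimes> y \<oplus> psum R d' m" for m
 proof (induction m)
  case (Suc m)
  then show ?case using ci di yc R.psum_closed[of c m] R.psum_closed[of d' m]
   by (simp add: cd(3) R.l_distr R.a_ac)
 qed (use yc in simp)
 have w'c: "w' : car S" using w'(1) S.ideal_props(1)[OF assms(1)] by auto
 let ?w = "v \<otimes>\<^sub>S \<iota> y \<oplus>\<^sub>S w'"
 have "?w : J" using v yc w' S.ideal_props(3,5)[OF assms(1)] by auto
 moreover have "?w \<ominus>\<^sub>S \<iota> (psum R d m) : Fil m" for m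
 proof -
  have c: "\<iota> (psum R c m) : car S" "\<iota> (psum R d' m) : car S" "\<iota> y : car S"
   using ci di yc by auto
  have "?w \<ominus>\<^sub>S \<iota> (psum R d m) =
   (v \<ominus>\<^sub>S \<iota> (psum R c m)) \<otimes>\<^sub>S \<iota> y \<oplus>\<^sub>S (w' \<ominus>\<^sub>S \<iota> (psum R d' m))"
   using ci di yc v w'c c
   by (simp add: ps a_minus_def S.l_distr S.l_minus S.minus_add S.a_ac)
  then show ?thesis using v(2)[of m] w'(2)[of m] c Fil(3,6) by simp
 qed
 ultimately show ?case by blast
qed

text \<open>An element of \<open>Fil n\<close> is approximated by elements of \<open>R\<close> whose
  successive differences lie in the powers \<open>m + n\<close> of \<open>P\<close>. Expanded in
  fixed generators of the \<open>n\<close>-th power, these differences form a series as in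
  \<open>list_mult_lift\<close>, so its sum lies in \<open>J\<close>; so does the image of the first
  approximation.\<close>

lemma Fil_min:
 assumes J: "ideal J S" and PJ: "!!r. r : ideal_power R P n ==> \<iota> r : J"
 shows "Fil n <= J"
proof
 fix z assume z: "z : Fil n"
 then have zc: "z : car S" using Fil(1) by auto
 \<comment> \<open>Precision \<open>m + n\<close> instead of \<open>m\<close>: the differences have
   to factor through generators of the \<open>n\<close>-th power of \<open>P\<close> and still leave
   coefficients in the \<open>m\<close>-th.\<close>
 have "\<forall>m. \<exists>r. r : car R & z \<ominus>\<^sub>S \<iota> r : Fil (m + n)" using approx[OF zc] by blast
 then obtain r where r: "!!m. r m : car R" "!!m. z \<ominus>\<^sub>S \<iota> (r m) : Fil (m + n)" by metis
 have diff: "\<iota> (r m') \<ominus>\<^sub>S \<iota> (r m) = (z \<ominus>\<^sub>S \<iota> (r m)) \<ominus>\<^sub>S (z \<ominus>\<^sub>S \<iota> (r m'))" for m m'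
  using zc r(1) by (simp add: a_minus_def S.minus_add S.a_ac S.r_neg1 S.r_neg2)
 define d where "d m = r (Suc m) \<ominus> r m" for m
 have d: "d m : ideal_power R P (m + n)" for m
 proof -
  have "z \<ominus>\<^sub>S \<iota> (r (Suc m)) : Fil (m + n)" using r(2)[of "Suc m"] Fil_mono[of "m + n" "Suc m + n"] by auto
  then have "\<iota> (r (Suc m)) \<ominus>\<^sub>S \<iota> (r m) : Fil (m + n)" unfolding diff using r(2) Fil(4) by auto
  moreover have "\<iota> (d m) = \<iota> (r (Suc m)) \<ominus>\<^sub>S \<iota> (r m)"
   using r(1) unfolding d_def by (simp add: a_minus_def)
  ultimately have "\<iota> (d m) : Fil (m + n)" by simp
  moreover have "d m : car R" using r(1) by (simp add: d_def)
  ultimately show ?thesis using Fil_iff by blast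
 qed
 obtain A where A: "A <= car R" "finite A" "ideal_power R P n = genideal R A"
  using noetherian_ring.finetely_gen[OF noetherian R.ideal_power_ideal[OF P_ideal]] by metis
 obtain ys where ys: "set ys = A" using finite_list[OF A(2)] by blast
 have "d m : list_mult R (ideal_power R P m) ys" for m
  using d R.ideal_power_list_mult[OF P_ideal, of ys n m] ys A by auto
 moreover have "\<iota> ` set ys <= J" using PJ A R.genideal_self[OF A(1)] ys by auto
 ultimately obtain w where w: "w : J" "!!m. w \<ominus>\<^sub>S \<iota> (psum R d m) : Fil m"
  using list_mult_lift[OF J, of ys d] ys A by blast
 have ps: "psum R d m = r m \<ominus> r 0" for m
 proof (induction m)
  case 0 then show ?case using r(1) by (simp add: a_minus_def R.r_neg)
 next
  case (Suc m)
  then show ?case using r(1)[of m] r(1)[of 0] r(1)[of "Suc m"]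
   by (simp add: d_def R.minus_add_minus)
 qed
 have wc: "w : car S" using w S.ideal_props(1)[OF J] by auto
 have r0: "\<iota> (r 0) : J"
 proof (rule PJ)
  have "z \<ominus>\<^sub>S (z \<ominus>\<^sub>S \<iota> (r 0)) : Fil n" using z r(2)[of 0] Fil(4) by auto
  moreover have "z \<ominus>\<^sub>S (z \<ominus>\<^sub>S \<iota> (r 0)) = \<iota> (r 0)"
   using zc r(1) by (simp add: a_minus_def S.minus_add S.r_neg2 S.r_neg1)
  ultimately show "r 0 : ideal_power R P n" using Fil_iff r(1) by simp
 qed
 have "z \<ominus>\<^sub>S (w \<oplus>\<^sub>S \<iota> (r 0)) : Fil m" for m
 proof -
  have c: "\<iota> (r m) : car S" "\<iota> (r 0) : car S" using r(1) by auto
  have "z \<ominus>\<^sub>S \<iota> (r m) : Fil m" using r(2)[of m] Fil_mono[of m "m + n"] by auto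
  moreover have "w \<ominus>\<^sub>S \<iota> (psum R d m) : Fil m" by (rule w)
  ultimately have "(z \<ominus>\<^sub>S \<iota> (r m)) \<ominus>\<^sub>S (w \<ominus>\<^sub>S \<iota> (psum R d m)) : Fil m" by (rule Fil(4))
  moreover have "(z \<ominus>\<^sub>S \<iota> (r m)) \<ominus>\<^sub>S (w \<ominus>\<^sub>S \<iota> (psum R d m)) = z \<ominus>\<^sub>S (w \<oplus>\<^sub>S \<iota> (r 0))"
  proof -
   have e: "\<iota> (psum R d m) = \<iota> (r m) \<oplus>\<^sub>S \<ominus>\<^sub>S \<iota> (r 0)" unfolding ps using r(1) by (simp add: a_minus_def)
   have "\<iota> (r m) \<oplus>\<^sub>S (\<ominus>\<^sub>S \<iota> (r 0) \<oplus>\<^sub>S \<ominus>\<^sub>S \<iota> (r m)) = \<ominus>\<^sub>S \<iota> (r 0)"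
    using c S.r_neg[of "\<iota> (r m)"] S.a_lcomm[of "\<iota> (r m)" "\<ominus>\<^sub>S \<iota> (r 0)" "\<ominus>\<^sub>S \<iota> (r m)"] by simp
   then show ?thesis unfolding e using zc c wc
    by (simp add: a_minus_def S.minus_add S.a_ac S.r_neg1 S.r_neg2)
  qed
  ultimately show ?thesis by simp
 qed
 then have "z \<ominus>\<^sub>S (w \<oplus>\<^sub>S \<iota> (r 0)) = \<zero>\<^sub>S" using separated zc wc r(1) by auto
 then have "z = w \<oplus>\<^sub>S \<iota> (r 0)" using zc wc r(1) by (metis S.r_right_minus_eq S.add.m_closed \<iota>.hom_closed)
 then show "z : J" using w r0 S.ideal_props(3)[OF J] by simp
qed

text \<open>The contraction of \<open>J\<close> to \<open>R\<close> contains a power of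
  \<open>P\<close> by \<open>nil_ideal_power\<close>, and \<open>Fil_min\<close> carries the
  inclusion back to \<open>S\<close>.\<close>

lemma Fil_subset_nil:
 assumes J: "ideal J S" and "!!x. x : P ==> \<exists>k::nat. \<iota> (x [^] k) : J"
 shows "\<exists>n. Fil n <= J"
proof -
 have "ideal {r \<in> car R. \<iota> r : J} R"
  by (rule R.idealI_simple) (use S.ideal_props[OF J] in auto)
 moreover have "\<exists>k::nat. x [^] k : {r \<in> car R. \<iota> r : J}" if "x : P" for x
  using assms(2)[OF that] that R.ideal_props(1)[OF P_ideal] by auto
 ultimately obtain n where "ideal_power R P n <= {r \<in> car R. \<iota> r : J}"
  using nil_ideal_power[OF R.is_cring noetherian P_ideal] by blast
 then have "Fil n <= J" by (intro Fil_min[OF J]) auto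
 then show ?thesis ..
qed

text \<open>\<open>Fil_min\<close> is used once for each factor: both may be replaced by images of
  elements of \<open>R\<close>, whose product lies in the next power of \<open>P\<close>.\<close>

lemma Fil1_mult:
 assumes "r : Fil 1" "y : Fil k" shows "r \<otimes>\<^sub>S y : Fil (Suc k)"
proof -
 have sc: "r : car S" "y : car S" using assms Fil(1) by auto
 have 1: "\<iota> x \<otimes>\<^sub>S w : Fil (Suc k)" if x: "x : P" and w: "w : Fil k" for x w
 proof -
  have xc: "x : car R" using x R.ideal_props(1)[OF P_ideal] by auto
  have "Fil k <= {u \<in> car S. \<iota> x \<otimes>\<^sub>S u : Fil (Suc k)}"
  proof (rule Fil_min)
   show "ideal {u \<in> car S. \<iota> x \<otimes>\<^sub>S u : Fil (Suc k)} S"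
    by (rule S.colon_ideal_single[OF Fil_ideal]) (use xc in simp)
   fix v assume v: "v : ideal_power R P k"
   then have vc: "v : car R" using P_power(1) by auto
   have "x \<otimes> v : ideal_power R P (Suc k)" using x v by (simp add: ideal_prod.prod)
   then have "\<iota> (x \<otimes> v) : Fil (Suc k)" using Fil_iff xc vc by blast
   then show "\<iota> v : {u \<in> car S. \<iota> x \<otimes>\<^sub>S u : Fil (Suc k)}" using xc vc by simp
  qed
  then show ?thesis using w by auto
 qed
 have "Fil 1 <= {u \<in> car S. y \<otimes>\<^sub>S u : Fil (Suc k)}"
 proof (rule Fil_min)
  show "ideal {u \<in> car S. y \<otimes>\<^sub>S u : Fil (Suc k)} S"
   by (rule S.colon_ideal_single[OF Fil_ideal sc(2)])
  fix v assume "v : ideal_power R P 1"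
  then have "v : P" using R.ideal_power_1[OF P_ideal] by auto
  moreover then have "v : car R" using R.ideal_props(1)[OF P_ideal] by auto
  ultimately show "\<iota> v : {u \<in> car S. y \<otimes>\<^sub>S u : Fil (Suc k)}" using 1[of v y] assms sc S.m_comm by simp
 qed
 then show ?thesis using assms sc S.m_comm by auto
qed

end

section \<open>Descent of Frobenius-linear maps from the completion\<close>

abbreviation frob_maps :: "('a, 'k) ring_scheme => nat => nat => nat => ('a => 'a) set" where
 "frob_maps R p e e' \<equiv> lin_maps R (frob_push R p e) (frob_push R p e')"

text \<open>For \<open>q = p ^ e\<close> these are the linear combinations in
  \<open>F\<^sup>e\<^sub>*R\<close>, where a coefficient acts by its \<open>q\<close>-th
  power.\<close>

primrec lincomb :: "('a, 'k) ring_scheme => nat => nat => (nat => 'a) => (nat => 'a) => 'a" where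
 "lincomb R q 0 c y = \<zero>\<^sub>R"
| "lincomb R q (Suc n) c y = lincomb R q n c y \<oplus>\<^sub>R c n [^]\<^sub>R q \<otimes>\<^sub>R y n"

text \<open>Finite sums of compositions \<open>F\<^sup>e\<^sub>*R \<rightarrow> F\<^bsup>e'\<^esup>\<^sub>*R \<rightarrow> F\<^sup>e\<^sub>*R\<close>.\<close>

inductive_set comp_sums :: "('a, 'k) ring_scheme => nat => nat => nat => ('a => 'a) set"
 for R :: "('a, 'k) ring_scheme" and p e e' :: nat where
 zero: "(\<lambda>x\<in>car R. \<zero>\<^sub>R) : comp_sums R p e e'"
| add: "[|t : comp_sums R p e e'; h : frob_maps R p e e'; g : frob_maps R p e' e|] ==>
  (\<lambda>x\<in>car R. t x \<oplus>\<^sub>R g (h x)) : comp_sums R p e e'"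

lemma (in abelian_group) add_cancel_iff_zero:
 "[|x : car G; y : car G; x \<oplus> y = y|] ==> x = \<zero>"
 by (metis add.r_cancel_one')

context char_ring
begin

lemma frob_maps_iff:
 "f : frob_maps R p e e' \<longleftrightarrow> f : car R \<rightarrow>\<^sub>E car R &
  (\<forall>x\<in>car R. \<forall>y\<in>car R. f (x \<oplus> y) = f x \<oplus> f y) &
  (\<forall>c\<in>car R. \<forall>x\<in>car R. f (c [^] (p ^ e) \<otimes> x) = c [^] (p ^ e') \<otimes> f x)"
 unfolding lin_maps_def additive_maps_def by simp

lemma frob_mapsD:
 assumes "f : frob_maps R p e e'"
 shows "f : car R \<rightarrow>\<^sub>E car R" "!!x. x : car R ==> f x : car R"
  "!!x y. x : car R ==> y : car R ==> f (x \<oplus> y) = f x \<oplus> f y"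
  "!!c x. c : car R ==> x : car R ==> f (c [^] (p ^ e) \<otimes> x) = c [^] (p ^ e') \<otimes> f x"
  "f \<zero> = \<zero>" "!!x y. x : car R ==> y : car R ==> f (x \<ominus> y) = f x \<ominus> f y"
proof -
 show 1: "f : car R \<rightarrow>\<^sub>E car R" and 2: "!!x. x : car R ==> f x : car R"
  and 3: "!!x y. x : car R ==> y : car R ==> f (x \<oplus> y) = f x \<oplus> f y"
  and "!!c x. c : car R ==> x : car R ==> f (c [^] (p ^ e) \<otimes> x) = c [^] (p ^ e') \<otimes> f x"
  using assms unfolding frob_maps_iff by auto
 show f0: "f \<zero> = \<zero>" by (rule additive_zero) (use 2 3 in auto)
 fix x y assume xy: "x : car R" "y : car R"
 have "f (x \<ominus> y) \<oplus> f y = f (x \<ominus> y \<oplus> y)" using 3 xy by simp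
 also have "x \<ominus> y \<oplus> y = x" using xy by (simp add: a_minus_def a_assoc l_neg)
 finally show "f (x \<ominus> y) = f x \<ominus> f y" using xy 2 by (metis add.inv_solve_right' minus_closed a_minus_def)
qed

lemma lincomb_closed [simp]:
 "(!!k. k < n ==> c k : car R) ==> (!!k. k < n ==> y k : car R) ==> lincomb R q n c y : car R"
 by (induction n) auto

lemma lincomb_cong:
 "(!!k. k < n ==> c k = c' k) ==> (!!k. k < n ==> y k = y' k) ==> lincomb R q n c y = lincomb R q n c' y'"
 by (induction n) auto

lemma lincomb_add_coeff:
 assumes "!!k. k < n ==> c k : car R" "!!k. k < n ==> d k : car R" "!!k. k < n ==> y k : car R"
 shows "lincomb R (p ^ e) n (%k. c k \<oplus> d k) y = lincomb R (p ^ e) n c y \<oplus> lincomb R (p ^ e) n d y"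
 using assms
proof (induction n)
 case (Suc n)
 have cl: "lincomb R (p ^ e) n c y : car R" "lincomb R (p ^ e) n d y : car R"
  "c n : car R" "d n : car R" "y n : car R"
  using Suc by (auto intro!: lincomb_closed)
 have "lincomb R (p ^ e) n (%k. c k \<oplus> d k) y = lincomb R (p ^ e) n c y \<oplus> lincomb R (p ^ e) n d y"
  using Suc by simp
 then show ?case using cl by (simp add: frob_add l_distr a_ac)
qed simp

lemma lincomb_add_vec:
 assumes "!!k. k < n ==> c k : car R" "!!k. k < n ==> x k : car R" "!!k. k < n ==> y k : car R"
 shows "lincomb R q n c (%k. x k \<oplus> y k) = lincomb R q n c x \<oplus> lincomb R q n c y"
 using assms
proof (induction n)
 case (Suc n)
 have cl: "lincomb R q n c x : car R" "lincomb R q n c y : car R"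
  "c n : car R" "x n : car R" "y n : car R"
  using Suc by (auto intro!: lincomb_closed)
 have "lincomb R q n c (%k. x k \<oplus> y k) = lincomb R q n c x \<oplus> lincomb R q n c y"
  using Suc by simp
 then show ?case using cl by (simp add: r_distr a_ac)
qed simp

lemma lincomb_smult_coeff:
 assumes "r : car R" "!!k. k < n ==> c k : car R" "!!k. k < n ==> y k : car R"
 shows "lincomb R q n (%k. r \<otimes> c k) y = r [^] q \<otimes> lincomb R q n c y"
 using assms
proof (induction n)
 case (Suc n)
 have cl: "lincomb R q n c y : car R" "c n : car R" "y n : car R"
  using Suc by (auto intro!: lincomb_closed)
 have "lincomb R q n (%k. r \<otimes> c k) y = r [^] q \<otimes> lincomb R q n c y" using Suc by simp
 then show ?case using cl assms(1) by (simp add: r_distr m_assoc nat_pow_distrib)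
qed simp

lemma lincomb_smult_vec:
 assumes "r : car R" "!!k. k < n ==> c k : car R" "!!k. k < n ==> y k : car R"
 shows "lincomb R q n c (%k. r \<otimes> y k) = r \<otimes> lincomb R q n c y"
 using assms
proof (induction n)
 case (Suc n)
 have cl: "lincomb R q n c y : car R" "c n : car R" "y n : car R"
  using Suc by (auto intro!: lincomb_closed)
 have "lincomb R q n c (%k. r \<otimes> y k) = r \<otimes> lincomb R q n c y" using Suc by simp
 then show ?case using cl assms(1) by (simp add: r_distr m_lcomm)
qed simp

lemma lincomb_minus_vec:
 assumes "!!k. k < n ==> c k : car R" "!!k. k < n ==> x k : car R" "!!k. k < n ==> y k : car R"
 shows "lincomb R q n c (%k. x k \<ominus> y k) = lincomb R q n c x \<ominus> lincomb R q n c y"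
proof -
 have cl: "lincomb R q n c x : car R" "lincomb R q n c y : car R" using assms by auto
 have "lincomb R q n c (%k. x k \<oplus> (\<ominus> \<one>) \<otimes> y k) = lincomb R q n c x \<oplus> (\<ominus> \<one>) \<otimes> lincomb R q n c y"
  using assms by (simp add: lincomb_add_vec lincomb_smult_vec)
 moreover have "lincomb R q n c (%k. x k \<oplus> (\<ominus> \<one>) \<otimes> y k) = lincomb R q n c (%k. x k \<ominus> y k)"
  using assms by (intro lincomb_cong) (auto simp: a_minus_def l_minus)
 ultimately show ?thesis using cl by (simp add: a_minus_def l_minus)
qed

lemma lincomb_zero_coeff:
 "(!!k. k < n ==> y k : car R) ==> lincomb R (p ^ e) n (%k. \<zero>) y = \<zero>"
 by (induction n) auto

lemma lincomb_zero_vec: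
 "(!!k. k < n ==> c k : car R) ==> lincomb R q n c (%k. \<zero>) = \<zero>"
 by (induction n) auto

lemma lincomb_unit:
 assumes "!!k. k < n ==> y k : car R" "j < n"
 shows "lincomb R (p ^ e) n (%k. if k = j then \<one> else \<zero>) y = y j"
 using assms
proof (induction n)
 case (Suc n)
 show ?case
 proof (cases "j = n")
  case True
  have "lincomb R (p ^ e) n (%k. if k = j then \<one> else \<zero>) y = lincomb R (p ^ e) n (%k. \<zero>) y"
   using True by (intro lincomb_cong) auto
  also have "\<dots> = \<zero>" by (rule lincomb_zero_coeff) (use Suc in auto)
  finally show ?thesis using Suc True by simp
 next
  case False
  then show ?thesis using Suc by auto
 qed
qed simp

lemma lincomb_ideal:
 assumes "ideal I R" "!!k. k < n ==> c k : car R" "!!k. k < n ==> y k : I"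
 shows "lincomb R q n c y : I"
 using assms(2,3) by (induction n) (auto simp: ideal_props[OF assms(1)])

lemma frob_maps_lincomb:
 assumes h: "h : frob_maps R p e e'"
  and "!!k. k < n ==> c k : car R" "!!k. k < n ==> y k : car R"
 shows "h (lincomb R (p ^ e) n c y) = lincomb R (p ^ e') n c (%k. h (y k))"
 using assms(2,3) by (induction n) (auto simp: frob_mapsD[OF h])

lemma spans_lincomb:
 assumes "spans R (frob_push R p e) B"
 obtains n x where "!!k. k < n ==> x k : car R"
  "!!r. r : car R ==> \<exists>c. (\<forall>k<n. c k : car R) & r = lincomb R (p ^ e) n c x"
proof -
 have B: "finite B" "B <= car R"
  "!!K. submodule K R (frob_push R p e) ==> B <= K ==> car R <= K" using assms by (auto simp: spans_def)
 obtain xs where xs: "set xs = B" using finite_list[OF B(1)] by blast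
 define n where "n = length xs"
 define x where "x k = xs ! k" for k
 have x: "x k : car R" if "k < n" for k using that xs B(2) by (auto simp: x_def n_def)
 let ?K = "{r. \<exists>c. (\<forall>k<n. c k : car R) & r = lincomb R (p ^ e) n c x}"
 have "submodule ?K R (frob_push R p e)"
  unfolding submodule_frob_iff
 proof (intro conjI ballI)
  show "?K <= car R" using x by auto
  have "\<zero> = lincomb R (p ^ e) n (%k. \<zero>) x" using x by (simp add: lincomb_zero_coeff)
  then show "\<zero> : ?K" by (intro CollectI exI[of _ "%k. \<zero>"]) simp
 next
  fix u v assume "u : ?K" "v : ?K"
  then obtain c d where cd: "\<forall>k<n. c k : car R" "u = lincomb R (p ^ e) n c x"
   "\<forall>k<n. d k : car R" "v = lincomb R (p ^ e) n d x" by blast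
  then have "u \<oplus> v = lincomb R (p ^ e) n (%k. c k \<oplus> d k) x" using x by (simp add: lincomb_add_coeff)
  then show "u \<oplus> v : ?K" using cd by (intro CollectI exI[of _ "%k. c k \<oplus> d k"]) simp
 next
  fix r u assume r: "r : car R" and "u : ?K"
  then obtain c where c: "\<forall>k<n. c k : car R" "u = lincomb R (p ^ e) n c x" by blast
  then have "r [^] (p ^ e) \<otimes> u = lincomb R (p ^ e) n (%k. r \<otimes> c k) x" using x r by (simp add: lincomb_smult_coeff)
  then show "r [^] (p ^ e) \<otimes> u : ?K" using c r by (intro CollectI exI[of _ "%k. r \<otimes> c k"]) simp
 qed
 moreover have "B <= ?K"
 proof
  fix b assume "b : B"
  then obtain j where j: "j < n" "b = x j" using xs by (auto simp: in_set_conv_nth x_def n_def)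
  then have "b = lincomb R (p ^ e) n (%k. if k = j then \<one> else \<zero>) x" using lincomb_unit[OF x] by simp
  then show "b : ?K" by (intro CollectI exI[of _ "%k. if k = j then \<one> else \<zero>"]) simp
 qed
 ultimately have sub: "car R <= ?K" by (rule B(3))
 show thesis
 proof (rule that)
  show "x k : car R" if "k < n" for k by (rule x[OF that])
  show "\<exists>c. (\<forall>k<n. c k : car R) & r = lincomb R (p ^ e) n c x" if "r : car R" for r
   using subsetD[OF sub that] by (simp only: mem_Collect_eq)
 qed
qed

end

lemma (in adic_ring) iota_lincomb:
 assumes "!!k. k < n ==> c k : car R" "!!k. k < n ==> y k : car R"
 shows "\<iota> (lincomb R q n c y) = lincomb S q n (%k. \<iota> (c k)) (%k. \<iota> (y k))"
 using assms by (induction n) auto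

text \<open>A \<open>p ^ e\<close>-th power passes through \<open>g\<close> as a
  \<open>p ^ e'\<close>-th power. For \<open>x\<close> in \<open>P\<close> the factor
  \<open>x [^] (\<tau> * p ^ e)\<close> therefore comes out as a positive power of an element of
  \<open>Fil \<tau>\<close>, and \<open>Fil_subset_nil\<close> applies.\<close>

lemma (in adic_ring) frob_maps_continuous:
 assumes g: "g : frob_maps S p e e'"
 shows "\<exists>n. \<forall>z\<in>Fil n. g z : Fil \<tau>"
proof -
 \<comment> \<open>The quantifier over \<open>y\<close> makes \<open>J\<close> an ideal although
   \<open>g\<close> is linear only over \<open>p ^ e\<close>-th powers.\<close>
 define J where "J = {z \<in> car S. \<forall>y\<in>car S. g (z \<otimes>\<^sub>S y) : Fil \<tau>}"
 have "ideal J S"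
 proof (rule S.idealI_simple)
  show "\<zero>\<^sub>S : J" using S.frob_mapsD(5)[OF g] Fil(2) by (simp add: J_def)
  show "x \<oplus>\<^sub>S y : J" if "x : J" "y : J" for x y
   using that S.frob_mapsD(3)[OF g] Fil(3) by (simp add: J_def S.l_distr)
  show "r \<otimes>\<^sub>S x : J" if "r : car S" "x : J" for r x
   unfolding J_def
  proof (intro CollectI conjI ballI)
   fix y assume y: "y : car S"
   have "r \<otimes>\<^sub>S x \<otimes>\<^sub>S y = x \<otimes>\<^sub>S (r \<otimes>\<^sub>S y)" using that y by (simp add: J_def S.m_ac)
   moreover have "r \<otimes>\<^sub>S y : car S" using that y by simp
   ultimately show "g (r \<otimes>\<^sub>S x \<otimes>\<^sub>S y) : Fil \<tau>" using that by (simp add: J_def)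
  qed (use that in \<open>auto simp: J_def\<close>)
 qed (auto simp: J_def)
 moreover have "\<exists>k::nat. \<iota> (x [^] k) : J" if x: "x : P" for x
 proof -
  have xc: "x : car R" using x R.ideal_props(1)[OF P_ideal] by auto
  have "x [^] \<tau> : ideal_power R P \<tau>" by (rule R.pow_mem_ideal_power[OF P_ideal x])
  then have xt: "\<iota> (x [^] \<tau>) : Fil \<tau>" using Fil_iff xc by blast
  have p0: "p ^ e' > 0" using R.prime_p prime_gt_0_nat by auto
  have "g (\<iota> (x [^] (\<tau> * p ^ e)) \<otimes>\<^sub>S y) : Fil \<tau>" if y: "y : car S" for y
  proof -
   have "\<iota> (x [^] (\<tau> * p ^ e)) = (\<iota> (x [^] \<tau>)) [^]\<^sub>S (p ^ e)" using xc by (simp add: S.nat_pow_pow)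
   then have "g (\<iota> (x [^] (\<tau> * p ^ e)) \<otimes>\<^sub>S y) = (\<iota> (x [^] \<tau>)) [^]\<^sub>S (p ^ e') \<otimes>\<^sub>S g y"
    using S.frob_mapsD(4)[OF g] y xc by simp
   moreover have "(\<iota> (x [^] \<tau>)) [^]\<^sub>S (p ^ e') : Fil \<tau>"
   proof -
    obtain m where "p ^ e' = Suc m" using p0 gr0_implies_Suc by blast
    then show ?thesis using xt xc Fil(5) by simp
   qed
   ultimately show ?thesis using Fil(6) S.frob_mapsD(2)[OF g y] by simp
  qed
  then have "\<iota> (x [^] (\<tau> * p ^ e)) : J" using xc by (simp add: J_def)
  then show ?thesis by blast
 qed
 ultimately obtain n where n: "Fil n <= J" using Fil_subset_nil by blast
 have "g z : Fil \<tau>" if z: "z : Fil n" for z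
 proof -
  have "g (z \<otimes>\<^sub>S \<one>\<^sub>S) : Fil \<tau>" using z n by (auto simp: J_def)
  then show ?thesis using z Fil(1) by (metis S.r_one subsetD)
 qed
 then show ?thesis by blast
qed

lemma (in char_ring) comp_sums_closed:
 assumes "t : comp_sums R p e e'" "x : car R" shows "t x : car R"
 using assms(1)
proof (induction rule: comp_sums.induct)
 case (add t h g)
 then show ?case using frob_mapsD(2)[OF add.hyps(2)] frob_mapsD(2)[OF add.hyps(3)] assms(2) by simp
qed (use assms(2) in simp)

locale adic_F_finite = adic_ring +
 assumes F_fin: "\<exists>B. spans R (frob_push R p 1) B"
begin

lemma ex_spans: "\<exists>B. spans R (frob_push R p e) B"
 using F_fin R.spans_frob_push by blast

lemma ex_lincomb:
 obtains n x where "!!k. k < n ==> x k : car R"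
  "!!r. r : car R ==> \<exists>c. (\<forall>k<n. c k : car R) & r = lincomb R (p ^ e) n c x"
 using ex_spans[of e] R.spans_lincomb by metis

lemma P_pow_nil: "x : P ==> \<exists>k::nat. x [^] k : ideal_power R P \<tau>"
 using R.pow_mem_ideal_power[OF P_ideal] by blast

text \<open>The images under \<open>h\<close> of generators of \<open>F\<^sup>e\<^sub>*R\<close> are approximated by elements \<open>y\<close> of \<open>R\<close>. Applying the
 finitely many relations of the generators to \<open>y\<close> gives a vector in a high power of \<open>P\<close>, so by
 Artin--Rees \<open>y\<close> can be corrected to satisfy the relations exactly.\<close>

lemma descend_frob_map:
 assumes h: "h : frob_maps S p e e'"
 shows "\<exists>h'\<in>frob_maps R p e e'. \<forall>r\<in>car R. \<iota> (h' r) \<ominus>\<^sub>S h (\<iota> r) : Fil \<tau>"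
proof -
 obtain n x where x: "!!k. k < n ==> x k : car R"
  and rep: "!!r. r : car R ==> \<exists>c. (\<forall>k<n. c k : car R) & r = lincomb R (p ^ e) n c x"
  using ex_lincomb[of e] by blast
 \<comment> \<open>\<open>frob_push R p 0\<close> is \<open>R\<close> with its usual action.
   Coefficient vectors live in its powers, vectors of values in the powers of
   \<open>frob_push R p e'\<close>.\<close>
 interpret F0: module R "frob_push R p 0" by (rule R.frob_push_module)
 interpret F': module R "frob_push R p e'" by (rule R.frob_push_module)
 let ?N = "pow_module (frob_push R p 0) n"
 interpret N: module R ?N by (rule F0.pow_module_module)
 have nN: "noeth_module R ?N" using ex_spans[of 0] F0.spans_pow N.spans_noeth[OF noetherian] by metis
 have rels: "submodule {c \<in> car ?N. lincomb R (p ^ d) n c y = \<zero>} R ?N"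
  if y: "!!k. k < n ==> y k : car R" for y d
 proof (rule N.submoduleI_simple)
  have "lincomb R (p ^ d) n \<zero>\<^sub>?N  y = lincomb R (p ^ d) n (%k. \<zero>) y" by (rule R.lincomb_cong) auto
  then show "\<zero>\<^sub>?N  : {c \<in> car ?N. lincomb R (p ^ d) n c y = \<zero>}"
   using R.lincomb_zero_coeff[of n y] y by auto
 next
  fix c c' assume "c : {c \<in> car ?N. lincomb R (p ^ d) n c y = \<zero>}" "c' : {c \<in> car ?N. lincomb R (p ^ d) n c y = \<zero>}"
  then have c: "c : car ?N" "c' : car ?N" "lincomb R (p ^ d) n c y = \<zero>" "lincomb R (p ^ d) n c' y = \<zero>" by auto
  have "lincomb R (p ^ d) n (c \<oplus>\<^sub>?N  c') y = lincomb R (p ^ d) n (%k. c k \<oplus> c' k) y" by (rule R.lincomb_cong) auto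
  also have "\<dots> = \<zero>" using c y by (subst R.lincomb_add_coeff) (auto simp: PiE_iff)
  finally have "lincomb R (p ^ d) n (c \<oplus>\<^sub>?N  c') y = \<zero>" .
  moreover have "c \<oplus>\<^sub>?N  c' : car ?N" using c(1,2) by (rule N.M.a_closed)
  ultimately show "c \<oplus>\<^sub>?N  c' : {c \<in> car ?N. lincomb R (p ^ d) n c y = \<zero>}" by (intro CollectI conjI)
 next
  fix r c assume r: "r : car R" and "c : {c \<in> car ?N. lincomb R (p ^ d) n c y = \<zero>}"
  then have c: "c : car ?N" "lincomb R (p ^ d) n c y = \<zero>" by auto
  have "lincomb R (p ^ d) n (r \<odot>\<^sub>?N  c) y = lincomb R (p ^ d) n (%k. r \<otimes> c k) y"
   using r c by (intro R.lincomb_cong) (auto simp: PiE_iff)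
  also have "\<dots> = \<zero>" using c y r by (subst R.lincomb_smult_coeff) (auto simp: PiE_iff)
  finally have "lincomb R (p ^ d) n (r \<odot>\<^sub>?N  c) y = \<zero>" .
  moreover have "r \<odot>\<^sub>?N  c : car ?N" using r c(1) by (rule N.smult_closed)
  ultimately show "r \<odot>\<^sub>?N  c : {c \<in> car ?N. lincomb R (p ^ d) n c y = \<zero>}" by (intro CollectI conjI)
 qed auto
 \<comment> \<open>The relations between the generators \<open>x\<close>; finitely many of them,
   listed by \<open>\<rho>s\<close>, generate all.\<close>
 define K where "K = {c \<in> car ?N. lincomb R (p ^ e) n c x = \<zero>}"
 have Ks: "submodule K R ?N" unfolding K_def by (rule rels[OF x])
 then obtain B where B: "finite B" "B <= K" "!!K'. submodule K' R ?N ==> B <= K' ==> K <= K'"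
  using nN unfolding noeth_module_def by meson
 obtain \<rho>s where \<rho>s: "set \<rho>s = B" using finite_list[OF B(1)] by blast
 define l where "l = length \<rho>s"
 have \<rho>K: "\<rho>s ! s : K" if "s < l" for s using that \<rho>s B(2) by (auto simp: l_def)
 have \<rho>c: "(\<rho>s ! s) k : car R" if "s < l" "k < n" for s k
  using \<rho>K[OF that(1)] that(2) by (auto simp: K_def PiE_iff)
 let ?Q = "pow_module (frob_push R p e') l"
 interpret Q: module R ?Q by (rule F'.pow_module_module)
 interpret Y: module R "pow_module (frob_push R p e') n" by (rule F'.pow_module_module)
 \<comment> \<open>\<open>A y\<close> records the values of the generating relations at
   \<open>y\<close>. A vector killed by \<open>A\<close> satisfies all relations and hence
   prescribes a map on the generators.\<close>
 define A where "A y = (\<lambda>s\<in>{..<l}. lincomb R (p ^ e') n (\<rho>s ! s) y)" for y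
 have Ac: "A y : car ?Q" if "!!k. k < n ==> y k : car R" for y
  using that \<rho>c by (auto simp: A_def intro!: R.lincomb_closed)
 have A_add: "A y \<oplus>\<^sub>?Q  A z = A (%k. y k \<oplus> z k)"
  if "!!k. k < n ==> y k : car R" "!!k. k < n ==> z k : car R" for y z
  using that \<rho>c by (auto simp: A_def R.lincomb_add_vec intro!: restrict_ext)
 have A_smult: "r \<odot>\<^sub>?Q  A y = A (%k. r [^] (p ^ e') \<otimes> y k)"
  if "r : car R" "!!k. k < n ==> y k : car R" for r y
  using that \<rho>c by (auto simp: A_def R.lincomb_smult_vec intro!: restrict_ext)
 have A_zero: "A (%k. \<zero>) = \<zero>\<^sub>?Q " using \<rho>c by (auto simp: A_def R.lincomb_zero_vec intro!: restrict_ext)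
 have sub: "submodule {A y | y. \<forall>k<n. y k : I} R ?Q" if I: "ideal I R" for I
 proof (rule Q.submoduleI_simple)
  note I' = R.ideal_props[OF I]
  have Ic: "y : car R" if "y : I" for y using that I'(1) by auto
  show "{A y | y. \<forall>k<n. y k : I} <= car ?Q" using Ac Ic by blast
  show "\<zero>\<^sub>?Q  : {A y | y. \<forall>k<n. y k : I}" unfolding A_zero[symmetric] using I'(2) by blast
  fix u v assume "u : {A y | y. \<forall>k<n. y k : I}" "v : {A y | y. \<forall>k<n. y k : I}"
  then obtain y z where yz: "\<forall>k<n. y k : I" "\<forall>k<n. z k : I" "u = A y" "v = A z" by blast
  have "u \<oplus>\<^sub>?Q  v = A (%k. y k \<oplus> z k)" unfolding yz(3,4) using yz(1,2) Ic by (intro A_add) auto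
  moreover have "\<forall>k<n. y k \<oplus> z k : I" using yz(1,2) I'(3) by simp
  ultimately show "u \<oplus>\<^sub>?Q  v : {A y | y. \<forall>k<n. y k : I}" by blast
 next
  note I' = R.ideal_props[OF I]
  have Ic: "y : car R" if "y : I" for y using that I'(1) by auto
  fix r u assume r: "r : car R" and "u : {A y | y. \<forall>k<n. y k : I}"
  then obtain y where y: "\<forall>k<n. y k : I" "u = A y" by blast
  have "r \<odot>\<^sub>?Q  u = A (%k. r [^] (p ^ e') \<otimes> y k)" unfolding y(2) using r y(1) Ic by (intro A_smult) auto
  moreover have "\<forall>k<n. r [^] (p ^ e') \<otimes> y k : I" using y(1) r I'(5) by simp
  ultimately show "r \<odot>\<^sub>?Q  u : {A y | y. \<forall>k<n. y k : I}" by blast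
 qed
 define Im where "Im = {A y | y. \<forall>k<n. y k : car R}"
 have Ims: "submodule Im R ?Q" unfolding Im_def by (rule sub[OF R.oneideal])
 let ?J = "ideal_power R P \<tau>"
 have Ji: "ideal ?J R" by (rule R.ideal_power_ideal[OF P_ideal])
 obtain B' where B': "spans R (frob_push R p e') B'" using ex_spans by blast
 \<comment> \<open>Artin-Rees for the image of \<open>A\<close>: together with \<open>JIm\<close>,
   an image vector with entries in the power \<open>t\<close> is the image of a vector with entries
   in \<open>?J\<close>.\<close>
 obtain t where t: "!!v. v : Im ==> (\<forall>i<l. v i : ideal_power R P t) ==>
   v : span_module R ?Q {r \<odot>\<^sub>?Q  y | r y. r : ?J & y : Im}"
  using R.artin_rees_pow[OF noetherian B' P_ideal Ji P_pow_nil Ims] by meson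
 have JIm: "span_module R ?Q {r \<odot>\<^sub>?Q  y | r y. r : ?J & y : Im} <= {A y | y. \<forall>k<n. y k : ?J}"
 proof (rule Q.span_min[OF sub[OF Ji]], rule subsetI)
  fix u assume "u : {r \<odot>\<^sub>?Q  y | r y. r : ?J & y : Im}"
  then obtain r y where ry: "r : ?J" "\<forall>k<n. y k : car R" "u = r \<odot>\<^sub>?Q  A y" unfolding Im_def by blast
  have rc: "r : car R" using ry(1) P_power(1) by auto
  have "u = A (%k. r [^] (p ^ e') \<otimes> y k)" unfolding ry(3) using rc ry(2) by (intro A_smult) auto
  moreover have "r [^] (p ^ e') : ?J"
  proof -
   have "p ^ e' > 0" using R.prime_p prime_gt_0_nat by auto
   then obtain m where "p ^ e' = Suc m" using gr0_implies_Suc by blast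
   then show ?thesis using P_power(5) rc ry(1) by simp
  qed
  then have "\<forall>k<n. r [^] (p ^ e') \<otimes> y k : ?J" using ry(2) P_power(6) by simp
  ultimately show "u : {A y | y. \<forall>k<n. y k : ?J}" by blast
 qed
 define z where "z k = h (\<iota> (x k))" for k
 have zc: "z k : car S" if "k < n" for k using S.frob_mapsD(2)[OF h] x[OF that] by (simp add: z_def)
 \<comment> \<open>Precision \<open>t + \<tau>\<close>: \<open>t\<close> for the use of Artin-Rees,
   \<open>\<tau>\<close> for the closeness that is demanded at the end.\<close>
 have "\<forall>k. \<exists>y. k < n \<longrightarrow> y : car R & z k \<ominus>\<^sub>S \<iota> y : Fil (t + \<tau>)" using approx[OF zc] by blast
 then obtain y where y: "!!k. k < n ==> y k : car R" "!!k. k < n ==> z k \<ominus>\<^sub>S \<iota> (y k) : Fil (t + \<tau>)" by metis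
 have hlc: "h (\<iota> (lincomb R (p ^ e) n c x)) = lincomb S (p ^ e') n (%k. \<iota> (c k)) z"
  if "!!k. k < n ==> c k : car R" for c
 proof -
  have "h (\<iota> (lincomb R (p ^ e) n c x)) = h (lincomb S (p ^ e) n (%k. \<iota> (c k)) (%k. \<iota> (x k)))"
   using iota_lincomb[of n c x] that x by simp
  also have "\<dots> = lincomb S (p ^ e') n (%k. \<iota> (c k)) z"
   unfolding z_def using that x by (intro S.frob_maps_lincomb[OF h]) auto
  finally show ?thesis .
 qed
 have close: "\<iota> (lincomb R (p ^ e') n c v) \<ominus>\<^sub>S lincomb S (p ^ e') n (%k. \<iota> (c k)) z : Fil m"
  if c: "!!k. k < n ==> c k : car R" and v: "!!k. k < n ==> v k : car R"
   and vz: "!!k. k < n ==> \<iota> (v k) \<ominus>\<^sub>S z k : Fil m" for c v m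
 proof -
  have "\<iota> (lincomb R (p ^ e') n c v) = lincomb S (p ^ e') n (%k. \<iota> (c k)) (%k. \<iota> (v k))"
   using iota_lincomb[of n c v] c v by simp
  then have "\<iota> (lincomb R (p ^ e') n c v) \<ominus>\<^sub>S lincomb S (p ^ e') n (%k. \<iota> (c k)) z =
   lincomb S (p ^ e') n (%k. \<iota> (c k)) (%k. \<iota> (v k) \<ominus>\<^sub>S z k)"
   using c v zc by (simp add: S.lincomb_minus_vec)
  then show ?thesis using S.lincomb_ideal[OF Fil_ideal, of n "%k. \<iota> (c k)" "%k. \<iota> (v k) \<ominus>\<^sub>S z k"] c vz by simp
 qed
 have neg: "b \<ominus>\<^sub>S a : Fil m" if "a \<ominus>\<^sub>S b : Fil m" "a : car S" "b : car S" for a b m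
 proof -
  have "b \<ominus>\<^sub>S a = \<ominus>\<^sub>S (a \<ominus>\<^sub>S b)" using that by (simp add: a_minus_def S.minus_add S.a_comm)
  then show ?thesis using Fil(7)[OF that(1)] by simp
 qed
 have yz: "\<iota> (y k) \<ominus>\<^sub>S z k : Fil (t + \<tau>)" if "k < n" for k using neg y that zc by simp
 have Ay: "A y i : ideal_power R P t" if i: "i < l" for i
 proof -
  have \<rho>i: "!!k. k < n ==> (\<rho>s ! i) k : car R" using \<rho>c[OF i] .
  have "lincomb S (p ^ e') n (%k. \<iota> ((\<rho>s ! i) k)) z = h (\<iota> \<zero>)"
   using hlc[of "\<rho>s ! i"] \<rho>i \<rho>K[OF i] by (simp add: K_def)
  then have "lincomb S (p ^ e') n (%k. \<iota> ((\<rho>s ! i) k)) z = \<zero>\<^sub>S" using S.frob_mapsD(5)[OF h] by simp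
  moreover have "\<iota> (lincomb R (p ^ e') n (\<rho>s ! i) y) \<ominus>\<^sub>S lincomb S (p ^ e') n (%k. \<iota> ((\<rho>s ! i) k)) z : Fil (t + \<tau>)"
   by (rule close[OF \<rho>i y(1) yz])
  moreover have lc: "lincomb R (p ^ e') n (\<rho>s ! i) y : car R" using \<rho>i y by simp
  ultimately have "\<iota> (lincomb R (p ^ e') n (\<rho>s ! i) y) : Fil (t + \<tau>)" by (simp add: S.a_minus_zero)
  then have "lincomb R (p ^ e') n (\<rho>s ! i) y : ideal_power R P t"
   using Fil_mono[of t "t + \<tau>"] Fil_iff[OF lc, of t] by auto
  then show ?thesis using i by (simp add: A_def)
 qed
 have "A y : Im" unfolding Im_def using y by blast
 then have "A y : {A y | y. \<forall>k<n. y k : ?J}" using t[of "A y"] Ay JIm by blast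
 then obtain w where w: "!!k. k < n ==> w k : ?J" "A y = A w" by blast
 have wc: "w k : car R" if "k < n" for k using w(1)[OF that] P_power(1) by auto
 \<comment> \<open>\<open>w\<close> has entries in the power \<open>\<tau>\<close> and the same
   relation values as \<open>y\<close>. So \<open>v\<close> satisfies the relations exactly and
   stays within \<open>Fil \<tau>\<close> of the values \<open>z\<close>.\<close>
 define v where "v k = y k \<ominus> w k" for k
 have vc: "v k : car R" if "k < n" for k using y wc that by (simp add: v_def)
 have "lincomb R (p ^ e') n (\<rho>s ! i) v = \<zero>" if i: "i < l" for i
 proof -
  have \<rho>i: "!!k. k < n ==> (\<rho>s ! i) k : car R" using \<rho>c[OF i] .
  have "lincomb R (p ^ e') n (\<rho>s ! i) y = lincomb R (p ^ e') n (\<rho>s ! i) w"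
   using fun_cong[OF w(2), of i] i by (simp add: A_def)
  moreover have "lincomb R (p ^ e') n (\<rho>s ! i) v = lincomb R (p ^ e') n (\<rho>s ! i) y \<ominus> lincomb R (p ^ e') n (\<rho>s ! i) w"
   unfolding v_def using \<rho>i y wc by (intro R.lincomb_minus_vec) auto
  moreover have "lincomb R (p ^ e') n (\<rho>s ! i) w : car R" using \<rho>i wc by simp
  ultimately show ?thesis by (simp add: R.r_neg a_minus_def)
 qed
 note \<rho>v = this
 have "B <= {c \<in> car ?N. lincomb R (p ^ e') n c v = \<zero>}"
 proof
  fix b assume "b : B"
  then obtain i where i: "i < l" "b = \<rho>s ! i" using \<rho>s by (auto simp: in_set_conv_nth l_def)
  have "b : car ?N" using \<rho>K[OF i(1)] i(2) unfolding K_def by blast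
  then show "b : {c \<in> car ?N. lincomb R (p ^ e') n c v = \<zero>}" using \<rho>v[OF i(1)] i(2) by blast
 qed
 from B(3)[OF rels[OF vc] this] have rel: "lincomb R (p ^ e') n c v = \<zero>" if "c : K" for c using that by blast
 \<comment> \<open>Independence of the chosen coefficients: two representations of one element
   differ by a relation, on which \<open>v\<close> gives zero.\<close>
 have wd: "lincomb R (p ^ e') n c v = lincomb R (p ^ e') n d v"
  if c: "!!k. k < n ==> c k : car R" and d: "!!k. k < n ==> d k : car R"
   and eq: "lincomb R (p ^ e) n c x = lincomb R (p ^ e) n d x" for c d
 proof -
  define b where "b = (\<lambda>k\<in>{..<n}. c k \<ominus> d k)"
  have bd: "lincomb R (p ^ m) n c u = lincomb R (p ^ m) n b u \<oplus> lincomb R (p ^ m) n d u"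
   if u: "!!k. k < n ==> u k : car R" for u m
  proof -
   have "lincomb R (p ^ m) n c u = lincomb R (p ^ m) n (%k. b k \<oplus> d k) u"
    using c d by (intro R.lincomb_cong) (auto simp: b_def a_minus_def R.a_assoc R.l_neg)
   then show ?thesis using c d u by (subst (asm) R.lincomb_add_coeff) (auto simp: b_def)
  qed
  have bc: "!!k. k < n ==> b k : car R" using c d by (simp add: b_def)
  have cl: "lincomb R (p ^ e) n b x : car R" "lincomb R (p ^ e) n d x : car R"
   "lincomb R (p ^ e') n d v : car R" using bc d x vc by auto
  have "lincomb R (p ^ e) n b x \<oplus> lincomb R (p ^ e) n d x = lincomb R (p ^ e) n d x"
   using bd[of x e] x eq by simp
  then have "lincomb R (p ^ e) n b x = \<zero>" by (rule R.add_cancel_iff_zero[OF cl(1,2)])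
  moreover have "b : car ?N" using bc by (auto simp: b_def)
  ultimately have "b : K" by (simp add: K_def)
  then show ?thesis using bd[of v e'] vc rel[of b] cl by simp
 qed
 define coef where "coef r = (SOME c. (\<forall>k<n. c k : car R) & r = lincomb R (p ^ e) n c x)" for r
 have coef: "!!k. k < n ==> coef r k : car R" "lincomb R (p ^ e) n (coef r) x = r" if "r : car R" for r
 proof -
  have "(\<forall>k<n. coef r k : car R) & r = lincomb R (p ^ e) n (coef r) x"
   unfolding coef_def by (rule someI_ex[OF rep[OF that]])
  then show "!!k. k < n ==> coef r k : car R" "lincomb R (p ^ e) n (coef r) x = r" by auto
 qed
 define h' where "h' = (\<lambda>r\<in>car R. lincomb R (p ^ e') n (coef r) v)"
 have h': "h' r = lincomb R (p ^ e') n c v"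
  if "r : car R" "!!k. k < n ==> c k : car R" "r = lincomb R (p ^ e) n c x" for r c
  unfolding h'_def using that coef wd[of "coef r" c] by simp
 have "h' : frob_maps R p e e'"
  unfolding R.frob_maps_iff
 proof (intro conjI ballI)
  show "h' : car R \<rightarrow>\<^sub>E car R" unfolding h'_def using coef vc by auto
  fix a b assume a: "a : car R" and b: "b : car R"
  have "a \<oplus> b = lincomb R (p ^ e) n (%k. coef a k \<oplus> coef b k) x"
   using coef[OF a] coef[OF b] x by (simp add: R.lincomb_add_coeff)
  then have "h' (a \<oplus> b) = lincomb R (p ^ e') n (%k. coef a k \<oplus> coef b k) v"
   using coef[OF a] coef[OF b] a b x by (intro h') auto
  also have "\<dots> = h' a \<oplus> h' b" using coef[OF a] coef[OF b] a b vc by (simp add: h'_def R.lincomb_add_coeff)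
  finally show "h' (a \<oplus> b) = h' a \<oplus> h' b" .
  have "a [^] (p ^ e) \<otimes> b = lincomb R (p ^ e) n (%k. a \<otimes> coef b k) x"
   using coef[OF b] x a by (simp add: R.lincomb_smult_coeff)
  then have "h' (a [^] (p ^ e) \<otimes> b) = lincomb R (p ^ e') n (%k. a \<otimes> coef b k) v"
   using coef[OF b] a b x by (intro h') auto
  also have "\<dots> = a [^] (p ^ e') \<otimes> h' b" using coef[OF b] a b vc by (simp add: h'_def R.lincomb_smult_coeff)
  finally show "h' (a [^] (p ^ e) \<otimes> b) = a [^] (p ^ e') \<otimes> h' b" .
 qed
 moreover have "\<iota> (h' r) \<ominus>\<^sub>S h (\<iota> r) : Fil \<tau>" if r: "r : car R" for r
 proof -
  have "\<iota> (v k) \<ominus>\<^sub>S z k : Fil \<tau>" if k: "k < n" for k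
  proof -
   have "\<iota> (y k) \<ominus>\<^sub>S z k : Fil \<tau>" using yz[OF k] Fil_mono[of \<tau> "t + \<tau>"] by auto
   moreover have "\<iota> (w k) : Fil \<tau>" using w(1)[OF k] Fil_iff wc[OF k] by blast
   ultimately have "(\<iota> (y k) \<ominus>\<^sub>S z k) \<ominus>\<^sub>S \<iota> (w k) : Fil \<tau>" by (rule Fil(4))
   moreover have "(\<iota> (y k) \<ominus>\<^sub>S z k) \<ominus>\<^sub>S \<iota> (w k) = \<iota> (v k) \<ominus>\<^sub>S z k"
    using y(1)[OF k] wc[OF k] zc[OF k] by (simp add: v_def a_minus_def S.a_ac)
   ultimately show ?thesis by simp
  qed
  then have "\<iota> (lincomb R (p ^ e') n (coef r) v) \<ominus>\<^sub>S lincomb S (p ^ e') n (%k. \<iota> (coef r k)) z : Fil \<tau>"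
   using coef[OF r] vc by (intro close) auto
  then show ?thesis using hlc[of "coef r"] coef[OF r] r by (simp add: h'_def)
 qed
 ultimately show ?thesis by blast
qed

text \<open>\<open>descend_frob_map\<close> is applied to both factors of a composition. The inner
  one has to be approximated to the precision \<open>m\<close> that the continuity of the outer map
  \<open>g\<close> demands for the target precision.\<close>

lemma descend_comp_sums:
 assumes "t : comp_sums S p e e'"
 shows "\<exists>t'\<in>comp_sums R p e e'. \<forall>r\<in>car R. \<iota> (t' r) \<ominus>\<^sub>S t (\<iota> r) : Fil \<tau>"
 using assms
proof (induction rule: comp_sums.induct)
 case zero
 have "\<iota> ((\<lambda>x\<in>car R. \<zero>) r) \<ominus>\<^sub>S (\<lambda>x\<in>car S. \<zero>\<^sub>S) (\<iota> r) : Fil \<tau>" if "r : car R" for r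
  using that Fil(2) by (simp add: a_minus_def)
 then show ?case using comp_sums.zero by blast
next
 case (add t h g)
 obtain t' where t': "t' : comp_sums R p e e'" "!!r. r : car R ==> \<iota> (t' r) \<ominus>\<^sub>S t (\<iota> r) : Fil \<tau>"
  using add.IH by blast
 obtain m where m: "!!z. z : Fil m ==> g z : Fil \<tau>" using frob_maps_continuous[OF add.hyps(3)] by blast
 obtain h' where h': "h' : frob_maps R p e e'" "!!r. r : car R ==> \<iota> (h' r) \<ominus>\<^sub>S h (\<iota> r) : Fil m"
  using descend_frob_map[OF add.hyps(2)] by blast
 obtain g' where g': "g' : frob_maps R p e' e" "!!r. r : car R ==> \<iota> (g' r) \<ominus>\<^sub>S g (\<iota> r) : Fil \<tau>"
  using descend_frob_map[OF add.hyps(3)] by blast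
 have "\<iota> ((\<lambda>x\<in>car R. t' x \<oplus> g' (h' x)) r) \<ominus>\<^sub>S (\<lambda>x\<in>car S. t x \<oplus>\<^sub>S g (h x)) (\<iota> r) : Fil \<tau>"
  if r: "r : car R" for r
 proof -
  have c: "t' r : car R" "h' r : car R" "g' (h' r) : car R" "\<iota> r : car S" "t (\<iota> r) : car S"
   "h (\<iota> r) : car S" "g (h (\<iota> r)) : car S" "g (\<iota> (h' r)) : car S"
   using r R.comp_sums_closed[OF t'(1)] S.comp_sums_closed[OF add.hyps(1)] R.frob_mapsD(2)[OF h'(1)] R.frob_mapsD(2)[OF g'(1)]
    S.frob_mapsD(2)[OF add.hyps(2)] S.frob_mapsD(2)[OF add.hyps(3)] by auto
  have 1: "\<iota> (t' r) \<ominus>\<^sub>S t (\<iota> r) : Fil \<tau>" by (rule t'(2)[OF r])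
  have 2: "\<iota> (g' (h' r)) \<ominus>\<^sub>S g (\<iota> (h' r)) : Fil \<tau>" by (rule g'(2)) (use c in simp)
  have "g (\<iota> (h' r) \<ominus>\<^sub>S h (\<iota> r)) : Fil \<tau>" by (rule m[OF h'(2)[OF r]])
  then have 3: "g (\<iota> (h' r)) \<ominus>\<^sub>S g (h (\<iota> r)) : Fil \<tau>" using S.frob_mapsD(6)[OF add.hyps(3)] c by simp
  have 4: "(g (\<iota> (h' r)) \<ominus>\<^sub>S g (h (\<iota> r))) \<oplus>\<^sub>S (\<iota> (g' (h' r)) \<ominus>\<^sub>S g (\<iota> (h' r))) = \<iota> (g' (h' r)) \<ominus>\<^sub>S g (h (\<iota> r))"
   using c by (intro S.minus_add_minus) auto
  have 5: "\<iota> (g' (h' r)) \<ominus>\<^sub>S g (h (\<iota> r)) : Fil \<tau>" using Fil(3)[OF 3 2] 4 by simp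
  have "\<iota> (t' r \<oplus> g' (h' r)) \<ominus>\<^sub>S (t (\<iota> r) \<oplus>\<^sub>S g (h (\<iota> r))) =
   (\<iota> (t' r) \<ominus>\<^sub>S t (\<iota> r)) \<oplus>\<^sub>S (\<iota> (g' (h' r)) \<ominus>\<^sub>S g (h (\<iota> r)))"
   using c by (simp add: a_minus_def S.minus_add S.a_ac)
  then show ?thesis using r c Fil(3)[OF 1 5] by simp
 qed
 then show ?case using comp_sums.add[OF t'(1) h'(1) g'(1)] by blast
qed

end

section \<open>From completions to the ring itself\<close>

text \<open>A form of Nakayama's lemma: a submodule \<open>W \<supseteq> T\<close> maximal among the proper submodules that are
 saturated with respect to \<open>R - P\<close> would have to contain \<open>P E\<close>.\<close>

lemma (in module) nakayama_saturated:
 assumes nM: "noeth_module R M" and P: "primeideal P R"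
  and E: "submodule E R M" and T: "submodule T R M" "T <= E"
  and gen: "!!v. v : E ==> \<exists>t\<in>T. v \<ominus>\<^sub>M t : span_module R M {r \<odot>\<^sub>M y | r y. r : P & y : E}"
  and v: "v : E"
 shows "\<exists>s\<in>car R - P. s \<odot>\<^sub>M v : T"
proof (rule ccontr)
 assume notin: "\<not> ?thesis"
 interpret P: primeideal P R by (rule P)
 note E' = submoduleE[OF E] and T' = submoduleE[OF T(1)]
 have one: "\<one> \<notin> P" using P.I_notcarr P.one_imp_carrier by auto
 have Pmult: "s \<otimes> s' : car R - P" if "s : car R - P" "s' : car R - P" for s s'
  using that P.I_prime by auto
 have Ec: "y : car M" if "y : E" for y using that E'(1) by auto
 \<comment> \<open>The elements of \<open>E\<close> that fall into \<open>N\<close> after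
   multiplication by something outside \<open>P\<close>, that is, after localization at
   \<open>P\<close>.\<close>
 define sat where "sat N = {y \<in> E. \<exists>s\<in>car R - P. s \<odot>\<^sub>M y : N}" for N
 have sat_sub: "submodule (sat N) R M" if N: "submodule N R M" for N
 proof (rule submoduleI_simple)
  note N' = submoduleE[OF N]
  show "sat N <= car M" using Ec by (auto simp: sat_def)
  show "\<zero>\<^sub>M : sat N" unfolding sat_def using submodule_zero[OF E] submodule_zero[OF N] one by (auto intro!: bexI[of _ \<one>])
 next
  note N' = submoduleE[OF N]
  fix y z assume "y : sat N" "z : sat N"
  then obtain s s' where s: "s : car R - P" "s' : car R - P" "s \<odot>\<^sub>M y : N" "s' \<odot>\<^sub>M z : N"
   and yz: "y : E" "z : E" by (auto simp: sat_def)
  have "(s \<otimes> s') \<odot>\<^sub>M (y \<oplus>\<^sub>M z) = s' \<odot>\<^sub>M (s \<odot>\<^sub>M y) \<oplus>\<^sub>M s \<odot>\<^sub>M (s' \<odot>\<^sub>M z)"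
   using s yz Ec by (simp add: smult_r_distr R.m_comm flip: smult_assoc1)
  then have "(s \<otimes> s') \<odot>\<^sub>M (y \<oplus>\<^sub>M z) : N" using s N'(4,5) by simp
  then show "y \<oplus>\<^sub>M z : sat N" unfolding sat_def using Pmult[OF s(1,2)] yz E'(5) by blast
 next
  note N' = submoduleE[OF N]
  fix r y assume r: "r : car R" and "y : sat N"
  then obtain s where s: "s : car R - P" "s \<odot>\<^sub>M y : N" and y: "y : E" by (auto simp: sat_def)
  have "s \<odot>\<^sub>M (r \<odot>\<^sub>M y) = r \<odot>\<^sub>M (s \<odot>\<^sub>M y)"
   using s y Ec r by (simp add: R.m_comm flip: smult_assoc1)
  then have "s \<odot>\<^sub>M (r \<odot>\<^sub>M y) : N" using s r N'(4) by simp
  then show "r \<odot>\<^sub>M y : sat N" unfolding sat_def using s y r E'(4) by blast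
 qed
 have sat_sup: "N \<inter> E <= sat N" if "submodule N R M" for N
  using one Ec by (auto simp: sat_def intro!: bexI[of _ \<one>])
 have sat_sat: "y : sat N" if ys: "y : E" "s : car R - P" "s \<odot>\<^sub>M y : sat N" for y s N
 proof -
  obtain s' where s': "s' : car R - P" "s' \<odot>\<^sub>M (s \<odot>\<^sub>M y) : N" using ys(3) by (auto simp: sat_def)
  have "(s' \<otimes> s) \<odot>\<^sub>M y : N" using s' ys Ec by (simp add: smult_assoc1)
  then show ?thesis unfolding sat_def using Pmult[OF s'(1) ys(2)] ys(1) by blast
 qed
 have "v \<notin> sat T" using notin by (auto simp: sat_def)
 moreover have "sat T <= E" by (auto simp: sat_def)
 moreover have "T <= sat T" using sat_sup[OF T(1)] T(2) by auto
 ultimately have satT: "submodule (sat T) R M" "T <= sat T" "sat T <= E" "sat T \<noteq> E"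
  using sat_sub[OF T(1)] v by auto
 define G where "G = {W. submodule W R M & T <= W & W <= E & W \<noteq> E &
  (\<forall>y\<in>E. \<forall>s\<in>car R - P. s \<odot>\<^sub>M y : W \<longrightarrow> y : W)}"
 have "sat T : G" unfolding G_def using satT sat_sat by blast
 moreover have "submodule W R M" if "W : G" for W using that by (simp add: G_def)
 ultimately obtain W where W: "W : G" "!!V. V : G ==> W <= V ==> V = W"
  using noeth_module_maximalE[OF nM, of G] by metis
 have Ws: "submodule W R M" "T <= W" "W <= E" "W \<noteq> E"
  and Wsat: "!!y s. y : E ==> s : car R - P ==> s \<odot>\<^sub>M y : W ==> y : W"
  using W(1) by (auto simp: G_def)
 note W' = submoduleE[OF Ws(1)]
 \<comment> \<open>Otherwise \<open>P E\<close> would lie in \<open>W\<close>, and with it all of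
   \<open>E\<close>, since \<open>E\<close> is \<open>T\<close> plus \<open>P E\<close>.\<close>
 have "\<exists>r y. r : P & y : E & r \<odot>\<^sub>M y \<notin> W"
 proof (rule ccontr)
  assume no: "\<not> ?thesis"
  then have sp: "span_module R M {r \<odot>\<^sub>M y | r y. r : P & y : E} <= W"
   by (intro span_min[OF Ws(1)]) blast
  have "y : W" if y: "y : E" for y
  proof -
   obtain t where t: "t : T" "y \<ominus>\<^sub>M t : W" using gen[OF y] sp by blast
   then have "(y \<ominus>\<^sub>M t) \<oplus>\<^sub>M t : W" using Ws W'(5) by blast
   moreover have "(y \<ominus>\<^sub>M t) \<oplus>\<^sub>M t = y"
    using Ec[OF y] t T'(1) by (auto simp: a_minus_def M.a_assoc M.l_neg)
   ultimately show ?thesis by simp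
  qed
  then show False using Ws by auto
 qed
 then obtain r y where ry: "r : P" "y : E" "r \<odot>\<^sub>M y \<notin> W" by blast
 have rc: "r : car R" using ry P.Icarr by auto
 have x: "r \<odot>\<^sub>M y : E" using rc ry E'(4) by auto
 define N where "N = {l \<oplus>\<^sub>M c \<odot>\<^sub>M (r \<odot>\<^sub>M y) | l c. l : W & c : car R}"
 have Ns: "submodule N R M" unfolding N_def by (rule submodule_add_cyclic[OF Ws(1) Ec[OF x]])
 have NE: "N <= E" unfolding N_def using Ws(3) E'(4,5) x by blast
 have WN: "W <= N"
 proof
  fix l assume l: "l : W"
  then have "l = l \<oplus>\<^sub>M \<zero> \<odot>\<^sub>M (r \<odot>\<^sub>M y)" using Ec[OF x] Ws(3) Ec by auto
  then show "l : N" unfolding N_def using l by blast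
 qed
 have xN: "r \<odot>\<^sub>M y : N"
 proof -
  have "r \<odot>\<^sub>M y = \<zero>\<^sub>M \<oplus>\<^sub>M \<one> \<odot>\<^sub>M (r \<odot>\<^sub>M y)" using Ec[OF x] by simp
  then show ?thesis unfolding N_def using submodule_zero[OF Ws(1)] by blast
 qed
 have Nsat: "N <= sat N" using sat_sup[OF Ns] NE by auto
 \<comment> \<open>\<open>sat N\<close> is strictly larger than the maximal \<open>W\<close>. It
   meets every condition of \<open>G\<close> except being different from \<open>E\<close>, so it is
   \<open>E\<close>.\<close>
 have "sat N \<notin> G" using W(2)[of "sat N"] Nsat WN xN ry(3) by blast
 moreover have "sat N <= E" by (auto simp: sat_def)
 ultimately have "sat N = E" unfolding G_def using sat_sub[OF Ns] Nsat WN Ws(2) sat_sat by blast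
 then obtain s where s: "s : car R - P" "s \<odot>\<^sub>M y : N" using ry(2) by (auto simp: sat_def)
 then obtain l c where lc: "l : W" "c : car R" "s \<odot>\<^sub>M y = l \<oplus>\<^sub>M c \<odot>\<^sub>M (r \<odot>\<^sub>M y)" unfolding N_def by blast
 have yc: "y : car M" and lcar: "l : car M" using Ec ry lc Ws(3) by auto
 \<comment> \<open>The term in \<open>r\<close> is absorbed into the coefficient of
   \<open>y\<close>. As \<open>r\<close> is in \<open>P\<close> and \<open>s\<close> is not, the new
   coefficient is outside \<open>P\<close>, and saturation puts \<open>y\<close> into
   \<open>W\<close>.\<close>
 have "(s \<ominus> c \<otimes> r) \<odot>\<^sub>M y = s \<odot>\<^sub>M y \<ominus>\<^sub>M c \<odot>\<^sub>M (r \<odot>\<^sub>M y)"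
  using s lc rc yc by (simp add: a_minus_def smult_l_distr smult_l_minus smult_assoc1)
 also have "\<dots> = l" unfolding lc(3) using lc rc yc lcar by (simp add: a_minus_def M.a_assoc M.r_neg)
 finally have "(s \<ominus> c \<otimes> r) \<odot>\<^sub>M y : W" using lc by simp
 moreover have "s \<ominus> c \<otimes> r : car R - P"
 proof -
  have "s \<ominus> c \<otimes> r \<notin> P"
  proof
   assume a: "s \<ominus> c \<otimes> r : P"
   have "c \<otimes> r : P" using ry(1) lc(2) P.I_l_closed by blast
   then have "(s \<ominus> c \<otimes> r) \<oplus> c \<otimes> r : P" using a R.ideal_props(3)[OF P.is_ideal] by blast
   moreover have "(s \<ominus> c \<otimes> r) \<oplus> c \<otimes> r = s" using s lc rc by (simp add: a_minus_def R.a_assoc R.l_neg)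
   ultimately show False using s by simp
  qed
  then show ?thesis using s lc rc by simp
 qed
 ultimately have "y : W" using Wsat ry(2) by blast
 then show False using ry W'(4) rc by blast
qed

section \<open>Sums of compositions of Frobenius-linear maps\<close>

context char_ring
begin

lemma frob_maps_restrictI:
 assumes "!!x. x : car R ==> F x : car R"
  and "!!x y. x : car R ==> y : car R ==> F (x \<oplus> y) = F x \<oplus> F y"
  and "!!c x. c : car R ==> x : car R ==> F (c [^] (p ^ e) \<otimes> x) = c [^] (p ^ e') \<otimes> F x"
 shows "(\<lambda>x\<in>car R. F x) : frob_maps R p e e'"
 unfolding frob_maps_iff using assms by simp

lemma frob_maps_comp:
 assumes "f : frob_maps R p e e'" "g : frob_maps R p e' e''"
 shows "(\<lambda>x\<in>car R. g (f x)) : frob_maps R p e e''"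
 by (rule frob_maps_restrictI) (simp_all add: frob_mapsD(2,3,4)[OF assms(1)] frob_mapsD(2,3,4)[OF assms(2)])

lemma frob_maps_mult: "r : car R ==> (\<lambda>x\<in>car R. r \<otimes> x) : frob_maps R p e e"
 by (rule frob_maps_restrictI) (simp_all add: r_distr m_lcomm)

lemma frob_maps_diff:
 assumes "f : frob_maps R p e e'" "g : frob_maps R p e e'"
 shows "(\<lambda>x\<in>car R. f x \<ominus> g x) : frob_maps R p e e'"
 by (rule frob_maps_restrictI)
  (simp_all add: frob_mapsD(2,3,4)[OF assms(1)] frob_mapsD(2,3,4)[OF assms(2)] a_minus_def minus_add a_ac r_distr r_minus)

lemma frob_maps_plus:
 assumes "f : frob_maps R p e e'" "g : frob_maps R p e e'"
 shows "(\<lambda>x\<in>car R. f x \<oplus> g x) : frob_maps R p e e'"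
 by (rule frob_maps_restrictI)
  (simp_all add: frob_mapsD(2,3,4)[OF assms(1)] frob_mapsD(2,3,4)[OF assms(2)] a_ac r_distr)

lemma comp_sums_frob_maps:
 assumes "t : comp_sums R p e e'" shows "t : frob_maps R p e e"
 using assms
proof (induction rule: comp_sums.induct)
 case zero
 show ?case by (rule frob_maps_restrictI) simp_all
next
 case (add t h g)
 have "(\<lambda>x\<in>car R. t x \<oplus> (\<lambda>x\<in>car R. g (h x)) x) : frob_maps R p e e"
  by (rule frob_maps_plus[OF add.IH frob_maps_comp[OF add.hyps(2,3)]])
 moreover have "(\<lambda>x\<in>car R. t x \<oplus> (\<lambda>x\<in>car R. g (h x)) x) = (\<lambda>x\<in>car R. t x \<oplus> g (h x))"
  by (rule restrict_ext) simp
 ultimately show ?case by (simp only:)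
qed

lemma comp_sums_add:
 assumes "t : comp_sums R p e e'" "u : comp_sums R p e e'"
 shows "(\<lambda>x\<in>car R. t x \<oplus> u x) : comp_sums R p e e'"
 using assms(2)
proof (induction rule: comp_sums.induct)
 case zero
 have "(\<lambda>x\<in>car R. t x \<oplus> (\<lambda>x\<in>car R. \<zero>) x) = t"
 proof -
  have "t : extensional (car R)"
   using frob_mapsD(1)[OF comp_sums_frob_maps[OF assms(1)]] by (simp add: PiE_iff)
  moreover have "t x \<oplus> (\<lambda>x\<in>car R. \<zero>) x = t x" if "x : car R" for x
   using that comp_sums_closed[OF assms(1)] by simp
  ultimately show ?thesis by (intro extensionalityI[of _ "car R"]) simp_all
 qed
 then show ?case using assms(1) by (simp only:)
next
 case (add u h g)
 have "(\<lambda>x\<in>car R. (\<lambda>x\<in>car R. t x \<oplus> u x) x \<oplus> g (h x)) : comp_sums R p e e'"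
  by (rule comp_sums.add[OF add.IH add.hyps(2,3)])
 moreover have "(\<lambda>x\<in>car R. (\<lambda>x\<in>car R. t x \<oplus> u x) x \<oplus> g (h x)) =
  (\<lambda>x\<in>car R. t x \<oplus> (\<lambda>x\<in>car R. u x \<oplus> g (h x)) x)"
  by (rule restrict_ext) (simp add: a_assoc comp_sums_closed[OF assms(1)] comp_sums_closed[OF add.hyps(1)]
    frob_mapsD(2)[OF add.hyps(2)] frob_mapsD(2)[OF add.hyps(3)])
 ultimately show ?case by (simp only:)
qed

text \<open>With closure under sums, the sums of compositions form a right ideal of the endomorphism
  ring. This is applied to scalars and, in \<open>comp_sums_local\<close>, to arbitrary
  endomorphisms.\<close>

lemma comp_sums_right:
 assumes "t : comp_sums R p e e'" "f : frob_maps R p e e"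
 shows "(\<lambda>x\<in>car R. t (f x)) : comp_sums R p e e'"
 using assms(1)
proof (induction rule: comp_sums.induct)
 case zero
 have "(\<lambda>x\<in>car R. (\<lambda>x\<in>car R. \<zero>) (f x)) = (\<lambda>x\<in>car R. \<zero>)"
  by (rule restrict_ext) (simp add: frob_mapsD(2)[OF assms(2)])
 then show ?case using comp_sums.zero by (simp only:)
next
 case (add t h g)
 have "(\<lambda>x\<in>car R. (\<lambda>x\<in>car R. t (f x)) x \<oplus> g ((\<lambda>x\<in>car R. h (f x)) x)) : comp_sums R p e e'"
  by (rule comp_sums.add[OF add.IH frob_maps_comp[OF assms(2) add.hyps(2)] add.hyps(3)])
 moreover have "(\<lambda>x\<in>car R. (\<lambda>x\<in>car R. t (f x)) x \<oplus> g ((\<lambda>x\<in>car R. h (f x)) x)) =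
  (\<lambda>x\<in>car R. (\<lambda>x\<in>car R. t x \<oplus> g (h x)) (f x))"
  by (rule restrict_ext) (simp add: frob_mapsD(2)[OF assms(2)])
 ultimately show ?case by (simp only:)
qed

lemma comp_sums_mult:
 assumes "t : comp_sums R p e e'" "r : car R"
 shows "(\<lambda>x\<in>car R. r [^] (p ^ e) \<otimes> t x) : comp_sums R p e e'"
proof -
 have "(\<lambda>x\<in>car R. t ((\<lambda>x\<in>car R. r [^] (p ^ e) \<otimes> x) x)) : comp_sums R p e e'"
  by (rule comp_sums_right[OF assms(1) frob_maps_mult]) (use assms in simp)
 moreover have "(\<lambda>x\<in>car R. t ((\<lambda>x\<in>car R. r [^] (p ^ e) \<otimes> x) x)) = (\<lambda>x\<in>car R. r [^] (p ^ e) \<otimes> t x)"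
  by (rule restrict_ext) (simp add: frob_mapsD(4)[OF comp_sums_frob_maps[OF assms(1)] assms(2)])
 ultimately show ?thesis by (simp only:)
qed

lemma frob_maps_eqI:
 assumes "f : frob_maps R p e e'" "g : frob_maps R p e e'"
  and "!!k. k < n ==> x k : car R"
  and "!!r. r : car R ==> \<exists>c. (\<forall>k<n. c k : car R) & r = lincomb R (p ^ e) n c x"
  and "!!k. k < n ==> f (x k) = g (x k)"
 shows "f = g"
proof (rule extensionalityI[of _ "car R"])
 show "f : extensional (car R)" "g : extensional (car R)"
  using frob_mapsD(1)[OF assms(1)] frob_mapsD(1)[OF assms(2)] by (auto simp: PiE_iff)
 fix r assume "r : car R"
 then obtain c where c: "\<forall>k<n. c k : car R" "r = lincomb R (p ^ e) n c x" using assms(4) by blast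
 have "f r = lincomb R (p ^ e') n c (%k. f (x k))"
  unfolding c(2) by (rule frob_maps_lincomb[OF assms(1)]) (use c(1) assms(3) in auto)
 also have "\<dots> = lincomb R (p ^ e') n c (%k. g (x k))"
  by (rule lincomb_cong) (use assms(5) in auto)
 also have "\<dots> = g r"
  unfolding c(2) by (rule frob_maps_lincomb[OF assms(2), symmetric]) (use c(1) assms(3) in auto)
 finally show "f r = g r" .
qed

end

lemma (in abelian_group) add_minus_cancel:
 "x : car G ==> y : car G ==> (x \<oplus> y) \<ominus> y = x"
 by (simp add: a_minus_def a_assoc r_neg)

context adic_F_finite
begin

text \<open>Let \<open>E\<close> be all endomorphisms and \<open>T\<close> the sums of compositions.
  For a sum \<open>u\<close> close to the identity and any \<open>f\<close>, the difference of
  \<open>f\<close> and \<open>u \<circ> f\<close> is small on the generators, so Artin-Rees places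
  it in \<open>P E\<close>. Thus \<open>E\<close> is \<open>T\<close> plus \<open>P E\<close>, and
  \<open>nakayama_saturated\<close> applies to the identity.\<close>

lemma comp_sums_local:
 assumes approx: "!!\<tau>. \<exists>u\<in>comp_sums R p e e'. \<forall>r\<in>car R. r \<ominus> u r : ideal_power R P \<tau>"
 shows "\<exists>s\<in>car R - P. (\<lambda>x\<in>car R. s [^] (p ^ e) \<otimes> x) : comp_sums R p e e'"
proof -
 obtain n x where x: "!!k. k < n ==> x k : car R"
  and rep: "!!r. r : car R ==> \<exists>c. (\<forall>k<n. c k : car R) & r = lincomb R (p ^ e) n c x"
  using ex_lincomb[of e] by blast
 let ?F = "frob_push R p e" let ?M = "pow_module ?F n"
 interpret F: module R ?F by (rule R.frob_push_module)
 interpret M: module R ?M by (rule F.pow_module_module)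
 obtain B where B: "spans R ?F B" using ex_spans by blast
 have nM: "noeth_module R ?M" using F.spans_pow[OF B, of n] M.spans_noeth[OF noetherian] by blast
 \<comment> \<open>An endomorphism is determined by its values on the generators \<open>x\<close>.
   Passing to tuples puts \<open>E\<close> and \<open>T\<close> into a Noetherian module over
   \<open>R\<close>.\<close>
 define tup where "tup f = (\<lambda>k\<in>{..<n}. f (x k))" for f :: "'a => 'a"
 have tup_sub: "submodule (tup ` H) R ?M"
  if H: "H <= frob_maps R p e e" "(\<lambda>x\<in>car R. \<zero>) : H"
   "!!f g. f : H ==> g : H ==> (\<lambda>x\<in>car R. f x \<oplus> g x) : H"
   "!!f r. f : H ==> r : car R ==> (\<lambda>x\<in>car R. r [^] (p ^ e) \<otimes> f x) : H" for H
 proof (rule M.submoduleI_simple)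
  have Hc: "f (x k) : car R" if "f : H" "k < n" for f k using R.frob_mapsD(2)[of f] that H(1) x by blast
  show "tup ` H <= car ?M"
   by (rule image_subsetI) (use Hc in \<open>simp add: tup_def restrict_PiE_iff\<close>)
  have "\<zero>\<^sub>?M  = tup (\<lambda>x\<in>car R. \<zero>)" unfolding tup_def pow_module_simps R.frob_push_simps by (rule restrict_ext) (simp add: x)
  then show "\<zero>\<^sub>?M  : tup ` H" using H(2) by (rule image_eqI)
 next
  fix u v assume "u : tup ` H" "v : tup ` H"
  then obtain f g where fg: "f : H" "g : H" "u = tup f" "v = tup g" by blast
  have "u \<oplus>\<^sub>?M  v = tup (\<lambda>x\<in>car R. f x \<oplus> g x)"
   unfolding fg(3,4) tup_def pow_module_simps R.frob_push_simps by (rule restrict_ext) (simp add: x)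
  then show "u \<oplus>\<^sub>?M  v : tup ` H" using H(3)[OF fg(1,2)] by (rule image_eqI)
 next
  fix r u assume r: "r : car R" and "u : tup ` H"
  then obtain f where f: "f : H" "u = tup f" by blast
  have "r \<odot>\<^sub>?M  u = tup (\<lambda>x\<in>car R. r [^] (p ^ e) \<otimes> f x)"
   unfolding f(2) tup_def pow_module_simps R.frob_push_simps by (rule restrict_ext) (simp add: x)
  then show "r \<odot>\<^sub>?M  u : tup ` H" using H(4)[OF f(1) r] by (rule image_eqI)
 qed
 define E where "E = tup ` frob_maps R p e e"
 define T where "T = tup ` comp_sums R p e e'"
 have E: "submodule E R ?M" unfolding E_def
 proof (rule tup_sub)
  show "(\<lambda>x\<in>car R. \<zero>) : frob_maps R p e e" by (rule R.comp_sums_frob_maps[OF comp_sums.zero])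
  show "(\<lambda>x\<in>car R. r [^] (p ^ e) \<otimes> f x) : frob_maps R p e e"
   if f: "f : frob_maps R p e e" and r: "r : car R" for f r
  proof -
   have "(\<lambda>x\<in>car R. (\<lambda>x\<in>car R. r [^] (p ^ e) \<otimes> x) (f x)) : frob_maps R p e e"
    by (rule R.frob_maps_comp[OF f R.frob_maps_mult]) (use r in simp)
   moreover have "(\<lambda>x\<in>car R. (\<lambda>x\<in>car R. r [^] (p ^ e) \<otimes> x) (f x)) = (\<lambda>x\<in>car R. r [^] (p ^ e) \<otimes> f x)"
    by (rule restrict_ext) (simp add: R.frob_mapsD(2)[OF f])
   ultimately show ?thesis by (simp only:)
  qed
 qed (auto intro: R.frob_maps_plus)
 have T: "submodule T R ?M" unfolding T_def
  by (rule tup_sub) (auto intro: R.comp_sums_frob_maps comp_sums.zero R.comp_sums_add R.comp_sums_mult)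
 have TE: "T <= E" unfolding T_def E_def using R.comp_sums_frob_maps by blast
 \<comment> \<open>The identity, in the form in which \<open>frob_maps_mult\<close> provides
   it.\<close>
 have idm: "(\<lambda>x\<in>car R. \<one> \<otimes> x) : frob_maps R p e e" by (rule R.frob_maps_mult) simp
 have "!!x. x : P ==> \<exists>k::nat. x [^] k : P" using R.ideal_props(1)[OF P_ideal] by (intro exI[of _ 1]) auto
 then obtain t where t: "!!v. v : E ==> (\<forall>i<n. v i : ideal_power R P t) ==>
   v : span_module R ?M {r \<odot>\<^sub>?M  y | r y. r : P & y : E}"
  using R.artin_rees_pow[OF noetherian B P_ideal P_ideal _ E] by meson
 obtain u where u: "u : comp_sums R p e e'" "!!r. r : car R ==> r \<ominus> u r : ideal_power R P t"
  using approx by blast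
 have gen: "\<exists>w\<in>T. v \<ominus>\<^sub>?M  w : span_module R ?M {r \<odot>\<^sub>?M  y | r y. r : P & y : E}" if v: "v : E" for v
 proof -
  obtain f where f: "f : frob_maps R p e e" "v = tup f" using v by (auto simp: E_def)
  define uf where "uf = (\<lambda>x\<in>car R. u (f x))"
  have uf: "uf : comp_sums R p e e'" unfolding uf_def by (rule R.comp_sums_right[OF u(1) f(1)])
  let ?d = "\<lambda>x\<in>car R. f x \<ominus> uf x"
  have d: "?d : frob_maps R p e e" by (rule R.frob_maps_diff[OF f(1) R.comp_sums_frob_maps[OF uf]])
  have fc: "f y : car R" "uf y : car R" if "y : car R" for y
   using R.frob_mapsD(2)[OF f(1) that] R.comp_sums_closed[OF uf that] by auto
  have "tup ?d : span_module R ?M {r \<odot>\<^sub>?M  y | r y. r : P & y : E}"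
  proof (rule t)
   show "tup ?d : E" unfolding E_def using d by (rule imageI)
   show "\<forall>i<n. tup ?d i : ideal_power R P t"
    using x u(2) fc by (auto simp: tup_def uf_def)
  qed
  moreover have "tup ?d = v \<ominus>\<^sub>?M  tup uf"
  proof -
   have c: "tup ?d : car ?M" "tup uf : car ?M" "v : car ?M"
    using x fc R.frob_mapsD(2)[OF d] unfolding f(2) by (auto simp: tup_def simp del: restrict_apply intro!: restrict_PiE_iff[THEN iffD2] split: if_splits)
   have "tup ?d \<oplus>\<^sub>?M  tup uf = v"
    unfolding f(2) tup_def pow_module_simps R.frob_push_simps
    by (rule restrict_ext) (simp add: x fc a_minus_def R.a_assoc R.l_neg)
   then have "v \<ominus>\<^sub>?M  tup uf = (tup ?d \<oplus>\<^sub>?M  tup uf) \<ominus>\<^sub>?M  tup uf" by (simp only:)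
   also have "\<dots> = tup ?d" by (rule M.M.add_minus_cancel[OF c(1,2)])
   finally show ?thesis by (rule sym)
  qed
  ultimately have "v \<ominus>\<^sub>?M  tup uf : span_module R ?M {r \<odot>\<^sub>?M  y | r y. r : P & y : E}" by (simp only:)
  moreover have "tup uf : T" unfolding T_def using uf by (rule imageI)
  ultimately show ?thesis by (rule bexI)
 qed
 have Pp: "primeideal P R" using R.maximalideal_prime[OF maximal] .
 have "tup (\<lambda>x\<in>car R. \<one> \<otimes> x) : E" unfolding E_def using idm by (rule imageI)
 have "\<exists>s\<in>car R - P. s \<odot>\<^sub>?M  tup (\<lambda>x\<in>car R. \<one> \<otimes> x) : T"
  by (rule M.nakayama_saturated[OF nM Pp E T TE]) (fact gen, fact \<open>tup (\<lambda>x\<in>car R. \<one> \<otimes> x) : E\<close>)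
 then obtain s where s: "s : car R - P" "s \<odot>\<^sub>?M  tup (\<lambda>x\<in>car R. \<one> \<otimes> x) : T" by (elim bexE)
 from s(2) obtain f where f: "s \<odot>\<^sub>?M  tup (\<lambda>x\<in>car R. \<one> \<otimes> x) = tup f" "f : comp_sums R p e e'"
  unfolding T_def by (elim imageE)
 have "f = (\<lambda>x\<in>car R. s [^] (p ^ e) \<otimes> x)"
 proof (rule R.frob_maps_eqI[OF R.comp_sums_frob_maps[OF f(2)] R.frob_maps_mult x rep])
  show "s [^] (p ^ e) : car R" using s by simp
  fix k assume k: "k < n"
  have "(s \<odot>\<^sub>?M  tup (\<lambda>x\<in>car R. \<one> \<otimes> x)) k = tup f k" by (simp only: f(1))
  then show "f (x k) = (\<lambda>x\<in>car R. s [^] (p ^ e) \<otimes> x) (x k)" using k x[OF k] by (simp add: tup_def)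
 qed auto
 then have "(\<lambda>x\<in>car R. s [^] (p ^ e) \<otimes> x) : comp_sums R p e e'" using f(2) by (simp only:)
 then show ?thesis using s(1) by (rule bexI)
qed

text \<open>A sum of compositions that is the identity over \<open>S\<close> descends, at every
  precision, to one over \<open>R\<close> that agrees with the identity to that precision.\<close>

lemma comp_sums_local_of_completion:
 assumes "(\<lambda>x\<in>car S. x) : comp_sums S p e e'"
 shows "\<exists>s\<in>car R - P. (\<lambda>x\<in>car R. s [^] (p ^ e) \<otimes> x) : comp_sums R p e e'"
proof (rule comp_sums_local)
 fix \<tau>
 obtain u where u: "u : comp_sums R p e e'"
  "!!r. r : car R ==> \<iota> (u r) \<ominus>\<^sub>S (\<lambda>x\<in>car S. x) (\<iota> r) : Fil \<tau>"
  using descend_comp_sums[OF assms] by blast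
 have "r \<ominus> u r : ideal_power R P \<tau>" if r: "r : car R" for r
 proof -
  have c: "u r : car R" by (rule R.comp_sums_closed[OF u(1) r])
  have "\<iota> (u r \<ominus> r) : Fil \<tau>" using u(2)[OF r] r c by (simp add: a_minus_def)
  then have "u r \<ominus> r : ideal_power R P \<tau>" using Fil_iff[of "u r \<ominus> r"] r c by simp
  then have "\<ominus> (u r \<ominus> r) : ideal_power R P \<tau>" by (rule P_power(7))
  moreover have "\<ominus> (u r \<ominus> r) = r \<ominus> u r" using r c by (simp add: a_minus_def R.minus_add R.a_comm)
  ultimately show ?thesis by simp
 qed
 then show "\<exists>u\<in>comp_sums R p e e'. \<forall>r\<in>car R. r \<ominus> u r : ideal_power R P \<tau>" using u(1) by blast
qed

end

section \<open>From the maximal ideals to the whole ring\<close>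

lemma (in noetherian_ring) ex_maximalideal:
 assumes "cring R" "ideal I R" "I \<noteq> car R"
 shows "\<exists>P. maximalideal P R & I <= P"
proof -
 interpret cring R by (rule assms(1))
 define F where "F = {J. ideal J R & I <= J & J \<noteq> car R}"
 have "I : F" using assms by (simp add: F_def)
 moreover have "ideal W R" if "W : F" for W using that by (simp add: F_def)
 ultimately obtain P where P: "P : F" "!!V. V : F ==> P <= V ==> V = P"
  using ideal_maximalE[of F] by metis
 have "maximalideal P R"
 proof (rule maximalidealI)
  show "ideal P R" "car R \<noteq> P" using P(1) by (auto simp: F_def)
  fix J assume J: "ideal J R" "P <= J" "J <= car R"
  have "J = car R | J : F" using J P(1) by (auto simp: F_def)
  then show "J = P | J = car R" using P(2)[of J] J(2) by blast
 qed
 then show ?thesis using P(1) by (auto simp: F_def)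
qed

lemma (in char_ring) comp_sums_global:
 assumes nR: "noetherian_ring R"
  and loc: "!!P. maximalideal P R ==> \<exists>s\<in>car R - P. (\<lambda>x\<in>car R. s [^] (p ^ e) \<otimes> x) : comp_sums R p e e'"
 shows "(\<lambda>x\<in>car R. x) : comp_sums R p e e'"
proof -
 define I where "I = {r \<in> car R. (\<lambda>x\<in>car R. r [^] (p ^ e) \<otimes> x) : comp_sums R p e e'}"
 have Ir: "(\<lambda>x\<in>car R. r [^] (p ^ e) \<otimes> x) : comp_sums R p e e'" if "r : I" for r
  using that unfolding I_def by blast
 have I: "ideal I R"
 proof (rule idealI_simple)
  have "(\<lambda>x\<in>car R. \<zero> [^] (p ^ e) \<otimes> x) = (\<lambda>x\<in>car R. \<zero>)" by (rule restrict_ext) simp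
  then have "(\<lambda>x\<in>car R. \<zero> [^] (p ^ e) \<otimes> x) : comp_sums R p e e'" using comp_sums.zero by (simp only:)
  then show "\<zero> : I" by (simp add: I_def)
 next
  fix r r' assume r: "r : I" "r' : I"
  have "(\<lambda>y\<in>car R. (\<lambda>x\<in>car R. r [^] (p ^ e) \<otimes> x) y \<oplus> (\<lambda>x\<in>car R. r' [^] (p ^ e) \<otimes> x) y) : comp_sums R p e e'"
   by (rule comp_sums_add[OF Ir[OF r(1)] Ir[OF r(2)]])
  moreover have "(\<lambda>y\<in>car R. (\<lambda>x\<in>car R. r [^] (p ^ e) \<otimes> x) y \<oplus> (\<lambda>x\<in>car R. r' [^] (p ^ e) \<otimes> x) y) =
   (\<lambda>x\<in>car R. (r \<oplus> r') [^] (p ^ e) \<otimes> x)"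
   by (rule restrict_ext) (use r in \<open>simp add: I_def frob_add l_distr\<close>)
  ultimately have "(\<lambda>x\<in>car R. (r \<oplus> r') [^] (p ^ e) \<otimes> x) : comp_sums R p e e'" by (simp only:)
  then show "r \<oplus> r' : I" using r by (simp add: I_def)
 next
  fix c r assume c: "c : car R" and r: "r : I"
  have "(\<lambda>y\<in>car R. c [^] (p ^ e) \<otimes> (\<lambda>x\<in>car R. r [^] (p ^ e) \<otimes> x) y) : comp_sums R p e e'"
   by (rule comp_sums_mult[OF Ir[OF r] c])
  moreover have "(\<lambda>y\<in>car R. c [^] (p ^ e) \<otimes> (\<lambda>x\<in>car R. r [^] (p ^ e) \<otimes> x) y) =
   (\<lambda>x\<in>car R. (c \<otimes> r) [^] (p ^ e) \<otimes> x)"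
   by (rule restrict_ext) (use r c in \<open>simp add: I_def nat_pow_distrib m_assoc\<close>)
  ultimately have "(\<lambda>x\<in>car R. (c \<otimes> r) [^] (p ^ e) \<otimes> x) : comp_sums R p e e'" by (simp only:)
  then show "c \<otimes> r : I" using r c by (simp add: I_def)
 qed (auto simp: I_def)
 have "I = car R"
 proof (rule ccontr)
  assume "I \<noteq> car R"
  then obtain P where P: "maximalideal P R" "I <= P" using noetherian_ring.ex_maximalideal[OF nR is_cring I] by blast
  obtain s where "s : car R - P" "(\<lambda>x\<in>car R. s [^] (p ^ e) \<otimes> x) : comp_sums R p e e'"
   using loc[OF P(1)] by blast
  then have "s : I - P" unfolding I_def by blast
  then show False using P(2) by blast
 qed
 then have "(\<lambda>x\<in>car R. \<one> [^] (p ^ e) \<otimes> x) : comp_sums R p e e'" by (intro Ir) simp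
 moreover have "(\<lambda>x\<in>car R. \<one> [^] (p ^ e) \<otimes> x) = (\<lambda>x\<in>car R. x)" by (rule restrict_ext) simp
 ultimately show ?thesis by (simp only:)
qed

section \<open>Decompositions into indecomposables\<close>

lemma (in abelian_group) eq_of_minus_zero:
 assumes "x \<ominus> y = \<zero>" "x : car G" "y : car G" shows "x = y"
 using minus_add_add_cancel[of x y \<zero>] assms by simp

definition direct_pair :: "('a, 'k) ring_scheme => ('a, 'm, 'l) module_scheme => 'm set => 'm set => 'm set => bool" where
 "direct_pair S M N N1 N2 \<longleftrightarrow> submodule N1 S M & submodule N2 S M & N1 \<inter> N2 = {\<zero>\<^sub>M} &
  N = {x \<oplus>\<^sub>M y | x y. x : N1 & y : N2}"

text \<open>\<open>internal_direct_sum\<close> relative to a submodule \<open>N\<close> of the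
  ambient module, so that summands can be split further inside one and the same module.\<close>

definition decomp :: "('a, 'k) ring_scheme => ('a, 'm, 'l) module_scheme => nat => (nat => 'm set) => 'm set => bool" where
 "decomp S M k f N \<longleftrightarrow> (\<forall>i<k. submodule (f i) S M & f i <= N) &
  (\<forall>x\<in>N. \<exists>!g. g : (\<Pi>\<^sub>E i\<in>{..<k}. f i) & x = (\<Oplus>\<^sub>M i\<in>{..<k}. g i))"

context module
begin

lemma direct_pair_unique:
 assumes d: "direct_pair R M N N1 N2"
  and "x : N1" "y : N2" "x' : N1" "y' : N2" "x \<oplus>\<^sub>M y = x' \<oplus>\<^sub>M y'"
 shows "x = x'" "y = y'"
proof -
 have N: "submodule N1 R M" "submodule N2 R M" "N1 \<inter> N2 = {\<zero>\<^sub>M}" using d by (auto simp: direct_pair_def)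
 have c: "x : car M" "y : car M" "x' : car M" "y' : car M"
  using assms(2-5) submoduleE(1)[OF N(1)] submoduleE(1)[OF N(2)] by auto
 have "x \<ominus>\<^sub>M x' = y' \<ominus>\<^sub>M y"
 proof -
  have "x \<ominus>\<^sub>M x' = (x \<oplus>\<^sub>M y) \<ominus>\<^sub>M (x' \<oplus>\<^sub>M y)" using c by (simp add: M.add_minus_add_cancel)
  also have "\<dots> = (y' \<oplus>\<^sub>M x') \<ominus>\<^sub>M (y \<oplus>\<^sub>M x')" using c assms(6) by (simp add: M.a_comm)
  also have "\<dots> = y' \<ominus>\<^sub>M y" using c by (simp add: M.add_minus_add_cancel)
  finally show ?thesis .
 qed
 moreover have "x \<ominus>\<^sub>M x' : N1" "y' \<ominus>\<^sub>M y : N2" using submodule_minus N assms by auto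
 ultimately have z: "x \<ominus>\<^sub>M x' = \<zero>\<^sub>M" "y' \<ominus>\<^sub>M y = \<zero>\<^sub>M" using N(3) by auto
 show "x = x'" using c z(1) by (metis M.eq_of_minus_zero)
 show "y = y'" using c z(2) by (metis M.eq_of_minus_zero)
qed

lemma submodule_sum:
 assumes "submodule N1 R M" "submodule N2 R M"
 shows "submodule {x \<oplus>\<^sub>M y | x y. x : N1 & y : N2} R M"
proof (rule submoduleI_simple)
 note E = submoduleE[OF assms(1)] submoduleE[OF assms(2)]
 have c: "!!x. x : N1 ==> x : car M" "!!x. x : N2 ==> x : car M"
  using submoduleE(1)[OF assms(1)] submoduleE(1)[OF assms(2)] by auto
 show "{x \<oplus>\<^sub>M y | x y. x : N1 & y : N2} <= car M" using c by auto
 have "\<zero>\<^sub>M = \<zero>\<^sub>M \<oplus>\<^sub>M \<zero>\<^sub>M" by simp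
 then show "\<zero>\<^sub>M : {x \<oplus>\<^sub>M y | x y. x : N1 & y : N2}" using assms submodule_zero by blast
next
 fix u v assume "u : {x \<oplus>\<^sub>M y | x y. x : N1 & y : N2}" "v : {x \<oplus>\<^sub>M y | x y. x : N1 & y : N2}"
 then obtain x y x' y' where e: "x : N1" "y : N2" "x' : N1" "y' : N2" "u = x \<oplus>\<^sub>M y" "v = x' \<oplus>\<^sub>M y'" by blast
 have c: "x : car M" "y : car M" "x' : car M" "y' : car M"
  using e submoduleE(1)[OF assms(1)] submoduleE(1)[OF assms(2)] by auto
 have "u \<oplus>\<^sub>M v = (x \<oplus>\<^sub>M x') \<oplus>\<^sub>M (y \<oplus>\<^sub>M y')" using e c by (simp add: M.a_ac)
 moreover have "x \<oplus>\<^sub>M x' : N1" "y \<oplus>\<^sub>M y' : N2" using e submoduleE(5) assms by auto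
 ultimately show "u \<oplus>\<^sub>M v : {x \<oplus>\<^sub>M y | x y. x : N1 & y : N2}" by blast
next
 fix r u assume r: "r : car R" and "u : {x \<oplus>\<^sub>M y | x y. x : N1 & y : N2}"
 then obtain x y where e: "x : N1" "y : N2" "u = x \<oplus>\<^sub>M y" by blast
 have c: "x : car M" "y : car M"
  using e submoduleE(1)[OF assms(1)] submoduleE(1)[OF assms(2)] by auto
 have "r \<odot>\<^sub>M u = r \<odot>\<^sub>M x \<oplus>\<^sub>M r \<odot>\<^sub>M y" using e c r by (simp add: smult_r_distr)
 moreover have "r \<odot>\<^sub>M x : N1" "r \<odot>\<^sub>M y : N2" using e r submoduleE(4) assms by auto
 ultimately show "r \<odot>\<^sub>M u : {x \<oplus>\<^sub>M y | x y. x : N1 & y : N2}" by blast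
qed

lemma direct_pair_incl:
 assumes "direct_pair R M N N1 N2" shows "N1 <= N" "N2 <= N"
proof -
 have N: "submodule N1 R M" "submodule N2 R M" "N = {x \<oplus>\<^sub>M y | x y. x : N1 & y : N2}" using assms by (auto simp: direct_pair_def)
 note c = submoduleE(1)[OF N(1)] submoduleE(1)[OF N(2)]
 show "N1 <= N"
 proof
  fix x assume x: "x : N1"
  then have "x = x \<oplus>\<^sub>M \<zero>\<^sub>M" using c by auto
  then show "x : N" using x submodule_zero[OF N(2)] N(3) by blast
 qed
 show "N2 <= N"
 proof
  fix x assume x: "x : N2"
  then have "x = \<zero>\<^sub>M \<oplus>\<^sub>M x" using c by auto
  then show "x : N" using x submodule_zero[OF N(1)] N(3) by blast
 qed
qed

lemma direct_pair_assoc: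
 assumes "direct_pair R M N N' L" "direct_pair R M N' N1 N2"
 shows "direct_pair R M N N1 {x \<oplus>\<^sub>M y | x y. x : N2 & y : L}"
  and "direct_pair R M {x \<oplus>\<^sub>M y | x y. x : N2 & y : L} N2 L"
proof -
 have 1: "submodule N' R M" "submodule L R M" "N' \<inter> L = {\<zero>\<^sub>M}" "N = {x \<oplus>\<^sub>M y | x y. x : N' & y : L}"
  using assms(1) by (auto simp: direct_pair_def)
 have 2: "submodule N1 R M" "submodule N2 R M" "N1 \<inter> N2 = {\<zero>\<^sub>M}" "N' = {x \<oplus>\<^sub>M y | x y. x : N1 & y : N2}"
  using assms(2) by (auto simp: direct_pair_def)
 have c: "!!x. x : N1 ==> x : car M" "!!x. x : N2 ==> x : car M" "!!x. x : L ==> x : car M"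
  using submoduleE(1)[OF 1(2)] submoduleE(1)[OF 2(1)] submoduleE(1)[OF 2(2)] by auto
 let ?K = "{x \<oplus>\<^sub>M y | x y. x : N2 & y : L}"
 have K: "submodule ?K R M" by (rule submodule_sum[OF 2(2) 1(2)])
 have "z = \<zero>\<^sub>M" if z: "z : N1" "z : ?K" for z
 proof -
  obtain x y where xy: "x : N2" "y : L" "z = x \<oplus>\<^sub>M y" using z(2) by blast
  have xN: "x : N'" "z : N'" using direct_pair_incl[OF assms(2)] xy z by auto
  have "z \<oplus>\<^sub>M \<zero>\<^sub>M = x \<oplus>\<^sub>M y" using xy c by simp
  then have "z = x" using direct_pair_unique[OF assms(1) xN(2) submodule_zero[OF 1(2)] xN(1) xy(2)] by simp
  then show ?thesis using z xy 2(3) by auto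
 qed
 then have "N1 \<inter> ?K = {\<zero>\<^sub>M}" using submodule_zero[OF K] submodule_zero[OF 2(1)] by blast
 moreover have "N = {x \<oplus>\<^sub>M y | x y. x : N1 & y : ?K}"
 proof (rule equalityI; rule subsetI)
  fix z assume "z : N"
  then obtain x y l where e: "x : N1" "y : N2" "l : L" "z = (x \<oplus>\<^sub>M y) \<oplus>\<^sub>M l" unfolding 1(4) 2(4) by blast
  then have "z = x \<oplus>\<^sub>M (y \<oplus>\<^sub>M l)" using c by (simp add: M.a_assoc)
  then show "z : {x \<oplus>\<^sub>M y | x y. x : N1 & y : ?K}" using e by blast
 next
  fix z assume "z : {x \<oplus>\<^sub>M y | x y. x : N1 & y : ?K}"
  then obtain x y l where e: "x : N1" "y : N2" "l : L" "z = x \<oplus>\<^sub>M (y \<oplus>\<^sub>M l)" by blast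
  then have "z = (x \<oplus>\<^sub>M y) \<oplus>\<^sub>M l" using c by (simp add: M.a_assoc)
  then show "z : N" unfolding 1(4) 2(4) using e by blast
 qed
 ultimately show "direct_pair R M N N1 ?K" using K 2(1) unfolding direct_pair_def by blast
 have "N2 \<inter> L <= {\<zero>\<^sub>M}" using direct_pair_incl(2)[OF assms(2)] 1(3) by blast
 then have "N2 \<inter> L = {\<zero>\<^sub>M}" using submodule_zero[OF 2(2)] submodule_zero[OF 1(2)] by blast
 then show "direct_pair R M ?K N2 L" using 1(2) 2(2) unfolding direct_pair_def by blast
qed

lemma direct_pair_commute: "direct_pair R M N N1 N2 ==> direct_pair R M N N2 N1"
proof -
 assume d: "direct_pair R M N N1 N2"
 then have N: "submodule N1 R M" "submodule N2 R M" "N1 \<inter> N2 = {\<zero>\<^sub>M}" "N = {x \<oplus>\<^sub>M y | x y. x : N1 & y : N2}"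
  by (auto simp: direct_pair_def)
 have "x \<oplus>\<^sub>M y = y \<oplus>\<^sub>M x" if "x : N1" "y : N2" for x y
  using that submoduleE(1)[OF N(1)] submoduleE(1)[OF N(2)] M.a_comm by auto
 then have "N = {x \<oplus>\<^sub>M y | x y. x : N2 & y : N1}" unfolding N(4) by (intro equalityI subsetI; clarify) metis+
 then show ?thesis using N(1-3) unfolding direct_pair_def by blast
qed

lemma finsum_lessThan_add:
 fixes k l :: nat
 assumes "!!i. i < k + l ==> g i : car M"
 shows "(\<Oplus>\<^sub>M i\<in>{..<k + l}. g i) = (\<Oplus>\<^sub>M i\<in>{..<k}. g i) \<oplus>\<^sub>M (\<Oplus>\<^sub>M i\<in>{..<l}. g (k + i))"
 using assms
proof (induction l)
 case 0
 then show ?case using M.finsum_closed[of g "{..<k}"] by (simp add: Pi_def)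
next
 case (Suc l)
 have c: "g : {..<k + l} \<rightarrow> car M" "g (k + l) : car M" "(%i. g (k + i)) : {..<l} \<rightarrow> car M"
  "g : {..<k} \<rightarrow> car M" using Suc.prems by auto
 have "(\<Oplus>\<^sub>M i\<in>{..<k + Suc l}. g i) = g (k + l) \<oplus>\<^sub>M (\<Oplus>\<^sub>M i\<in>{..<k + l}. g i)"
  using c by (simp add: lessThan_Suc M.finsum_insert)
 also have "\<dots> = g (k + l) \<oplus>\<^sub>M ((\<Oplus>\<^sub>M i\<in>{..<k}. g i) \<oplus>\<^sub>M (\<Oplus>\<^sub>M i\<in>{..<l}. g (k + i)))"
  using Suc by simp
 also have "\<dots> = (\<Oplus>\<^sub>M i\<in>{..<k}. g i) \<oplus>\<^sub>M (g (k + l) \<oplus>\<^sub>M (\<Oplus>\<^sub>M i\<in>{..<l}. g (k + i)))"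
  using c by (simp add: M.a_lcomm)
 also have "g (k + l) \<oplus>\<^sub>M (\<Oplus>\<^sub>M i\<in>{..<l}. g (k + i)) = (\<Oplus>\<^sub>M i\<in>{..<Suc l}. g (k + i))"
  using c by (simp add: lessThan_Suc M.finsum_insert)
 finally show ?case .
qed

lemma decomp_concat:
 assumes d: "direct_pair R M N N1 N2" and d1: "decomp R M k f N1" and d2: "decomp R M l h N2"
 shows "decomp R M (k + l) (%i. if i < k then f i else h (i - k)) N"
 unfolding decomp_def
proof (intro conjI allI impI ballI)
 let ?F = "%i. if i < k then f i else h (i - k)"
 have N: "submodule N1 R M" "submodule N2 R M" "N = {x \<oplus>\<^sub>M y | x y. x : N1 & y : N2}" using d by (auto simp: direct_pair_def)
 have f: "!!i. i < k ==> submodule (f i) R M" "!!i. i < k ==> f i <= N1"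
  and fu: "!!x. x : N1 ==> \<exists>!g. g : (\<Pi>\<^sub>E i\<in>{..<k}. f i) & x = (\<Oplus>\<^sub>M i\<in>{..<k}. g i)"
  using d1 by (simp_all add: decomp_def)
 have h: "!!i. i < l ==> submodule (h i) R M" "!!i. i < l ==> h i <= N2"
  and hu: "!!x. x : N2 ==> \<exists>!g. g : (\<Pi>\<^sub>E i\<in>{..<l}. h i) & x = (\<Oplus>\<^sub>M i\<in>{..<l}. g i)"
  using d2 by (simp_all add: decomp_def)
 note incl = direct_pair_incl[OF d]
 { fix i assume i: "i < k + l"
  show "submodule (?F i) R M" using f(1) h(1) i by simp
  show "?F i <= N"
  proof (cases "i < k")
   case False
   then have "i - k < l" using i by simp
   then show ?thesis using False h(2) incl(2) by auto
  qed (use f(2) incl(1) in auto) }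
 fix x assume "x : N"
 then obtain x1 x2 where x: "x1 : N1" "x2 : N2" "x = x1 \<oplus>\<^sub>M x2" unfolding N(3) by blast
 obtain g1 where g1: "g1 : (\<Pi>\<^sub>E i\<in>{..<k}. f i)" "x1 = (\<Oplus>\<^sub>M i\<in>{..<k}. g1 i)" using fu[OF x(1)] by blast
 obtain g2 where g2: "g2 : (\<Pi>\<^sub>E i\<in>{..<l}. h i)" "x2 = (\<Oplus>\<^sub>M i\<in>{..<l}. g2 i)" using hu[OF x(2)] by blast
 have carr: "u i : car M" if "u : (\<Pi>\<^sub>E i\<in>{..<k + l}. ?F i)" "i < k + l" for u i
 proof -
  have "u i : ?F i" using that by (auto simp: PiE_iff)
  moreover have "submodule (?F i) R M" using f(1) h(1) that(2) by simp
  ultimately show ?thesis using submoduleE(1) by blast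
 qed
 define g where "g = (\<lambda>i\<in>{..<k + l}. if i < k then g1 i else g2 (i - k))"
 have g: "g : (\<Pi>\<^sub>E i\<in>{..<k + l}. ?F i)" using g1 g2 by (auto simp: g_def PiE_iff)
 have split: "(\<Oplus>\<^sub>M i\<in>{..<k + l}. u i) = (\<Oplus>\<^sub>M i\<in>{..<k}. u i) \<oplus>\<^sub>M (\<Oplus>\<^sub>M i\<in>{..<l}. u (k + i))"
  if "u : (\<Pi>\<^sub>E i\<in>{..<k + l}. ?F i)" for u using carr[OF that] by (rule finsum_lessThan_add)
 have "(\<Oplus>\<^sub>M i\<in>{..<k}. g i) = x1"
  unfolding g1(2) using g1(1) f submoduleE(1) by (intro M.finsum_cong') (auto simp: g_def PiE_iff, blast)
 moreover have "(\<Oplus>\<^sub>M i\<in>{..<l}. g (k + i)) = x2"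
  unfolding g2(2) using g2(1) h submoduleE(1) by (intro M.finsum_cong') (auto simp: g_def PiE_iff, blast)
 ultimately have gx: "x = (\<Oplus>\<^sub>M i\<in>{..<k + l}. g i)" using split[OF g] x(3) by simp
 have uniq: "u = g" if u: "u : (\<Pi>\<^sub>E i\<in>{..<k + l}. ?F i)" "x = (\<Oplus>\<^sub>M i\<in>{..<k + l}. u i)" for u
 proof -
  define u1 where "u1 = (\<lambda>i\<in>{..<k}. u i)"
  define u2 where "u2 = (\<lambda>i\<in>{..<l}. u (k + i))"
  have ui: "u i : ?F i" if "i < k + l" for i using u(1) that by (auto simp: PiE_iff)
  have u1: "u1 : (\<Pi>\<^sub>E i\<in>{..<k}. f i)"
  proof -
   have "u i : f i" if "i < k" for i using ui[of i] that by simp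
   then show ?thesis by (auto simp: u1_def)
  qed
  have u2: "u2 : (\<Pi>\<^sub>E i\<in>{..<l}. h i)"
  proof -
   have "u (k + i) : h i" if "i < l" for i using ui[of "k + i"] that by simp
   then show ?thesis by (auto simp: u2_def)
  qed
  have s1: "(\<Oplus>\<^sub>M i\<in>{..<k}. u i) = (\<Oplus>\<^sub>M i\<in>{..<k}. u1 i)"
   using carr[OF u(1)] by (intro M.finsum_cong') (auto simp: u1_def)
  have s2: "(\<Oplus>\<^sub>M i\<in>{..<l}. u (k + i)) = (\<Oplus>\<^sub>M i\<in>{..<l}. u2 i)"
   using carr[OF u(1)] by (intro M.finsum_cong') (auto simp: u2_def)
  have m1: "(\<Oplus>\<^sub>M i\<in>{..<k}. u1 i) : N1"
   using u1 f(2) by (intro submodule_finsum[OF N(1)]) (auto simp: PiE_iff)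
  have m2: "(\<Oplus>\<^sub>M i\<in>{..<l}. u2 i) : N2"
   using u2 h(2) by (intro submodule_finsum[OF N(2)]) (auto simp: PiE_iff)
  have "x1 \<oplus>\<^sub>M x2 = (\<Oplus>\<^sub>M i\<in>{..<k}. u1 i) \<oplus>\<^sub>M (\<Oplus>\<^sub>M i\<in>{..<l}. u2 i)"
   using split[OF u(1)] u(2) x(3) s1 s2 by simp
  then have "x1 = (\<Oplus>\<^sub>M i\<in>{..<k}. u1 i)" "x2 = (\<Oplus>\<^sub>M i\<in>{..<l}. u2 i)"
   using direct_pair_unique[OF d x(1,2) m1 m2] by auto
  then have e: "u1 = g1" "u2 = g2" using fu[OF x(1)] hu[OF x(2)] u1 u2 g1 g2 by blast+
  show "u = g"
  proof (rule extensionalityI[of _ "{..<k + l}"])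
   show "u : extensional {..<k + l}" "g : extensional {..<k + l}" using u(1) g by (auto simp: PiE_iff)
   fix i assume i: "i : {..<k + l}"
   show "u i = g i"
   proof (cases "i < k")
    case True
    then have "u1 i = g1 i" using e by simp
    then show ?thesis using True i by (simp add: u1_def g_def)
   next
    case False
    then have "u2 (i - k) = g2 (i - k)" using e by simp
    moreover have "i - k < l" "k + (i - k) = i" using False i by auto
    ultimately show ?thesis using False i by (simp add: u2_def g_def)
   qed
  qed
 qed
 show "\<exists>!g. g : (\<Pi>\<^sub>E i\<in>{..<k + l}. ?F i) & x = (\<Oplus>\<^sub>M i\<in>{..<k + l}. g i)"
  by (rule ex1I[of _ g], rule conjI[OF g gx], elim conjE, rule uniq)
qed

end

lemma (in module) direct_pair_proj:
 assumes d: "direct_pair R M (car M) A B"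
 shows "\<exists>\<pi>. (\<forall>x\<in>car M. \<pi> x : A) &
  (\<forall>x\<in>car M. \<forall>y\<in>car M. \<pi> (x \<oplus>\<^sub>M y) = \<pi> x \<oplus>\<^sub>M \<pi> y) &
  (\<forall>r\<in>car R. \<forall>x\<in>car M. \<pi> (r \<odot>\<^sub>M x) = r \<odot>\<^sub>M \<pi> x) &
  (\<forall>x\<in>A. \<pi> x = x) & (\<forall>x\<in>B. \<pi> x = \<zero>\<^sub>M)"
proof -
 have N: "submodule A R M" "submodule B R M" "car M = {x \<oplus>\<^sub>M y | x y. x : A & y : B}"
  using d by (auto simp: direct_pair_def)
 have c: "!!x. x : A ==> x : car M" "!!x. x : B ==> x : car M"
  using submoduleE(1)[OF N(1)] submoduleE(1)[OF N(2)] by auto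
 have "\<forall>x\<in>car M. \<exists>y z. y : A & z : B & x = y \<oplus>\<^sub>M z" using N(3) by blast
 then obtain \<pi> \<rho> where pr0: "!!x. x : car M ==> \<pi> x : A & \<rho> x : B & x = \<pi> x \<oplus>\<^sub>M \<rho> x" by metis
 have pr: "\<pi> x : A" "\<rho> x : B" "\<pi> x \<oplus>\<^sub>M \<rho> x = x" if "x : car M" for x using pr0[OF that] by simp_all
 have prc: "\<pi> x : car M" "\<rho> x : car M" if "x : car M" for x
  by (rule c(1)[OF pr(1)[OF that]], rule c(2)[OF pr(2)[OF that]])
 have u: "\<pi> x = y" if "y : A" "z : B" "y \<oplus>\<^sub>M z = x" for x y z
 proof -
  have xc: "x : car M" using c(1)[OF that(1)] c(2)[OF that(2)] that(3) by auto
  show ?thesis by (rule direct_pair_unique(1)[OF d pr(1,2)[OF xc] that(1,2)]) (simp add: pr(3)[OF xc] that(3))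
 qed
 show ?thesis
 proof (intro exI[of _ \<pi>] conjI ballI)
  show "\<pi> x : A" if "x : car M" for x by (rule pr(1)[OF that])
  show "\<pi> (x \<oplus>\<^sub>M y) = \<pi> x \<oplus>\<^sub>M \<pi> y" if xy: "x : car M" "y : car M" for x y
  proof (rule u)
   show "\<pi> x \<oplus>\<^sub>M \<pi> y : A" by (rule submoduleE(5)[OF N(1) pr(1)[OF xy(1)] pr(1)[OF xy(2)]])
   show "\<rho> x \<oplus>\<^sub>M \<rho> y : B" by (rule submoduleE(5)[OF N(2) pr(2)[OF xy(1)] pr(2)[OF xy(2)]])
   have "(\<pi> x \<oplus>\<^sub>M \<pi> y) \<oplus>\<^sub>M (\<rho> x \<oplus>\<^sub>M \<rho> y) = (\<pi> x \<oplus>\<^sub>M \<rho> x) \<oplus>\<^sub>M (\<pi> y \<oplus>\<^sub>M \<rho> y)"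
    using prc[OF xy(1)] prc[OF xy(2)] by (simp add: M.a_ac)
   then show "(\<pi> x \<oplus>\<^sub>M \<pi> y) \<oplus>\<^sub>M (\<rho> x \<oplus>\<^sub>M \<rho> y) = x \<oplus>\<^sub>M y" by (simp only: pr(3)[OF xy(1)] pr(3)[OF xy(2)])
  qed
  show "\<pi> (r \<odot>\<^sub>M x) = r \<odot>\<^sub>M \<pi> x" if rx: "r : car R" "x : car M" for r x
  proof (rule u)
   show "r \<odot>\<^sub>M \<pi> x : A" by (rule submoduleE(4)[OF N(1) rx(1) pr(1)[OF rx(2)]])
   show "r \<odot>\<^sub>M \<rho> x : B" by (rule submoduleE(4)[OF N(2) rx(1) pr(2)[OF rx(2)]])
   have "r \<odot>\<^sub>M (\<pi> x \<oplus>\<^sub>M \<rho> x) = r \<odot>\<^sub>M \<pi> x \<oplus>\<^sub>M r \<odot>\<^sub>M \<rho> x"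
    by (rule smult_r_distr[OF rx(1) prc[OF rx(2)]])
   then show "r \<odot>\<^sub>M \<pi> x \<oplus>\<^sub>M r \<odot>\<^sub>M \<rho> x = r \<odot>\<^sub>M x" by (simp only: pr(3)[OF rx(2)])
  qed
  show "\<pi> x = x" if "x : A" for x by (rule u[OF that submodule_zero[OF N(2)]]) (simp add: c(1)[OF that])
  show "\<pi> x = \<zero>\<^sub>M" if "x : B" for x by (rule u[OF submodule_zero[OF N(1)] that]) (simp add: c(2)[OF that])
 qed
qed

lemma (in module) decomp_proj:
 assumes d: "decomp R M k f (car M)"
 shows "\<exists>\<pi>. (\<forall>i<k. \<forall>x\<in>car M. \<pi> i x : f i) &
  (\<forall>i<k. \<forall>x\<in>car M. \<forall>y\<in>car M. \<pi> i (x \<oplus>\<^sub>M y) = \<pi> i x \<oplus>\<^sub>M \<pi> i y) &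
  (\<forall>i<k. \<forall>r\<in>car R. \<forall>x\<in>car M. \<pi> i (r \<odot>\<^sub>M x) = r \<odot>\<^sub>M \<pi> i x) &
  (\<forall>i<k. \<forall>x\<in>f i. \<pi> i x = x) & (\<forall>x\<in>car M. (\<Oplus>\<^sub>M i\<in>{..<k}. \<pi> i x) = x)"
proof -
 have f: "submodule (f i) R M" "f i <= car M" if "i < k" for i using d that by (auto simp: decomp_def)
 have ex1: "\<exists>!g. g : (\<Pi>\<^sub>E i\<in>{..<k}. f i) & x = (\<Oplus>\<^sub>M i\<in>{..<k}. g i)" if "x : car M" for x
  using d that by (simp add: decomp_def)
 then obtain G where G0: "!!x. x : car M ==> G x : (\<Pi>\<^sub>E i\<in>{..<k}. f i) & x = (\<Oplus>\<^sub>M i\<in>{..<k}. G x i)" by metis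
 have G: "G x : (\<Pi>\<^sub>E i\<in>{..<k}. f i)" "(\<Oplus>\<^sub>M i\<in>{..<k}. G x i) = x" if "x : car M" for x using G0[OF that] by simp_all
 have Gi: "G x i : f i" if "x : car M" "i < k" for x i using G(1)[OF that(1)] that(2) by (auto simp: PiE_iff)
 have Gc: "G x i : car M" if "x : car M" "i < k" for x i using Gi[OF that] f(2)[OF that(2)] by auto
 have u: "G x i = g i" if g: "!!i. i < k ==> g i : f i" and x: "x : car M" "(\<Oplus>\<^sub>M i\<in>{..<k}. g i) = x" and i: "i < k" for x g i
 proof -
  define h where "h = (\<lambda>i\<in>{..<k}. g i)"
  have "(\<Oplus>\<^sub>M i\<in>{..<k}. h i) = (\<Oplus>\<^sub>M i\<in>{..<k}. g i)" using g f(2) by (intro M.finsum_cong') (auto simp: h_def)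
  then have "x = (\<Oplus>\<^sub>M i\<in>{..<k}. h i)" using x(2) by simp
  moreover have "h : (\<Pi>\<^sub>E i\<in>{..<k}. f i)" using g by (auto simp: h_def)
  ultimately have "G x = h" using ex1[OF x(1)] G0[OF x(1)] by blast
  then show ?thesis using i by (simp add: h_def)
 qed
 show ?thesis
 proof (intro exI[of _ "%i x. G x i"] conjI allI impI ballI)
  show "G x i : f i" if "i < k" "x : car M" for i x by (rule Gi[OF that(2,1)])
  show "(\<Oplus>\<^sub>M i\<in>{..<k}. G x i) = x" if "x : car M" for x by (rule G(2)[OF that])
  show "G (x \<oplus>\<^sub>M y) i = G x i \<oplus>\<^sub>M G y i" if i: "i < k" and x: "x : car M" and y: "y : car M" for i x y
  proof (rule u[of "%i. G x i \<oplus>\<^sub>M G y i", OF _ _ _ i])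
   show "G x i \<oplus>\<^sub>M G y i : f i" if "i < k" for i
    by (rule submoduleE(5)[OF f(1)[OF that] Gi[OF x that] Gi[OF y that]])
   have "(\<Oplus>\<^sub>M i\<in>{..<k}. G x i \<oplus>\<^sub>M G y i) = (\<Oplus>\<^sub>M i\<in>{..<k}. G x i) \<oplus>\<^sub>M (\<Oplus>\<^sub>M i\<in>{..<k}. G y i)"
    using Gc x y by (intro M.finsum_addf) auto
   then show "(\<Oplus>\<^sub>M i\<in>{..<k}. G x i \<oplus>\<^sub>M G y i) = x \<oplus>\<^sub>M y" by (simp only: G(2)[OF x] G(2)[OF y])
   show "x \<oplus>\<^sub>M y : car M" using x y by simp
  qed
  show "G (r \<odot>\<^sub>M x) i = r \<odot>\<^sub>M G x i" if i: "i < k" and r: "r : car R" and x: "x : car M" for i r x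
  proof (rule u[of "%i. r \<odot>\<^sub>M G x i", OF _ _ _ i])
   show "r \<odot>\<^sub>M G x i : f i" if "i < k" for i by (rule submoduleE(4)[OF f(1)[OF that] r Gi[OF x that]])
   have "r \<odot>\<^sub>M (\<Oplus>\<^sub>M i\<in>{..<k}. G x i) = (\<Oplus>\<^sub>M i\<in>{..<k}. r \<odot>\<^sub>M G x i)"
    using Gc x r by (intro finsum_smult_ldistr) auto
   then show "(\<Oplus>\<^sub>M i\<in>{..<k}. r \<odot>\<^sub>M G x i) = r \<odot>\<^sub>M x" by (simp only: G(2)[OF x])
   show "r \<odot>\<^sub>M x : car M" using x r by simp
  qed
  show "G x i = x" if i: "i < k" and x: "x : f i" for i x
  proof -
   have xc: "x : car M" using x f(2)[OF i] by auto
   have "G x i = (if i = i then x else \<zero>\<^sub>M)"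
   proof (rule u[of "%j. if i = j then x else \<zero>\<^sub>M", OF _ xc _ i])
    show "(if i = j then x else \<zero>\<^sub>M) : f j" if "j < k" for j
     using x submodule_zero[OF f(1)[OF that]] by (cases "i = j") auto
    show "(\<Oplus>\<^sub>M j\<in>{..<k}. if i = j then x else \<zero>\<^sub>M) = x"
     using M.finsum_singleton[of i "{..<k}" "%_. x"] i xc by simp
   qed
   then show ?thesis by simp
  qed
 qed
qed

lemma restricted_submodule:
 assumes "module S M" "submodule A S (M\<lparr>carrier := N\<rparr>)" "submodule N S M"
 shows "submodule A S M" "A <= N"
proof -
 interpret module S M by (rule assms(1))
 interpret A: submodule A S "M\<lparr>carrier := N\<rparr>" by (rule assms(2))
 show AN: "A <= N" using A.subset by simp
 show "submodule A S M"
 proof (rule submoduleI_simple)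
  show "A <= car M" using AN submoduleE(1)[OF assms(3)] by auto
  show "\<zero>\<^sub>M : A" using A.one_closed by simp
  show "x \<oplus>\<^sub>M y : A" if "x : A" "y : A" for x y using A.m_closed[OF that] by simp
  show "r \<odot>\<^sub>M x : A" if "r : car S" "x : A" for r x using A.smult_closed[OF that] by simp
 qed
qed

lemma not_indecomposable:
 fixes M :: "('a, 'm) module"
 assumes "module S M" "submodule N S M" "N \<noteq> {\<zero>\<^sub>M}" "\<not> indecomposable_module S (M\<lparr>carrier := N\<rparr>)"
 obtains N1 N2 where "direct_pair S M N N1 N2" "N1 \<noteq> {\<zero>\<^sub>M}" "N2 \<noteq> {\<zero>\<^sub>M}"
proof -
 have m: "module S (M\<lparr>carrier := N\<rparr>)" by (rule submodule.submodule_is_module[OF assms(2,1)])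
 obtain N1 N2 where N: "submodule N1 S (M\<lparr>carrier := N\<rparr>)" "submodule N2 S (M\<lparr>carrier := N\<rparr>)"
  "N1 \<inter> N2 = {\<zero>\<^sub>M}" "N1 <+>\<^bsub>M\<lparr>carrier := N\<rparr>\<^esub> N2 = N" "N1 \<noteq> {\<zero>\<^sub>M}" "N2 \<noteq> {\<zero>\<^sub>M}"
  using assms(3,4) m unfolding indecomposable_module_def by auto
 have "N1 <+>\<^bsub>M\<lparr>carrier := N\<rparr>\<^esub> N2 = {x \<oplus>\<^sub>M y | x y. x : N1 & y : N2}"
  unfolding set_add_def set_mult_def by auto
 then have "direct_pair S M N N1 N2"
  using N restricted_submodule[OF assms(1) _ assms(2)] unfolding direct_pair_def by auto
 then show thesis using that N by blast
qed

lemma (in module) decomp_trivial: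
 "decomp R M 0 f {\<zero>\<^sub>M}" "submodule N R M ==> decomp R M 1 (%_. N) N"
proof -
 show "decomp R M 0 f {\<zero>\<^sub>M}" by (auto simp: decomp_def)
 assume N: "submodule N R M"
 have "\<exists>!g. g : (\<Pi>\<^sub>E i\<in>{..<1::nat}. N) & x = (\<Oplus>\<^sub>M i\<in>{..<1}. g i)" if x: "x : N" for x
 proof (rule ex1I)
  have s: "(\<Oplus>\<^sub>M i\<in>{..<1::nat}. g i) = g 0" if "g 0 : car M" for g
   using that by (simp add: lessThan_Suc M.finsum_insert Pi_def)
  have xc: "x : car M" using x submoduleE(1)[OF N] by auto
  show "(\<lambda>i\<in>{..<1::nat}. x) : (\<Pi>\<^sub>E i\<in>{..<1}. N) & x = (\<Oplus>\<^sub>M i\<in>{..<1}. (\<lambda>i\<in>{..<1::nat}. x) i)"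
   using s[of "\<lambda>i\<in>{..<1::nat}. x"] x xc by auto
  fix g assume g: "g : (\<Pi>\<^sub>E i\<in>{..<1::nat}. N) & x = (\<Oplus>\<^sub>M i\<in>{..<1}. g i)"
  then have "g 0 : car M" using submoduleE(1)[OF N] by (auto simp: PiE_iff)
  then have "g 0 = x" using g s by simp
  then show "g = (\<lambda>i\<in>{..<1::nat}. x)" using g by (auto simp: PiE_iff intro!: extensionalityI[of _ "{..<1}"])
 qed
 then show "decomp R M 1 (%_. N) N" using N by (simp add: decomp_def)
qed

context adic_F_finite
begin

lemma Fil_0: "Fil 0 = car S"
proof -
 have "\<one> : ideal_power R P 0" by simp
 then have "\<iota> \<one> : Fil 0" using Fil_iff by blast
 then have "\<one>\<^sub>S : Fil 0" by simp
 then have "z : Fil 0" if "z : car S" for z using Fil(5)[OF that] that by (metis S.r_one)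
 then show ?thesis using Fil(1) by blast
qed

text \<open>If \<open>N\<close> had no finite decomposition, it could be split as \<open>N = N1 \<oplus> N2\<close> with the same being true of
 \<open>N1\<close>. As \<open>F\<^sup>e\<^sub>*S/mF\<^sup>e\<^sub>*S\<close> is a quotient of the Noetherian \<open>R\<close>-module \<open>F\<^sup>e\<^sub>*R\<close>, the growing complements
 eventually satisfy \<open>N2 <= N' + mF\<^sup>e\<^sub>*S\<close>, and projecting to \<open>N2\<close> yields \<open>N2 = m N2\<close>, hence \<open>N2 = 0\<close>.\<close>

lemma exists_indecomposable_decomp:
 "\<exists>k f. decomp S (frob_push S p e) k f (car S) &
  (\<forall>i<k. indecomposable_module S ((frob_push S p e)\<lparr>carrier := f i\<rparr>))"
proof -
 let ?M = "frob_push S p e"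
 interpret M: module S ?M by (rule S.frob_push_module)
 interpret FR: module R "frob_push R p e" by (rule R.frob_push_module)
 have nR: "noeth_module R (frob_push R p e)" using ex_spans FR.spans_noeth[OF noetherian] by blast
 define good where "good N \<longleftrightarrow> (\<exists>k f. decomp S ?M k f N & (\<forall>i<k. indecomposable_module S (?M\<lparr>carrier := f i\<rparr>)))" for N
 have good_sum: "good N" if gs: "direct_pair S ?M N N1 N2" "good N1" "good N2" for N N1 N2
 proof -
  obtain k f l h where k: "decomp S ?M k f N1" "\<forall>i<k. indecomposable_module S (?M\<lparr>carrier := f i\<rparr>)"
   and l: "decomp S ?M l h N2" "\<forall>i<l. indecomposable_module S (?M\<lparr>carrier := h i\<rparr>)"
   using gs(2,3) unfolding good_def by blast
  have "\<forall>i<k + l. indecomposable_module S (?M\<lparr>carrier := (if i < k then f i else h (i - k))\<rparr>)"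
   using k(2) l(2) by auto
  then show ?thesis unfolding good_def using M.decomp_concat[OF gs(1) k(1) l(1)] by blast
 qed
 \<comment> \<open>\<open>Fil 1\<close> acts on the push-forward through \<open>p ^ e\<close>-th
   powers, so its multiples of the module make up the ideal \<open>mM\<close> generated by these
   powers.\<close>
 define gens where "gens = {r [^]\<^sub>S (p ^ e) | r. r : Fil 1}"
 have gens_c: "gens <= car S" using Fil(1) by (auto simp: gens_def)
 define mM where "mM = genideal S gens"
 have mM: "ideal mM S" unfolding mM_def by (rule S.genideal_ideal[OF gens_c])
 note mM' = S.ideal_props[OF mM]
 have mM_sub: "submodule mM S ?M" unfolding S.submodule_frob_iff using mM' by auto
 have "\<exists>n::nat. \<iota> (x [^] n) : mM" if x: "x : P" for x
 proof -
  have xc: "x : car R" using x R.ideal_props(1)[OF P_ideal] by auto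
  have "x [^] (1::nat) : ideal_power R P 1" by (rule R.pow_mem_ideal_power[OF P_ideal x])
  then have "\<iota> x : Fil 1" using xc Fil_iff by simp
  then have "(\<iota> x) [^]\<^sub>S (p ^ e) : gens" by (auto simp: gens_def)
  then have "(\<iota> x) [^]\<^sub>S (p ^ e) : mM" unfolding mM_def using S.genideal_self[OF gens_c] by auto
  then show ?thesis using xc by (intro exI[of _ "p ^ e"]) simp
 qed
 \<comment> \<open>With \<open>approx\<close> this means that modulo \<open>mM\<close> every element
   of \<open>S\<close> is the image of an element of \<open>R\<close>.\<close>
 from Fil_subset_nil[OF mM this] obtain t where t: "Fil t <= mM" by blast
 define plus where "plus A B = {x \<oplus>\<^sub>?M  y | x y. x : A & y : B}" for A B
 have plus_sub: "submodule (plus A B) S ?M" if "submodule A S ?M" "submodule B S ?M" for A B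
  unfolding plus_def by (rule M.submodule_sum[OF that])
 define pull where "pull K = {r \<in> car R. \<iota> r : K}" for K
 have pull_sub: "submodule (pull K) R (frob_push R p e)" if K: "submodule K S ?M" for K
  using K unfolding R.submodule_frob_iff S.submodule_frob_iff pull_def by auto
 define bad where "bad = {(N, N'). direct_pair S ?M (car S) N N' & \<not> good N}"
 have "good (car S)"
 proof (rule ccontr)
  assume nb: "\<not> good (car S)"
  have "direct_pair S ?M (car S) (car S) {\<zero>\<^sub>S}"
  proof -
   have 1: "submodule (car S) S ?M" using M.carrier_is_submodule by simp
   have 2: "submodule {\<zero>\<^sub>S} S ?M" unfolding S.submodule_frob_iff by auto
   have "car S = {x \<oplus>\<^sub>S y | x y. x : car S & y : {\<zero>\<^sub>S}}" by force
   then show ?thesis unfolding direct_pair_def using 1 2 by auto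
  qed
  then have b0: "(car S, {\<zero>\<^sub>S}) \<in> bad" using nb by (simp add: bad_def)
  \<comment> \<open>The complements of the bad summands, enlarged by \<open>mM\<close> and pulled
    back. They are submodules of a Noetherian module over \<open>R\<close>, so one of them is
    maximal.\<close>
  define F where "F = (%(N, N'). pull (plus N' mM)) ` bad"
  have "pull (plus {\<zero>\<^sub>S} mM) : F" unfolding F_def using b0 by force
  moreover have "submodule W R (frob_push R p e)" if "W : F" for W
   using that plus_sub[OF _ mM_sub] pull_sub by (auto simp: F_def bad_def direct_pair_def)
  ultimately obtain W where W: "W : F" "!!V. V : F ==> W <= V ==> V = W"
   using FR.noeth_module_maximalE[OF nR, of F] by metis
  obtain N N' where NN: "direct_pair S ?M (car S) N N'" "\<not> good N" "W = pull (plus N' mM)"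
   using W(1) by (auto simp: F_def bad_def)
  have Ns: "submodule N S ?M" "submodule N' S ?M" using NN(1) by (auto simp: direct_pair_def)
  have "N \<noteq> {\<zero>\<^sub>?M }" using NN(2) M.decomp_trivial(1) unfolding good_def by blast
  moreover have "\<not> indecomposable_module S (?M\<lparr>carrier := N\<rparr>)"
   using NN(2) M.decomp_trivial(2)[OF Ns(1)] unfolding good_def by blast
  ultimately obtain A B where AB: "direct_pair S ?M N A B" "A \<noteq> {\<zero>\<^sub>?M }" "B \<noteq> {\<zero>\<^sub>?M }"
   using not_indecomposable[OF S.frob_push_module Ns(1)] by metis
  \<comment> \<open>By \<open>good_sum\<close> at least one of the two parts is not good; it takes
    the role of \<open>N1\<close>.\<close>
  have "\<exists>N1 N2. direct_pair S ?M N N1 N2 & N2 \<noteq> {\<zero>\<^sub>?M } & \<not> good N1"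
  proof (cases "good A")
   case True
   then have "\<not> good B" using good_sum[OF AB(1)] NN(2) by blast
   then show ?thesis using M.direct_pair_commute[OF AB(1)] AB(2) by blast
  qed (use AB in blast)
  then obtain N1 N2 where N12: "direct_pair S ?M N N1 N2" "N2 \<noteq> {\<zero>\<^sub>?M }" "\<not> good N1" by blast
  have N2s: "submodule N1 S ?M" "submodule N2 S ?M" using N12(1) by (auto simp: direct_pair_def)
  let ?K = "plus N2 N'"
  have Ks: "submodule ?K S ?M" by (rule plus_sub[OF N2s(2) Ns(2)])
  have "direct_pair S ?M (car S) N1 ?K" using M.direct_pair_assoc(1)[OF NN(1) N12(1)] by (simp add: plus_def)
  then have "pull (plus ?K mM) : F" unfolding F_def bad_def using N12(3) by force
  have KI: "N2 <= ?K" "N' <= ?K"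
   using M.direct_pair_incl[OF M.direct_pair_assoc(2)[OF NN(1) N12(1)]] by (auto simp: plus_def)
  have z0: "\<zero>\<^sub>S : mM" by (rule mM'(2))
  have plusI1: "A <= plus A mM" if "submodule A S ?M" for A
  proof
   fix x assume x: "x : A"
   then have "x = x \<oplus>\<^sub>?M  \<zero>\<^sub>S" using M.submoduleE(1)[OF that] by auto
   then show "x : plus A mM" unfolding plus_def using x z0 by blast
  qed
  have plusI2: "mM <= plus A mM" if "submodule A S ?M" for A
  proof
   fix x assume x: "x : mM"
   then have "x = \<zero>\<^sub>S \<oplus>\<^sub>?M  x" using mM'(1) by auto
   then show "x : plus A mM" unfolding plus_def using x M.submodule_zero[OF that] by auto
  qed
  have "plus N' mM <= plus ?K mM" using KI(2) unfolding plus_def by blast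
  then have "W <= pull (plus ?K mM)" unfolding NN(3) pull_def by blast
  \<comment> \<open>By maximality the larger complement \<open>?K\<close> has the same pull-back as
    \<open>N'\<close>, although it contains \<open>N2\<close>.\<close>
  then have Weq: "pull (plus ?K mM) = pull (plus N' mM)" using W(2) \<open>pull (plus ?K mM) : F\<close> NN(3) by blast
  \<comment> \<open>Subtracting an element of \<open>mM\<close> leads from \<open>z\<close> to the
    image of some \<open>r\<close>. There the equality of pull-backs is used, and the element is
    added back.\<close>
  have N2sub: "z : plus N' mM" if z: "z : N2" for z
  proof -
   note LK = M.submoduleE[OF plus_sub[OF Ks mM_sub]] and LN = M.submoduleE[OF plus_sub[OF Ns(2) mM_sub]]
   have zc: "z : car S" using z M.submoduleE(1)[OF N2s(2)] by auto
   obtain r where r: "r : car R" "z \<ominus>\<^sub>S \<iota> r : Fil t" using approx[OF zc] by blast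
   then have w: "z \<ominus>\<^sub>S \<iota> r : mM" using t by auto
   have nw: "\<ominus>\<^sub>S (z \<ominus>\<^sub>S \<iota> r) : mM" by (rule mM'(7)[OF w])
   have zK: "z : plus ?K mM" using z KI(1) plusI1[OF Ks] by blast
   have "z \<oplus>\<^sub>S \<ominus>\<^sub>S (z \<ominus>\<^sub>S \<iota> r) = \<iota> r"
    using zc r by (simp add: a_minus_def S.minus_add S.r_neg2 S.r_neg1)
   moreover have "z \<oplus>\<^sub>S \<ominus>\<^sub>S (z \<ominus>\<^sub>S \<iota> r) : plus ?K mM"
    using LK(5)[OF zK subsetD[OF plusI2[OF Ks] nw]] by simp
   ultimately have "\<iota> r : plus ?K mM" by simp
   then have "r : pull (plus ?K mM)" using r(1) by (simp add: pull_def)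
   then have "\<iota> r : plus N' mM" unfolding Weq by (simp add: pull_def)
   then have "\<iota> r \<oplus>\<^sub>?M  (z \<ominus>\<^sub>S \<iota> r) : plus N' mM" by (rule LN(5)[OF _ subsetD[OF plusI2[OF Ns(2)] w]])
   moreover have "\<iota> r \<oplus>\<^sub>S (z \<ominus>\<^sub>S \<iota> r) = z" using zc r by (simp add: a_minus_def S.a_lcomm S.r_neg)
   ultimately show ?thesis by simp
  qed
  have dp: "direct_pair S ?M (car ?M) N2 (plus N1 N')"
   using M.direct_pair_assoc(1)[OF NN(1) M.direct_pair_commute[OF N12(1)]] by (simp add: plus_def)
  \<comment> \<open>The projection to \<open>N2\<close> along \<open>N1\<close> plus
    \<open>N'\<close>. It kills \<open>N'\<close>, so an element of \<open>N2\<close> is the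
    projection of its part in \<open>mM\<close>.\<close>
  obtain \<pi> where "(\<forall>x\<in>car ?M. \<pi> x : N2) &
   (\<forall>x\<in>car ?M. \<forall>y\<in>car ?M. \<pi> (x \<oplus>\<^sub>?M  y) = \<pi> x \<oplus>\<^sub>?M  \<pi> y) &
   (\<forall>r\<in>car S. \<forall>x\<in>car ?M. \<pi> (r \<odot>\<^sub>?M  x) = r \<odot>\<^sub>?M  \<pi> x) &
   (\<forall>x\<in>N2. \<pi> x = x) & (\<forall>x\<in>plus N1 N'. \<pi> x = \<zero>\<^sub>?M )"
   using M.direct_pair_proj[OF dp] by (elim exE)
  then have \<pi>: "!!x. x : car S ==> \<pi> x : N2"
   "!!x y. x : car S ==> y : car S ==> \<pi> (x \<oplus>\<^sub>S y) = \<pi> x \<oplus>\<^sub>S \<pi> y"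
   "!!r x. r : car S ==> x : car S ==> \<pi> (r [^]\<^sub>S (p ^ e) \<otimes>\<^sub>S x) = r [^]\<^sub>S (p ^ e) \<otimes>\<^sub>S \<pi> x"
   "!!x. x : N2 ==> \<pi> x = x" "!!x. x : plus N1 N' ==> \<pi> x = \<zero>\<^sub>S" unfolding S.frob_push_simps by blast+
  have N2c: "N2 <= car S" using M.submoduleE(1)[OF N2s(2)] by simp
  have p0: "p ^ e > 0" using R.prime_p prime_gt_0_nat by auto
  \<comment> \<open>Every element of \<open>N2\<close> is a value of \<open>\<pi>\<close> on
    \<open>mM\<close>, which gains one step of the filtration each time. Separation then gives
    \<open>N2\<close> zero.\<close>
  have "N2 <= Fil k" for k
  proof (induction k)
   case 0
   then show ?case using N2c Fil_0 by simp
  next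
   case (Suc k)
   \<comment> \<open>As in \<open>frob_maps_continuous\<close>, the quantifier over \<open>y\<close>
     yields an ideal, which contains \<open>mM\<close> as soon as it contains
     \<open>gens\<close>.\<close>
   define J where "J = {w \<in> car S. \<forall>y\<in>car S. \<pi> (w \<otimes>\<^sub>S y) : Fil (Suc k)}"
   have pz: "\<pi> \<zero>\<^sub>S = \<zero>\<^sub>S" using \<pi>(4) M.submodule_zero[OF N2s(2)] by simp
   have "ideal J S"
   proof (rule S.idealI_simple)
    show "\<zero>\<^sub>S : J" using pz Fil(2) by (simp add: J_def)
    show "x \<oplus>\<^sub>S y : J" if "x : J" "y : J" for x y
     using that \<pi>(2) Fil(3) by (simp add: J_def S.l_distr)
    show "r \<otimes>\<^sub>S x : J" if "r : car S" "x : J" for r x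
     unfolding J_def
    proof (intro CollectI conjI ballI)
     fix y assume y: "y : car S"
     have "r \<otimes>\<^sub>S x \<otimes>\<^sub>S y = x \<otimes>\<^sub>S (r \<otimes>\<^sub>S y)" using that y by (simp add: J_def S.m_ac)
     moreover have "r \<otimes>\<^sub>S y : car S" using that y by simp
     ultimately show "\<pi> (r \<otimes>\<^sub>S x \<otimes>\<^sub>S y) : Fil (Suc k)" using that by (simp add: J_def)
    qed (use that in \<open>auto simp: J_def\<close>)
   qed (auto simp: J_def)
   moreover have "gens <= J"
   proof
    fix w assume "w : gens"
    then obtain r where r: "r : Fil 1" "w = r [^]\<^sub>S (p ^ e)" by (auto simp: gens_def)
    have rc: "r : car S" using r Fil(1) by auto
    obtain m where m: "p ^ e = Suc m" using p0 gr0_implies_Suc by blast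
    have rq: "r [^]\<^sub>S (p ^ e) : Fil 1" unfolding m using rc r(1) Fil(5) by simp
    have "\<pi> (w \<otimes>\<^sub>S y) : Fil (Suc k)" if y: "y : car S" for y
    proof -
     have "\<pi> y : Fil k" using \<pi>(1)[OF y] Suc by auto
     then show ?thesis using \<pi>(3)[OF rc y] Fil1_mult[OF rq] r(2) by simp
    qed
    then show "w : J" using rc r(2) by (simp add: J_def)
   qed
   ultimately have mJ: "mM <= J" unfolding mM_def by (rule S.genideal_minimal)
   show ?case
   proof
    fix z assume z: "z : N2"
    obtain n w where nw: "n : N'" "w : mM" "z = n \<oplus>\<^sub>S w" using N2sub[OF z] unfolding plus_def by auto
    have c: "n : car S" "w : car S" using nw M.submoduleE(1)[OF Ns(2)] mM'(1) by auto
    have "n : plus N1 N'"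
    proof -
     have "n = \<zero>\<^sub>S \<oplus>\<^sub>?M  n" using c by simp
     then show ?thesis unfolding plus_def using nw(1) M.submodule_zero[OF N2s(1)] by auto
    qed
    then have "z = \<pi> w" using \<pi>(4)[OF z] \<pi>(2)[OF c] \<pi>(5) nw(3) c N2c \<pi>(1)[OF c(2)] by auto
    moreover have "\<pi> (w \<otimes>\<^sub>S \<one>\<^sub>S) : Fil (Suc k)" using nw(2) mJ by (auto simp: J_def)
    ultimately show "z : Fil (Suc k)" using c by simp
   qed
  qed
  then have "N2 <= {\<zero>\<^sub>S}" using separated N2c by blast
  then show False using N12(2) M.submodule_zero[OF N2s(2)] by auto
 qed
 then show ?thesis unfolding good_def .
qed

end

text \<open>The identity is the sum of the projections to the \<open>f i\<close>. Each of them
  passes through the other push-forward: go over by the isomorphism with \<open>h j\<close>, come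
  back by the projection to \<open>h j\<close> and the inverse isomorphism.\<close>

lemma (in char_ring) comp_sums_summands:
 assumes dec: "decomp R (frob_push R p e) k f (car R)"
  and iso: "!!i. i < k ==> \<exists>m h j. decomp R (frob_push R p e') m h (car R) & j < m &
   lin_isos R ((frob_push R p e)\<lparr>carrier := f i\<rparr>) ((frob_push R p e')\<lparr>carrier := h j\<rparr>) \<noteq> {}"
 shows "(\<lambda>x\<in>car R. x) : comp_sums R p e e'"
proof -
 let ?M = "frob_push R p e" let ?M' = "frob_push R p e'"
 interpret M: module R ?M by (rule frob_push_module)
 interpret M': module R ?M' by (rule frob_push_module)
 have dec': "decomp R ?M k f (car ?M)" using dec by simp
 obtain \<pi> where "(\<forall>i<k. \<forall>x\<in>car ?M. \<pi> i x : f i) &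
  (\<forall>i<k. \<forall>x\<in>car ?M. \<forall>y\<in>car ?M. \<pi> i (x \<oplus>\<^sub>?M  y) = \<pi> i x \<oplus>\<^sub>?M  \<pi> i y) &
  (\<forall>i<k. \<forall>r\<in>car R. \<forall>x\<in>car ?M. \<pi> i (r \<odot>\<^sub>?M  x) = r \<odot>\<^sub>?M  \<pi> i x) &
  (\<forall>i<k. \<forall>x\<in>f i. \<pi> i x = x) & (\<forall>x\<in>car ?M. (\<Oplus>\<^sub>?M i\<in>{..<k}. \<pi> i x) = x)"
  using M.decomp_proj[OF dec'] by (elim exE)
 then have \<pi>: "!!i x. i < k ==> x : car R ==> \<pi> i x : f i"
  "!!i x y. i < k ==> x : car R ==> y : car R ==> \<pi> i (x \<oplus> y) = \<pi> i x \<oplus> \<pi> i y"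
  "!!i r x. i < k ==> r : car R ==> x : car R ==> \<pi> i (r [^] (p ^ e) \<otimes> x) = r [^] (p ^ e) \<otimes> \<pi> i x"
  "!!i x. i < k ==> x : f i ==> \<pi> i x = x" "!!x. x : car R ==> (\<Oplus>\<^sub>?M i\<in>{..<k}. \<pi> i x) = x"
  unfolding frob_push_simps by blast+
 have fc: "f i <= car R" if "i < k" for i using dec that by (auto simp: decomp_def)
 have step: "\<exists>h\<in>frob_maps R p e e'. \<exists>g\<in>frob_maps R p e' e. \<forall>x\<in>car R. g (h x) = \<pi> i x" if i: "i < k" for i
 proof -
  obtain m h j \<chi> where d': "decomp R ?M' m h (car R)" and j: "j < m"
   and \<chi>: "\<chi> : lin_isos R (?M\<lparr>carrier := f i\<rparr>) (?M'\<lparr>carrier := h j\<rparr>)" using iso[OF i] by blast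
  have d'': "decomp R ?M' m h (car ?M')" using d' by simp
  obtain \<rho> where "(\<forall>i<m. \<forall>x\<in>car ?M'. \<rho> i x : h i) &
   (\<forall>i<m. \<forall>x\<in>car ?M'. \<forall>y\<in>car ?M'. \<rho> i (x \<oplus>\<^sub>?M'  y) = \<rho> i x \<oplus>\<^sub>?M'  \<rho> i y) &
   (\<forall>i<m. \<forall>r\<in>car R. \<forall>x\<in>car ?M'. \<rho> i (r \<odot>\<^sub>?M'  x) = r \<odot>\<^sub>?M'  \<rho> i x) &
   (\<forall>i<m. \<forall>x\<in>h i. \<rho> i x = x) & (\<forall>x\<in>car ?M'. (\<Oplus>\<^sub>?M' i\<in>{..<m}. \<rho> i x) = x)"
   using M'.decomp_proj[OF d''] by (elim exE)
  then have \<rho>: "!!i x. i < m ==> x : car R ==> \<rho> i x : h i"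
   "!!i x y. i < m ==> x : car R ==> y : car R ==> \<rho> i (x \<oplus> y) = \<rho> i x \<oplus> \<rho> i y"
   "!!i r x. i < m ==> r : car R ==> x : car R ==> \<rho> i (r [^] (p ^ e') \<otimes> x) = r [^] (p ^ e') \<otimes> \<rho> i x"
   "!!i x. i < m ==> x : h i ==> \<rho> i x = x" unfolding frob_push_simps by blast+
  have hs: "submodule (h j) R ?M'" and fs: "submodule (f i) R ?M" using d' j dec i by (auto simp: decomp_def)
  note H = hs[unfolded submodule_frob_iff] and Fi = fs[unfolded submodule_frob_iff]
  have bij: "bij_betw \<chi> (f i) (h j)" using \<chi> by (simp add: lin_isos_def)
  have \<chi>l: "!!x y. x : f i ==> y : f i ==> \<chi> (x \<oplus> y) = \<chi> x \<oplus> \<chi> y"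
   "!!c x. c : car R ==> x : f i ==> \<chi> (c [^] (p ^ e) \<otimes> x) = c [^] (p ^ e') \<otimes> \<chi> x"
   using \<chi> by (auto simp: lin_isos_def lin_maps_def additive_maps_def)
  have \<chi>h: "\<chi> x : h j" if "x : f i" for x using bij that by (auto simp: bij_betw_def)
  have hc: "h j <= car R" using H by simp
  define \<xi> where "\<xi> = inv_into (f i) \<chi>"
  have \<xi>1: "\<xi> (\<chi> x) = x" if "x : f i" for x using bij that by (simp add: \<xi>_def bij_betw_inv_into_left)
  have \<xi>2: "\<chi> (\<xi> y) = y" "\<xi> y : f i" if "y : h j" for y
   using bij that bij_betw_inv_into_right[OF bij that] inv_into_into[of y \<chi> "f i"] by (auto simp: \<xi>_def bij_betw_def)
  have \<xi>l: "\<xi> (y \<oplus> z) = \<xi> y \<oplus> \<xi> z" if "y : h j" "z : h j" for y z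
   using \<xi>1[of "\<xi> y \<oplus> \<xi> z"] \<xi>2[OF that(1)] \<xi>2[OF that(2)] \<chi>l(1) Fi by simp
  have \<xi>s: "\<xi> (c [^] (p ^ e') \<otimes> y) = c [^] (p ^ e) \<otimes> \<xi> y" if "y : h j" "c : car R" for y c
   using \<xi>1[of "c [^] (p ^ e) \<otimes> \<xi> y"] \<xi>2[OF that(1)] \<chi>l(2)[OF that(2)] Fi that(2) by simp
  have "(\<lambda>x\<in>car R. \<chi> (\<pi> i x)) : frob_maps R p e e'"
  proof (rule frob_maps_restrictI)
   show "\<chi> (\<pi> i x) : car R" if "x : car R" for x using \<chi>h[OF \<pi>(1)[OF i that]] hc by blast
  qed (simp_all add: \<pi>(1)[OF i] \<pi>(2)[OF i] \<pi>(3)[OF i] \<chi>l)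
  moreover have "(\<lambda>y\<in>car R. \<xi> (\<rho> j y)) : frob_maps R p e' e"
  proof (rule frob_maps_restrictI)
   show "\<xi> (\<rho> j x) : car R" if "x : car R" for x using \<xi>2(2)[OF \<rho>(1)[OF j that]] fc[OF i] by blast
  qed (simp_all add: \<rho>(1)[OF j] \<rho>(2)[OF j] \<rho>(3)[OF j] \<xi>l \<xi>s)
  moreover have "(\<lambda>y\<in>car R. \<xi> (\<rho> j y)) ((\<lambda>x\<in>car R. \<chi> (\<pi> i x)) x) = \<pi> i x" if x: "x : car R" for x
   using x \<chi>h[OF \<pi>(1)[OF i x]] hc \<rho>(4)[OF j] \<xi>1[OF \<pi>(1)[OF i x]] by auto
  ultimately show ?thesis by blast
 qed
 have "m \<le> k ==> (\<lambda>x\<in>car R. \<Oplus>\<^sub>?M i\<in>{..<m}. \<pi> i x) : comp_sums R p e e'" for m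
 proof (induction m)
  case 0
  have "(\<lambda>x\<in>car R. \<Oplus>\<^sub>?M i\<in>{..<0::nat}. \<pi> i x) = (\<lambda>x\<in>car R. \<zero>)" by (rule restrict_ext) simp
  then show ?case using comp_sums.zero by (simp only:)
 next
  case (Suc m)
  obtain h g where hg: "h : frob_maps R p e e'" "g : frob_maps R p e' e" "!!x. x : car R ==> g (h x) = \<pi> m x"
   using step[of m] Suc.prems by auto
  have "(\<lambda>x\<in>car R. (\<lambda>x\<in>car R. \<Oplus>\<^sub>?M i\<in>{..<m}. \<pi> i x) x \<oplus> g (h x)) : comp_sums R p e e'"
   using Suc by (intro comp_sums.add[OF _ hg(1,2)]) simp
  moreover have "(\<lambda>x\<in>car R. (\<lambda>x\<in>car R. \<Oplus>\<^sub>?M i\<in>{..<m}. \<pi> i x) x \<oplus> g (h x)) =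
   (\<lambda>x\<in>car R. \<Oplus>\<^sub>?M i\<in>{..<Suc m}. \<pi> i x)"
  proof (rule restrict_ext)
   fix x assume x: "x : car R"
   have c: "\<pi> i x : car R" if "i < Suc m" for i using \<pi>(1)[of i x] fc[of i] that x Suc.prems by auto
   have "(\<Oplus>\<^sub>?M i\<in>{..<Suc m}. \<pi> i x) = \<pi> m x \<oplus> (\<Oplus>\<^sub>?M i\<in>{..<m}. \<pi> i x)"
    using c M.finsum_insert[of "{..<m}" m "%i. \<pi> i x"] by (simp add: lessThan_Suc Pi_def)
   moreover have "(\<Oplus>\<^sub>?M i\<in>{..<m}. \<pi> i x) : car R"
    using c M.finsum_closed[of "%i. \<pi> i x" "{..<m}"] by (simp add: Pi_def)
   ultimately show "(\<lambda>x\<in>car R. \<Oplus>\<^sub>?M i\<in>{..<m}. \<pi> i x) x \<oplus> g (h x) = (\<Oplus>\<^sub>?M i\<in>{..<Suc m}. \<pi> i x)"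
    using x hg(3)[OF x] c[of m] by (simp add: a_comm)
  qed
  ultimately show ?case by (simp only:)
 qed
 from this[of k] have "(\<lambda>x\<in>car R. \<Oplus>\<^sub>?M i\<in>{..<k}. \<pi> i x) : comp_sums R p e e'" by simp
 moreover have "(\<lambda>x\<in>car R. \<Oplus>\<^sub>?M i\<in>{..<k}. \<pi> i x) = (\<lambda>x\<in>car R. x)"
  by (rule restrict_ext) (use \<pi>(5) in simp)
 ultimately show ?thesis by (simp only:)
qed

text \<open>Every summand lies in its own isomorphism class. If this class equals that of some
  \<open>h j\<close>, the summand is isomorphic to \<open>h j\<close>.\<close>

lemma (in adic_F_finite) comp_sums_completion:
 assumes KS: "KS_classes S (frob_push S p e) <= KS_classes S (frob_push S p e')"
 shows "(\<lambda>x\<in>car S. x) : comp_sums S p e e'"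
proof -
 let ?M = "frob_push S p e" let ?M' = "frob_push S p e'"
 have ids: "decomp S (frob_push S p d) k f (car S) \<longleftrightarrow> internal_direct_sum S (frob_push S p d) k f" for d k f
 proof -
  interpret M: module S "frob_push S p d" by (rule S.frob_push_module)
  show ?thesis unfolding decomp_def internal_direct_sum_def using M.submoduleE(1) by auto
 qed
 obtain k f where kf: "decomp S ?M k f (car S)" "\<forall>i<k. indecomposable_module S (?M\<lparr>carrier := f i\<rparr>)"
  using exists_indecomposable_decomp[of e] by blast
 show ?thesis
 proof (rule S.comp_sums_summands[OF kf(1)])
  fix i assume i: "i < k"
  let ?L = "?M\<lparr>carrier := f i\<rparr>"
  have "iso_class S ?L : KS_classes S ?M"
   unfolding KS_classes_def using kf ids i by blast
  then have "iso_class S ?L : KS_classes S ?M'" using KS by blast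
  then obtain m h j where h: "iso_class S ?L = iso_class S (?M'\<lparr>carrier := h j\<rparr>)"
   "internal_direct_sum S ?M' m h" "j < m" unfolding KS_classes_def by blast
  have mL: "module S ?L" using kf(2) i by (simp add: indecomposable_module_def)
  interpret L: module S ?L by (rule mL)
  have "(\<lambda>x\<in>car ?L. x) : lin_isos S ?L ?L"
   unfolding lin_isos_def lin_maps_def additive_maps_def bij_betw_def inj_on_def
   using L.M.a_closed L.smult_closed by auto
  then have "?L : iso_class S ?L" using mL by (auto simp: iso_class_def)
  then have "?L : iso_class S (?M'\<lparr>carrier := h j\<rparr>)" using h(1) by simp
  then have "lin_isos S ?L (?M'\<lparr>carrier := h j\<rparr>) \<noteq> {}" by (simp add: iso_class_def)
  then show "\<exists>m h j. decomp S ?M' m h (car S) & j < m & lin_isos S ?L (?M'\<lparr>carrier := h j\<rparr>) \<noteq> {}"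
   using h(2,3) ids by blast
 qed
qed

section \<open>Localization and completion\<close>

context cring
begin

text \<open>The completion consists of sequences of cosets. Writing them through coherent sequences
  of representatives reduces the ring laws to those of \<open>R\<close> in each component.\<close>

abbreviation compl_seq :: "'a set => (nat => 'a) => nat => 'a set" where
 "compl_seq I x \<equiv> %n. ideal_power R I n +> x n"

definition coherent :: "'a set => (nat => 'a) => bool" where
 "coherent I x \<longleftrightarrow> (\<forall>n. x n : car R & x (Suc n) \<ominus> x n : ideal_power R I n)"

lemma coset_eq_iff:
 "ideal J R ==> x : car R ==> y : car R ==> J +> x = J +> y \<longleftrightarrow> x \<ominus> y : J"
 using quotient_eq_iff_same_a_r_cos by metis

lemma coset_self: "ideal J R ==> x : car R ==> x : J +> x"
 using ideal_props(2)[of J] by (auto simp: a_r_coset_def' intro!: bexI[of _ \<zero>])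

lemma coset_subset_iff:
 assumes J: "ideal J R" "ideal J' R" "J' <= J" and x: "x : car R" "y : car R"
 shows "J' +> x <= J +> y \<longleftrightarrow> x \<ominus> y : J"
proof
 assume "J' +> x <= J +> y"
 then have "x : J +> y" using coset_self[OF J(2) x(1)] by auto
 then obtain j where "j : J" "x = j \<oplus> y" by (auto simp: a_r_coset_def')
 moreover have "j : car R" using calculation ideal_props(1)[OF J(1)] by auto
 ultimately show "x \<ominus> y : J" using x add_minus_cancel by simp
next
 assume "x \<ominus> y : J"
 then have "J +> x = J +> y" using coset_eq_iff[OF J(1) x] by simp
 moreover have "J' +> x <= J +> x" using J(3) unfolding a_r_coset_def r_coset_def by auto
 ultimately show "J' +> x <= J +> y" by simp
qed

lemma completion_carrier:
 assumes I: "ideal I R"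
 shows "z : car (adic_completion R I) \<longleftrightarrow> (\<exists>x. coherent I x & z = compl_seq I x)"
proof
 note J = ideal_power_ideal[OF I]
 assume "z : car (adic_completion R I)"
 then have z: "!!n. z n : car (R Quot ideal_power R I n)" "!!n. z (Suc n) <= z n" by (auto simp: adic_completion_def)
 have "\<forall>n. \<exists>x\<in>car R. z n = ideal_power R I n +> x" using z(1) by (simp add: FactRing_def A_RCOSETS_def')
 then obtain x where x: "!!n. x n : car R" "!!n. z n = ideal_power R I n +> x n" by metis
 have "x (Suc n) \<ominus> x n : ideal_power R I n" for n
  using z(2)[of n] unfolding x(2) coset_subset_iff[OF J J ideal_power_Suc_subset[OF I] x(1) x(1)] .
 then show "\<exists>x. coherent I x & z = compl_seq I x" using x unfolding coherent_def by blast
next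
 note J = ideal_power_ideal[OF I]
 assume "\<exists>x. coherent I x & z = compl_seq I x"
 then obtain x where x: "!!n. x n : car R" "!!n. x (Suc n) \<ominus> x n : ideal_power R I n" "z = compl_seq I x"
  unfolding coherent_def by blast
 have "z (Suc n) <= z n" for n
  unfolding x(3) coset_subset_iff[OF J J ideal_power_Suc_subset[OF I] x(1) x(1)] by (rule x(2))
 moreover have "z n : car (R Quot ideal_power R I n)" for n
  unfolding x(3) using x(1) by (auto simp: FactRing_def A_RCOSETS_def')
 ultimately show "z : car (adic_completion R I)" by (auto simp: adic_completion_def)
qed

lemma compl_seq_ops:
 assumes I: "ideal I R" and "coherent I x" "coherent I y"
 shows "compl_seq I x \<otimes>\<^sub>(adic_completion R I) compl_seq I y = compl_seq I (%n. x n \<otimes> y n)"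
  "compl_seq I x \<oplus>\<^sub>(adic_completion R I) compl_seq I y = compl_seq I (%n. x n \<oplus> y n)"
  "\<one>\<^sub>(adic_completion R I) = compl_seq I (%n. \<one>)" "\<zero>\<^sub>(adic_completion R I) = compl_seq I (%n. \<zero>)"
proof -
 have c: "x n : car R" "y n : car R" for n using assms(2,3) by (auto simp: coherent_def)
 note J = ideal_power_ideal[OF I]
 show "compl_seq I x \<otimes>\<^sub>(adic_completion R I) compl_seq I y = compl_seq I (%n. x n \<otimes> y n)"
  using ideal.rcoset_mult_add[OF J c] by (simp add: adic_completion_def FactRing_def)
 show "compl_seq I x \<oplus>\<^sub>(adic_completion R I) compl_seq I y = compl_seq I (%n. x n \<oplus> y n)"
  using ideal.a_rcos_sum[OF J] c abelian_subgroup.a_rcos_sum[OF abelian_subgroupI3[OF ideal.axioms(1)[OF J] is_abelian_group]]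
  by (simp add: adic_completion_def FactRing_def)
 show "\<one>\<^sub>(adic_completion R I) = compl_seq I (%n. \<one>)" by (simp add: adic_completion_def FactRing_def)
 show "\<zero>\<^sub>(adic_completion R I) = compl_seq I (%n. \<zero>)"
  using a_coset_add_zero ideal_props(1)[OF J] by (simp add: adic_completion_def FactRing_def)
qed

lemma coherent_ops:
 assumes I: "ideal I R" and x: "coherent I x" and y: "coherent I y"
 shows "coherent I (%n. x n \<otimes> y n)" "coherent I (%n. x n \<oplus> y n)" "coherent I (%n. \<ominus> x n)"
  "c : car R ==> coherent I (%n. c)"
proof -
 note J = ideal_props[OF ideal_power_ideal[OF I]]
 have c: "x n : car R" "y n : car R" for n using x y by (auto simp: coherent_def)
 have d: "x (Suc n) \<ominus> x n : ideal_power R I n" "y (Suc n) \<ominus> y n : ideal_power R I n" for n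
  using x y by (auto simp: coherent_def)
 have "x (Suc n) \<otimes> y (Suc n) \<ominus> x n \<otimes> y n : ideal_power R I n" for n
 proof -
  have "x (Suc n) \<otimes> y (Suc n) \<ominus> x n \<otimes> y n =
   (x n \<otimes> y (Suc n) \<ominus> x n \<otimes> y n) \<oplus> (x (Suc n) \<otimes> y (Suc n) \<ominus> x n \<otimes> y (Suc n))"
   using c by (simp add: minus_add_minus)
  also have "\<dots> = x n \<otimes> (y (Suc n) \<ominus> y n) \<oplus> (x (Suc n) \<ominus> x n) \<otimes> y (Suc n)"
   using c by (simp add: a_minus_def l_distr r_distr l_minus r_minus)
  finally show ?thesis using d c J(3,5,6) by simp
 qed
 then show "coherent I (%n. x n \<otimes> y n)" using c by (simp add: coherent_def)
 have "(x (Suc n) \<oplus> y (Suc n)) \<ominus> (x n \<oplus> y n) : ideal_power R I n" for n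
 proof -
  have "(x (Suc n) \<oplus> y (Suc n)) \<ominus> (x n \<oplus> y n) = (x (Suc n) \<ominus> x n) \<oplus> (y (Suc n) \<ominus> y n)"
   using c by (simp add: a_minus_def minus_add a_ac)
  then show ?thesis using d J(3) by simp
 qed
 then show "coherent I (%n. x n \<oplus> y n)" using c by (simp add: coherent_def)
 have "(\<ominus> x (Suc n)) \<ominus> (\<ominus> x n) : ideal_power R I n" for n
 proof -
  have "(\<ominus> x (Suc n)) \<ominus> (\<ominus> x n) = \<ominus> (x (Suc n) \<ominus> x n)" using c by (simp add: a_minus_def minus_add)
  then show ?thesis using d J(7) by simp
 qed
 then show "coherent I (%n. \<ominus> x n)" using c by (simp add: coherent_def)
 show "coherent I (%n. c)" if "c : car R" using that J(2) by (simp add: coherent_def a_minus_def r_neg)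
qed

lemma completion_cring:
 assumes I: "ideal I R"
 shows "cring (adic_completion R I)"
proof -
 let ?C = "adic_completion R I"
 note car = completion_carrier[OF I]
 note ops = compl_seq_ops[OF I]
 have coh: "!!x. coherent I x ==> compl_seq I x : car ?C" using car by blast
 have c: "x n : car R" if "coherent I x" for x n using that by (simp add: coherent_def)
 have k: "coherent I (%n. \<zero>)" "coherent I (%n. \<one>)"
  using ideal_props(2)[OF ideal_power_ideal[OF I]] by (auto simp: coherent_def a_minus_def r_neg)
 note co = coherent_ops[OF I]
 show ?thesis
 proof (rule cringI)
  show "abelian_group ?C"
  proof (rule abelian_groupI)
   fix u v assume "u : car ?C" "v : car ?C"
   then obtain x y where e: "coherent I x" "coherent I y" "u = compl_seq I x" "v = compl_seq I y" unfolding car by blast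
   show "u \<oplus>\<^sub>?C  v : car ?C" unfolding e(3,4) ops(2)[OF e(1,2)] by (rule coh[OF co(2)[OF e(1,2)]])
   show "u \<oplus>\<^sub>?C  v = v \<oplus>\<^sub>?C  u"
    unfolding e(3,4) ops(2)[OF e(1,2)] ops(2)[OF e(2,1)] using c[OF e(1)] c[OF e(2)] by (simp add: a_comm)
  next
   fix u v w assume "u : car ?C" "v : car ?C" "w : car ?C"
   then obtain x y z where e: "coherent I x" "coherent I y" "coherent I z"
    "u = compl_seq I x" "v = compl_seq I y" "w = compl_seq I z" unfolding car by blast
   show "u \<oplus>\<^sub>?C  v \<oplus>\<^sub>?C  w = u \<oplus>\<^sub>?C  (v \<oplus>\<^sub>?C  w)"
    unfolding e(4-6) ops(2)[OF e(1,2)] ops(2)[OF e(2,3)] ops(2)[OF co(2)[OF e(1,2)] e(3)] ops(2)[OF e(1) co(2)[OF e(2,3)]]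
    using c[OF e(1)] c[OF e(2)] c[OF e(3)] by (simp add: a_assoc)
  next
   show "\<zero>\<^sub>?C  : car ?C" unfolding ops(4)[OF k] by (rule coh[OF k(1)])
   fix u assume "u : car ?C"
   then obtain x where e: "coherent I x" "u = compl_seq I x" unfolding car by blast
   show "\<zero>\<^sub>?C  \<oplus>\<^sub>?C  u = u" unfolding ops(4)[OF k] e(2) ops(2)[OF k(1) e(1)] using c[OF e(1)] by simp
   have "compl_seq I (%n. \<ominus> x n) \<oplus>\<^sub>?C  u = \<zero>\<^sub>?C "
    unfolding ops(4)[OF k] e(2) ops(2)[OF co(3)[OF e(1) e(1)] e(1)] using c[OF e(1)] by (simp add: l_neg)
   then show "\<exists>v\<in>car ?C. v \<oplus>\<^sub>?C  u = \<zero>\<^sub>?C " using coh[OF co(3)[OF e(1) e(1)]] by blast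
  qed
  show "comm_monoid ?C"
  proof (rule comm_monoidI)
   fix u v assume "u : car ?C" "v : car ?C"
   then obtain x y where e: "coherent I x" "coherent I y" "u = compl_seq I x" "v = compl_seq I y" unfolding car by blast
   show "u \<otimes>\<^sub>?C  v : car ?C" unfolding e(3,4) ops(1)[OF e(1,2)] by (rule coh[OF co(1)[OF e(1,2)]])
   show "u \<otimes>\<^sub>?C  v = v \<otimes>\<^sub>?C  u"
    unfolding e(3,4) ops(1)[OF e(1,2)] ops(1)[OF e(2,1)] using c[OF e(1)] c[OF e(2)] by (simp add: m_comm)
  next
   fix u v w assume "u : car ?C" "v : car ?C" "w : car ?C"
   then obtain x y z where e: "coherent I x" "coherent I y" "coherent I z"
    "u = compl_seq I x" "v = compl_seq I y" "w = compl_seq I z" unfolding car by blast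
   show "u \<otimes>\<^sub>?C  v \<otimes>\<^sub>?C  w = u \<otimes>\<^sub>?C  (v \<otimes>\<^sub>?C  w)"
    unfolding e(4-6) ops(1)[OF e(1,2)] ops(1)[OF e(2,3)] ops(1)[OF co(1)[OF e(1,2)] e(3)] ops(1)[OF e(1) co(1)[OF e(2,3)]]
    using c[OF e(1)] c[OF e(2)] c[OF e(3)] by (simp add: m_assoc)
  next
   show "\<one>\<^sub>?C  : car ?C" unfolding ops(3)[OF k] by (rule coh[OF k(2)])
   fix u assume "u : car ?C"
   then obtain x where e: "coherent I x" "u = compl_seq I x" unfolding car by blast
   show "\<one>\<^sub>?C  \<otimes>\<^sub>?C  u = u" unfolding ops(3)[OF k] e(2) ops(1)[OF k(2) e(1)] using c[OF e(1)] by simp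
  qed
  fix u v w assume "u : car ?C" "v : car ?C" "w : car ?C"
  then obtain x y z where e: "coherent I x" "coherent I y" "coherent I z"
   "u = compl_seq I x" "v = compl_seq I y" "w = compl_seq I z" unfolding car by blast
  show "(u \<oplus>\<^sub>?C  v) \<otimes>\<^sub>?C  w = u \<otimes>\<^sub>?C  w \<oplus>\<^sub>?C  v \<otimes>\<^sub>?C  w"
   unfolding e(4-6) ops(2)[OF e(1,2)] ops(1)[OF e(1,3)] ops(1)[OF e(2,3)] ops(1)[OF co(2)[OF e(1,2)] e(3)]
    ops(2)[OF co(1)[OF e(1,3)] co(1)[OF e(2,3)]]
   using c[OF e(1)] c[OF e(2)] c[OF e(3)] by (simp add: l_distr)
 qed
qed

end

section \<open>Localization at a prime ideal\<close>

locale prime_localization = cring R + prime: primeideal P R for R :: "('a, 'k) ring_scheme" (structure) and P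
begin

abbreviation "U \<equiv> car R - P"
abbreviation "L \<equiv> localization R U"
abbreviation "fr \<equiv> fraction R U"

lemma U_props: "\<one> : U" "s : U ==> t : U ==> s \<otimes> t : U" "s : U ==> s : car R"
 using prime.I_notcarr prime.one_imp_carrier prime.I_prime by auto

lemma frac_eq_iff:
 assumes "x : car R" "s : U" "y : car R" "t : U"
 shows "fr x s = fr y t \<longleftrightarrow> (\<exists>u\<in>U. u \<otimes> (x \<otimes> t) = u \<otimes> (y \<otimes> s))"
proof
 assume eq: "fr x s = fr y t"
 have "(y, t) : fr y t" using assms U_props(1) by (auto simp: fraction_def intro!: bexI[of _ \<one>])
 then show "\<exists>u\<in>U. u \<otimes> (x \<otimes> t) = u \<otimes> (y \<otimes> s)" unfolding eq[symmetric] by (auto simp: fraction_def)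
next
 \<comment> \<open>Transitivity of equality of fractions: the denominator \<open>f\<close> of the
   middle fraction joins the two factors \<open>u\<close> and \<open>v\<close>.\<close>
 have tr: "\<exists>w\<in>U. w \<otimes> (a \<otimes> d) = w \<otimes> (c \<otimes> b)"
  if u: "u : U" "u \<otimes> (a \<otimes> f) = u \<otimes> (e \<otimes> b)" and v: "v : U" "v \<otimes> (e \<otimes> d) = v \<otimes> (c \<otimes> f)"
   and c: "a : car R" "c : car R" "e : car R" "b : U" "d : U" "f : U" for u v a b c d e f
 proof -
  have cc: "u : car R" "v : car R" "b : car R" "d : car R" "f : car R" using u v c by auto
  have "(u \<otimes> v \<otimes> f) \<otimes> (a \<otimes> d) = (v \<otimes> d) \<otimes> (u \<otimes> (a \<otimes> f))" using c cc by (simp add: m_ac)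
  also have "\<dots> = (u \<otimes> b) \<otimes> (v \<otimes> (e \<otimes> d))" unfolding u(2) using c cc by (simp add: m_ac)
  also have "\<dots> = (u \<otimes> v \<otimes> f) \<otimes> (c \<otimes> b)" unfolding v(2) using c cc by (simp add: m_ac)
  finally show ?thesis using U_props(2) u v c by blast
 qed
 assume "\<exists>u\<in>U. u \<otimes> (x \<otimes> t) = u \<otimes> (y \<otimes> s)"
 then obtain u where u: "u : U" "u \<otimes> (x \<otimes> t) = u \<otimes> (y \<otimes> s)" by blast
 show "fr x s = fr y t"
 proof (rule Set.set_eqI, clarify)
  fix a b
  show "(a, b) : fr x s \<longleftrightarrow> (a, b) : fr y t"
  proof
   assume "(a, b) : fr x s"
   then obtain v where v: "a : car R" "b : U" "v : U" "v \<otimes> (x \<otimes> b) = v \<otimes> (a \<otimes> s)" by (auto simp: fraction_def)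
   have "\<exists>w\<in>U. w \<otimes> (y \<otimes> b) = w \<otimes> (a \<otimes> t)"
    by (rule tr[OF u(1) u(2)[symmetric] v(3,4)]) (use assms v in auto)
   then show "(a, b) : fr y t" using v by (auto simp: fraction_def)
  next
   assume "(a, b) : fr y t"
   then obtain v where v: "a : car R" "b : U" "v : U" "v \<otimes> (y \<otimes> b) = v \<otimes> (a \<otimes> t)" by (auto simp: fraction_def)
   have "\<exists>w\<in>U. w \<otimes> (x \<otimes> b) = w \<otimes> (a \<otimes> s)"
    by (rule tr[OF u v(3,4)]) (use assms v in auto)
   then show "(a, b) : fr x s" using v by (auto simp: fraction_def)
  qed
 qed
qed

lemma frac_eqI:
 assumes "x : car R" "s : U" "y : car R" "t : U" "x \<otimes> t = y \<otimes> s"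
 shows "fr x s = fr y t"
 unfolding frac_eq_iff[OF assms(1-4)] using U_props(1) assms(5) by auto

lemma frac_self: "x : car R ==> s : U ==> (x, s) : fr x s"
 using U_props(1) by (auto simp: fraction_def intro!: bexI[of _ \<one>])

lemma frac_mem: "(y, t) : fr x s ==> y : car R & t : U & (\<exists>u\<in>U. u \<otimes> (x \<otimes> t) = u \<otimes> (y \<otimes> s))"
 by (auto simp: fraction_def)

lemma L_carrier: "z : car L \<longleftrightarrow> (\<exists>x s. x : car R & s : U & z = fr x s)"
 by (auto simp: localization_def)

lemma L_consts: "\<one>\<^sub>L = fr \<one> \<one>" "\<zero>\<^sub>L = fr \<zero> \<one>"
 by (auto simp: localization_def)

lemma L_ops:
 assumes "x : car R" "s : U" "y : car R" "t : U"
 shows "fr x s \<otimes>\<^sub>L fr y t = fr (x \<otimes> y) (s \<otimes> t)"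
  "fr x s \<oplus>\<^sub>L fr y t = fr (x \<otimes> t \<oplus> y \<otimes> s) (s \<otimes> t)"
proof -
 \<comment> \<open>The union in the definition runs over a nonempty family of equal sets once
   independence of the representatives is known.\<close>
 have un: "(\<Union>v\<in>fr x s. \<Union>w\<in>fr y t. F v w) = F (x, s) (y, t)"
  if F: "!!a b c d. (a, b) : fr x s ==> (c, d) : fr y t ==> F (a, b) (c, d) = F (x, s) (y, t)"
  for F :: "'a \<times> 'a => 'a \<times> 'a => ('a \<times> 'a) set"
 proof -
  have "F v w = F (x, s) (y, t)" if "v : fr x s" "w : fr y t" for v w
   using F[of "fst v" "snd v" "fst w" "snd w"] that by simp
  then have "(\<Union>v\<in>fr x s. \<Union>w\<in>fr y t. F v w) = (\<Union>v\<in>fr x s. \<Union>w\<in>fr y t. F (x, s) (y, t))" by simp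
  also have "\<dots> = F (x, s) (y, t)"
  proof -
   have "fr x s \<noteq> {}" "fr y t \<noteq> {}" using frac_self[OF assms(1,2)] frac_self[OF assms(3,4)] by auto
   then show ?thesis by simp
  qed
  finally show ?thesis .
 qed
 show "fr x s \<otimes>\<^sub>L fr y t = fr (x \<otimes> y) (s \<otimes> t)"
 proof -
  have "(\<Union>v\<in>fr x s. \<Union>w\<in>fr y t. fr (fst v \<otimes> fst w) (snd v \<otimes> snd w)) =
   fr (fst (x, s) \<otimes> fst (y, t)) (snd (x, s) \<otimes> snd (y, t))"
  proof (rule un)
   fix a b c d assume ab: "(a, b) : fr x s" and cd: "(c, d) : fr y t"
   obtain u where e1: "a : car R" "b : U" "u : U" "u \<otimes> (x \<otimes> b) = u \<otimes> (a \<otimes> s)"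
    using frac_mem[OF ab] by blast
   obtain v where e2: "c : car R" "d : U" "v : U" "v \<otimes> (y \<otimes> d) = v \<otimes> (c \<otimes> t)"
    using frac_mem[OF cd] by blast
   note e = e1 e2
   have cc: "u : car R" "v : car R" "b : car R" "d : car R" "s : car R" "t : car R" using e assms by auto
   have "(u \<otimes> v) \<otimes> ((a \<otimes> c) \<otimes> (s \<otimes> t)) = (u \<otimes> (a \<otimes> s)) \<otimes> (v \<otimes> (c \<otimes> t))" using e cc by (simp add: m_ac)
   also have "\<dots> = (u \<otimes> v) \<otimes> ((x \<otimes> y) \<otimes> (b \<otimes> d))" unfolding e(4)[symmetric] e(8)[symmetric] using e(1,5) cc assms by (simp add: m_ac)
   finally have "\<exists>w\<in>U. w \<otimes> ((a \<otimes> c) \<otimes> (s \<otimes> t)) = w \<otimes> ((x \<otimes> y) \<otimes> (b \<otimes> d))" by (rule bexI[OF _ U_props(2)[OF e(3,7)]])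
   then show "fr (fst (a, b) \<otimes> fst (c, d)) (snd (a, b) \<otimes> snd (c, d)) = fr (fst (x, s) \<otimes> fst (y, t)) (snd (x, s) \<otimes> snd (y, t))"
    using frac_eq_iff[of "a \<otimes> c" "b \<otimes> d" "x \<otimes> y" "s \<otimes> t"] e assms U_props(2) by simp
  qed
  then show ?thesis by (simp add: localization_def)
 qed
 show "fr x s \<oplus>\<^sub>L fr y t = fr (x \<otimes> t \<oplus> y \<otimes> s) (s \<otimes> t)"
 proof -
  have "(\<Union>v\<in>fr x s. \<Union>w\<in>fr y t. fr (fst v \<otimes> snd w \<oplus> fst w \<otimes> snd v) (snd v \<otimes> snd w)) =
   fr (fst (x, s) \<otimes> snd (y, t) \<oplus> fst (y, t) \<otimes> snd (x, s)) (snd (x, s) \<otimes> snd (y, t))"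
  proof (rule un)
   fix a b c d assume ab: "(a, b) : fr x s" and cd: "(c, d) : fr y t"
   obtain u where e1: "a : car R" "b : U" "u : U" "u \<otimes> (x \<otimes> b) = u \<otimes> (a \<otimes> s)"
    using frac_mem[OF ab] by blast
   obtain v where e2: "c : car R" "d : U" "v : U" "v \<otimes> (y \<otimes> d) = v \<otimes> (c \<otimes> t)"
    using frac_mem[OF cd] by blast
   note e = e1 e2
   have cc: "u : car R" "v : car R" "b : car R" "d : car R" "s : car R" "t : car R" using e assms by auto
   have "(u \<otimes> v) \<otimes> ((a \<otimes> d \<oplus> c \<otimes> b) \<otimes> (s \<otimes> t)) = (u \<otimes> (a \<otimes> s)) \<otimes> (v \<otimes> d \<otimes> t) \<oplus> (v \<otimes> (c \<otimes> t)) \<otimes> (u \<otimes> b \<otimes> s)"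
    using e cc by (simp add: r_distr l_distr m_ac)
   also have "\<dots> = (u \<otimes> v) \<otimes> ((x \<otimes> t \<oplus> y \<otimes> s) \<otimes> (b \<otimes> d))"
    unfolding e(4)[symmetric] e(8)[symmetric] using e(1,5) cc assms by (simp add: r_distr l_distr m_ac)
   finally have "\<exists>w\<in>U. w \<otimes> ((a \<otimes> d \<oplus> c \<otimes> b) \<otimes> (s \<otimes> t)) = w \<otimes> ((x \<otimes> t \<oplus> y \<otimes> s) \<otimes> (b \<otimes> d))" by (rule bexI[OF _ U_props(2)[OF e(3,7)]])
   then show "fr (fst (a, b) \<otimes> snd (c, d) \<oplus> fst (c, d) \<otimes> snd (a, b)) (snd (a, b) \<otimes> snd (c, d)) =
     fr (fst (x, s) \<otimes> snd (y, t) \<oplus> fst (y, t) \<otimes> snd (x, s)) (snd (x, s) \<otimes> snd (y, t))"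
    using frac_eq_iff[of "a \<otimes> d \<oplus> c \<otimes> b" "b \<otimes> d" "x \<otimes> t \<oplus> y \<otimes> s" "s \<otimes> t"] e cc assms U_props(2) by simp
  qed
  then show ?thesis by (simp add: localization_def)
 qed
qed

lemma L_cring: "cring L"
proof -
 have Uc: "!!s. s : U ==> s : car R" by simp
 have UU: "!!s t. s : U ==> t : U ==> s \<otimes> t : U" by (rule U_props(2))
 have one: "\<one> : U" by (rule U_props(1))
 show ?thesis
 proof (rule cringI)
  show "abelian_group L"
  proof (rule abelian_groupI)
   fix u v assume "u : car L" "v : car L"
   then obtain x s y t where e: "x : car R" "s : U" "u = fr x s" "y : car R" "t : U" "v = fr y t" unfolding L_carrier by blast
   have c: "s : car R" "t : car R" using e by auto
   have "x \<otimes> t \<oplus> y \<otimes> s : car R" "s \<otimes> t : U" using e c UU by auto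
   then show "u \<oplus>\<^sub>L v : car L" unfolding e(3,6) L_ops(2)[OF e(1,2,4,5)] L_carrier by blast
   show "u \<oplus>\<^sub>L v = v \<oplus>\<^sub>L u"
    unfolding e(3,6) L_ops(2)[OF e(1,2,4,5)] L_ops(2)[OF e(4,5,1,2)] using e c by (simp add: a_comm m_comm)
  next
   fix u v w assume "u : car L" "v : car L" "w : car L"
   then obtain x s y t z r where e: "x : car R" "s : U" "u = fr x s" "y : car R" "t : U" "v = fr y t"
    "z : car R" "r : U" "w = fr z r" unfolding L_carrier by blast
   have c: "s : car R" "t : car R" "r : car R" using e by auto
   have a: "x \<otimes> t \<oplus> y \<otimes> s : car R" "y \<otimes> r \<oplus> z \<otimes> t : car R" using e c by auto
   show "u \<oplus>\<^sub>L v \<oplus>\<^sub>L w = u \<oplus>\<^sub>L (v \<oplus>\<^sub>L w)"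
    unfolding e(3,6,9) L_ops(2)[OF e(1,2,4,5)] L_ops(2)[OF e(4,5,7,8)]
     L_ops(2)[OF a(1) UU[OF e(2,5)] e(7,8)] L_ops(2)[OF e(1,2) a(2) UU[OF e(5,8)]]
    using e(1,4,7) c by (simp add: r_distr l_distr m_ac a_ac)
  next
   show "\<zero>\<^sub>L : car L" unfolding L_consts L_carrier using one by blast
   fix u assume "u : car L"
   then obtain x s where e: "x : car R" "s : U" "u = fr x s" unfolding L_carrier by blast
   have c: "s : car R" using e by auto
   show "\<zero>\<^sub>L \<oplus>\<^sub>L u = u" unfolding L_consts e(3) L_ops(2)[OF zero_closed one e(1,2)] using e(1) c by simp
   have "fr (\<ominus> x) s \<oplus>\<^sub>L u = \<zero>\<^sub>L"
    unfolding L_consts e(3) L_ops(2)[OF a_inv_closed[OF e(1)] e(2) e(1,2)]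
    by (rule frac_eqI) (use e c UU[OF e(2,2)] one in \<open>auto simp: l_minus l_neg\<close>)
   moreover have "fr (\<ominus> x) s : car L" unfolding L_carrier using e by blast
   ultimately show "\<exists>v\<in>car L. v \<oplus>\<^sub>L u = \<zero>\<^sub>L" by blast
  qed
  show "comm_monoid L"
  proof (rule comm_monoidI)
   fix u v assume "u : car L" "v : car L"
   then obtain x s y t where e: "x : car R" "s : U" "u = fr x s" "y : car R" "t : U" "v = fr y t" unfolding L_carrier by blast
   have c: "s : car R" "t : car R" using e by auto
   have "x \<otimes> y : car R" "s \<otimes> t : U" using e c UU by auto
   then show "u \<otimes>\<^sub>L v : car L" unfolding e(3,6) L_ops(1)[OF e(1,2,4,5)] L_carrier by blast
   show "u \<otimes>\<^sub>L v = v \<otimes>\<^sub>L u"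
    unfolding e(3,6) L_ops(1)[OF e(1,2,4,5)] L_ops(1)[OF e(4,5,1,2)] using e c by (simp add: m_comm)
  next
   fix u v w assume "u : car L" "v : car L" "w : car L"
   then obtain x s y t z r where e: "x : car R" "s : U" "u = fr x s" "y : car R" "t : U" "v = fr y t"
    "z : car R" "r : U" "w = fr z r" unfolding L_carrier by blast
   have c: "s : car R" "t : car R" "r : car R" using e by auto
   have a: "x \<otimes> y : car R" "y \<otimes> z : car R" using e c by auto
   show "u \<otimes>\<^sub>L v \<otimes>\<^sub>L w = u \<otimes>\<^sub>L (v \<otimes>\<^sub>L w)"
    unfolding e(3,6,9) L_ops(1)[OF e(1,2,4,5)] L_ops(1)[OF e(4,5,7,8)]
     L_ops(1)[OF a(1) UU[OF e(2,5)] e(7,8)] L_ops(1)[OF e(1,2) a(2) UU[OF e(5,8)]]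
    using e(1,4,7) c by (simp add: m_assoc)
  next
   show "\<one>\<^sub>L : car L" unfolding L_consts L_carrier using one by blast
   fix u assume "u : car L"
   then obtain x s where e: "x : car R" "s : U" "u = fr x s" unfolding L_carrier by blast
   have c: "s : car R" using e by auto
   show "\<one>\<^sub>L \<otimes>\<^sub>L u = u" unfolding L_consts e(3) L_ops(1)[OF one_closed one e(1,2)] using e(1) c by simp
  qed
  fix u v w assume "u : car L" "v : car L" "w : car L"
  then obtain x s y t z r where e: "x : car R" "s : U" "u = fr x s" "y : car R" "t : U" "v = fr y t"
   "z : car R" "r : U" "w = fr z r" unfolding L_carrier by blast
  have c: "s : car R" "t : car R" "r : car R" using e by auto
  have a: "x \<otimes> t \<oplus> y \<otimes> s : car R" "x \<otimes> z : car R" "y \<otimes> z : car R" using e c by auto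
  show "(u \<oplus>\<^sub>L v) \<otimes>\<^sub>L w = u \<otimes>\<^sub>L w \<oplus>\<^sub>L v \<otimes>\<^sub>L w"
   unfolding e(3,6,9) L_ops(2)[OF e(1,2,4,5)] L_ops(1)[OF e(1,2,7,8)] L_ops(1)[OF e(4,5,7,8)]
    L_ops(1)[OF a(1) UU[OF e(2,5)] e(7,8)] L_ops(2)[OF a(2) UU[OF e(2,8)] a(3) UU[OF e(5,8)]]
   by (rule frac_eqI) (use e(1,4,7) c UU e(2,5,8) in \<open>simp_all add: r_distr l_distr m_ac a_ac\<close>)
 qed
qed

end

text \<open>An inverse \<open>t0\<close> of \<open>s\<close> modulo \<open>P\<close> comes from
  maximality. The product of \<open>\<one> \<ominus> s \<otimes> t0\<close> and
  \<open>\<one> \<ominus> s \<otimes> t\<close> is again one minus a multiple of \<open>s\<close>,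
  and lies in the next power of \<open>P\<close>.\<close>

lemma (in cring) maximal_unit_mod_power:
 assumes P: "maximalideal P R" and s: "s : car R" "s \<notin> P"
 shows "\<exists>t\<in>car R. \<one> \<ominus> s \<otimes> t : ideal_power R P n"
proof -
 interpret P: maximalideal P R by (rule P)
 note P' = ideal_props[OF P.is_ideal]
 \<comment> \<open>\<open>K\<close> is the sum of \<open>P\<close> and the multiples of
   \<open>s\<close>.\<close>
 define K where "K = {x \<in> car R. \<exists>b\<in>car R. x \<ominus> s \<otimes> b : P}"
 have "ideal K R"
 proof (rule idealI_simple)
  show "\<zero> : K" using s P'(2) by (auto simp: K_def a_minus_def intro!: bexI[of _ \<zero>])
 next
  fix x y assume "x : K" "y : K"
  then obtain b c where e: "x : car R" "y : car R" "b : car R" "c : car R"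
   "x \<ominus> s \<otimes> b : P" "y \<ominus> s \<otimes> c : P" by (auto simp: K_def)
  have "(x \<oplus> y) \<ominus> s \<otimes> (b \<oplus> c) = (x \<ominus> s \<otimes> b) \<oplus> (y \<ominus> s \<otimes> c)"
   using e(1-4) s by (simp add: a_minus_def r_distr minus_add a_ac)
  then have "(x \<oplus> y) \<ominus> s \<otimes> (b \<oplus> c) : P" using P'(3)[OF e(5,6)] by simp
  moreover have "b \<oplus> c : car R" "x \<oplus> y : car R" using e by auto
  ultimately show "x \<oplus> y : K" unfolding K_def by blast
 next
  fix r x assume r: "r : car R" and "x : K"
  then obtain b where e: "x : car R" "b : car R" "x \<ominus> s \<otimes> b : P" by (auto simp: K_def)
  have "(r \<otimes> x) \<ominus> s \<otimes> (r \<otimes> b) = r \<otimes> (x \<ominus> s \<otimes> b)"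
   using e(1,2) r s by (simp add: a_minus_def r_distr r_minus m_lcomm)
  then have "(r \<otimes> x) \<ominus> s \<otimes> (r \<otimes> b) : P" using P'(5)[OF r e(3)] by simp
  moreover have "r \<otimes> b : car R" "r \<otimes> x : car R" using e r by auto
  ultimately show "r \<otimes> x : K" unfolding K_def by blast
 qed (auto simp: K_def)
 moreover have "P <= K"
 proof
  fix x assume x: "x : P"
  then have "x \<ominus> s \<otimes> \<zero> = x" using P'(1) s by (auto simp: a_minus_def)
  then have "x \<ominus> s \<otimes> \<zero> : P" by (simp only: x)
  then show "x : K" unfolding K_def using x P'(1) zero_closed by blast
 qed
 moreover have "K <= car R" by (auto simp: K_def)
 moreover have "s : K"
 proof -
  have "s \<ominus> s \<otimes> \<one> = \<zero>" using s by (simp add: a_minus_def r_neg)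
  then have "s \<ominus> s \<otimes> \<one> : P" by (simp only: P'(2))
  then show ?thesis unfolding K_def using s(1) one_closed by blast
 qed
 ultimately have "K = car R" using P.I_maximal s by blast
 then obtain t0 where t0: "t0 : car R" "\<one> \<ominus> s \<otimes> t0 : P" by (auto simp: K_def)
 show ?thesis
 proof (induction n)
  case 0
  show ?case using s by (intro bexI[of _ \<zero>]) auto
 next
  case (Suc n)
  then obtain t where t: "t : car R" "\<one> \<ominus> s \<otimes> t : ideal_power R P n" by blast
  have "(\<one> \<ominus> s \<otimes> t0) \<otimes> (\<one> \<ominus> s \<otimes> t) : ideal_power R P (Suc n)"
   using t0 t by (simp add: ideal_prod.prod)
  moreover have "(\<one> \<ominus> s \<otimes> t0) \<otimes> (\<one> \<ominus> s \<otimes> t) = \<one> \<ominus> s \<otimes> (t0 \<oplus> t \<ominus> s \<otimes> t0 \<otimes> t)"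
   using s t0(1) t(1) by (simp add: a_minus_def l_distr r_distr l_minus r_minus minus_add m_ac a_ac)
  moreover have "t0 \<oplus> t \<ominus> s \<otimes> t0 \<otimes> t : car R" using s t0(1) t(1) by simp
  ultimately have "\<one> \<ominus> s \<otimes> (t0 \<oplus> t \<ominus> s \<otimes> t0 \<otimes> t) : ideal_power R P (Suc n)" by (simp only:)
  then show ?case by (rule bexI) fact
 qed
qed

section \<open>Localization at a maximal ideal and its completion\<close>

locale max_localization = prime_localization + maximal: maximalideal P R
begin

definition "PL = {fr x s | x s. x : P & s : U}"

interpretation L: cring L by (rule L_cring)

lemma fr_ideal:
 assumes K: "ideal K R"
 shows "ideal {fr x s | x s. x : K & s : U} L"
proof (rule L.idealI_simple)
 note K' = ideal_props[OF K]
 have Kc: "!!x. x : K ==> x : car R" using K'(1) by auto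
 show "{fr x s | x s. x : K & s : U} <= car L" unfolding L_carrier[abs_def] subset_iff using Kc L_carrier by blast
 show "\<zero>\<^sub>L : {fr x s | x s. x : K & s : U}" unfolding L_consts using K'(2) U_props(1) by blast
next
 note K' = ideal_props[OF K]
 have Kc: "!!x. x : K ==> x : car R" using K'(1) by auto
 fix u v assume "u : {fr x s | x s. x : K & s : U}" "v : {fr x s | x s. x : K & s : U}"
 then obtain x s y t where e: "x : K" "s : U" "u = fr x s" "y : K" "t : U" "v = fr y t" by blast
 have "x \<otimes> t \<oplus> y \<otimes> s : K" using e K'(3,6) by simp
 moreover have "s \<otimes> t : U" by (rule U_props(2)[OF e(2,5)])
 ultimately show "u \<oplus>\<^sub>L v : {fr x s | x s. x : K & s : U}"
  unfolding e(3,6) L_ops(2)[OF Kc[OF e(1)] e(2) Kc[OF e(4)] e(5)] by blast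
next
 note K' = ideal_props[OF K]
 have Kc: "!!x. x : K ==> x : car R" using K'(1) by auto
 fix u v assume "u : car L" "v : {fr x s | x s. x : K & s : U}"
 then obtain x s y t where e: "x : car R" "s : U" "u = fr x s" "y : K" "t : U" "v = fr y t"
  unfolding L_carrier by blast
 have "x \<otimes> y : K" using e K'(5) by simp
 moreover have "s \<otimes> t : U" by (rule U_props(2)[OF e(2,5)])
 ultimately show "u \<otimes>\<^sub>L v : {fr x s | x s. x : K & s : U}"
  unfolding e(3,6) L_ops(1)[OF e(1,2) Kc[OF e(4)] e(5)] by blast
qed

lemma PL_ideal: "ideal PL L"
 unfolding PL_def by (rule fr_ideal[OF prime.is_ideal])

lemma PL_power: "ideal_power L PL n = {fr x s | x s. x : ideal_power R P n & s : U}"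
proof (induction n)
 case 0
 show ?case unfolding ideal_power.simps using L_carrier by blast
next
 case (Suc n)
 have Pn: "!!n. ideal (ideal_power R P n) R" by (rule ideal_power_ideal[OF prime.is_ideal])
 have Pc: "!!n x. x : ideal_power R P n ==> x : car R" using ideal_props(1)[OF Pn] by auto
 have Pc1: "!!x. x : P ==> x : car R" using ideal_props(1)[OF prime.is_ideal] by auto
 show ?case
 proof (rule equalityI)
  show "ideal_power L PL (Suc n) <= {fr x s | x s. x : ideal_power R P (Suc n) & s : U}"
   unfolding ideal_power.simps(2)[of L]
  proof (rule L.ideal_prod_min[OF fr_ideal[OF Pn]])
   fix i j assume "i : PL" "j : ideal_power L PL n"
   from \<open>i : PL\<close> obtain x s where e: "x : P" "s : U" "i = fr x s" unfolding PL_def by blast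
   from \<open>j : ideal_power L PL n\<close> obtain y t where e': "y : ideal_power R P n" "t : U" "j = fr y t"
    unfolding Suc by blast
   have "x \<otimes> y : ideal_power R P (Suc n)" using e(1) e'(1) by (simp add: ideal_prod.prod)
   moreover have "s \<otimes> t : U" by (rule U_props(2)[OF e(2) e'(2)])
   ultimately show "i \<otimes>\<^sub>L j : {fr x s | x s. x : ideal_power R P (Suc n) & s : U}"
    unfolding e(3) e'(3) L_ops(1)[OF Pc1[OF e(1)] e(2) Pc[OF e'(1)] e'(2)] by blast
  qed
  have LP: "ideal (ideal_power L PL (Suc n)) L" by (rule L.ideal_power_ideal[OF PL_ideal])
  \<comment> \<open>The numerators that are admissible over every denominator form an ideal of
    \<open>R\<close>, so it is enough to test products of an element of \<open>P\<close> and one of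
    its \<open>n\<close>-th power.\<close>
  have K: "ideal {x \<in> car R. \<forall>s\<in>U. fr x s : ideal_power L PL (Suc n)} R" (is "ideal ?K R")
  proof (rule idealI_simple)
   have "fr \<zero> s = \<zero>\<^sub>L" if "s : U" for s
    unfolding L_consts by (rule frac_eqI) (use that U_props(1) in auto)
   then show "\<zero> : ?K" using L.ideal_props(2)[OF LP] by auto
  next
   fix x y assume xy: "x : ?K" "y : ?K"
   have "fr (x \<oplus> y) s : ideal_power L PL (Suc n)" if s: "s : U" for s
   proof -
    have c: "x : car R" "y : car R" "s : car R" using xy s by auto
    have "fr (x \<oplus> y) s = fr x s \<oplus>\<^sub>L fr y s"
     unfolding L_ops(2)[OF c(1) s c(2) s]
     by (rule frac_eqI) (use c s U_props(2)[OF s s] in \<open>simp_all add: l_distr r_distr m_ac\<close>)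
    then show ?thesis using xy s L.ideal_props(3)[OF LP] by simp
   qed
   then show "x \<oplus> y : ?K" using xy by simp
  next
   fix r x assume r: "r : car R" and x: "x : ?K"
   have "fr (r \<otimes> x) s : ideal_power L PL (Suc n)" if s: "s : U" for s
   proof -
    have c: "x : car R" using CollectD[OF x] by (rule conjunct1)
    have "s : car R" using s by (rule DiffD1)
    note c = c this
    have "fr (r \<otimes> x) s = fr r \<one> \<otimes>\<^sub>L fr x s"
     unfolding L_ops(1)[OF r U_props(1) c(1) s] l_one[OF c(2)] ..
    moreover have "fr r \<one> : car L" unfolding L_carrier using r U_props(1) by blast
    moreover have "fr x s : ideal_power L PL (Suc n)" using conjunct2[OF CollectD[OF x]] s by (rule bspec)
    ultimately show ?thesis using L.ideal_props(5)[OF LP] by (simp only:)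
   qed
   then show "r \<otimes> x : ?K" using r CollectD[OF x, THEN conjunct1] by (intro CollectI conjI ballI m_closed)
  qed auto
  have "ideal_power R P (Suc n) <= ?K"
   unfolding ideal_power.simps(2)[of R]
  proof (rule ideal_prod_min[OF K])
   fix i j assume i: "i : P" and j: "j : ideal_power R P n"
   have "fr (i \<otimes> j) s : ideal_power L PL (Suc n)" if s: "s : U" for s
   proof -
    have "fr (i \<otimes> j) s = fr i s \<otimes>\<^sub>L fr j \<one>"
     unfolding L_ops(1)[OF Pc1[OF i] s Pc[OF j] U_props(1)] using s by simp
    moreover have "fr i s : PL" unfolding PL_def using i s by blast
    moreover have "fr j \<one> : ideal_power L PL n" unfolding Suc using j U_props(1) by blast
    ultimately show ?thesis by (simp add: ideal_prod.prod)
   qed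
   then show "i \<otimes> j : ?K" using Pc1[OF i] Pc[OF j] by simp
  qed
  then show "{fr x s | x s. x : ideal_power R P (Suc n) & s : U} <= ideal_power L PL (Suc n)" by blast
 qed
qed

text \<open>Elements outside the maximal ideal \<open>P\<close> are invertible modulo each of its
  powers, so the factor \<open>u \<otimes> s\<close> that clears denominators can be removed
  again.\<close>

lemma fr_one_mem:
 assumes r: "r : car R"
 shows "fr r \<one> : ideal_power L PL n \<longleftrightarrow> r : ideal_power R P n"
proof
 note Pn = ideal_props[OF ideal_power_ideal[OF prime.is_ideal, of n]]
 assume "fr r \<one> : ideal_power L PL n"
 then obtain y s where e: "y : ideal_power R P n" "s : U" "fr r \<one> = fr y s" unfolding PL_power by blast
 have yc: "y : car R" using e Pn(1) by auto
 obtain u where u: "u : U" "u \<otimes> (r \<otimes> s) = u \<otimes> (y \<otimes> \<one>)"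
  using e(3) unfolding frac_eq_iff[OF r U_props(1) yc e(2)] by blast
 have us: "u \<otimes> s : U" by (rule U_props(2)[OF u(1) e(2)])
 obtain t where t: "t : car R" "\<one> \<ominus> (u \<otimes> s) \<otimes> t : ideal_power R P n"
  using maximal_unit_mod_power[OF maximal.is_maximalideal, of "u \<otimes> s" n] us by auto
 have c: "u : car R" "s : car R" using u e by auto
 have "r = r \<otimes> (\<one> \<ominus> (u \<otimes> s) \<otimes> t) \<oplus> (u \<otimes> (r \<otimes> s)) \<otimes> t"
  using c r t(1) by (simp add: a_minus_def r_distr r_minus m_ac a_assoc l_neg)
 moreover have "u \<otimes> (r \<otimes> s) : ideal_power R P n" unfolding u(2) using e(1) yc c Pn(5) by simp
 ultimately show "r : ideal_power R P n" using Pn(3,5,6) t r by metis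
next
 assume "r : ideal_power R P n"
 then show "fr r \<one> : ideal_power L PL n" unfolding PL_power using U_props(1) by blast
qed

text \<open>Let \<open>t\<close> be an inverse of \<open>s\<close> modulo the \<open>n\<close>-th
  power of \<open>P\<close>. The fraction of \<open>x\<close> over \<open>s\<close> differs from
  \<open>x \<otimes> t\<close> by the fraction with numerator
  \<open>x \<otimes> (\<one> \<ominus> s \<otimes> t)\<close> and denominator
  \<open>s\<close>.\<close>

lemma fr_approx:
 assumes "z : car L" shows "\<exists>r\<in>car R. z \<ominus>\<^sub>L fr r \<one> : ideal_power L PL n"
proof -
 obtain x s where e: "x : car R" "s : U" "z = fr x s" using assms unfolding L_carrier by blast
 note Pn = ideal_props[OF ideal_power_ideal[OF prime.is_ideal, of n]]
 obtain t where t: "t : car R" "\<one> \<ominus> s \<otimes> t : ideal_power R P n"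
  using maximal_unit_mod_power[OF maximal.is_maximalideal, of s n] e by auto
 have c: "s : car R" "x \<otimes> t : car R" using e t by auto
 have m: "x \<otimes> (\<one> \<ominus> s \<otimes> t) : ideal_power R P n" by (rule Pn(5)[OF e(1) t(2)])
 have "z = fr (x \<otimes> (\<one> \<ominus> s \<otimes> t)) s \<oplus>\<^sub>L fr (x \<otimes> t) \<one>"
 proof -
  have "x \<otimes> (\<one> \<ominus> s \<otimes> t) : car R" using e t c by simp
  from L_ops(2)[OF this e(2) c(2) U_props(1)]
  have "fr (x \<otimes> (\<one> \<ominus> s \<otimes> t)) s \<oplus>\<^sub>L fr (x \<otimes> t) \<one> = fr (x \<otimes> (\<one> \<ominus> s \<otimes> t) \<otimes> \<one> \<oplus> x \<otimes> t \<otimes> s) (s \<otimes> \<one>)" .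
  also have "x \<otimes> (\<one> \<ominus> s \<otimes> t) \<otimes> \<one> \<oplus> x \<otimes> t \<otimes> s = x"
   using e c t(1) by (simp add: a_minus_def r_distr r_minus m_ac a_assoc l_neg)
  also have "s \<otimes> \<one> = s" using c by simp
  finally show ?thesis using e by simp
 qed
 note z = this
 have k: "fr (x \<otimes> (\<one> \<ominus> s \<otimes> t)) s : ideal_power L PL n" unfolding PL_power using m e(2) by blast
 have k1: "fr (x \<otimes> t) \<one> : car L" unfolding L_carrier using c U_props(1) by blast
 have k2: "fr (x \<otimes> (\<one> \<ominus> s \<otimes> t)) s : car L"
  by (rule subsetD[OF L.ideal_props(1)[OF L.ideal_power_ideal[OF PL_ideal]] k])
 have "z \<ominus>\<^sub>L fr (x \<otimes> t) \<one> = fr (x \<otimes> (\<one> \<ominus> s \<otimes> t)) s"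
  unfolding z by (rule L.add_minus_cancel[OF k2 k1])
 then show ?thesis using c k by (intro bexI[of _ "x \<otimes> t"]) (simp_all only:)
qed

lemma fr_hom:
 "r : car R ==> fr r \<one> : car L"
 "x : car R ==> y : car R ==> fr (x \<otimes> y) \<one> = fr x \<one> \<otimes>\<^sub>L fr y \<one>"
 "x : car R ==> y : car R ==> fr (x \<oplus> y) \<one> = fr x \<one> \<oplus>\<^sub>L fr y \<one>"
 "x : car R ==> y : car R ==> fr (x \<ominus> y) \<one> = fr x \<one> \<ominus>\<^sub>L fr y \<one>"
proof -
 show 1: "fr r \<one> : car L" if "r : car R" for r unfolding L_carrier using that U_props(1) by blast
 show "fr (x \<otimes> y) \<one> = fr x \<one> \<otimes>\<^sub>L fr y \<one>" if "x : car R" "y : car R" for x y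
  unfolding L_ops(1)[OF that(1) U_props(1) that(2) U_props(1)] by simp
 show 3: "fr (x \<oplus> y) \<one> = fr x \<one> \<oplus>\<^sub>L fr y \<one>" if "x : car R" "y : car R" for x y
  unfolding L_ops(2)[OF that(1) U_props(1) that(2) U_props(1)] using that by simp
 show "fr (x \<ominus> y) \<one> = fr x \<one> \<ominus>\<^sub>L fr y \<one>" if xy: "x : car R" "y : car R" for x y
 proof -
  have "fr x \<one> = fr (x \<ominus> y) \<one> \<oplus>\<^sub>L fr y \<one>"
   using 3[of "x \<ominus> y" y] xy by (simp add: a_minus_def a_assoc l_neg)
  then show ?thesis using L.add_minus_cancel[of "fr (x \<ominus> y) \<one>" "fr y \<one>"] 1 xy by simp
 qed
qed

definition "S = completed_local_ring R P"
definition "iota r = L.compl_seq PL (%_. fr r \<one>)"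
text \<open>The kernel of the projection of the completion to its \<open>n\<close>-th
  quotient.\<close>

definition "FilS n = {z \<in> car S. z n = ideal_power L PL n}"

lemma S_def': "S = adic_completion L PL"
 by (simp add: S_def completed_local_ring_def PL_def)

lemma FilS_iff:
 assumes "L.coherent PL x"
 shows "L.compl_seq PL x : FilS n \<longleftrightarrow> x n : ideal_power L PL n"
proof -
 note J = L.ideal_power_ideal[OF PL_ideal]
 have xc: "x n : car L" using assms by (simp add: L.coherent_def)
 have "L.compl_seq PL x : car S" unfolding S_def' L.completion_carrier[OF PL_ideal] using assms by blast
 then have "L.compl_seq PL x : FilS n \<longleftrightarrow> ideal_power L PL n +>\<^sub>L x n = ideal_power L PL n" by (simp add: FilS_def)
 also have "\<dots> \<longleftrightarrow> ideal_power L PL n +>\<^sub>L x n = ideal_power L PL n +>\<^sub>L \<zero>\<^sub>L"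
  using L.a_coset_add_zero[OF L.ideal_props(1)[OF J]] by simp
 also have "\<dots> \<longleftrightarrow> x n : ideal_power L PL n"
  using L.coset_eq_iff[OF J xc L.zero_closed] xc by (simp add: L.a_minus_zero)
 finally show ?thesis .
qed

interpretation S: cring S unfolding S_def' by (rule L.completion_cring[OF PL_ideal])

lemma S_cring: "cring S" by (rule S.is_cring)

lemma S_minus:
 assumes x: "L.coherent PL x" and y: "L.coherent PL y"
 shows "L.compl_seq PL x \<ominus>\<^sub>S L.compl_seq PL y = L.compl_seq PL (%n. x n \<ominus>\<^sub>L y n)"
  "L.coherent PL (%n. x n \<ominus>\<^sub>L y n)"
proof -
 note co = L.coherent_ops[OF PL_ideal]
 show c: "L.coherent PL (%n. x n \<ominus>\<^sub>L y n)"
  unfolding a_minus_def by (rule co(2)[OF x co(3)[OF y y]])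
 have 1: "L.compl_seq PL (%n. x n \<ominus>\<^sub>L y n) \<oplus>\<^sub>S L.compl_seq PL y = L.compl_seq PL x"
  unfolding S_def' L.compl_seq_ops(2)[OF PL_ideal c y]
  using x y by (simp add: L.coherent_def a_minus_def L.a_assoc L.l_neg)
 have 2: "L.compl_seq PL (%n. x n \<ominus>\<^sub>L y n) : car S" "L.compl_seq PL y : car S"
  unfolding S_def' L.completion_carrier[OF PL_ideal] using c y by blast+
 show "L.compl_seq PL x \<ominus>\<^sub>S L.compl_seq PL y = L.compl_seq PL (%n. x n \<ominus>\<^sub>L y n)"
  using S.add_minus_cancel[OF 2] unfolding 1 .
qed

lemma iota_coherent: "r : car R ==> L.coherent PL (%_. fr r \<one>)"
 using fr_hom(1) L.ideal_props(2)[OF L.ideal_power_ideal[OF PL_ideal]]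
 by (simp add: L.coherent_def a_minus_def L.r_neg)

lemma FilS_ideal: "ideal (FilS n) S"
proof (rule S.idealI_simple)
 note car = L.completion_carrier[OF PL_ideal, folded S_def']
 note ops = L.compl_seq_ops[OF PL_ideal, folded S_def']
 note co = L.coherent_ops[OF PL_ideal]
 note Jn = L.ideal_props[OF L.ideal_power_ideal[OF PL_ideal]]
 have rep: "\<exists>x. L.coherent PL x & z = L.compl_seq PL x & x n : ideal_power L PL n" if z: "z : FilS n" for z
 proof -
  obtain x where x: "L.coherent PL x" "z = L.compl_seq PL x" using z unfolding FilS_def car by blast
  have "x n : ideal_power L PL n" using z unfolding x(2) FilS_iff[OF x(1)] .
  then show ?thesis using x by blast
 qed
 show "FilS n <= car S" by (auto simp: FilS_def)
 have k: "L.coherent PL (%_. \<zero>\<^sub>L)" using Jn(2) by (simp add: L.coherent_def a_minus_def L.r_neg)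
 show "\<zero>\<^sub>S : FilS n" unfolding ops(4)[OF k k] FilS_iff[OF k] by (rule Jn(2))
 { fix u v assume "u : FilS n" "v : FilS n"
  then obtain x y where e: "L.coherent PL x" "u = L.compl_seq PL x" "x n : ideal_power L PL n"
   "L.coherent PL y" "v = L.compl_seq PL y" "y n : ideal_power L PL n" using rep by meson
  show "u \<oplus>\<^sub>S v : FilS n"
   unfolding e(2,5) ops(2)[OF e(1,4)] FilS_iff[OF co(2)[OF e(1,4)]] by (rule Jn(3)[OF e(3,6)]) }
 { fix u v assume "u : car S" "v : FilS n"
  then obtain x where e1: "L.coherent PL x" "u = L.compl_seq PL x" unfolding car by blast
  from rep[OF \<open>v : FilS n\<close>] obtain y where e2: "L.coherent PL y" "v = L.compl_seq PL y" "y n : ideal_power L PL n" by blast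
  note e = e1 e2
  have "x n : car L" using e(1) by (simp add: L.coherent_def)
  then show "u \<otimes>\<^sub>S v : FilS n"
   unfolding e(2,4) ops(1)[OF e(1,3)] FilS_iff[OF co(1)[OF e(1,3)]] using Jn(5) e(5) by blast }
qed

lemma iota_hom: "iota : ring_hom R S"
proof (rule ring_hom_memI)
 note car = L.completion_carrier[OF PL_ideal, folded S_def']
 note ops = L.compl_seq_ops[OF PL_ideal, folded S_def']
 show "iota r : car S" if "r : car R" for r unfolding iota_def car using iota_coherent[OF that] by blast
 show "iota (x \<otimes> y) = iota x \<otimes>\<^sub>S iota y" if "x : car R" "y : car R" for x y
  unfolding iota_def ops(1)[OF iota_coherent[OF that(1)] iota_coherent[OF that(2)]] fr_hom(2)[OF that] ..
 show "iota (x \<oplus> y) = iota x \<oplus>\<^sub>S iota y" if "x : car R" "y : car R" for x y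
  unfolding iota_def ops(2)[OF iota_coherent[OF that(1)] iota_coherent[OF that(2)]] fr_hom(3)[OF that] ..
 show "iota \<one> = \<one>\<^sub>S"
  unfolding iota_def ops(3)[OF iota_coherent[OF one_closed] iota_coherent[OF one_closed]] L_consts ..
qed

end

lemma adic_ring_completed_local_ring:
 assumes ch: "char_ring R p" and nR: "noetherian_ring R" and P: "maximalideal P R"
  and F: "\<exists>B. spans R (frob_push R p 1) B"
 shows "\<exists>\<iota> Fil. adic_F_finite R (completed_local_ring R P) p P \<iota> Fil"
proof -
 interpret R: char_ring R p by (rule ch)
 interpret max_localization R P
  by (intro max_localization.intro prime_localization.intro R.is_cring R.maximalideal_prime[OF P] P)
 interpret L: cring L by (rule L_cring)
 interpret S: cring S by (rule S_cring)
 note car = L.completion_carrier[OF PL_ideal, folded S_def']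
 note co = L.coherent_ops[OF PL_ideal]
 note Jn = L.ideal_props[OF L.ideal_power_ideal[OF PL_ideal]]
 have "char_ring S p"
 proof (rule char_ring.intro[OF S_cring], unfold_locales)
  show "Factorial_Ring.prime p" by (rule R.prime_p)
  interpret h: ring_hom_cring R S iota by (rule ring_hom_cringI[OF R.is_cring S_cring iota_hom])
  have "iota (add_pow R k \<one>\<^sub>R) = add_pow S k \<one>\<^sub>S" for k :: nat
   by (induction k) (simp_all add: R.add.nat_pow_Suc S.add.nat_pow_Suc)
  then show "add_pow S p \<one>\<^sub>S = \<zero>\<^sub>S" using R.char_one h.hom_zero by metis
 qed
 moreover have "FilS (Suc n) <= FilS n" for n
 proof
  fix z assume z: "z : FilS (Suc n)"
  then obtain x where x: "L.coherent PL x" "z = L.compl_seq PL x" unfolding FilS_def car by blast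
  have "x (Suc n) : ideal_power L PL (Suc n)" using z FilS_iff[OF x(1)] x(2) by simp
  then have "x (Suc n) : ideal_power L PL n" using L.ideal_power_Suc_subset[OF PL_ideal] by blast
  moreover have d: "x (Suc n) \<ominus>\<^sub>L x n : ideal_power L PL n" "x (Suc n) : car L" "x n : car L"
   using x(1) by (auto simp: L.coherent_def)
  ultimately have "x (Suc n) \<ominus>\<^sub>L (x (Suc n) \<ominus>\<^sub>L x n) : ideal_power L PL n" using Jn(4) by blast
  moreover have "x (Suc n) \<ominus>\<^sub>L (x (Suc n) \<ominus>\<^sub>L x n) = x n"
   using d(2,3) by (simp add: a_minus_def L.minus_add L.r_neg2 L.r_neg1)
  ultimately show "z : FilS n" unfolding x(2) FilS_iff[OF x(1)] by simp
 qed
 moreover have "\<exists>r\<in>car R. z \<ominus>\<^sub>S iota r : FilS n" if z: "z : car S" for z n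
 proof -
  obtain x where x: "L.coherent PL x" "z = L.compl_seq PL x" using z unfolding car by blast
  then obtain r where r: "r : car R" "x n \<ominus>\<^sub>L fr r \<one>\<^sub>R : ideal_power L PL n"
   using fr_approx[of "x n" n] by (auto simp: L.coherent_def)
  have "z \<ominus>\<^sub>S iota r : FilS n"
   unfolding x(2) iota_def S_minus(1)[OF x(1) iota_coherent[OF r(1)]] FilS_iff[OF S_minus(2)[OF x(1) iota_coherent[OF r(1)]]]
   by (rule r(2))
  then show ?thesis using r(1) by blast
 qed
 moreover have "iota r : FilS n \<longleftrightarrow> r : ideal_power R P n" if "r : car R" for r n
  unfolding iota_def FilS_iff[OF iota_coherent[OF that]] by (rule fr_one_mem[OF that])
 moreover have "z = \<zero>\<^sub>S" if z: "z : car S" "!!n. z : FilS n" for z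
 proof -
  have "\<zero>\<^sub>S : FilS n" for n by (rule S.ideal_props(2)[OF FilS_ideal])
  then show ?thesis using z(2) by (auto simp: FilS_def fun_eq_iff)
 qed
 moreover have "\<exists>z\<in>car S. \<forall>n. z \<ominus>\<^sub>S iota (u n) : FilS n"
  if u: "!!n. u n : car R" "!!n. u (Suc n) \<ominus>\<^sub>R u n : ideal_power R P n" for u
 proof -
  have "fr (u (Suc n)) \<one>\<^sub>R \<ominus>\<^sub>L fr (u n) \<one>\<^sub>R : ideal_power L PL n" for n
   unfolding fr_hom(4)[OF u(1) u(1), symmetric] using u by (simp add: fr_one_mem)
  then have x: "L.coherent PL (%n. fr (u n) \<one>\<^sub>R)" using fr_hom(1)[OF u(1)] by (simp add: L.coherent_def)
  have "L.compl_seq PL (%n. fr (u n) \<one>\<^sub>R) \<ominus>\<^sub>S iota (u m) : FilS m" for m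
   unfolding iota_def S_minus(1)[OF x iota_coherent[OF u(1)]] FilS_iff[OF S_minus(2)[OF x iota_coherent[OF u(1)]]]
   using Jn(2) fr_hom(1)[OF u(1)] by (simp add: a_minus_def L.r_neg)
  moreover have "L.compl_seq PL (%n. fr (u n) \<one>\<^sub>R) : car S" unfolding car using x by blast
  ultimately show ?thesis by blast
 qed
 ultimately have "adic_F_finite R S p P iota FilS"
  using ch nR P F iota_hom FilS_ideal
  by (intro adic_F_finite.intro adic_ring.intro adic_ring_axioms.intro adic_F_finite_axioms.intro) auto
 then show ?thesis unfolding S_def by blast
qed

section \<open>The trace property\<close>

lemma comp_sums_of_stable_KS:
 assumes ch: "char_ring R p" and CL: "CL_FFRT R p"
  and KS: "!!P. maximalideal P R ==> KS_classes (completed_local_ring R P) (frob_push (completed_local_ring R P) p e)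
   <= KS_classes (completed_local_ring R P) (frob_push (completed_local_ring R P) p e')"
 shows "(\<lambda>x\<in>car R. x) : comp_sums R p e e'"
proof -
 interpret char_ring R p by (rule ch)
 have nR: "noetherian_ring R" and fg: "fin_gen_module R (frob_push R p 1)" using CL by (simp_all add: CL_FFRT_def F_finite_def)
 have F: "\<exists>B. spans R (frob_push R p 1) B" by (rule fin_gen_spans[OF frob_push_module fg])
 show ?thesis
 proof (rule comp_sums_global[OF nR])
  fix P assume P: "maximalideal P R"
  obtain \<iota> Fil where "adic_F_finite R (completed_local_ring R P) p P \<iota> Fil"
   using adic_ring_completed_local_ring[OF ch nR P F] by blast
  then interpret A: adic_F_finite R "completed_local_ring R P" p P \<iota> Fil .
  show "\<exists>s\<in>car R - P. (\<lambda>x\<in>car R. s [^]\<^sub>R (p ^ e) \<otimes>\<^sub>R x) : comp_sums R p e e'"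
   by (rule A.comp_sums_local_of_completion[OF A.comp_sums_completion[OF KS[OF P]]])
 qed
qed

section \<open>Differential operators on an $F$-finite ring\<close>

context cring
begin

lemma additive_mapsD:
 assumes "\<delta> : additive_maps R R"
 shows "\<delta> : car R \<rightarrow>\<^sub>E car R" "!!x. x : car R ==> \<delta> x : car R"
  "!!x y. x : car R ==> y : car R ==> \<delta> (x \<oplus> y) = \<delta> x \<oplus> \<delta> y"
  "\<delta> \<zero> = \<zero>" "!!x. x : car R ==> \<delta> (\<ominus> x) = \<ominus> \<delta> x"
  "!!x y. x : car R ==> y : car R ==> \<delta> (x \<ominus> y) = \<delta> x \<ominus> \<delta> y"
proof -
 show 1: "\<delta> : car R \<rightarrow>\<^sub>E car R" and 2: "!!x. x : car R ==> \<delta> x : car R"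
  and 3: "!!x y. x : car R ==> y : car R ==> \<delta> (x \<oplus> y) = \<delta> x \<oplus> \<delta> y"
  using assms by (auto simp: additive_maps_def)
 show 4: "\<delta> \<zero> = \<zero>" by (rule additive_zero) (use 2 3 in auto)
 show 5: "\<delta> (\<ominus> x) = \<ominus> \<delta> x" if x: "x : car R" for x
  using 3[of "\<ominus> x" x] 2 4 x by (intro sum_zero_eq_neg) (auto simp: l_neg)
 show "\<delta> (x \<ominus> y) = \<delta> x \<ominus> \<delta> y" if "x : car R" "y : car R" for x y
  using that 3 5 by (simp add: a_minus_def)
qed

lemma additive_maps_restrictI:
 assumes "!!x. x : car R ==> F x : car R"
  and "!!x y. x : car R ==> y : car R ==> F (x \<oplus> y) = F x \<oplus> F y"
 shows "(\<lambda>x\<in>car R. F x) : additive_maps R R"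
 using assms by (auto simp: additive_maps_def)

lemma additive_maps_ext:
 assumes "\<delta> : additive_maps R R" "!!x. x : car R ==> \<delta> x = F x"
 shows "\<delta> = (\<lambda>x\<in>car R. F x)"
 by (rule extensionalityI[of _ "car R"])
  (use additive_mapsD(1)[OF assms(1)] assms(2) in \<open>auto simp: PiE_def\<close>)

text \<open>With \<open>rmul\<close> these are the two multiplications by \<open>r\<close> on
  operators. They commute, and \<open>ad r\<close> is \<open>rmul r\<close> minus
  \<open>lmul r\<close>.\<close>

definition lmul :: "'a => ('a => 'a) => 'a => 'a" where
 "lmul r \<delta> = (\<lambda>x\<in>car R. r \<otimes> \<delta> x)"

definition rmul :: "'a => ('a => 'a) => 'a => 'a" where
 "rmul r \<delta> = (\<lambda>x\<in>car R. \<delta> (r \<otimes> x))"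

abbreviation ad :: "'a => ('a => 'a) => 'a => 'a" where
 "ad r \<delta> \<equiv> op_commutator R \<delta> r"

abbreviation zero_map :: "'a => 'a" where
 "zero_map \<equiv> \<lambda>x\<in>car R. \<zero>"

lemma additive_maps_closed:
 "zero_map : additive_maps R R" "(\<lambda>x\<in>car R. x) : additive_maps R R"
 "\<delta> : additive_maps R R ==> \<theta> : additive_maps R R ==> op_add R \<delta> \<theta> : additive_maps R R"
 "\<delta> : additive_maps R R ==> (\<lambda>x\<in>car R. \<ominus> \<delta> x) : additive_maps R R"
 "\<delta> : additive_maps R R ==> \<theta> : additive_maps R R ==> compose (car R) \<delta> \<theta> : additive_maps R R"
 "r : car R ==> \<delta> : additive_maps R R ==> lmul r \<delta> : additive_maps R R"
 "r : car R ==> \<delta> : additive_maps R R ==> rmul r \<delta> : additive_maps R R"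
 "r : car R ==> \<delta> : additive_maps R R ==> ad r \<delta> : additive_maps R R"
 unfolding op_add_def compose_def lmul_def rmul_def op_commutator_def
 by (rule additive_maps_restrictI;
   simp add: additive_mapsD a_ac r_distr minus_add a_minus_def)+

lemma op_group_axioms:
 assumes H: "H <= additive_maps R R" "zero_map : H"
  and add: "!!\<delta> \<theta>. \<delta> : H ==> \<theta> : H ==> op_add R \<delta> \<theta> : H"
  and neg: "!!\<delta>. \<delta> : H ==> (\<lambda>x\<in>car R. \<ominus> \<delta> x) : H"
 shows "abelian_group (op_ring R H)"
proof (rule abelian_groupI)
 have D: "!!\<delta> x. \<delta> : H ==> x : car R ==> \<delta> x : car R" by (rule additive_mapsD(2)[OF subsetD[OF H(1)]])
 fix u v w assume u: "u : car (op_ring R H)"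
 then have uH: "u : H" by (simp add: op_ring_def)
 have ue: "u = (\<lambda>x\<in>car R. u x)" using H(1) uH by (intro additive_maps_ext) auto
 show "\<zero>\<^sub>(op_ring R H) \<oplus>\<^sub>(op_ring R H) u = u"
  unfolding op_ring_def op_add_def ring_record_simps
  by (subst (2) ue, rule restrict_ext) (simp add: D[OF uH])
 have "(\<lambda>x\<in>car R. \<ominus> u x) \<oplus>\<^sub>(op_ring R H) u = \<zero>\<^sub>(op_ring R H)"
  unfolding op_ring_def op_add_def ring_record_simps
  by (rule restrict_ext) (simp add: D[OF uH] l_neg)
 then show "\<exists>y\<in>car (op_ring R H). y \<oplus>\<^sub>(op_ring R H) u = \<zero>\<^sub>(op_ring R H)"
  using neg[OF uH] by (intro bexI[of _ "\<lambda>x\<in>car R. \<ominus> u x"]) (simp_all only: op_ring_def partial_object.select_convs)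
 assume v: "v : car (op_ring R H)"
 then have vH: "v : H" by (simp add: op_ring_def)
 show "u \<oplus>\<^sub>(op_ring R H) v : car (op_ring R H)" using add[OF uH vH] by (simp add: op_ring_def)
 show "u \<oplus>\<^sub>(op_ring R H) v = v \<oplus>\<^sub>(op_ring R H) u"
  unfolding op_ring_def op_add_def ring_record_simps
  by (rule restrict_ext) (simp add: D[OF uH] D[OF vH] a_comm)
 assume w: "w : car (op_ring R H)"
 then have wH: "w : H" by (simp add: op_ring_def)
 show "(u \<oplus>\<^sub>(op_ring R H) v) \<oplus>\<^sub>(op_ring R H) w = u \<oplus>\<^sub>(op_ring R H) (v \<oplus>\<^sub>(op_ring R H) w)"
  unfolding op_ring_def op_add_def ring_record_simps
  by (rule restrict_ext) (simp add: D[OF uH] D[OF vH] D[OF wH] a_assoc)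
qed (use H in \<open>simp add: op_ring_def\<close>)

lemma op_ring_axioms:
 assumes H: "H <= additive_maps R R" "zero_map : H" "(\<lambda>x\<in>car R. x) : H"
  and add: "!!\<delta> \<theta>. \<delta> : H ==> \<theta> : H ==> op_add R \<delta> \<theta> : H"
  and neg: "!!\<delta>. \<delta> : H ==> (\<lambda>x\<in>car R. \<ominus> \<delta> x) : H"
  and mult: "!!\<delta> \<theta>. \<delta> : H ==> \<theta> : H ==> compose (car R) \<delta> \<theta> : H"
 shows "ring (op_ring R H)"
proof (rule ringI)
 have D: "!!\<delta> x. \<delta> : H ==> x : car R ==> \<delta> x : car R"
  and Da: "!!\<delta> x y. \<delta> : H ==> x : car R ==> y : car R ==> \<delta> (x \<oplus> y) = \<delta> x \<oplus> \<delta> y"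
  by (rule additive_mapsD(2,3)[OF subsetD[OF H(1)]], assumption+)+
 have HE: "\<delta> = (\<lambda>x\<in>car R. \<delta> x)" if "\<delta> : H" for \<delta>
  by (rule additive_maps_ext) (use that H(1) in auto)
 show "abelian_group (op_ring R H)" by (rule op_group_axioms[OF H(1,2) add neg])
 show "Group.monoid (op_ring R H)"
 proof (rule monoidI)
  fix u v w assume u: "u : car (op_ring R H)"
  then have uH: "u : H" by (simp add: op_ring_def)
  show "\<one>\<^sub>(op_ring R H) \<otimes>\<^sub>(op_ring R H) u = u"
   unfolding op_ring_def compose_def ring_record_simps monoid.simps
   by (subst (2) HE[OF uH], rule restrict_ext) (simp add: D[OF uH])
  show "u \<otimes>\<^sub>(op_ring R H) \<one>\<^sub>(op_ring R H) = u"
   unfolding op_ring_def compose_def ring_record_simps monoid.simps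
   by (subst (2) HE[OF uH], rule restrict_ext) (simp add: D[OF uH])
  assume "v : car (op_ring R H)"
  then have vH: "v : H" by (simp add: op_ring_def)
  show "u \<otimes>\<^sub>(op_ring R H) v : car (op_ring R H)" using mult[OF uH vH] by (simp add: op_ring_def)
  assume "w : car (op_ring R H)"
  then have wH: "w : H" by (simp add: op_ring_def)
  show "(u \<otimes>\<^sub>(op_ring R H) v) \<otimes>\<^sub>(op_ring R H) w = u \<otimes>\<^sub>(op_ring R H) (v \<otimes>\<^sub>(op_ring R H) w)"
   unfolding op_ring_def compose_def ring_record_simps monoid.simps
   by (rule restrict_ext) (simp add: D[OF uH] D[OF vH] D[OF wH])
 qed (use H in \<open>simp add: op_ring_def\<close>)
 fix u v w assume "u : car (op_ring R H)" "v : car (op_ring R H)" "w : car (op_ring R H)"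
 then have uH: "u : H" "v : H" "w : H" by (simp_all add: op_ring_def)
 show "(u \<oplus>\<^sub>(op_ring R H) v) \<otimes>\<^sub>(op_ring R H) w = u \<otimes>\<^sub>(op_ring R H) w \<oplus>\<^sub>(op_ring R H) v \<otimes>\<^sub>(op_ring R H) w"
  unfolding op_ring_def compose_def op_add_def ring_record_simps monoid.simps
  by (rule restrict_ext) (simp add: D[OF uH(1)] D[OF uH(2)] D[OF uH(3)])
 show "w \<otimes>\<^sub>(op_ring R H) (u \<oplus>\<^sub>(op_ring R H) v) = w \<otimes>\<^sub>(op_ring R H) u \<oplus>\<^sub>(op_ring R H) w \<otimes>\<^sub>(op_ring R H) v"
  unfolding op_ring_def compose_def op_add_def ring_record_simps monoid.simps
  by (rule restrict_ext) (simp add: D[OF uH(1)] D[OF uH(2)] Da[OF uH(3)])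
qed

end

text \<open>A restricted function is evaluated from here on only where the argument is known to lie
  in the domain.\<close>

declare restrict_apply [simp del] restrict_apply' [simp]

lemma (in abelian_group) frobenius_operators_power:
 assumes A: "A : car G \<rightarrow> car G" "!!x y. x : car G ==> y : car G ==> A (x \<oplus> y) = A x \<oplus> A y"
  and B: "B : car G \<rightarrow> car G" "!!x y. x : car G ==> y : car G ==> B (x \<oplus> y) = B x \<oplus> B y"
  and comm: "!!x. x : car G ==> A (B x) = B (A x)"
  and P: "!!x. x : car G ==> P x = A x \<oplus> B x"
  and p: "Factorial_Ring.prime p" "!!x. x : car G ==> add_pow G p x = \<zero>"
  and u: "u : car G"
 shows "(P ^^ (p ^ e)) u = (A ^^ (p ^ e)) u \<oplus> (B ^^ (p ^ e)) u"
 using u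
proof (induction e arbitrary: u)
 case 0 then show ?case using P by simp
next
 case (Suc e)
 have A': "A x : car G" "B x : car G" if "x : car G" for x using that A B by auto
 have Ai: "(A ^^ i) x : car G" "(B ^^ i) x : car G" if "x : car G" for i x
  using that A' by (induction i) auto
 have Aa: "(A ^^ i) (x \<oplus> y) = (A ^^ i) x \<oplus> (A ^^ i) y" "(B ^^ i) (x \<oplus> y) = (B ^^ i) x \<oplus> (B ^^ i) y"
  if "x : car G" "y : car G" for x y i
  using that A(2) B(2) Ai by (induction i) auto
 have c1: "A ((B ^^ j) x) = (B ^^ j) (A x)" if "x : car G" for j x
  using that comm Ai by (induction j) (auto simp: A')
 have c: "(A ^^ i) ((B ^^ j) x) = (B ^^ j) ((A ^^ i) x)" if "x : car G" for i j x
  using that c1 Ai by (induction i) auto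
 have "((P ^^ (p ^ e)) ^^ p) u = ((A ^^ (p ^ e)) ^^ p) u \<oplus> ((B ^^ (p ^ e)) ^^ p) u"
  by (rule frobenius_operators) (use Ai Aa c Suc p in auto)
 then show ?case by (simp add: funpow_mult mult.commute)
qed

section \<open>Nilpotent commutators and linearity over Frobenius powers\<close>

context char_ring
begin

lemma ad_eq_zero_iff:
 assumes "\<delta> : additive_maps R R" "r : car R"
 shows "ad r \<delta> = zero_map \<longleftrightarrow> (\<forall>x\<in>car R. \<delta> (r \<otimes> x) = r \<otimes> \<delta> x)"
proof
 assume a: "ad r \<delta> = zero_map"
 show "\<forall>x\<in>car R. \<delta> (r \<otimes> x) = r \<otimes> \<delta> x"
 proof
  fix x assume x: "x : car R"
  have "\<delta> (r \<otimes> x) \<ominus> r \<otimes> \<delta> x = \<zero>"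
   using fun_cong[OF a, of x] x by (simp add: op_commutator_def)
  then show "\<delta> (r \<otimes> x) = r \<otimes> \<delta> x"
   by (rule eq_of_minus_zero) (use x assms(2) additive_mapsD(2)[OF assms(1)] in auto)
 qed
next
 assume a: "\<forall>x\<in>car R. \<delta> (r \<otimes> x) = r \<otimes> \<delta> x"
 show "ad r \<delta> = zero_map" unfolding op_commutator_def
  by (rule restrict_ext) (use a assms(2) additive_mapsD(2)[OF assms(1)] in \<open>simp add: a_minus_def r_neg\<close>)
qed

text \<open>\<open>rmul r\<close> is the sum of the commuting operators \<open>lmul r\<close> and
  \<open>ad r\<close>. In characteristic \<open>p\<close> its \<open>p ^ e\<close>-th power is the
  sum of their powers, and the powers of the two multiplications are the multiplications by
  \<open>r [^] (p ^ e)\<close>.\<close>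

lemma ad_power:
 assumes d: "\<delta> : additive_maps R R" and r: "r : car R"
 shows "(ad r ^^ (p ^ e)) \<delta> = ad (r [^] (p ^ e)) \<delta>"
proof -
 let ?E = "op_ring R (additive_maps R R)"
 interpret E: abelian_group ?E by (rule op_group_axioms) (auto intro: additive_maps_closed)
 note D = additive_mapsD
 have car: "car ?E = additive_maps R R" "add ?E = op_add R" "\<zero>\<^sub>?E  = zero_map" by (simp_all only: op_ring_def ring_record_simps)
 have main: "(rmul r ^^ (p ^ e)) \<delta> = op_add R ((lmul r ^^ (p ^ e)) \<delta>) ((ad r ^^ (p ^ e)) \<delta>)"
 proof (rule E.frobenius_operators_power[unfolded car])
  fix x y assume x: "x : additive_maps R R"
  show "lmul r (ad r x) = ad r (lmul r x)"
   unfolding lmul_def op_commutator_def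
   by (rule restrict_ext) (use r D[OF x] in \<open>simp add: a_minus_def r_distr r_minus\<close>)
  show "rmul r x = op_add R (lmul r x) (ad r x)"
   unfolding lmul_def rmul_def op_commutator_def op_add_def
   by (rule restrict_ext) (use r D[OF x] in \<open>simp add: a_minus_def a_comm[of _ "\<ominus> _"] r_neg1 r_neg2 a_lcomm[of "_ \<otimes> _"]\<close>)
  have "add_pow ?E k x = (\<lambda>z\<in>car R. add_pow R k (x z))" for k :: nat
  proof (induction k)
   case 0 show ?case using car(3) by (simp add: E.add.nat_pow_0)
  next
   case (Suc k)
   show ?case unfolding E.add.nat_pow_Suc Suc car op_add_def
    by (rule restrict_ext) (simp add: add.nat_pow_Suc)
  qed
  then show "add_pow ?E p x = zero_map"
   using D(2)[OF x] char_zero by (simp only:) (rule restrict_ext, simp)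
  assume y: "y : additive_maps R R"
  show "lmul r (op_add R x y) = op_add R (lmul r x) (lmul r y)"
   unfolding lmul_def op_add_def by (rule restrict_ext) (use r D[OF x] D[OF y] in \<open>simp add: r_distr\<close>)
  show "ad r (op_add R x y) = op_add R (ad r x) (ad r y)"
   unfolding op_commutator_def op_add_def
   by (rule restrict_ext) (use r D[OF x] D[OF y] in \<open>simp add: r_distr a_minus_def minus_add a_ac\<close>)
 qed (use r d prime_p in \<open>auto intro: additive_maps_closed\<close>)
 have R: "(rmul r ^^ n) \<delta> = (\<lambda>x\<in>car R. \<delta> (r [^] n \<otimes> x))" for n :: nat
 proof (induction n)
  case 0 show ?case unfolding funpow.simps id_apply by (rule additive_maps_ext[OF d]) simp
 next
  case (Suc n)
  show ?case unfolding funpow.simps comp_def Suc unfolding rmul_def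
   by (rule restrict_ext) (use r in \<open>simp add: m_assoc nat_pow_Suc\<close>)
 qed
 have L: "(lmul r ^^ n) \<delta> = (\<lambda>x\<in>car R. r [^] n \<otimes> \<delta> x)" for n :: nat
 proof (induction n)
  case 0 show ?case unfolding funpow.simps id_apply by (rule additive_maps_ext[OF d]) (simp add: D(2)[OF d])
 next
  case (Suc n)
  show ?case unfolding funpow.simps comp_def Suc unfolding lmul_def
   by (rule restrict_ext) (use r D(2)[OF d] in \<open>simp add: m_ac nat_pow_Suc\<close>)
 qed
 have adE: "(ad r ^^ n) \<delta> : additive_maps R R" for n
  by (induction n) (auto intro: additive_maps_closed r d)
 show ?thesis
  unfolding op_commutator_def[of R \<delta>]
 proof (rule additive_maps_ext[OF adE])
  fix x assume x: "x : car R"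
  have "\<delta> (r [^] (p ^ e) \<otimes> x) = r [^] (p ^ e) \<otimes> \<delta> x \<oplus> (ad r ^^ (p ^ e)) \<delta> x"
   using fun_cong[OF main[unfolded R L op_add_def], of x] x by simp
  then have "\<delta> (r [^] (p ^ e) \<otimes> x) = (ad r ^^ (p ^ e)) \<delta> x \<oplus> r [^] (p ^ e) \<otimes> \<delta> x"
   using a_comm D(2)[OF d] D(2)[OF adE] x r by simp
  then show "(ad r ^^ (p ^ e)) \<delta> x = \<delta> (r [^] (p ^ e) \<otimes> x) \<ominus> r [^] (p ^ e) \<otimes> \<delta> x"
   using add_minus_cancel D(2)[OF d] D(2)[OF adE] x r by simp
 qed
qed

lemma frob_maps_iff_ad:
 "\<delta> : frob_maps R p e e \<longleftrightarrow>
  \<delta> : additive_maps R R & (\<forall>r\<in>car R. (ad r ^^ (p ^ e)) \<delta> = zero_map)"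
proof -
 have "\<delta> : frob_maps R p e e \<longleftrightarrow> \<delta> : additive_maps R R &
   (\<forall>r\<in>car R. \<forall>x\<in>car R. \<delta> (r [^] (p ^ e) \<otimes> x) = r [^] (p ^ e) \<otimes> \<delta> x)"
  unfolding frob_maps_iff additive_maps_def by blast
 then show ?thesis by (auto simp: ad_power ad_eq_zero_iff)
qed

lemma ad_zero_map: "r : car R ==> ad r zero_map = zero_map"
 unfolding op_commutator_def by (rule restrict_ext) (simp add: a_minus_def r_neg)

lemma ad_pow_zero_map: "r : car R ==> (ad r ^^ n) zero_map = zero_map"
 by (induction n) (simp_all add: ad_zero_map)

lemma zero_map_diff_op: "zero_map : diff_ops_upto R n"
 by (induction n) (simp_all add: additive_maps_closed ad_zero_map)

lemma diff_ops_additive: "\<delta> : diff_ops_upto R n ==> \<delta> : additive_maps R R"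
 by (cases n) simp_all

lemma diff_op_ad_nilpotent:
 "\<delta> : diff_ops_upto R n ==> n < m ==> r : car R ==> (ad r ^^ m) \<delta> = zero_map"
proof (induction n arbitrary: \<delta> m)
 case 0
 then obtain k where m: "m = Suc k" by (cases m) auto
 have "ad r \<delta> = zero_map" using 0 by simp
 then show ?case unfolding m funpow_Suc_right comp_def using ad_pow_zero_map 0(3) by simp
next
 case (Suc n)
 then obtain k where m: "m = Suc k" by (cases m) auto
 have "ad r \<delta> : diff_ops_upto R n" using Suc.prems by simp
 then show ?case unfolding m funpow_Suc_right comp_def using Suc m by simp
qed

lemma diff_op_frob_map:
 assumes "\<delta> : diff_ops_upto R n" "n < p ^ e" shows "\<delta> : frob_maps R p e e"
 unfolding frob_maps_iff_ad using diff_ops_additive[OF assms(1)] diff_op_ad_nilpotent[OF assms] by blast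

lemma diff_ops_add_lmul:
 "[|\<delta> : diff_ops_upto R n; \<theta> : diff_ops_upto R n|] ==> op_add R \<delta> \<theta> : diff_ops_upto R n"
 "[|\<delta> : diff_ops_upto R n; r : car R|] ==> lmul r \<delta> : diff_ops_upto R n"
proof -
 note D = additive_mapsD
 have a: "ad s (op_add R \<delta> \<theta>) = op_add R (ad s \<delta>) (ad s \<theta>)" if "s : car R" "\<delta> : additive_maps R R" "\<theta> : additive_maps R R" for s \<delta> \<theta>
  unfolding op_commutator_def op_add_def
  by (rule restrict_ext) (use that(1) D[OF that(2)] D[OF that(3)] in \<open>simp add: r_distr a_minus_def minus_add a_ac\<close>)
 have l: "ad s (lmul r \<delta>) = lmul r (ad s \<delta>)" if "s : car R" "\<delta> : additive_maps R R" "r : car R" for s \<delta> r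
  unfolding op_commutator_def lmul_def
  by (rule restrict_ext) (use that(1,3) D[OF that(2)] in \<open>simp add: r_distr a_minus_def r_minus m_lcomm\<close>)
 have z: "op_add R zero_map zero_map = zero_map" "r : car R ==> lmul r zero_map = zero_map" for r
  unfolding op_add_def lmul_def by (rule restrict_ext, simp)+
 show "[|\<delta> : diff_ops_upto R n; \<theta> : diff_ops_upto R n|] ==> op_add R \<delta> \<theta> : diff_ops_upto R n"
  by (induction n arbitrary: \<delta> \<theta>) (simp_all add: additive_maps_closed a z)
 show "[|\<delta> : diff_ops_upto R n; r : car R|] ==> lmul r \<delta> : diff_ops_upto R n"
  by (induction n arbitrary: \<delta>) (simp_all add: additive_maps_closed l z)
qed

lemma ad_frob_map:
 assumes "\<delta> : frob_maps R p e e" "r : car R" shows "ad r \<delta> : frob_maps R p e e"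
proof -
 have sw: "r \<otimes> (c [^] (p ^ e) \<otimes> x) = c [^] (p ^ e) \<otimes> (r \<otimes> x)" if "c : car R" "x : car R" for c x
  using that assms(2) by (simp add: m_lcomm)
 show ?thesis
  unfolding op_commutator_def
  by (rule frob_maps_restrictI)
   (use assms(2) frob_mapsD(2,3,4)[OF assms(1)] in \<open>simp_all add: r_distr a_minus_def minus_add a_ac r_minus sw\<close>)
qed

lemma ad_commute:
 assumes "\<delta> : additive_maps R R" "r : car R" "s : car R"
 shows "ad r (ad s \<delta>) = ad s (ad r \<delta>)"
 unfolding op_commutator_def
 by (rule restrict_ext) (use assms(2,3) additive_mapsD[OF assms(1)] in
   \<open>simp add: r_distr a_minus_def minus_add a_ac m_lcomm r_minus\<close>)

text \<open>Since \<open>\<delta>\<close> commutes with \<open>p ^ e\<close>-th powers, its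
  commutator with a linear combination in \<open>F\<^sup>e\<^sub>*R\<close> is the same combination
  of the commutators with the single \<open>x k\<close>.\<close>

lemma ad_lincomb:
 assumes d: "\<delta> : frob_maps R p e e"
  and c: "!!k. k < n ==> c k : car R" "!!k. k < n ==> x k : car R"
  and ad: "!!k. k < n ==> ad (x k) \<delta> : diff_ops_upto R N"
 shows "ad (lincomb R (p ^ e) n c x) \<delta> : diff_ops_upto R N"
 using c ad
proof (induction n)
 case 0
 have "ad \<zero> \<delta> = zero_map" unfolding op_commutator_def
  by (rule restrict_ext) (simp add: frob_mapsD(2,5)[OF d] a_minus_def)
 then show ?case using zero_map_diff_op by simp
next
 case (Suc n)
 have cl: "lincomb R (p ^ e) n c x : car R" "c n : car R" "x n : car R" using Suc.prems by auto
 have "ad (lincomb R (p ^ e) (Suc n) c x) \<delta>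
   = op_add R (ad (lincomb R (p ^ e) n c x) \<delta>) (lmul (c n [^] (p ^ e)) (ad (x n) \<delta>))"
  unfolding lincomb.simps op_commutator_def op_add_def lmul_def
  by (rule restrict_ext) (use cl frob_mapsD[OF d] in
   \<open>simp add: l_distr r_distr a_minus_def minus_add a_ac m_assoc r_minus\<close>)
 moreover have "ad (lincomb R (p ^ e) n c x) \<delta> : diff_ops_upto R N" using Suc by simp
 ultimately show ?case using diff_ops_add_lmul Suc.prems(3)[of n] cl by simp
qed

text \<open>Induction over the total nilpotency exponent of the commutators with the generators.
  Taking the commutator with \<open>x k\<close> lowers \<open>f k\<close> by one and keeps the other
  exponents, because commutators with different elements commute; \<open>ad_lincomb\<close> then
  covers every \<open>r\<close>.\<close>

lemma frob_map_diff_op: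
 assumes x: "!!k. k < n ==> x k : car R"
  "!!r. r : car R ==> \<exists>c. (\<forall>k<n. c k : car R) & r = lincomb R (p ^ e) n c x"
  and "\<delta> : frob_maps R p e e" "!!k. k < n ==> (ad (x k) ^^ f k) \<delta> = zero_map" "(\<Sum>k<n. f k) = N"
 shows "\<delta> : diff_ops_upto R N"
 using assms(3-5)
proof (induction N arbitrary: \<delta> f)
 case 0
 have dE: "\<delta> : additive_maps R R" using 0(1) by (simp only: frob_maps_iff_ad)
 have "ad r \<delta> = zero_map" if r: "r : car R" for r
 \<comment> \<open>A total of zero leaves two cases: there are no generators and \<open>R\<close> is
   zero, or the first exponent is zero and \<open>\<delta>\<close> is zero.\<close>
 proof (cases "n = 0")
  case True
  moreover obtain c where "r = lincomb R (p ^ e) n c x" using x(2)[OF r] by blast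
  ultimately have "r = \<zero>" by simp
  moreover have "ad \<zero> \<delta> = zero_map" unfolding op_commutator_def
   by (rule restrict_ext) (simp add: frob_mapsD(2,5)[OF 0(1)] a_minus_def)
  ultimately show ?thesis by simp
 next
  case False
  then have "f 0 = 0" using 0(3) by auto
  then have "\<delta> = zero_map" using 0(2)[of 0] False by simp
  then show ?thesis using ad_zero_map[OF r] by simp
 qed
 then show ?case using dE by simp
next
 case (Suc N)
 have dE: "\<delta> : additive_maps R R" using Suc.prems(1) by (simp only: frob_maps_iff_ad)
 show ?case
 proof (cases "\<exists>k<n. f k = 0")
  case True
  then have "\<delta> = zero_map" using Suc.prems(2) by (metis funpow_0)
  then show ?thesis using zero_map_diff_op by (simp only:)
 next
  case False
  have "ad (x k) \<delta> : diff_ops_upto R N" if k: "k < n" for k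
  proof (rule Suc.IH)
   have fk: "f k = Suc (f k - 1)" using False k by (cases "f k") auto
   show "ad (x k) \<delta> : frob_maps R p e e" by (rule ad_frob_map[OF Suc.prems(1) x(1)[OF k]])
   have adE: "(ad (x j) ^^ i) \<delta> : additive_maps R R" if "j < n" for i j
    by (induction i) (auto intro: additive_maps_closed x that dE)
   have comm: "(ad (x j) ^^ i) (ad (x k) \<delta>) = ad (x k) ((ad (x j) ^^ i) \<delta>)" if "j < n" for i j
    by (induction i) (simp_all add: ad_commute[OF adE[OF that] x(1)[OF that] x(1)[OF k]])
   show "(ad (x j) ^^ (f(k := f k - 1)) j) (ad (x k) \<delta>) = zero_map" if j: "j < n" for j
   proof (cases "j = k")
    case True
    have "(ad (x k) ^^ (f k - 1)) (ad (x k) \<delta>) = (ad (x k) ^^ Suc (f k - 1)) \<delta>"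
     unfolding funpow_Suc_right comp_def ..
    then show ?thesis using True Suc.prems(2)[OF k] fk by simp
   next
    case False
    then show ?thesis using comm[OF j] Suc.prems(2)[OF j] ad_zero_map[OF x(1)[OF k]] by simp
   qed
   have "(\<Sum>j<n. f j) = f k + (\<Sum>j\<in>{..<n} - {k}. f j)" using k by (simp add: sum.remove)
   moreover have "(\<Sum>j<n. (f(k := f k - 1)) j) = (f k - 1) + (\<Sum>j\<in>{..<n} - {k}. f j)"
    using k by (simp add: sum.remove)
   ultimately show "(\<Sum>j<n. (f(k := f k - 1)) j) = N" using Suc.prems(3) fk by linarith
  qed
  note step = this
  have "ad r \<delta> : diff_ops_upto R N" if r: "r : car R" for r
  proof -
   obtain c where c: "\<forall>k<n. c k : car R" "r = lincomb R (p ^ e) n c x" using x(2)[OF r] by blast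
   show ?thesis unfolding c(2) by (rule ad_lincomb[OF Suc.prems(1)]) (use c(1) x(1) step in auto)
  qed
  then show ?thesis using dE by simp
 qed
qed

lemma diff_ops_eq_frob_maps:
 assumes "F_finite R p" "b > 0"
 shows "(\<Union>n. diff_ops_upto R n) = (\<Union>i. frob_maps R p (a + i * b) (a + i * b))"
proof (intro equalityI subsetI)
 fix \<delta> assume "\<delta> : (\<Union>n. diff_ops_upto R n)"
 then obtain n where n: "\<delta> : diff_ops_upto R n" by blast
 \<comment> \<open>Level \<open>n\<close> is large enough: its exponent \<open>a + n * b\<close> is
   at least \<open>n\<close>, as \<open>b\<close> is positive.\<close>
 have "n < p ^ n" using prime_p prime_gt_1_nat by (intro power_gt_expt) auto
 also have "p ^ n \<le> p ^ (a + n * b)" using assms(2) prime_gt_0_nat[OF prime_p]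
  by (intro power_increasing) (auto intro: trans_le_add2)
 finally show "\<delta> : (\<Union>i. frob_maps R p (a + i * b) (a + i * b))" using diff_op_frob_map[OF n] by blast
next
 fix \<delta> assume "\<delta> : (\<Union>i. frob_maps R p (a + i * b) (a + i * b))"
 then obtain e where e: "\<delta> : frob_maps R p e e" by blast
 have "\<exists>B. spans R (frob_push R p 1) B"
  using assms(1) by (intro fin_gen_spans frob_push_module) (simp add: F_finite_def)
 then obtain B where B: "spans R (frob_push R p e) B" using spans_frob_push by blast
 obtain n x where x: "!!k. k < n ==> x k : car R"
  "!!r. r : car R ==> \<exists>c. (\<forall>k<n. c k : car R) & r = lincomb R (p ^ e) n c x"
  using spans_lincomb[OF B] by metis
 \<comment> \<open>The bound on the order: each of the \<open>n\<close> generators contributes the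
   nilpotency exponent \<open>p ^ e\<close>.\<close>
 have "\<delta> : diff_ops_upto R (\<Sum>k<n. p ^ e)"
  by (rule frob_map_diff_op[OF x e _ refl]) (use e x(1) in \<open>simp_all add: frob_maps_iff_ad\<close>)
 then show "\<delta> : (\<Union>n. diff_ops_upto R n)" by blast
qed

end

section \<open>Tensor products of operators with modules\<close>

text \<open>A free abelian group on an infinite basis has the cardinality of the basis. Here the
  basis embeds into the square of \<open>'u\<close>, which is as large as the infinite
  \<open>'u\<close> itself.\<close>

lemma ex_inj_frag_code:
 assumes inf: "infinite (UNIV :: 'u set)" and large: "(UNIV :: 't set) \<lesssim> (UNIV :: 'u set)"
 shows "\<exists>f :: ('t \<times> 'u \<Rightarrow>\<^sub>0 int) => 'u. inj f"
proof -
 have "infinite (UNIV :: ('t \<times> 'u) set)"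
  using inf by (metis UNIV_Times_UNIV finite_cartesian_productD2 UNIV_not_empty)
 then have 1: "car (free_Abelian_group (UNIV :: ('t \<times> 'u) set)) \<approx> (UNIV :: 't set) \<times> (UNIV :: 'u set)"
  using eqpoll_free_Abelian_group_infinite by simp
 have 2: "(UNIV :: 't set) \<times> (UNIV :: 'u set) \<lesssim> (UNIV :: 'u set) \<times> (UNIV :: 'u set)"
  by (rule times_lepoll_mono[OF large lepoll_refl])
 have 3: "(UNIV :: 'u set) \<times> (UNIV :: 'u set) \<approx> (UNIV :: 'u set)"
  unfolding eqpoll_iff_card_of_ordIso by (rule card_of_Times_same_infinite[OF inf])
 have "car (free_Abelian_group (UNIV :: ('t \<times> 'u) set)) \<lesssim> (UNIV :: 'u set)"
  by (rule lepoll_trans1[OF 1 lepoll_trans2[OF 2 3]])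
 moreover have "car (free_Abelian_group (UNIV :: ('t \<times> 'u) set)) = UNIV" by (auto simp: free_Abelian_group_def)
 ultimately show ?thesis by (auto simp: lepoll_def)
qed

text \<open>The right hand side has the shape of the body of \<open>tensor_lift\<close>, so that
  this explicit sum can be exchanged for a homomorphism with known values on the basis.\<close>

lemma frag_hom_eq_finsum:
 assumes N: "abelian_group N" and h: "h : hom (free_Abelian_group S) (add_monoid N)"
  and f: "!!t. t : S ==> f t : car N" "!!t. t : S ==> h (frag_of t) = f t"
  and x: "Poly_Mapping.keys x <= S"
 shows "h x = (\<Oplus>\<^sub>N t\<in>Poly_Mapping.keys x. add_pow N (Poly_Mapping.lookup x t) (f t))"
proof -
 interpret N: abelian_group N by (rule N)
 let ?G = "free_Abelian_group S"
 interpret hh: group_hom ?G "add_monoid N" h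
  by (intro group_hom.intro group_hom_axioms.intro group_free_Abelian_group h N.a_group)
 have one: "h (frag_cmul n (frag_of t)) = add_pow N n (f t)" if "t : S" for n :: int and t
  using hh.hom_int_pow[of "frag_of t" n] f(2)[OF that] that by (simp add: add_pow_def)
 have "h (\<Sum>t\<in>I. frag_cmul (c t) (frag_of t)) = (\<Oplus>\<^sub>N t\<in>I. add_pow N (c t) (f t))"
  if "finite I" "I <= S" for I and c :: "_ => int"
  using that
 proof (induction I rule: finite_induct)
  case empty
  show ?case using hh.hom_one by simp
 next
  case (insert t I)
  have k: "frag_cmul (c s) (frag_of s) : car ?G" if "s : S" for s
   using that keys_cmul[of "c s" "frag_of s"] by auto
  have "(\<Sum>s\<in>I. frag_cmul (c s) (frag_of s)) : car ?G"
   by (rule sum_closed_free_Abelian_group) (use insert k in blast)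
  then have "h (frag_cmul (c t) (frag_of t) + (\<Sum>s\<in>I. frag_cmul (c s) (frag_of s)))
    = h (frag_cmul (c t) (frag_of t)) \<oplus>\<^sub>N h (\<Sum>s\<in>I. frag_cmul (c s) (frag_of s))"
   using hh.hom_mult[OF k[of t]] insert by simp
  moreover have "add_pow N (c s) (f s) : car N" if "s : S" for s
   using f(1)[OF that] N.add.int_pow_closed by simp
  ultimately show ?case using insert one by (subst N.finsum_insert) auto
 qed
 from this[OF finite_keys x, of "Poly_Mapping.lookup x"] show ?thesis
  using frag_expansion[of x] by (simp add: frag_extend_def)
qed

locale tensor_data = M: abelian_group M
 for R :: "('a, 'k) ring_scheme" and H A :: "('a => 'a) set" and M :: "('a => 'a, 'u) module" +
 assumes code: "\<exists>f :: ((('a => 'a) \<times> 'u) \<Rightarrow>\<^sub>0 int) => 'u. inj f"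
  and smult_M: "d : A ==> m : car M ==> d \<odot>\<^sub>M m : car M"
  and H_add: "\<theta> : H ==> \<theta>' : H ==> op_add R \<theta> \<theta>' : H"
  and H_comp: "\<theta> : H ==> d : A ==> compose (car R) \<theta> d : H"
begin

abbreviation G where "G \<equiv> free_Abelian_group (H \<times> car M)"
abbreviation rels where "rels \<equiv> tensor_rels R H A M"
abbreviation K where "K \<equiv> generate G rels"
abbreviation T where "T \<equiv> op_tensor R H A M"
abbreviation cls where "cls \<equiv> tensor_class R H A M"
abbreviation tens (infixl "\<cdot>\<otimes>" 75) where "\<theta> \<cdot>\<otimes> m \<equiv> pure_tensor R H A M \<theta> m"

interpretation G: comm_group G by (rule abelian_free_Abelian_group)

lemma keys_diff_subset: "Poly_Mapping.keys x <= S ==> Poly_Mapping.keys y <= S ==> Poly_Mapping.keys (x - y) <= S"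
 using keys_diff[of x y] by blast

lemma keys_add_subset: "Poly_Mapping.keys x <= S ==> Poly_Mapping.keys y <= S ==> Poly_Mapping.keys (x + y) <= S"
 using keys_add[of x y] by blast

lemma rels_cases:
 assumes "x : rels"
 obtains (add_left) \<theta> \<theta>' m where "x = frag_of (op_add R \<theta> \<theta>', m) - frag_of (\<theta>, m) - frag_of (\<theta>', m)"
   "\<theta> : H" "\<theta>' : H" "m : car M"
  | (add_right) \<theta> m m' where "x = frag_of (\<theta>, m \<oplus>\<^sub>M m') - frag_of (\<theta>, m) - frag_of (\<theta>, m')"
   "\<theta> : H" "m : car M" "m' : car M"
  | (balanced) \<theta> d m where "x = frag_of (compose (car R) \<theta> d, m) - frag_of (\<theta>, d \<odot>\<^sub>M m)"
   "\<theta> : H" "d : A" "m : car M"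
 using assms unfolding tensor_rels_def by blast

lemma rels_carrier: "rels <= car G"
proof
 fix x assume "x : rels"
 then show "x : car G"
  by (cases x rule: rels_cases) (simp_all add: H_add H_comp smult_M keys_diff_subset)
qed

lemma K_subgroup: "subgroup K G" by (rule G.generate_is_subgroup[OF rels_carrier])

lemma K_closed:
 "0 : K" "x : K ==> y : K ==> x + y : K" "x : K ==> - x : K" "x : K ==> y : K ==> x - y : K"
 "x : K ==> Poly_Mapping.keys x <= H \<times> car M" "x : rels ==> x : K"
proof -
 interpret K: subgroup K G by (rule K_subgroup)
 have c: "Poly_Mapping.keys x <= H \<times> car M" if "x : K" for x using K.mem_carrier[OF that] by simp
 show "0 : K" using K.one_closed by simp
 show a: "x : K ==> y : K ==> x + y : K" for x y using K.m_closed by simp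
 show n: "x : K ==> - x : K" for x using K.m_inv_closed[of x] c[of x] by simp
 show "x : K ==> y : K ==> x - y : K" using a[OF _ n] by (metis add_uminus_conv_diff)
 show "x : K ==> Poly_Mapping.keys x <= H \<times> car M" by (rule c)
 show "x : rels ==> x : K" by (rule generate.incl)
qed

lemma coset_iff: "Poly_Mapping.keys x <= H \<times> car M ==> y : K #>\<^sub>G x \<longleftrightarrow> y - x : K"
proof
 assume "y : K #>\<^sub>G x" then show "y - x : K" by (auto simp: r_coset_def)
next
 assume "y - x : K"
 moreover have "y = (y - x) + x" by simp
 ultimately show "y : K #>\<^sub>G x" unfolding r_coset_def by (intro UN_I[of "y - x"]) auto
qed

text \<open>The code is injective, so equal codes mean equal chosen representatives, and these
  determine their cosets.\<close>

lemma cls_eq_iff: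
 assumes x: "Poly_Mapping.keys x <= H \<times> car M" and y: "Poly_Mapping.keys y <= H \<times> car M"
 shows "cls x = cls y \<longleftrightarrow> x - y : K"
proof -
 have sm: "(SOME z. z : K #>\<^sub>G w) - w : K" if w: "Poly_Mapping.keys w <= H \<times> car M" for w
 proof -
  have "w : K #>\<^sub>G w" using coset_iff[OF w] K_closed(1) by simp
  then show ?thesis using coset_iff[OF w] someI[of "%z. z : K #>\<^sub>G w" w] by simp
 qed
 have "inj (univ_code :: ((('a => 'a) \<times> 'u) \<Rightarrow>\<^sub>0 int) => 'u)"
  unfolding univ_code_def using code by (rule someI_ex)
 then have "cls x = cls y \<longleftrightarrow> (SOME z. z : K #>\<^sub>G x) = (SOME z. z : K #>\<^sub>G y)"
  unfolding tensor_class_def Let_def by (auto dest: injD)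
 also have "\<dots> \<longleftrightarrow> x - y : K"
 proof
  assume e: "(SOME z. z : K #>\<^sub>G x) = (SOME z. z : K #>\<^sub>G y)"
  from K_closed(4)[OF sm[OF y] sm[OF x]] show "x - y : K" unfolding e by (simp add: algebra_simps)
 next
  assume a: "x - y : K"
  have "z - x : K \<longleftrightarrow> z - y : K" for z
   using K_closed(2)[OF _ a, of "z - x"] K_closed(4)[OF _ a, of "z - y"] by (auto simp: algebra_simps)
  then have "K #>\<^sub>G x = K #>\<^sub>G y" using coset_iff[OF x] coset_iff[OF y] by blast
  then show "(SOME z. z : K #>\<^sub>G x) = (SOME z. z : K #>\<^sub>G y)" by simp
 qed
 finally show ?thesis .
qed

lemma carrier_T: "u : car T \<longleftrightarrow> (\<exists>x. Poly_Mapping.keys x <= H \<times> car M & u = cls x)"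
 by (simp add: op_tensor_def image_iff Bex_def)

lemma rep:
 assumes "u : car T"
 shows "Poly_Mapping.keys (tensor_rep R H A M u) <= H \<times> car M" "cls (tensor_rep R H A M u) = u"
proof -
 obtain x where "x : car G & cls x = u" using assms unfolding carrier_T by auto
 then have "tensor_rep R H A M u : car G & cls (tensor_rep R H A M u) = u"
  unfolding tensor_rep_def by (rule someI)
 then show "Poly_Mapping.keys (tensor_rep R H A M u) <= H \<times> car M" "cls (tensor_rep R H A M u) = u" by simp_all
qed

lemma rep_cls:
 assumes "Poly_Mapping.keys x <= H \<times> car M"
 shows "tensor_rep R H A M (cls x) - x : K"
proof -
 have "cls x : car T" using assms carrier_T by blast
 from rep[OF this] show ?thesis using cls_eq_iff assms by blast
qed

lemma T_add:
 assumes "Poly_Mapping.keys x <= H \<times> car M" "Poly_Mapping.keys y <= H \<times> car M"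
 shows "cls x \<oplus>\<^sub>T cls y = cls (x + y)"
proof -
 have c: "cls x : car T" "cls y : car T" using assms carrier_T by blast+
 have "cls x \<oplus>\<^sub>T cls y = cls (tensor_rep R H A M (cls x) + tensor_rep R H A M (cls y))"
  by (simp add: op_tensor_def)
 also have "\<dots> = cls (x + y)"
  using cls_eq_iff[OF keys_add_subset[OF rep(1)[OF c(1)] rep(1)[OF c(2)]] keys_add_subset[OF assms]]
   K_closed(2)[OF rep_cls[OF assms(1)] rep_cls[OF assms(2)]] by (simp add: algebra_simps)
 finally show ?thesis .
qed

lemma T_zero: "\<zero>\<^sub>T = cls 0" by (simp add: op_tensor_def)

lemma T_group: "abelian_group T"
proof (rule abelian_groupI)
 fix u v w assume "u : car T"
 then obtain x where x: "Poly_Mapping.keys x <= H \<times> car M" "u = cls x" unfolding carrier_T by blast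
 show "\<zero>\<^sub>T \<oplus>\<^sub>T u = u" using T_add[of 0 x] x by (simp add: T_zero)
 have "cls (- x) : car T" unfolding carrier_T by (intro exI[of _ "- x"]) (use x in auto)
 moreover have "cls (- x) \<oplus>\<^sub>T u = \<zero>\<^sub>T" using T_add[of "- x" x] x by (simp add: T_zero)
 ultimately show "\<exists>y\<in>car T. y \<oplus>\<^sub>T u = \<zero>\<^sub>T" by blast
 assume "v : car T"
 then obtain y where y: "Poly_Mapping.keys y <= H \<times> car M" "v = cls y" unfolding carrier_T by blast
 show "u \<oplus>\<^sub>T v : car T" unfolding x y T_add[OF x(1) y(1)] carrier_T using keys_add_subset[OF x(1) y(1)] by blast
 show "u \<oplus>\<^sub>T v = v \<oplus>\<^sub>T u" unfolding x y T_add[OF x(1) y(1)] T_add[OF y(1) x(1)] by (simp add: add.commute)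
 assume "w : car T"
 then obtain z where z: "Poly_Mapping.keys z <= H \<times> car M" "w = cls z" unfolding carrier_T by blast
 show "u \<oplus>\<^sub>T v \<oplus>\<^sub>T w = u \<oplus>\<^sub>T (v \<oplus>\<^sub>T w)"
  unfolding x y z T_add[OF x(1) y(1)] T_add[OF y(1) z(1)] T_add[OF x(1) keys_add_subset[OF y(1) z(1)]]
   T_add[OF keys_add_subset[OF x(1) y(1)] z(1)] by (simp add: add.assoc)
qed (auto simp: T_zero carrier_T)

interpretation T: abelian_group T by (rule T_group)

lemma T_uminus: "Poly_Mapping.keys x <= H \<times> car M ==> \<ominus>\<^sub>T cls x = cls (- x)"
proof -
 assume x: "Poly_Mapping.keys x <= H \<times> car M"
 have "cls (- x) \<oplus>\<^sub>T cls x = \<zero>\<^sub>T" using T_add[of "- x" x] x by (simp add: T_zero)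
 moreover have "cls (- x) : car T" "cls x : car T"
  unfolding carrier_T using x by (metis keys_minus)+
 ultimately show ?thesis using T.minus_equality by blast
qed

lemma tens_closed [intro, simp]: "\<theta> : H ==> m : car M ==> \<theta> \<cdot>\<otimes> m : car T"
 unfolding pure_tensor_def carrier_T by (intro exI[of _ "frag_of (\<theta>, m)"]) auto

lemma cls_rel:
 assumes "x - y - z : rels" "Poly_Mapping.keys x <= H \<times> car M" "Poly_Mapping.keys y <= H \<times> car M" "Poly_Mapping.keys z <= H \<times> car M"
 shows "cls x = cls y \<oplus>\<^sub>T cls z"
 unfolding T_add[OF assms(3,4)] cls_eq_iff[OF assms(2) keys_add_subset[OF assms(3,4)]]
 using K_closed(6)[OF assms(1)] by (simp add: algebra_simps)

lemma tens_add_left: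
 assumes "\<theta> : H" "\<theta>' : H" "m : car M"
 shows "op_add R \<theta> \<theta>' \<cdot>\<otimes> m = \<theta> \<cdot>\<otimes> m \<oplus>\<^sub>T \<theta>' \<cdot>\<otimes> m"
 unfolding pure_tensor_def by (rule cls_rel) (use assms H_add in \<open>auto simp: tensor_rels_def\<close>)

lemma tens_add_right:
 assumes "\<theta> : H" "m : car M" "m' : car M"
 shows "\<theta> \<cdot>\<otimes> (m \<oplus>\<^sub>M m') = \<theta> \<cdot>\<otimes> m \<oplus>\<^sub>T \<theta> \<cdot>\<otimes> m'"
 unfolding pure_tensor_def by (rule cls_rel) (use assms in \<open>auto simp: tensor_rels_def\<close>)

lemma tens_balanced:
 assumes "\<theta> : H" "d : A" "m : car M"
 shows "compose (car R) \<theta> d \<cdot>\<otimes> m = \<theta> \<cdot>\<otimes> (d \<odot>\<^sub>M m)"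
proof -
 have "frag_of (compose (car R) \<theta> d, m) - frag_of (\<theta>, d \<odot>\<^sub>M m) : rels"
  unfolding tensor_rels_def using assms by blast
 then show ?thesis unfolding pure_tensor_def
  by (subst cls_eq_iff) (use assms H_comp smult_M K_closed(6) in auto)
qed

lemma tens_minus_right:
 assumes "\<theta> : H" "m : car M" shows "\<theta> \<cdot>\<otimes> (\<ominus>\<^sub>M m) = \<ominus>\<^sub>T (\<theta> \<cdot>\<otimes> m)"
proof -
 have "\<theta> \<cdot>\<otimes> \<zero>\<^sub>M \<oplus>\<^sub>T \<theta> \<cdot>\<otimes> \<zero>\<^sub>M = \<theta> \<cdot>\<otimes> \<zero>\<^sub>M" using tens_add_right[OF assms(1), of "\<zero>\<^sub>M" "\<zero>\<^sub>M"] by simp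
 then have z: "\<theta> \<cdot>\<otimes> \<zero>\<^sub>M = \<zero>\<^sub>T" using T.add_cancel_iff_zero assms by blast
 have "\<theta> \<cdot>\<otimes> (\<ominus>\<^sub>M m) \<oplus>\<^sub>T \<theta> \<cdot>\<otimes> m = \<zero>\<^sub>T"
  using tens_add_right[OF assms(1), of "\<ominus>\<^sub>M m" m] assms z by (simp add: M.l_neg)
 then show ?thesis using T.minus_equality[symmetric] assms by auto
qed

text \<open>Negatives of pure tensors are pure tensors by \<open>tens_minus_right\<close>, so adding
  one pure tensor at a time reaches every element.\<close>

lemma tens_induct [consumes 1, case_names zero add]:
 assumes u: "u : car T" and zero: "P \<zero>\<^sub>T"
  and add: "!!u \<theta> m. u : car T ==> P u ==> \<theta> : H ==> m : car M ==> P (u \<oplus>\<^sub>T \<theta> \<cdot>\<otimes> m)"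
 shows "P u"
proof -
 obtain x where x: "Poly_Mapping.keys x <= H \<times> car M" "u = cls x" using u carrier_T by blast
 \<comment> \<open>Formal sums are built from the basis by differences. The claim is therefore
   strengthened to adding and subtracting \<open>cls x\<close> at an arbitrary
   \<open>v\<close>.\<close>
 have "cls x : car T & (\<forall>v\<in>car T. P v \<longrightarrow> P (v \<oplus>\<^sub>T cls x) & P (v \<oplus>\<^sub>T \<ominus>\<^sub>T cls x))"
  using x(1)
 proof (induction x rule: free_Abelian_group_induct[consumes 1, case_names zero diff of])
  case zero
  have m0: "\<ominus>\<^sub>T \<zero>\<^sub>T = \<zero>\<^sub>T" using T_uminus[of 0] by (simp add: T_zero)
  show ?case using T.r_zero by (simp add: T_zero[symmetric] m0)
 next
  case (diff x y)
  have "cls (x - y) = cls x \<oplus>\<^sub>T \<ominus>\<^sub>T cls y"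
   unfolding T_uminus[OF diff(2)] by (subst T_add) (use diff in auto)
  moreover have "v \<oplus>\<^sub>T (cls x \<oplus>\<^sub>T \<ominus>\<^sub>T cls y) = (v \<oplus>\<^sub>T cls x) \<oplus>\<^sub>T \<ominus>\<^sub>T cls y"
   "v \<oplus>\<^sub>T \<ominus>\<^sub>T (cls x \<oplus>\<^sub>T \<ominus>\<^sub>T cls y) = (v \<oplus>\<^sub>T \<ominus>\<^sub>T cls x) \<oplus>\<^sub>T cls y" if "v : car T" for v
   using that diff by (simp_all add: T.a_assoc T.minus_add)
  ultimately show ?case using diff by simp
 next
  case (of a)
  obtain \<theta> m where a: "a = (\<theta>, m)" "\<theta> : H" "m : car M" using of by auto
  then show ?case using add tens_minus_right[of \<theta> m, symmetric] tens_closed[OF a(2,3)]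
   by (simp add: pure_tensor_def)
 qed
 then have "P (\<zero>\<^sub>T \<oplus>\<^sub>T u)" using zero x(2) by blast
 then show ?thesis using u by simp
qed

lemma additive_unique:
 assumes N: "abelian_group N" and f: "f : additive_maps T N" and g: "g : additive_maps T N"
  and eq: "!!\<theta> m. \<theta> : H ==> m : car M ==> f (\<theta> \<cdot>\<otimes> m) = g (\<theta> \<cdot>\<otimes> m)"
 shows "f = g"
proof (rule PiE_ext)
 interpret N: abelian_group N by (rule N)
 show "f : car T \<rightarrow>\<^sub>E car N" "g : car T \<rightarrow>\<^sub>E car N" using f g by (auto simp: additive_maps_def)
 fix u assume "u : car T"
 then show "f u = g u"
 proof (induction u rule: tens_induct)
  case zero
  have z: "h \<zero>\<^sub>T = \<zero>\<^sub>N" if "h : additive_maps T N" for h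
  proof (rule N.add_cancel_iff_zero)
   show "h \<zero>\<^sub>T : car N" using that by (auto simp: additive_maps_def)
   then show "h \<zero>\<^sub>T : car N" .
   have "h (\<zero>\<^sub>T \<oplus>\<^sub>T \<zero>\<^sub>T) = h \<zero>\<^sub>T \<oplus>\<^sub>N h \<zero>\<^sub>T" using that T.zero_closed unfolding additive_maps_def by blast
   then show "h \<zero>\<^sub>T \<oplus>\<^sub>N h \<zero>\<^sub>T = h \<zero>\<^sub>T" by simp
  qed
  show ?case using z[OF f] z[OF g] by simp
 next
  case (add u \<theta> m)
  have a: "h (u \<oplus>\<^sub>T \<theta> \<cdot>\<otimes> m) = h u \<oplus>\<^sub>N h (\<theta> \<cdot>\<otimes> m)" if "h : additive_maps T N" for h
   using that add tens_closed unfolding additive_maps_def by blast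
  show ?case using a[OF f] a[OF g] add eq by simp
 qed
qed

lemma K_hom_zero:
 assumes N: "group N" and h: "h : hom G N" and z: "!!x. x : rels ==> h x = \<one>\<^sub>N" and x: "x : K"
 shows "h x = \<one>\<^sub>N"
proof -
 interpret hh: group_hom G N h by (intro group_hom.intro group_hom_axioms.intro group_free_Abelian_group N h)
 have "K <= kernel G N h"
  by (rule G.generate_subgroup_incl[OF _ hh.subgroup_kernel]) (use rels_carrier z in \<open>auto simp: kernel_def simp del: carrier_free_Abelian_group_iff\<close>)
 then show ?thesis using x by (auto simp: kernel_def)
qed

text \<open>The homomorphism from the free group with values \<open>f\<close> vanishes on the
  relations, so the explicit sum at the chosen representative depends only on its class.\<close>

lemma tensor_lift:
 assumes N: "abelian_group N" and f: "!!\<theta> m. \<theta> : H ==> m : car M ==> f \<theta> m : car N"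
  and addl: "!!\<theta> \<theta>' m. \<theta> : H ==> \<theta>' : H ==> m : car M ==> f (op_add R \<theta> \<theta>') m = f \<theta> m \<oplus>\<^sub>N f \<theta>' m"
  and addr: "!!\<theta> m m'. \<theta> : H ==> m : car M ==> m' : car M ==> f \<theta> (m \<oplus>\<^sub>M m') = f \<theta> m \<oplus>\<^sub>N f \<theta> m'"
  and bal: "!!\<theta> d m. \<theta> : H ==> d : A ==> m : car M ==> f (compose (car R) \<theta> d) m = f \<theta> (d \<odot>\<^sub>M m)"
 shows "tensor_lift R H A M N f : additive_maps T N"
  "!!\<theta> m. \<theta> : H ==> m : car M ==> tensor_lift R H A M N f (\<theta> \<cdot>\<otimes> m) = f \<theta> m"
proof -
 interpret N: abelian_group N by (rule N)
 have fS: "(%t. f (fst t) (snd t)) ` (H \<times> car M) <= car (add_monoid N)" using f by auto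
 obtain h where h: "h : hom G (add_monoid N)" "!!t. t : H \<times> car M ==> h (frag_of t) = f (fst t) (snd t)"
  using comm_group.free_Abelian_group_universal[OF N.a_comm_group fS] by blast
 interpret hh: group_hom G "add_monoid N" h
  by (intro group_hom.intro group_hom_axioms.intro group_free_Abelian_group h(1) N.a_group)
 have ha: "h (x + y) = h x \<oplus>\<^sub>N h y" "h (- x) = \<ominus>\<^sub>N h x" "h x : car N"
  if "Poly_Mapping.keys x <= H \<times> car M" "Poly_Mapping.keys y <= H \<times> car M" for x y
  using hh.hom_mult[of x y] hh.hom_inv[of x] hh.hom_closed[of x] that by (simp_all add: a_inv_def)
 have hd: "h (x - y) = h x \<ominus>\<^sub>N h y"
  if "Poly_Mapping.keys x <= H \<times> car M" "Poly_Mapping.keys y <= H \<times> car M" for x y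
  using ha(1)[of x "- y"] ha(2)[of y] that by (simp add: a_minus_def)
 have hK: "h x = \<zero>\<^sub>N" if "x : K" for x
 proof -
  have "h x = \<one>\<^sub>(add_monoid N)"
  proof (rule K_hom_zero[OF N.a_group h(1) _ that])
   fix x assume "x : rels"
   then show "h x = \<one>\<^sub>(add_monoid N)"
   proof (cases x rule: rels_cases)
    case (add_left \<theta> \<theta>' m)
    have "h x = (f \<theta> m \<oplus>\<^sub>N f \<theta>' m) \<ominus>\<^sub>N f \<theta> m \<ominus>\<^sub>N f \<theta>' m"
     unfolding add_left(1) using add_left H_add addl by (simp add: hd h(2) keys_diff_subset)
    then show ?thesis using f add_left by (simp add: a_minus_def N.a_ac N.r_neg N.r_neg1 N.r_neg2)
   next
    case (add_right \<theta> m m')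
    have "h x = (f \<theta> m \<oplus>\<^sub>N f \<theta> m') \<ominus>\<^sub>N f \<theta> m \<ominus>\<^sub>N f \<theta> m'"
     unfolding add_right(1) using add_right addr by (simp add: hd h(2) keys_diff_subset)
    then show ?thesis using f add_right by (simp add: a_minus_def N.a_ac N.r_neg N.r_neg1 N.r_neg2)
   next
    case (balanced \<theta> d m)
    have "h x = f \<theta> (d \<odot>\<^sub>M m) \<ominus>\<^sub>N f \<theta> (d \<odot>\<^sub>M m)"
     unfolding balanced(1) using balanced H_comp smult_M bal by (simp add: hd h(2))
    then show ?thesis using f smult_M balanced by (simp add: a_minus_def N.r_neg)
   qed
  qed
  then show ?thesis by simp
 qed
 have hc: "h x = h y" if "Poly_Mapping.keys x <= H \<times> car M" "Poly_Mapping.keys y <= H \<times> car M" "x - y : K" for x y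
 proof (rule N.eq_of_minus_zero)
  show "h x \<ominus>\<^sub>N h y = \<zero>\<^sub>N" unfolding hd[OF that(1,2), symmetric] by (rule hK[OF that(3)])
 qed (rule ha(3)[OF that(1,2)] ha(3)[OF that(2,1)])+
 have L: "tensor_lift R H A M N f (cls x) = h x" if x: "Poly_Mapping.keys x <= H \<times> car M" for x
 proof -
  have c: "cls x : car T" using x carrier_T by blast
  have "tensor_lift R H A M N f (cls x) = h (tensor_rep R H A M (cls x))"
   using frag_hom_eq_finsum[OF N h(1) _ h(2) rep(1)[OF c]] f c
   by (auto simp: tensor_lift_def Let_def mem_Times_iff)
  also have "\<dots> = h x" by (rule hc[OF rep(1)[OF c] x rep_cls[OF x]])
  finally show ?thesis .
 qed
 show "tensor_lift R H A M N f : additive_maps T N"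
  unfolding additive_maps_def
 proof (intro CollectI conjI ballI)
  show "tensor_lift R H A M N f : car T \<rightarrow>\<^sub>E car N"
  proof (rule PiE_I)
   fix u assume "u : car T"
   then obtain x where "Poly_Mapping.keys x <= H \<times> car M" "u = cls x" unfolding carrier_T by blast
   then show "tensor_lift R H A M N f u : car N" using L ha(3) by simp
  qed (simp add: tensor_lift_def restrict_def)
  fix u v assume "u : car T" "v : car T"
  then obtain x y where xy: "Poly_Mapping.keys x <= H \<times> car M" "u = cls x"
   "Poly_Mapping.keys y <= H \<times> car M" "v = cls y" unfolding carrier_T by blast
  show "tensor_lift R H A M N f (u \<oplus>\<^sub>T v) = tensor_lift R H A M N f u \<oplus>\<^sub>N tensor_lift R H A M N f v"
   unfolding xy T_add[OF xy(1,3)] L[OF keys_add_subset[OF xy(1,3)]] L[OF xy(1)] L[OF xy(3)] by (rule ha(1)[OF xy(1,3)])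
 qed
 fix \<theta> m assume "\<theta> : H" "m : car M"
 then show "tensor_lift R H A M N f (\<theta> \<cdot>\<otimes> m) = f \<theta> m"
  unfolding pure_tensor_def by (subst L) (simp_all add: h(2))
qed

text \<open>Composition with \<open>d\<close> on the left maps each of the three kinds of relations
  to relations of the same kind, so it descends to classes.\<close>

lemma tensor_smult:
 assumes dH: "!!\<theta>. \<theta> : H ==> compose (car R) d \<theta> : H"
  and dadd: "!!\<theta> \<theta>'. \<theta> : H ==> \<theta>' : H ==> compose (car R) d (op_add R \<theta> \<theta>') = op_add R (compose (car R) d \<theta>) (compose (car R) d \<theta>')"
  and dcomp: "!!\<theta> c. \<theta> : H ==> c : A ==> compose (car R) d (compose (car R) \<theta> c) = compose (car R) (compose (car R) d \<theta>) c"
 shows "!!u. u : car T ==> d \<odot>\<^sub>T u : car T"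
  "!!u v. u : car T ==> v : car T ==> d \<odot>\<^sub>T (u \<oplus>\<^sub>T v) = d \<odot>\<^sub>T u \<oplus>\<^sub>T d \<odot>\<^sub>T v"
  "!!\<theta> m. \<theta> : H ==> m : car M ==> d \<odot>\<^sub>T (\<theta> \<cdot>\<otimes> m) = compose (car R) d \<theta> \<cdot>\<otimes> m"
proof -
 let ?F = "frag_extend (%(\<theta>, m). frag_of (compose (car R) d \<theta>, m))"
 have Fc: "Poly_Mapping.keys (?F x) <= H \<times> car M" if "Poly_Mapping.keys x <= H \<times> car M" for x
  using keys_frag_extend[of "%(\<theta>, m). frag_of (compose (car R) d \<theta>, m)" x] that dH by fastforce
 have FK: "?F x : K" if x: "x : K" for x
 proof -
  have hom: "(%x. cls (?F x)) : hom G (add_monoid T)"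
  proof (rule homI)
   fix x y assume "x : car G" "y : car G"
   then show "cls (?F (x \<otimes>\<^sub>G y)) = cls (?F x) \<otimes>\<^sub>(add_monoid T) cls (?F y)"
    using T_add[OF Fc Fc, of x y] by (simp add: frag_extend_add)
  qed (use Fc carrier_T in auto)
  have "cls (?F x) = \<one>\<^sub>(add_monoid T)"
  proof (rule K_hom_zero[OF T.a_group hom _ x])
   fix x assume x: "x : rels"
   then have "?F x : rels"
   proof (cases x rule: rels_cases)
    case (add_left \<theta> \<theta>' m)
    have "?F x = frag_of (op_add R (compose (car R) d \<theta>) (compose (car R) d \<theta>'), m)
      - frag_of (compose (car R) d \<theta>, m) - frag_of (compose (car R) d \<theta>', m)"
     using add_left by (simp add: frag_extend_diff dadd)
    then show ?thesis unfolding tensor_rels_def using add_left dH by blast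
   next
    case (add_right \<theta> m m')
    have "?F x = frag_of (compose (car R) d \<theta>, m \<oplus>\<^sub>M m')
      - frag_of (compose (car R) d \<theta>, m) - frag_of (compose (car R) d \<theta>, m')"
     using add_right by (simp add: frag_extend_diff)
    then show ?thesis unfolding tensor_rels_def using add_right dH by blast
   next
    case (balanced \<theta> c m)
    have "?F x = frag_of (compose (car R) (compose (car R) d \<theta>) c, m)
      - frag_of (compose (car R) d \<theta>, c \<odot>\<^sub>M m)"
     using balanced by (simp add: frag_extend_diff dcomp)
    then show ?thesis unfolding tensor_rels_def using balanced dH by blast
   qed
   then have "?F x - 0 : K" using K_closed(6) by simp
   then show "cls (?F x) = \<one>\<^sub>(add_monoid T)"
    using cls_eq_iff[of "?F x" 0] Fc[of x] rels_carrier x by (auto simp: T_zero)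
  qed
  then have "cls (?F x) = cls 0" by (simp add: T_zero)
  then show ?thesis using cls_eq_iff[of "?F x" 0] Fc[OF K_closed(5)[OF x]] by simp
 qed
 have S: "d \<odot>\<^sub>T (cls x) = cls (?F x)" if x: "Poly_Mapping.keys x <= H \<times> car M" for x
 proof -
  have c: "cls x : car T" using x carrier_T by blast
  have "?F (tensor_rep R H A M (cls x)) - ?F x : K" using FK[OF rep_cls[OF x]] by (simp add: frag_extend_diff)
  then show ?thesis using cls_eq_iff[OF Fc[OF rep(1)[OF c]] Fc[OF x]] by (simp add: op_tensor_def)
 qed
 show "!!u. u : car T ==> d \<odot>\<^sub>T u : car T" using S Fc unfolding carrier_T by metis
 show "d \<odot>\<^sub>T (u \<oplus>\<^sub>T v) = d \<odot>\<^sub>T u \<oplus>\<^sub>T d \<odot>\<^sub>T v" if uv: "u : car T" "v : car T" for u v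
 proof -
  obtain x y where xy: "Poly_Mapping.keys x <= H \<times> car M" "u = cls x"
   "Poly_Mapping.keys y <= H \<times> car M" "v = cls y" using uv unfolding carrier_T by blast
  show ?thesis unfolding xy T_add[OF xy(1,3)] S[OF keys_add_subset[OF xy(1,3)]] S[OF xy(1)] S[OF xy(3)]
    T_add[OF Fc[OF xy(1)] Fc[OF xy(3)]] by (simp add: frag_extend_add)
 qed
 show "d \<odot>\<^sub>T (\<theta> \<cdot>\<otimes> m) = compose (car R) d \<theta> \<cdot>\<otimes> m" if "\<theta> : H" "m : car M" for \<theta> m
  unfolding pure_tensor_def by (subst S) (use that in auto)
qed

end

section \<open>Modules over the rings of Frobenius levels\<close>

lemma additive_mapsI:
 assumes "f : extensional (car M)" "!!x. x : car M ==> f x : car N"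
  "!!x y. x : car M ==> y : car M ==> f (x \<oplus>\<^sub>M y) = f x \<oplus>\<^sub>N f y"
 shows "f : additive_maps M N"
 using assms by (auto simp: additive_maps_def PiE_def)

lemma additive_mapsE:
 assumes "f : additive_maps M N"
 shows "f : extensional (car M)" "!!x. x : car M ==> f x : car N"
  "!!x y. x : car M ==> y : car M ==> f (x \<oplus>\<^sub>M y) = f x \<oplus>\<^sub>N f y"
 using assms by (auto simp: additive_maps_def PiE_def)

lemma additive_map_zero:
 assumes "abelian_group M" "abelian_group N" "f : additive_maps M N"
 shows "f \<zero>\<^sub>M = \<zero>\<^sub>N"
proof -
 interpret M: abelian_group M by fact
 interpret N: abelian_group N by fact
 have "f \<zero>\<^sub>M \<oplus>\<^sub>N f \<zero>\<^sub>M = f \<zero>\<^sub>M"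
  using additive_mapsE(3)[OF assms(3), of "\<zero>\<^sub>M" "\<zero>\<^sub>M"] by simp
 then show ?thesis using N.add_cancel_iff_zero additive_mapsE(2)[OF assms(3)] by blast
qed

lemma compose_additive:
 assumes "f : additive_maps L M" "g : additive_maps M N" "abelian_group L"
 shows "compose (car L) g f : additive_maps L N"
proof -
 interpret L: abelian_group L by fact
 show ?thesis
  by (rule additive_mapsI)
   (simp_all add: compose_def additive_mapsE[OF assms(1)] additive_mapsE[OF assms(2)])
qed

lemma inv_into_additive:
 assumes f: "f : additive_maps M N" "bij_betw f (car M) (car N)" and M: "abelian_group M" and N: "abelian_group N"
 shows "(\<lambda>y\<in>car N. inv_into (car M) f y) : additive_maps N M"
proof -
 interpret M: abelian_group M by fact
 interpret N: abelian_group N by fact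
 have i: "inv_into (car M) f y : car M" "f (inv_into (car M) f y) = y" if "y : car N" for y
  using f(2) that by (auto simp: bij_betw_def f_inv_into_f inv_into_into)
 show ?thesis
 proof (rule additive_mapsI)
  fix x y assume xy: "x : car N" "y : car N"
  have "f (inv_into (car M) f x \<oplus>\<^sub>M inv_into (car M) f y) = x \<oplus>\<^sub>N y"
   using additive_mapsE(3)[OF f(1)] i xy by simp
  then have "inv_into (car M) f (x \<oplus>\<^sub>N y) = inv_into (car M) f x \<oplus>\<^sub>M inv_into (car M) f y"
   using bij_betw_inv_into_left[OF f(2)] i xy M.a_closed by metis
  then show "(\<lambda>y\<in>car N. inv_into (car M) f y) (x \<oplus>\<^sub>N y) =
    (\<lambda>y\<in>car N. inv_into (car M) f y) x \<oplus>\<^sub>M (\<lambda>y\<in>car N. inv_into (car M) f y) y"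
   using xy N.a_closed by simp
 qed (use i in simp_all)
qed

text \<open>\<open>trace\<close> is what remains of the finite representation type: for any two
  levels the identity of one is a sum of compositions through the other. \<open>code\<close>
  guarantees that different classes in a tensor product have different codes.\<close>

locale frob_levels = char_ring R p for R :: "('a, 'k) ring_scheme" (structure) and p :: nat +
 fixes a b :: nat and code :: "((('a => 'a) \<times> 'u) \<Rightarrow>\<^sub>0 int) => 'u"
 assumes inj_code: "inj code"
  and trace: "!!i j. (\<lambda>x\<in>car R. x) : comp_sums R p (a + i * b) (a + j * b)"
begin

abbreviation H where "H \<equiv> HomF R p a b"
abbreviation comp (infixr "\<cdot>" 75) where "f \<cdot> g \<equiv> compose (car R) f g"
abbreviation idm where "idm \<equiv> \<lambda>x\<in>car R. x"
abbreviation lmod :: "nat => ('a => 'a, 'u) module => bool" where "lmod i M \<equiv> left_module (D_level R p a b i) M"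
abbreviation Tn :: "nat => nat => ('a => 'a, 'u) module => ('a => 'a, 'u) module" where "Tn \<equiv> hom_tensor R p a b"
abbreviation pt :: "nat => nat => ('a => 'a, 'u) module => ('a => 'a) => 'u => 'u" where "pt \<equiv> hom_pure R p a b"

lemma H_eq: "H i j = frob_maps R p (a + i * b) (a + j * b)" by (simp add: HomF_def)

lemma H_additive: "\<theta> : H i j ==> \<theta> : additive_maps R R"
 unfolding H_eq by (auto simp: frob_maps_iff additive_maps_def)

lemmas HD = additive_mapsD[OF H_additive]

lemma H_add: "\<theta> : H i j ==> \<theta>' : H i j ==> op_add R \<theta> \<theta>' : H i j"
 unfolding H_eq op_add_def by (rule frob_maps_plus)

lemma H_comp: "\<phi> : H i j ==> \<theta> : H j k ==> \<theta> \<cdot> \<phi> : H i k"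
 unfolding H_eq compose_def by (rule frob_maps_comp)

lemma H_zero: "zero_map : H i j" unfolding H_eq by (rule frob_maps_restrictI) simp_all

lemma H_id: "idm : H i i" unfolding H_eq by (rule frob_maps_restrictI) simp_all

lemma H_neg: "\<theta> : H i j ==> (\<lambda>x\<in>car R. \<ominus> \<theta> x) : H i j"
 unfolding H_eq by (rule frob_maps_restrictI) (simp_all add: frob_mapsD minus_add r_minus)

text \<open>The scalar that \<open>c\<close> gives at level \<open>l + k\<close> is the one that
  \<open>c [^] (p ^ (k * b))\<close> gives at level \<open>l\<close>, for source and target
  alike.\<close>

lemma H_shift: "\<theta> : H i j ==> \<theta> : H (i + k) (j + k)"
proof -
 assume t: "\<theta> : H i j"
 have "\<theta> (c [^] (p ^ (a + (i + k) * b)) \<otimes> x) = c [^] (p ^ (a + (j + k) * b)) \<otimes> \<theta> x"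
  if "c : car R" "x : car R" for c x
 proof -
  have e: "c [^] (p ^ (a + (l + k) * b)) = (c [^] (p ^ (k * b))) [^] (p ^ (a + l * b))" for l
   using that by (simp add: nat_pow_pow power_add[symmetric] algebra_simps)
  show ?thesis unfolding e using t that unfolding H_eq by (simp add: frob_mapsD(4))
 qed
 then show ?thesis using t unfolding H_eq by (simp add: frob_maps_iff)
qed

lemma H_Suc: "\<theta> : H i j ==> \<theta> : H (Suc i) (Suc j)" using H_shift[of \<theta> i j 1] by simp

lemma H_mono: "i \<le> k ==> d : H i i ==> d : H k k" using H_shift[of d i i "k - i"] by simp

lemma comp_assoc: "\<phi> : H i j ==> (\<theta> \<cdot> \<psi>) \<cdot> \<phi> = \<theta> \<cdot> (\<psi> \<cdot> \<phi>)"
 unfolding compose_def by (rule restrict_ext) (simp add: HD(2))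

lemma comp_add_left: "\<phi> : H i j ==> op_add R \<theta> \<theta>' \<cdot> \<phi> = op_add R (\<theta> \<cdot> \<phi>) (\<theta>' \<cdot> \<phi>)"
 unfolding compose_def op_add_def by (rule restrict_ext) (simp add: HD(2))

lemma comp_add_right:
 "\<theta> : H i' j' ==> \<phi> : H i j ==> \<phi>' : H i j ==> \<theta> \<cdot> op_add R \<phi> \<phi>' = op_add R (\<theta> \<cdot> \<phi>) (\<theta> \<cdot> \<phi>')"
 unfolding compose_def op_add_def by (rule restrict_ext) (simp add: HD(2,3))

lemma comp_id: "\<theta> : H i j ==> idm \<cdot> \<theta> = \<theta>" "\<theta> : H i j ==> \<theta> \<cdot> idm = \<theta>"
 unfolding compose_def by (rule additive_maps_ext[OF H_additive, symmetric]; simp add: HD(2))+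

lemma comp_zero: "\<theta> : H i j ==> zero_map \<cdot> \<theta> = zero_map"
 unfolding compose_def by (rule restrict_ext) (simp add: HD(2))

lemma D_level_ring: "ring (D_level R p a b i)"
 by (rule op_ring_axioms) (auto intro: H_additive H_zero H_id H_add H_neg H_comp simp del: restrict_apply')

lemma lmod_props:
 assumes "lmod i M"
 shows "abelian_group M" "!!c x. c : H i i ==> x : car M ==> c \<odot>\<^sub>M x : car M"
  "!!c d x. c : H i i ==> d : H i i ==> x : car M ==> op_add R c d \<odot>\<^sub>M x = c \<odot>\<^sub>M x \<oplus>\<^sub>M d \<odot>\<^sub>M x"
  "!!c x y. c : H i i ==> x : car M ==> y : car M ==> c \<odot>\<^sub>M (x \<oplus>\<^sub>M y) = c \<odot>\<^sub>M x \<oplus>\<^sub>M c \<odot>\<^sub>M y"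
  "!!c d x. c : H i i ==> d : H i i ==> x : car M ==> (c \<cdot> d) \<odot>\<^sub>M x = c \<odot>\<^sub>M (d \<odot>\<^sub>M x)"
  "!!x. x : car M ==> idm \<odot>\<^sub>M x = x"
proof -
 interpret left_module "D_level R p a b i" M by fact
 show "abelian_group M" by (rule M.abelian_group_axioms)
 show "!!c x. c : H i i ==> x : car M ==> c \<odot>\<^sub>M x : car M"
  "!!c d x. c : H i i ==> d : H i i ==> x : car M ==> op_add R c d \<odot>\<^sub>M x = c \<odot>\<^sub>M x \<oplus>\<^sub>M d \<odot>\<^sub>M x"
  "!!c x y. c : H i i ==> x : car M ==> y : car M ==> c \<odot>\<^sub>M (x \<oplus>\<^sub>M y) = c \<odot>\<^sub>M x \<oplus>\<^sub>M c \<odot>\<^sub>M y"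
  "!!c d x. c : H i i ==> d : H i i ==> x : car M ==> (c \<cdot> d) \<odot>\<^sub>M x = c \<odot>\<^sub>M (d \<odot>\<^sub>M x)"
  using smult_closed smult_l_distr smult_r_distr smult_assoc by (simp_all add: op_ring_def)
 show "!!x. x : car M ==> idm \<odot>\<^sub>M x = x"
  using smult_one unfolding op_ring_def monoid.simps .
qed

lemma lmodI:
 assumes "abelian_group M" "!!c x. c : H i i ==> x : car M ==> c \<odot>\<^sub>M x : car M"
  "!!c d x. c : H i i ==> d : H i i ==> x : car M ==> op_add R c d \<odot>\<^sub>M x = c \<odot>\<^sub>M x \<oplus>\<^sub>M d \<odot>\<^sub>M x"
  "!!c x y. c : H i i ==> x : car M ==> y : car M ==> c \<odot>\<^sub>M (x \<oplus>\<^sub>M y) = c \<odot>\<^sub>M x \<oplus>\<^sub>M c \<odot>\<^sub>M y"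
  "!!c d x. c : H i i ==> d : H i i ==> x : car M ==> (c \<cdot> d) \<odot>\<^sub>M x = c \<odot>\<^sub>M (d \<odot>\<^sub>M x)"
  "!!x. x : car M ==> idm \<odot>\<^sub>M x = x"
 shows "lmod i M"
 unfolding left_module_def left_module_axioms_def
 using D_level_ring assms(1-5) assms(6)[unfolded restrict_def] by (simp add: op_ring_def restrict_def)

lemma lmod_mono: "lmod k M ==> i \<le> k ==> lmod i M"
 by (rule lmodI) (simp_all add: lmod_props[of k M] H_mono[of i k] del: restrict_apply')

lemma tensor_data_H: "lmod i M ==> tensor_data R (H i j) (H i i) M"
 by (intro tensor_data.intro tensor_data_axioms.intro exI[of _ code])
  (auto intro: inj_code lmod_props H_add H_comp)

lemma Tn_group: "lmod i M ==> abelian_group (Tn i j M)"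
 unfolding hom_tensor_def by (rule tensor_data.T_group[OF tensor_data_H])

lemma pt_closed: "lmod i M ==> \<theta> : H i j ==> m : car M ==> pt i j M \<theta> m : car (Tn i j M)"
 unfolding hom_tensor_def hom_pure_def by (rule tensor_data.tens_closed[OF tensor_data_H])

lemma pt_add_left:
 "lmod i M ==> \<theta> : H i j ==> \<theta>' : H i j ==> m : car M ==>
  pt i j M (op_add R \<theta> \<theta>') m = pt i j M \<theta> m \<oplus>\<^sub>(Tn i j M) pt i j M \<theta>' m"
 unfolding hom_tensor_def hom_pure_def by (rule tensor_data.tens_add_left[OF tensor_data_H])

lemma pt_add_right:
 "lmod i M ==> \<theta> : H i j ==> m : car M ==> m' : car M ==>
  pt i j M \<theta> (m \<oplus>\<^sub>M m') = pt i j M \<theta> m \<oplus>\<^sub>(Tn i j M) pt i j M \<theta> m'"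
 unfolding hom_tensor_def hom_pure_def by (rule tensor_data.tens_add_right[OF tensor_data_H])

lemma pt_bal:
 "lmod i M ==> \<theta> : H i j ==> d : H i i ==> m : car M ==> pt i j M (\<theta> \<cdot> d) m = pt i j M \<theta> (d \<odot>\<^sub>M m)"
 unfolding hom_tensor_def hom_pure_def by (rule tensor_data.tens_balanced[OF tensor_data_H])

lemma pt_zero_left: assumes "lmod i M" "m : car M" shows "pt i j M zero_map m = \<zero>\<^sub>(Tn i j M)"
proof -
 interpret T: abelian_group "Tn i j M" by (rule Tn_group[OF assms(1)])
 have "op_add R zero_map zero_map = zero_map" unfolding op_add_def by (rule restrict_ext) simp
 then have "pt i j M zero_map m \<oplus>\<^sub>(Tn i j M) pt i j M zero_map m = pt i j M zero_map m"
  using pt_add_left[OF assms(1) H_zero H_zero assms(2), of j] by (simp only:)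
 then show ?thesis using T.add_cancel_iff_zero pt_closed[OF assms(1) H_zero assms(2)] by blast
qed

lemma Tn_induct [consumes 2, case_names zero add]:
 assumes "lmod i M" "u : car (Tn i j M)" "P \<zero>\<^sub>(Tn i j M)"
  "!!u \<theta> m. u : car (Tn i j M) ==> P u ==> \<theta> : H i j ==> m : car M ==> P (u \<oplus>\<^sub>(Tn i j M) pt i j M \<theta> m)"
 shows "P u"
 using tensor_data.tens_induct[OF tensor_data_H[OF assms(1)] assms(2)[unfolded hom_tensor_def], of P] assms(3,4)
 unfolding hom_tensor_def hom_pure_def by blast

lemma Tn_eq:
 assumes "lmod i M" "abelian_group N" "f : additive_maps (Tn i j M) N" "g : additive_maps (Tn i j M) N"
  "!!\<theta> m. \<theta> : H i j ==> m : car M ==> f (pt i j M \<theta> m) = g (pt i j M \<theta> m)"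
 shows "f = g"
 by (rule tensor_data.additive_unique[OF tensor_data_H[OF assms(1)] assms(2)
    assms(3,4)[unfolded hom_tensor_def] assms(5)[unfolded hom_pure_def]])

definition balanced :: "nat => nat => ('a => 'a, 'u) module => ('a => 'a, 'u) module => (('a => 'a) => 'u => 'u) => bool" where
 "balanced i j M N f \<longleftrightarrow>
  (\<forall>\<theta>\<in>H i j. \<forall>m\<in>car M. f \<theta> m : car N &
   (\<forall>\<theta>'\<in>H i j. f (op_add R \<theta> \<theta>') m = f \<theta> m \<oplus>\<^sub>N f \<theta>' m) &
   (\<forall>m'\<in>car M. f \<theta> (m \<oplus>\<^sub>M m') = f \<theta> m \<oplus>\<^sub>N f \<theta> m') &
   (\<forall>d\<in>H i i. f (\<theta> \<cdot> d) m = f \<theta> (d \<odot>\<^sub>M m)))"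

lemma balancedI:
 assumes "!!\<theta> m. \<theta> : H i j ==> m : car M ==> f \<theta> m : car N"
  "!!\<theta> \<theta>' m. \<theta> : H i j ==> \<theta>' : H i j ==> m : car M ==> f (op_add R \<theta> \<theta>') m = f \<theta> m \<oplus>\<^sub>N f \<theta>' m"
  "!!\<theta> m m'. \<theta> : H i j ==> m : car M ==> m' : car M ==> f \<theta> (m \<oplus>\<^sub>M m') = f \<theta> m \<oplus>\<^sub>N f \<theta> m'"
  "!!\<theta> d m. \<theta> : H i j ==> d : H i i ==> m : car M ==> f (\<theta> \<cdot> d) m = f \<theta> (d \<odot>\<^sub>M m)"
 shows "balanced i j M N f"
 unfolding balanced_def using assms by simp

lemma lift:
 assumes "lmod i M" "abelian_group N" "balanced i j M N f"
 shows "hom_lift R p a b i j M N f : additive_maps (Tn i j M) N"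
  "!!\<theta> m. \<theta> : H i j ==> m : car M ==> hom_lift R p a b i j M N f (pt i j M \<theta> m) = f \<theta> m"
 unfolding hom_tensor_def hom_lift_def hom_pure_def
 by (rule tensor_data.tensor_lift[OF tensor_data_H[OF assms(1)] assms(2)];
   use assms(3) in \<open>simp add: balanced_def\<close>)+

lemma Tn_smult:
 assumes M: "lmod i M" and d: "d : H j j"
 shows "!!u. u : car (Tn i j M) ==> d \<odot>\<^sub>(Tn i j M) u : car (Tn i j M)"
  "!!u v. u : car (Tn i j M) ==> v : car (Tn i j M) ==>
   d \<odot>\<^sub>(Tn i j M) (u \<oplus>\<^sub>(Tn i j M) v) = d \<odot>\<^sub>(Tn i j M) u \<oplus>\<^sub>(Tn i j M) d \<odot>\<^sub>(Tn i j M) v"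
  "!!\<theta> m. \<theta> : H i j ==> m : car M ==> d \<odot>\<^sub>(Tn i j M) pt i j M \<theta> m = pt i j M (d \<cdot> \<theta>) m"
proof -
 have 1: "!!\<theta>. \<theta> : H i j ==> d \<cdot> \<theta> : H i j" by (rule H_comp[OF _ d])
 have 2: "!!\<theta> \<theta>'. \<theta> : H i j ==> \<theta>' : H i j ==> d \<cdot> op_add R \<theta> \<theta>' = op_add R (d \<cdot> \<theta>) (d \<cdot> \<theta>')" by (rule comp_add_right[OF d])
 have 3: "!!\<theta> c. \<theta> : H i j ==> c : H i i ==> d \<cdot> (\<theta> \<cdot> c) = (d \<cdot> \<theta>) \<cdot> c" by (rule comp_assoc[symmetric])
 note S = tensor_data.tensor_smult[OF tensor_data_H[OF M] 1 2 3, folded hom_tensor_def hom_pure_def]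
 show "!!u. u : car (Tn i j M) ==> d \<odot>\<^sub>(Tn i j M) u : car (Tn i j M)"
  "!!u v. u : car (Tn i j M) ==> v : car (Tn i j M) ==>
   d \<odot>\<^sub>(Tn i j M) (u \<oplus>\<^sub>(Tn i j M) v) = d \<odot>\<^sub>(Tn i j M) u \<oplus>\<^sub>(Tn i j M) d \<odot>\<^sub>(Tn i j M) v"
  "!!\<theta> m. \<theta> : H i j ==> m : car M ==> d \<odot>\<^sub>(Tn i j M) pt i j M \<theta> m = pt i j M (d \<cdot> \<theta>) m"
  using S by blast+
qed

lemma smult_additive:
 assumes "lmod i M" "d : H i i" shows "(\<lambda>u\<in>car M. d \<odot>\<^sub>M u) : additive_maps M M"
proof -
 interpret M: abelian_group M by (rule lmod_props(1)[OF assms(1)])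
 show ?thesis by (rule additive_mapsI) (use assms in \<open>simp_all add: lmod_props[of i M]\<close>)
qed

lemma Tn_lmod: assumes M: "lmod i M" shows "lmod j (Tn i j M)"
proof (rule lmodI)
 note S = Tn_smult[OF M]
 interpret T: abelian_group "Tn i j M" by (rule Tn_group[OF M])
 have z: "c \<odot>\<^sub>(Tn i j M) \<zero>\<^sub>(Tn i j M) = \<zero>\<^sub>(Tn i j M)" if c: "c : H j j" for c
  using S(2)[OF c, of "\<zero>\<^sub>(Tn i j M)" "\<zero>\<^sub>(Tn i j M)"] S(1)[OF c] by (intro T.add_cancel_iff_zero) auto
 show "abelian_group (Tn i j M)" by (rule T.abelian_group_axioms)
 show "c \<odot>\<^sub>(Tn i j M) u : car (Tn i j M)" if "c : H j j" "u : car (Tn i j M)" for c u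
  using S(1) that by blast
 show "c \<odot>\<^sub>(Tn i j M) (x \<oplus>\<^sub>(Tn i j M) y) = c \<odot>\<^sub>(Tn i j M) x \<oplus>\<^sub>(Tn i j M) c \<odot>\<^sub>(Tn i j M) y"
  if "c : H j j" "x : car (Tn i j M)" "y : car (Tn i j M)" for c x y using S(2) that by blast
 show "op_add R c d \<odot>\<^sub>(Tn i j M) u = c \<odot>\<^sub>(Tn i j M) u \<oplus>\<^sub>(Tn i j M) d \<odot>\<^sub>(Tn i j M) u"
  if c: "c : H j j" and d: "d : H j j" and u: "u : car (Tn i j M)" for c d u
  using M u
 proof (induction u rule: Tn_induct)
  case zero
  show ?case using z H_add[OF c d] c d by simp
 next
  case (add u \<theta> m)
  note t = pt_closed[OF M add(2,3)]
  have "pt i j M (op_add R c d \<cdot> \<theta>) m = pt i j M (c \<cdot> \<theta>) m \<oplus>\<^sub>(Tn i j M) pt i j M (d \<cdot> \<theta>) m"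
   unfolding comp_add_left[OF add(2)] by (rule pt_add_left[OF M H_comp[OF add(2) c] H_comp[OF add(2) d] add(3)])
  then show ?case
   unfolding S(2)[OF H_add[OF c d] add(1) t] S(2)[OF c add(1) t] S(2)[OF d add(1) t] add(4)
    S(3)[OF H_add[OF c d] add(2,3)] S(3)[OF c add(2,3)] S(3)[OF d add(2,3)]
   using S(1)[OF c add(1)] S(1)[OF d add(1)] pt_closed[OF M H_comp[OF add(2) c] add(3)] pt_closed[OF M H_comp[OF add(2) d] add(3)]
   by (simp add: T.a_ac)
 qed
 show "(c \<cdot> d) \<odot>\<^sub>(Tn i j M) u = c \<odot>\<^sub>(Tn i j M) (d \<odot>\<^sub>(Tn i j M) u)"
  if c: "c : H j j" and d: "d : H j j" and u: "u : car (Tn i j M)" for c d u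
  using M u
 proof (induction u rule: Tn_induct)
  case zero
  show ?case using z H_comp[OF d c] c d by simp
 next
  case (add u \<theta> m)
  note t = pt_closed[OF M add(2,3)] and t' = pt_closed[OF M H_comp[OF add(2) d] add(3)]
  show ?case
   unfolding S(2)[OF H_comp[OF d c] add(1) t] S(2)[OF d add(1) t] add(4)
    S(3)[OF H_comp[OF d c] add(2,3)] S(3)[OF d add(2,3)] S(2)[OF c S(1)[OF d add(1)] t']
    S(3)[OF c H_comp[OF add(2) d] add(3)] comp_assoc[OF add(2)] ..
 qed
 show "idm \<odot>\<^sub>(Tn i j M) u = u" if u: "u : car (Tn i j M)" for u
  using M u
 proof (induction u rule: Tn_induct)
  case zero
  show ?case by (rule z[OF H_id])
 next
  case (add u \<theta> m)
  show ?case
   unfolding S(2)[OF H_id add(1) pt_closed[OF M add(2,3)]] add(4) S(3)[OF H_id add(2,3)] comp_id(1)[OF add(2)] ..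
 qed
qed

text \<open>The left inverse of the induced map is \<open>n \<mapsto> \<Sum> g\<^sub>k \<otimes> s h\<^sub>k n\<close>, where \<open>\<Sum> g\<^sub>k \<circ> h\<^sub>k\<close> is the identity.\<close>

lemma morita_inj:
 assumes M: "lmod i M" and N: "abelian_group N" and f: "balanced i j M N f"
  and s: "!!h n. h : H j i ==> n : car N ==> s h n : car M"
   "!!h n n'. h : H j i ==> n : car N ==> n' : car N ==> s h (n \<oplus>\<^sub>N n') = s h n \<oplus>\<^sub>M s h n'"
   "!!h \<theta> m. h : H j i ==> \<theta> : H i j ==> m : car M ==> s h (f \<theta> m) = (h \<cdot> \<theta>) \<odot>\<^sub>M m"
 shows "inj_on (hom_lift R p a b i j M N f) (car (Tn i j M))"
proof -
 interpret T: abelian_group "Tn i j M" by (rule Tn_group[OF M])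
 interpret N: abelian_group N by (rule N)
 have fc: "!!\<theta> m. \<theta> : H i j ==> m : car M ==> f \<theta> m : car N" using f by (simp add: balanced_def)
 \<comment> \<open>The left inverse is built along the derivation of the sum: for each partial sum
   \<open>t\<close> there is an additive map that sends \<open>f \<theta> m\<close> to the tensor of
   \<open>t \<cdot> \<theta>\<close> and \<open>m\<close>. For the identity it undoes the induced
   map.\<close>
 have "\<exists>\<Psi>. \<Psi> : additive_maps N (Tn i j M) & (\<forall>\<theta>\<in>H i j. \<forall>m\<in>car M. \<Psi> (f \<theta> m) = pt i j M (t \<cdot> \<theta>) m)"
  if "t : comp_sums R p (a + j * b) (a + i * b)" for t
  using that
 proof induction
  case zero
  have "(\<lambda>n\<in>car N. \<zero>\<^sub>(Tn i j M)) : additive_maps N (Tn i j M)" by (rule additive_mapsI) simp_all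
  moreover have "pt i j M (zero_map \<cdot> \<theta>) m = \<zero>\<^sub>(Tn i j M)" if "\<theta> : H i j" "m : car M" for \<theta> m
   using pt_zero_left[OF M that(2)] comp_zero[OF that(1)] by simp
  ultimately show ?case using fc by (intro exI[of _ "\<lambda>n\<in>car N. \<zero>\<^sub>(Tn i j M)"]) simp
 next
  case (add t h g)
  then obtain \<Psi> where P: "\<Psi> : additive_maps N (Tn i j M)" "!!\<theta> m. \<theta> : H i j ==> m : car M ==> \<Psi> (f \<theta> m) = pt i j M (t \<cdot> \<theta>) m" by blast
  have t: "t : H j j" unfolding H_eq by (rule comp_sums_frob_maps[OF add.hyps(1)])
  have h: "h : H j i" and g: "g : H i j" using add.hyps(2,3) by (simp_all add: H_eq)
  let ?Q = "\<lambda>n\<in>car N. \<Psi> n \<oplus>\<^sub>(Tn i j M) pt i j M g (s h n)"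
  note PD = additive_mapsE[OF P(1)]
  have "?Q : additive_maps N (Tn i j M)"
  proof (rule additive_mapsI)
   fix x y assume xy: "x : car N" "y : car N"
   then show "?Q (x \<oplus>\<^sub>N y) = ?Q x \<oplus>\<^sub>(Tn i j M) ?Q y"
    using PD(2,3) s(1,2)[OF h] pt_add_right[OF M g] pt_closed[OF M g] by (simp add: T.a_ac)
  qed (use PD s(1)[OF h] pt_closed[OF M g] in auto)
  moreover have "?Q (f \<theta> m) = pt i j M ((\<lambda>x\<in>car R. t x \<oplus> g (h x)) \<cdot> \<theta>) m"
   if th: "\<theta> : H i j" and m: "m : car M" for \<theta> m
  proof -
   have "(\<lambda>x\<in>car R. t x \<oplus> g (h x)) \<cdot> \<theta> = op_add R (t \<cdot> \<theta>) (g \<cdot> (h \<cdot> \<theta>))"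
    unfolding compose_def op_add_def by (rule restrict_ext) (simp add: HD(2)[OF th])
   moreover have "?Q (f \<theta> m) = pt i j M (t \<cdot> \<theta>) m \<oplus>\<^sub>(Tn i j M) pt i j M (g \<cdot> (h \<cdot> \<theta>)) m"
    using fc[OF th m] P(2)[OF th m] s(3)[OF h th m] pt_bal[OF M g H_comp[OF th h] m] by simp
   ultimately show ?thesis
    using pt_add_left[OF M H_comp[OF th t] H_comp[OF H_comp[OF th h] g] m] by (simp only:)
  qed
  ultimately show ?case by blast
 qed
 from this[OF trace] obtain \<Psi> where P: "\<Psi> : additive_maps N (Tn i j M)"
  "!!\<theta> m. \<theta> : H i j ==> m : car M ==> \<Psi> (f \<theta> m) = pt i j M (idm \<cdot> \<theta>) m" by blast
 let ?L = "hom_lift R p a b i j M N f"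
 have "compose (car (Tn i j M)) \<Psi> ?L = (\<lambda>u\<in>car (Tn i j M). u)"
 proof (rule Tn_eq[OF M T.abelian_group_axioms])
  show "compose (car (Tn i j M)) \<Psi> ?L : additive_maps (Tn i j M) (Tn i j M)"
   by (rule compose_additive[OF lift(1)[OF M N f] P(1) T.abelian_group_axioms])
  show "(\<lambda>u\<in>car (Tn i j M). u) : additive_maps (Tn i j M) (Tn i j M)" by (rule additive_mapsI) simp_all
  fix \<theta> m assume th: "\<theta> : H i j" and m: "m : car M"
  show "compose (car (Tn i j M)) \<Psi> ?L (pt i j M \<theta> m) = (\<lambda>u\<in>car (Tn i j M). u) (pt i j M \<theta> m)"
   using pt_closed[OF M th m] lift(2)[OF M N f th m] P(2)[OF th m] comp_id(1)[OF th] by (simp add: compose_def)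
 qed
 then have "\<Psi> (?L u) = u" if "u : car (Tn i j M)" for u
  using that by (metis compose_eq restrict_apply')
 then show ?thesis by (rule inj_on_inverseI)
qed

text \<open>The tool for surjectivity: adding a composition \<open>g \<cdot> h\<close> changes the
  value of \<open>F\<close> by an element of the image of \<open>L\<close>, and the identity is a
  sum of such compositions.\<close>

lemma trace_image:
 assumes L: "L : additive_maps T N" and T: "abelian_group T" and N: "abelian_group N"
  and zero: "F zero_map = \<zero>\<^sub>N"
  and add: "!!t h g. t : H j j ==> h : H j i ==> g : H i j ==>
   w g h : car T & F (op_add R t (g \<cdot> h)) = F t \<oplus>\<^sub>N L (w g h)"
 shows "F idm : L ` car T"
proof -
 interpret T: abelian_group T by (rule T)
 have "F t : L ` car T" if "t : comp_sums R p (a + j * b) (a + i * b)" for t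
  using that
 proof induction
  case zero
  show ?case using assms(4) additive_map_zero[OF T N L] by (intro image_eqI[of _ _ "\<zero>\<^sub>T"]) auto
 next
  case (add t h g)
  then obtain u where u: "u : car T" "F t = L u" by blast
  have t: "t : H j j" unfolding H_eq by (rule comp_sums_frob_maps[OF add.hyps(1)])
  have h: "h : H j i" and g: "g : H i j" using add.hyps(2,3) by (simp_all add: H_eq)
  have "(\<lambda>x\<in>car R. t x \<oplus> g (h x)) = op_add R t (g \<cdot> h)"
   unfolding op_add_def compose_def by (rule restrict_ext) simp
  then have "F (\<lambda>x\<in>car R. t x \<oplus> g (h x)) = L (u \<oplus>\<^sub>T w g h)"
   using assms(5)[OF t h g] additive_mapsE(3)[OF L] u by simp
  then show ?case using assms(5)[OF t h g] u by blast
 qed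
 from this[OF trace] show ?thesis .
qed

lemma Tn_surj:
 assumes M: "lmod i M" and L: "L : additive_maps T (Tn i j M)" and T: "abelian_group T"
  and "!!\<theta> m. \<theta> : H i j ==> m : car M ==> pt i j M \<theta> m : L ` car T"
 shows "L ` car T = car (Tn i j M)"
proof -
 interpret T: abelian_group T by (rule T)
 have "u : L ` car T" if "u : car (Tn i j M)" for u
  using M that
 proof (induction rule: Tn_induct)
  case zero
  show ?case using additive_map_zero[OF T Tn_group[OF M] L] by (intro image_eqI[of _ _ "\<zero>\<^sub>T"]) auto
 next
  case (add u \<theta> m)
  obtain v w where "v : car T" "u = L v" "w : car T" "pt i j M \<theta> m = L w"
   using add(4) assms(4)[OF add(2,3)] by blast
  then show ?case using additive_mapsE(3)[OF L] by (intro image_eqI[of _ _ "v \<oplus>\<^sub>T w"]) auto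
 qed
 then show ?thesis using additive_mapsE(2)[OF L] by blast
qed

lemma tensor_map:
 assumes M: "lmod i M" and N: "lmod i N" and f: "f : lin_maps (D_level R p a b i) M N"
 shows "hom_tensor_map R p a b i j M N f : additive_maps (Tn i j M) (Tn i j N)"
  "!!\<theta> m. \<theta> : H i j ==> m : car M ==> hom_tensor_map R p a b i j M N f (pt i j M \<theta> m) = pt i j N \<theta> (f m)"
proof -
 have fa: "f : additive_maps M N" "!!d m. d : H i i ==> m : car M ==> f (d \<odot>\<^sub>M m) = d \<odot>\<^sub>N f m"
  using f by (auto simp: lin_maps_def op_ring_def)
 have "balanced i j M (Tn i j N) (%\<theta> m. pt i j N \<theta> (f m))"
  by (rule balancedI) (use pt_closed[OF N] pt_add_left[OF N] pt_add_right[OF N] pt_bal[OF N] additive_mapsE[OF fa(1)] fa(2) in auto)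
 note l = lift[OF M Tn_group[OF N] this]
 show "hom_tensor_map R p a b i j M N f : additive_maps (Tn i j M) (Tn i j N)"
  "!!\<theta> m. \<theta> : H i j ==> m : car M ==> hom_tensor_map R p a b i j M N f (pt i j M \<theta> m) = pt i j N \<theta> (f m)"
  unfolding hom_tensor_map_def using l by simp_all
qed

lemma Tn_linear:
 assumes M: "lmod i M" and N: "lmod k N" and f: "f : additive_maps (Tn i j M) N" and d: "d : H j j" "d : H k k"
  and eq: "!!\<theta> m. \<theta> : H i j ==> m : car M ==> f (pt i j M (d \<cdot> \<theta>) m) = d \<odot>\<^sub>N f (pt i j M \<theta> m)"
  and u: "u : car (Tn i j M)"
 shows "f (d \<odot>\<^sub>(Tn i j M) u) = d \<odot>\<^sub>N f u"
proof -
 let ?T = "Tn i j M"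
 have "compose (car ?T) f (\<lambda>u\<in>car ?T. d \<odot>\<^sub>?T  u) = compose (car ?T) (\<lambda>u\<in>car N. d \<odot>\<^sub>N u) f"
 proof (rule Tn_eq[OF M lmod_props(1)[OF N]])
  show "compose (car ?T) f (\<lambda>u\<in>car ?T. d \<odot>\<^sub>?T  u) : additive_maps ?T N"
   by (rule compose_additive[OF smult_additive[OF Tn_lmod[OF M] d(1)] f Tn_group[OF M]])
  show "compose (car ?T) (\<lambda>u\<in>car N. d \<odot>\<^sub>N u) f : additive_maps ?T N"
   by (rule compose_additive[OF f smult_additive[OF N d(2)] Tn_group[OF M]])
  fix \<theta> m assume th: "\<theta> : H i j" "m : car M"
  show "compose (car ?T) f (\<lambda>u\<in>car ?T. d \<odot>\<^sub>?T  u) (pt i j M \<theta> m)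
    = compose (car ?T) (\<lambda>u\<in>car N. d \<odot>\<^sub>N u) f (pt i j M \<theta> m)"
   using pt_closed[OF M th] Tn_smult(3)[OF M d(1) th] eq[OF th] additive_mapsE(2)[OF f pt_closed[OF M th]]
   by (simp add: compose_def)
 qed
 from fun_cong[OF this, of u] show ?thesis using u additive_mapsE(2)[OF f u] by (simp add: compose_def)
qed

end

text \<open>Levels are arguments of the tensor products; \<open>1\<close> is kept as it stands so
  that they match.\<close>

declare One_nat_def [simp del]

text \<open>\<open>additive_maps\<close> without extensionality, so that composites may be written
  as plain functions.\<close>

definition addf :: "('x, 'k) ring_scheme => ('y, 'l) ring_scheme => ('x => 'y) => bool" where
 "addf M N f \<longleftrightarrow> (\<forall>x\<in>car M. f x : car N) &
  (\<forall>x\<in>car M. \<forall>y\<in>car M. f (x \<oplus>\<^sub>M y) = f x \<oplus>\<^sub>N f y)"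

lemma addfD:
 assumes "addf M N f"
 shows "!!x. x : car M ==> f x : car N"
  "!!x y. x : car M ==> y : car M ==> f (x \<oplus>\<^sub>M y) = f x \<oplus>\<^sub>N f y"
 using assms by (simp_all add: addf_def)

lemma additive_addf: "f : additive_maps M N ==> addf M N f"
 by (simp add: addf_def additive_mapsE)

lemma addf_restrict: "abelian_group M ==> addf M N f ==> (\<lambda>x\<in>car M. f x) : additive_maps M N"
 by (rule additive_mapsI) (simp_all add: addf_def abelian_monoid.a_closed[OF abelian_group.axioms(1)])

lemma addf_comp: "addf L M f ==> addf M N g ==> addf L N (%x. g (f x))"
 by (simp add: addf_def)

lemma addf_plus:
 assumes "abelian_group N" "addf M N f" "addf M N g" shows "addf M N (%x. f x \<oplus>\<^sub>N g x)"
proof -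
 interpret N: abelian_group N by fact
 show ?thesis using assms(2,3) by (simp add: addf_def N.a_ac)
qed

section \<open>Canonical maps between tensor products over different levels\<close>

context frob_levels
begin

lemma addf_smult: "lmod i M ==> d : H i i ==> addf M M (%u. d \<odot>\<^sub>M u)"
 by (simp add: addf_def lmod_props[of i M])

lemma addf_Tn_smult: "lmod i M ==> d : H j j ==> addf (Tn i j M) (Tn i j M) (%u. d \<odot>\<^sub>(Tn i j M) u)"
 by (rule addf_smult[OF Tn_lmod])

text \<open>The pointwise form of \<open>Tn_eq\<close>, for maps that are not restricted to the
  carrier. Identities between canonical maps are obtained from it by comparing pure tensors.\<close>

lemma Tn_agree:
 assumes "lmod i M" "abelian_group N" "addf (Tn i j M) N f" "addf (Tn i j M) N g" "u : car (Tn i j M)"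
  "!!\<theta> m. \<theta> : H i j ==> m : car M ==> f (pt i j M \<theta> m) = g (pt i j M \<theta> m)"
 shows "f u = g u"
proof -
 note r = addf_restrict[OF Tn_group[OF assms(1)]]
 have "(\<lambda>u\<in>car (Tn i j M). f u) = (\<lambda>u\<in>car (Tn i j M). g u)"
  by (rule Tn_eq[OF assms(1,2) r[OF assms(3)] r[OF assms(4)]]) (simp add: pt_closed[OF assms(1)] assms(6))
 from fun_cong[OF this, of u] show ?thesis using assms(5) by simp
qed

text \<open>Contraction with an operator that leads back to the level of the module. In
  \<open>compat\<close> it provides the maps \<open>s\<close> that \<open>morita_inj\<close> asks
  for.\<close>

definition act :: "nat => nat => ('a => 'a, 'u) module => ('a => 'a) => 'u => 'u" where
 "act i j M h = hom_lift R p a b i j M M (%\<theta> m. (h \<cdot> \<theta>) \<odot>\<^sub>M m)"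

lemma act:
 assumes M: "lmod i M" and h: "h : H j i"
 shows "addf (Tn i j M) M (act i j M h)"
  "!!\<theta> m. \<theta> : H i j ==> m : car M ==> act i j M h (pt i j M \<theta> m) = (h \<cdot> \<theta>) \<odot>\<^sub>M m"
proof -
 have "balanced i j M M (%\<theta> m. (h \<cdot> \<theta>) \<odot>\<^sub>M m)"
  by (rule balancedI)
   (simp_all add: lmod_props(2-4)[OF M] H_comp[OF _ h] comp_add_right[OF h] comp_assoc lmod_props(5)[OF M, symmetric])
 note l = lift[OF M lmod_props(1)[OF M] this]
 show "addf (Tn i j M) M (act i j M h)"
  "!!\<theta> m. \<theta> : H i j ==> m : car M ==> act i j M h (pt i j M \<theta> m) = (h \<cdot> \<theta>) \<odot>\<^sub>M m"
  unfolding act_def using l by (auto intro: additive_addf)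
qed

text \<open>The scalar multiplication of the tensor product, extended to operators that change the
  level.\<close>

definition mv :: "nat => nat => nat => ('a => 'a, 'u) module => ('a => 'a) => 'u => 'u" where
 "mv i j k M h = hom_lift R p a b i j M (Tn i k M) (%\<theta>. pt i k M (h \<cdot> \<theta>))"

lemma mv:
 assumes M: "lmod i M" and h: "h : H j k"
 shows "addf (Tn i j M) (Tn i k M) (mv i j k M h)"
  "!!\<theta> m. \<theta> : H i j ==> m : car M ==> mv i j k M h (pt i j M \<theta> m) = pt i k M (h \<cdot> \<theta>) m"
proof -
 have "balanced i j M (Tn i k M) (%\<theta>. pt i k M (h \<cdot> \<theta>))"
  by (rule balancedI)
   (simp_all add: pt_closed[OF M] pt_add_left[OF M] pt_add_right[OF M] H_comp[OF _ h]
    comp_add_right[OF h] comp_assoc pt_bal[OF M, symmetric])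
 note l = lift[OF M Tn_group[OF M] this]
 show "addf (Tn i j M) (Tn i k M) (mv i j k M h)"
  "!!\<theta> m. \<theta> : H i j ==> m : car M ==> mv i j k M h (pt i j M \<theta> m) = pt i k M (h \<cdot> \<theta>) m"
  unfolding mv_def using l by (auto intro: additive_addf)
qed

lemma mv_add:
 assumes M: "lmod i M" and h: "h : H j k" "h' : H j k" and u: "u : car (Tn i j M)"
 shows "mv i j k M (op_add R h h') u = mv i j k M h u \<oplus>\<^sub>(Tn i k M) mv i j k M h' u"
 by (rule Tn_agree[OF M Tn_group[OF M] mv(1)[OF M H_add[OF h]] addf_plus[OF Tn_group[OF M] mv(1)[OF M h(1)] mv(1)[OF M h(2)]] u])
  (simp add: mv(2)[OF M H_add[OF h]] mv(2)[OF M h(1)] mv(2)[OF M h(2)] comp_add_left pt_add_left[OF M] H_comp[OF _ h(1)] H_comp[OF _ h(2)])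

lemma mv_smult:
 assumes M: "lmod i M" and h: "h : H j k" and d: "d : H j j" and u: "u : car (Tn i j M)"
 shows "mv i j k M (h \<cdot> d) u = mv i j k M h (d \<odot>\<^sub>(Tn i j M) u)"
 by (rule Tn_agree[OF M Tn_group[OF M] mv(1)[OF M H_comp[OF d h]] addf_comp[OF addf_Tn_smult[OF M d] mv(1)[OF M h]] u])
  (simp add: mv(2)[OF M H_comp[OF d h]] mv(2)[OF M h] Tn_smult(3)[OF M d] H_comp[OF _ d] comp_assoc)

lemma smult_mv:
 assumes M: "lmod i M" and h: "h : H j k" and d: "d : H k k" and u: "u : car (Tn i j M)"
 shows "mv i j k M (d \<cdot> h) u = d \<odot>\<^sub>(Tn i k M) mv i j k M h u"
 by (rule Tn_agree[OF M Tn_group[OF M] mv(1)[OF M H_comp[OF h d]] addf_comp[OF mv(1)[OF M h] addf_Tn_smult[OF M d]] u])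
  (simp add: mv(2)[OF M H_comp[OF h d]] mv(2)[OF M h] Tn_smult(3)[OF M d] H_comp[OF _ h] comp_assoc)

lemma mv_mv:
 assumes M: "lmod i M" and h: "h : H j k" and g: "g : H k j" and u: "u : car (Tn i j M)"
 shows "mv i k j M g (mv i j k M h u) = (g \<cdot> h) \<odot>\<^sub>(Tn i j M) u"
 by (rule Tn_agree[OF M Tn_group[OF M] addf_comp[OF mv(1)[OF M h] mv(1)[OF M g]] addf_Tn_smult[OF M H_comp[OF h g]] u])
  (simp add: mv(2)[OF M g] mv(2)[OF M h] Tn_smult(3)[OF M H_comp[OF h g]] H_comp[OF _ h] comp_assoc)

text \<open>Composition of operators as a map of tensor products, where the outer operators are regarded
 as operators between levels shifted by \<open>s\<close>.\<close>

definition cmp :: "nat => nat => nat => nat => ('a => 'a, 'u) module => 'u => 'u" where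
 "cmp s i j k M = hom_lift R p a b j k (Tn i (j + s) M) (Tn i (k + s) M) (mv i (j + s) (k + s) M)"

lemma cmp:
 assumes M: "lmod i M"
 shows "cmp s i j k M : additive_maps (Tn j k (Tn i (j + s) M)) (Tn i (k + s) M)"
  "!!\<theta> u. \<theta> : H j k ==> u : car (Tn i (j + s) M) ==>
   cmp s i j k M (pt j k (Tn i (j + s) M) \<theta> u) = mv i (j + s) (k + s) M \<theta> u"
  "bij_betw (cmp s i j k M) (car (Tn j k (Tn i (j + s) M))) (car (Tn i (k + s) M))"
  "!!d u. d : H k k ==> u : car (Tn j k (Tn i (j + s) M)) ==>
   cmp s i j k M (d \<odot>\<^sub>(Tn j k (Tn i (j + s) M)) u) = d \<odot>\<^sub>(Tn i (k + s) M) cmp s i j k M u"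
proof -
 let ?N = "Tn i (j + s) M" and ?K = "Tn i (k + s) M"
 have N: "lmod j ?N" by (rule lmod_mono[OF Tn_lmod[OF M]]) simp
 have K: "lmod k ?K" by (rule lmod_mono[OF Tn_lmod[OF M]]) simp
 have bal: "balanced j k ?N ?K (mv i (j + s) (k + s) M)"
  by (rule balancedI)
   (simp_all add: addfD[OF mv(1)[OF M H_shift]] mv_add[OF M H_shift H_shift] mv_smult[OF M H_shift H_shift])
 note l = lift[OF N Tn_group[OF M] bal, folded cmp_def]
 show 1: "cmp s i j k M : additive_maps (Tn j k ?N) ?K"
  and 2: "!!\<theta> u. \<theta> : H j k ==> u : car ?N ==> cmp s i j k M (pt j k ?N \<theta> u) = mv i (j + s) (k + s) M \<theta> u"
  using l by blast+
 \<comment> \<open>\<open>mv\<close> in the opposite direction serves as \<open>s\<close>: composing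
   first with \<open>\<theta>\<close> and then with \<open>h\<close> is the action of
   \<open>h \<cdot> \<theta>\<close>.\<close>
 have inj: "inj_on (cmp s i j k M) (car (Tn j k ?N))"
  unfolding cmp_def
  by (rule morita_inj[OF N Tn_group[OF M] bal, where s = "mv i (k + s) (j + s) M"])
   (simp_all add: addfD[OF mv(1)[OF M H_shift]] mv_mv[OF M H_shift H_shift])
 have "cmp s i j k M ` car (Tn j k ?N) = car ?K"
 proof (rule Tn_surj[OF M 1 Tn_group[OF N]])
  fix \<theta> m assume th: "\<theta> : H i (k + s)" and m: "m : car M"
  \<comment> \<open>With the identity replaced by \<open>g \<cdot> h\<close>, the tensor becomes the
    image of \<open>g\<close> tensored with the tensor of \<open>h \<cdot> \<theta>\<close> and
    \<open>m\<close>.\<close>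
  have "pt i (k + s) M (idm \<cdot> \<theta>) m : cmp s i j k M ` car (Tn j k ?N)"
  proof (rule trace_image[OF 1 Tn_group[OF N] Tn_group[OF M], where F = "%t. pt i (k + s) M (t \<cdot> \<theta>) m"
     and w = "%g h. pt j k ?N g (pt i (j + s) M (h \<cdot> \<theta>) m)"])
   show "pt i (k + s) M (zero_map \<cdot> \<theta>) m = \<zero>\<^sub>?K "
    unfolding comp_zero[OF th] by (rule pt_zero_left[OF M m])
   fix t h g assume t: "t : H k k" and h: "h : H k j" and g: "g : H j k"
   have h': "h \<cdot> \<theta> : H i (j + s)" by (rule H_comp[OF th H_shift[OF h]])
   have "pt i (k + s) M (op_add R t (g \<cdot> h) \<cdot> \<theta>) m
     = pt i (k + s) M (t \<cdot> \<theta>) m \<oplus>\<^sub>?K  pt i (k + s) M (g \<cdot> (h \<cdot> \<theta>)) m"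
    unfolding comp_add_left[OF th] comp_assoc[OF th]
    by (rule pt_add_left[OF M H_comp[OF th H_shift[OF t]] H_comp[OF h' H_shift[OF g]] m])
   moreover have "pt i (k + s) M (g \<cdot> (h \<cdot> \<theta>)) m = cmp s i j k M (pt j k ?N g (pt i (j + s) M (h \<cdot> \<theta>) m))"
    unfolding 2[OF g pt_closed[OF M h' m]] mv(2)[OF M H_shift[OF g] h' m] ..
   ultimately show "pt j k ?N g (pt i (j + s) M (h \<cdot> \<theta>) m) : car (Tn j k ?N) &
     pt i (k + s) M (op_add R t (g \<cdot> h) \<cdot> \<theta>) m = pt i (k + s) M (t \<cdot> \<theta>) m \<oplus>\<^sub>?K
      cmp s i j k M (pt j k ?N g (pt i (j + s) M (h \<cdot> \<theta>) m))"
    using pt_closed[OF N g pt_closed[OF M h' m]] by simp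
  qed
  then show "pt i (k + s) M \<theta> m : cmp s i j k M ` car (Tn j k ?N)" unfolding comp_id(1)[OF th] .
 qed
 with inj show "bij_betw (cmp s i j k M) (car (Tn j k ?N)) (car ?K)" by (simp add: bij_betw_def)
 show "cmp s i j k M (d \<odot>\<^sub>(Tn j k ?N) u) = d \<odot>\<^sub>?K  cmp s i j k M u"
  if d: "d : H k k" and u: "u : car (Tn j k ?N)" for d u
  by (rule Tn_linear[OF N K 1 d d _ u]) (simp add: 2 H_comp[OF _ d] smult_mv[OF M H_shift H_shift[OF d]])
qed

lemma Phi_Cartier_comp_eq: "Phi_Cartier_comp R p a b M e = cmp 0 (Suc e) 0 1 M"
 unfolding Phi_Cartier_comp_def cmp_def mv_def by (simp add: Suc_eq_plus1_left)

lemma Phi_comp_eq: "Phi_comp R p a b j M = cmp 1 0 0 j M"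
 unfolding Phi_comp_def cmp_def mv_def by (simp add: Suc_eq_plus1)

text \<open>An operator from level \<open>e\<close> to \<open>0\<close> is also one from level
  \<open>Suc e\<close> to \<open>1\<close>, which gives the map. Injectivity follows by contraction
  with \<open>act\<close>. For surjectivity the identity is replaced by \<open>g \<cdot> h\<close>,
  and \<open>h \<cdot> \<theta>\<close>, an operator of level \<open>Suc e\<close>, moves across the
  tensor sign to \<open>m\<close>.\<close>

lemma compat:
 assumes M: "lmod (Suc e) M"
 shows "Cartier_compat R p a b M e : additive_maps (Tn e 0 M) (Tn (Suc e) 1 M)"
  "!!\<theta> m. \<theta> : H e 0 ==> m : car M ==> Cartier_compat R p a b M e (pt e 0 M \<theta> m) = pt (Suc e) 1 M \<theta> m"
  "bij_betw (Cartier_compat R p a b M e) (car (Tn e 0 M)) (car (Tn (Suc e) 1 M))"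
  "!!d u. d : H 0 0 ==> u : car (Tn e 0 M) ==>
   Cartier_compat R p a b M e (d \<odot>\<^sub>(Tn e 0 M) u) = d \<odot>\<^sub>(Tn (Suc e) 1 M) Cartier_compat R p a b M e u"
proof -
 let ?c = "Cartier_compat R p a b M e" and ?N = "Tn (Suc e) 1 M"
 have Me: "lmod e M" by (rule lmod_mono[OF M]) simp
 have S: "\<theta> : H (Suc i) 1" if "\<theta> : H i 0" for \<theta> i using H_shift[OF that, of 1] by (simp add: Suc_eq_plus1)
 have S': "\<theta> : H 1 (Suc i)" if "\<theta> : H 0 i" for \<theta> i using H_shift[OF that, of 1] by (simp add: Suc_eq_plus1)
 have bal: "balanced e 0 M ?N (pt (Suc e) 1 M)"
  by (rule balancedI) (simp_all add: pt_closed[OF M] pt_add_left[OF M] pt_add_right[OF M] pt_bal[OF M] S H_Suc)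
 have cd: "?c = hom_lift R p a b e 0 M ?N (pt (Suc e) 1 M)"
  unfolding Cartier_compat_def by (simp add: Suc_eq_plus1_left)
 note l = lift[OF Me Tn_group[OF M] bal, folded cd]
 show 1: "?c : additive_maps (Tn e 0 M) ?N"
  and 2: "!!\<theta> m. \<theta> : H e 0 ==> m : car M ==> ?c (pt e 0 M \<theta> m) = pt (Suc e) 1 M \<theta> m"
  using l by blast+
 have inj: "inj_on ?c (car (Tn e 0 M))"
  unfolding cd
  by (rule morita_inj[OF Me Tn_group[OF M] bal, where s = "act (Suc e) 1 M"])
   (simp_all add: addfD[OF act(1)[OF M S']] act(2)[OF M S'] S)
 have "?c ` car (Tn e 0 M) = car ?N"
 proof (rule Tn_surj[OF M 1 Tn_group[OF Me]])
  fix \<theta> m assume th: "\<theta> : H (Suc e) 1" and m: "m : car M"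
  have "pt (Suc e) 1 M (idm \<cdot> \<theta>) m : ?c ` car (Tn e 0 M)"
  proof (rule trace_image[OF 1 Tn_group[OF Me] Tn_group[OF M], where F = "%t. pt (Suc e) 1 M (t \<cdot> \<theta>) m"
     and w = "%g h. pt e 0 M g ((h \<cdot> \<theta>) \<odot>\<^sub>M m)"])
   show "pt (Suc e) 1 M (zero_map \<cdot> \<theta>) m = \<zero>\<^sub>?N "
    unfolding comp_zero[OF th] by (rule pt_zero_left[OF M m])
   fix t h g assume t: "t : H 0 0" and h: "h : H 0 e" and g: "g : H e 0"
   have t': "t : H 1 1" using S[OF t] One_nat_def by simp
   have h': "h \<cdot> \<theta> : H (Suc e) (Suc e)" by (rule H_comp[OF th S'[OF h]])
   have hm: "(h \<cdot> \<theta>) \<odot>\<^sub>M m : car M" by (rule lmod_props(2)[OF M h' m])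
   have "pt (Suc e) 1 M (op_add R t (g \<cdot> h) \<cdot> \<theta>) m = pt (Suc e) 1 M (t \<cdot> \<theta>) m \<oplus>\<^sub>?N  pt (Suc e) 1 M (g \<cdot> (h \<cdot> \<theta>)) m"
    unfolding comp_add_left[OF th] comp_assoc[OF th]
    by (rule pt_add_left[OF M H_comp[OF th t'] H_comp[OF h' S[OF g]] m])
   moreover have "pt (Suc e) 1 M (g \<cdot> (h \<cdot> \<theta>)) m = ?c (pt e 0 M g ((h \<cdot> \<theta>) \<odot>\<^sub>M m))"
    unfolding 2[OF g hm] by (rule pt_bal[OF M S[OF g] h' m])
   ultimately show "pt e 0 M g ((h \<cdot> \<theta>) \<odot>\<^sub>M m) : car (Tn e 0 M) &
     pt (Suc e) 1 M (op_add R t (g \<cdot> h) \<cdot> \<theta>) m = pt (Suc e) 1 M (t \<cdot> \<theta>) m \<oplus>\<^sub>?N  ?c (pt e 0 M g ((h \<cdot> \<theta>) \<odot>\<^sub>M m))"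
    using pt_closed[OF Me g hm] by simp
  qed
  then show "pt (Suc e) 1 M \<theta> m : ?c ` car (Tn e 0 M)" unfolding comp_id(1)[OF th] .
 qed
 with inj show "bij_betw ?c (car (Tn e 0 M)) (car ?N)" by (simp add: bij_betw_def)
 show "?c (d \<odot>\<^sub>(Tn e 0 M) u) = d \<odot>\<^sub>?N  ?c u" if d: "d : H 0 0" and u: "u : car (Tn e 0 M)" for d u
 proof (rule Tn_linear[OF Me Tn_lmod[OF M] 1 d _ _ u])
  show d1: "d : H 1 1" using H_shift[OF d, of 1] by simp
  show "?c (pt e 0 M (d \<cdot> \<theta>) m) = d \<odot>\<^sub>?N  ?c (pt e 0 M \<theta> m)" if "\<theta> : H e 0" "m : car M" for \<theta> m
   using that by (simp add: 2 H_comp[OF _ d] Tn_smult(3)[OF M d1] S)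
 qed
qed

lemma lin_mapsE:
 assumes "f : lin_maps (D_level R p a b i) M N"
 shows "f : additive_maps M N" "!!d m. d : H i i ==> m : car M ==> f (d \<odot>\<^sub>M m) = d \<odot>\<^sub>N f m"
 using assms by (auto simp: lin_maps_def op_ring_def)

lemma lin_mapsI:
 "f : additive_maps M N ==> (!!d m. d : H i i ==> m : car M ==> f (d \<odot>\<^sub>M m) = d \<odot>\<^sub>N f m) ==>
  f : lin_maps (D_level R p a b i) M N"
 by (simp add: lin_maps_def op_ring_def)

lemma bij_inv:
 assumes "bij_betw f A B"
 shows "!!y. y : B ==> inv_into A f y : A" "!!y. y : B ==> f (inv_into A f y) = y"
  "!!x. x : A ==> inv_into A f (f x) = x" "!!x y. x : A ==> y : A ==> f x = f y ==> x = y"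
 using assms by (auto simp: bij_betw_def inv_into_into f_inv_into_f inj_on_def inv_into_f_f)

text \<open>The second statement determines the map through the injective compatibility map. It
  takes the place of the chosen inverse in the definition when values are compared.\<close>

lemma canonical_alpha:
 assumes M: "lmod (Suc e) M"
 shows "canonical_alpha R p a b M e : lin_isos (D_level R p a b 0) (Tn 0 1 (Tn (Suc e) 0 M)) (Tn e 0 M)"
  "!!w. w : car (Tn 0 1 (Tn (Suc e) 0 M)) ==>
   Cartier_compat R p a b M e (canonical_alpha R p a b M e w) = cmp 0 (Suc e) 0 1 M w"
proof -
 let ?T = "Tn 0 1 (Tn (Suc e) 0 M)" and ?c = "Cartier_compat R p a b M e" and ?f = "cmp 0 (Suc e) 0 1 M"
 let ?al = "canonical_alpha R p a b M e"
 have Me: "lmod e M" by (rule lmod_mono[OF M]) simp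
 have N: "lmod 0 (Tn (Suc e) 0 M)" by (rule Tn_lmod[OF M])
 note f = cmp[OF M, where s = 0 and j = 0 and k = 1, unfolded add_0_right]
 note c = compat[OF M]
 note ci = bij_inv[OF c(3)]
 interpret T: abelian_group ?T by (rule Tn_group[OF N])
 interpret E: abelian_group "Tn e 0 M" by (rule Tn_group[OF Me])
 have ald: "?al = (\<lambda>w\<in>car ?T. inv_into (car (Tn e 0 M)) ?c (?f w))"
  unfolding canonical_alpha_def Phi_Cartier_comp_eq compose_def by (simp add: Suc_eq_plus1_left)
 have ac: "?al w : car (Tn e 0 M)" "?c (?al w) = ?f w" if "w : car ?T" for w
  using that ci(1,2) additive_mapsE(2)[OF f(1)] by (simp_all add: ald)
 then show "!!w. w : car ?T ==> ?c (?al w) = ?f w" by blast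
 have add: "?al : additive_maps ?T (Tn e 0 M)"
 proof (rule additive_mapsI)
  show "?al : extensional (car ?T)" by (simp add: ald)
  fix x y assume xy: "x : car ?T" "y : car ?T"
  show "?al (x \<oplus>\<^sub>?T  y) = ?al x \<oplus>\<^sub>(Tn e 0 M) ?al y"
   by (rule ci(4)) (use xy ac additive_mapsE(3)[OF c(1)] additive_mapsE(3)[OF f(1)] in simp_all)
 qed (rule ac(1))
 have "?al : lin_maps (D_level R p a b 0) ?T (Tn e 0 M)"
 proof (rule lin_mapsI[OF add])
  fix d w assume d: "d : H 0 0" and w: "w : car ?T"
  have d1: "d : H 1 1" using H_shift[OF d, of 1] by simp
  have dw: "d \<odot>\<^sub>?T  w : car ?T" by (rule Tn_smult(1)[OF N d1 w])
  show "?al (d \<odot>\<^sub>?T  w) = d \<odot>\<^sub>(Tn e 0 M) ?al w"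
  proof (rule ci(4)[OF ac(1)[OF dw] Tn_smult(1)[OF Me d ac(1)[OF w]]])
   show "?c (?al (d \<odot>\<^sub>?T  w)) = ?c (d \<odot>\<^sub>(Tn e 0 M) ?al w)"
    unfolding c(4)[OF d ac(1)[OF w]] ac(2)[OF w] ac(2)[OF dw] by (rule f(4)[OF d1 w])
  qed
 qed
 moreover have "bij_betw ?al (car ?T) (car (Tn e 0 M))"
 proof (rule bij_betw_imageI)
  show "inj_on ?al (car ?T)"
   by (rule inj_onI) (metis ac(2) bij_inv(4)[OF f(3)])
  show "?al ` car ?T = car (Tn e 0 M)"
  proof (intro equalityI subsetI)
   fix y assume y: "y : car (Tn e 0 M)"
   define w where "w = inv_into (car ?T) ?f (?c y)"
   have w: "w : car ?T" "?f w = ?c y"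
    using bij_inv(1,2)[OF f(3)] additive_mapsE(2)[OF c(1) y] by (simp_all add: w_def)
   have "?al w = y" by (rule ci(4)) (use ac[OF w(1)] w y in auto)
   then show "y : ?al ` car ?T" using w(1) by blast
  qed (use ac(1) in auto)
 qed
 ultimately show "?al : lin_isos (D_level R p a b 0) ?T (Tn e 0 M)" by (simp add: lin_isos_def)
qed

end

lemma lin_isos_inv:
 assumes M: "left_module A M" and N: "left_module A N" and f: "f : lin_isos A M N"
 shows "(\<lambda>y\<in>car N. inv_into (car M) f y) : lin_isos A N M"
proof -
 interpret M: left_module A M by fact
 interpret N: left_module A N by fact
 have fa: "f : additive_maps M N" and fl: "!!c x. c : car A ==> x : car M ==> f (c \<odot>\<^sub>M x) = c \<odot>\<^sub>N f x"
  and b: "bij_betw f (car M) (car N)" using f by (auto simp: lin_isos_def lin_maps_def)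
 let ?g = "\<lambda>y\<in>car N. inv_into (car M) f y"
 have i: "inv_into (car M) f y : car M" "f (inv_into (car M) f y) = y" if "y : car N" for y
  using b that by (auto simp: bij_betw_def f_inv_into_f inv_into_into)
 have "inv_into (car M) f (c \<odot>\<^sub>N y) = c \<odot>\<^sub>M inv_into (car M) f y" if "c : car A" "y : car N" for c y
  using bij_betw_inv_into_left[OF b, of "c \<odot>\<^sub>M inv_into (car M) f y"] fl[OF that(1) i(1)[OF that(2)]]
   i[OF that(2)] M.smult_closed[OF that(1)] by simp
 moreover have "?g : additive_maps N M"
  by (rule inv_into_additive[OF fa b M.M.abelian_group_axioms N.M.abelian_group_axioms])
 moreover have "bij_betw ?g (car N) (car M)"
  using bij_betw_inv_into[OF b] by (rule bij_betw_cong[THEN iffD1, rotated]) simp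
 ultimately show ?thesis using N.smult_closed by (simp add: lin_isos_def lin_maps_def)
qed

section \<open>Functoriality of the tensor products\<close>

context frob_levels
begin

abbreviation tm where "tm \<equiv> hom_tensor_map R p a b"

lemma lin_mapsD:
 assumes "f : lin_maps (D_level R p a b i) M N"
 shows "addf M N f" "!!x. x : car M ==> f x : car N"
 using additive_addf[OF lin_mapsE(1)[OF assms]] by (auto dest: addfD)

lemma lin_isosE:
 assumes "f : lin_isos (D_level R p a b i) M N"
 shows "f : lin_maps (D_level R p a b i) M N" "bij_betw f (car M) (car N)"
 using assms by (simp_all add: lin_isos_def)

lemma tm_addf:
 "lmod i M ==> lmod i N ==> f : lin_maps (D_level R p a b i) M N ==> addf (Tn i j M) (Tn i j N) (tm i j M N f)"
 by (rule additive_addf[OF tensor_map(1)])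

lemmas tm_closed = addfD(1)[OF tm_addf]

lemma tm_smult:
 assumes M: "lmod i M" and N: "lmod i N" and f: "f : lin_maps (D_level R p a b i) M N"
  and d: "d : H j j" and u: "u : car (Tn i j M)"
 shows "tm i j M N f (d \<odot>\<^sub>(Tn i j M) u) = d \<odot>\<^sub>(Tn i j N) tm i j M N f u"
 by (rule Tn_agree[OF M Tn_group[OF N] addf_comp[OF addf_Tn_smult[OF M d] tm_addf[OF M N f]]
    addf_comp[OF tm_addf[OF M N f] addf_Tn_smult[OF N d]] u])
  (simp add: tensor_map(2)[OF M N f] Tn_smult(3)[OF M d] Tn_smult(3)[OF N d] H_comp[OF _ d] lin_mapsD(2)[OF f])

lemma tm_lin:
 assumes M: "lmod i M" and N: "lmod i N" and f: "f : lin_maps (D_level R p a b i) M N"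
 shows "tm i j M N f : lin_maps (D_level R p a b j) (Tn i j M) (Tn i j N)"
 by (rule lin_mapsI[OF tensor_map(1)[OF M N f] tm_smult[OF M N f]])

lemma tm_comp:
 assumes L: "lmod i L" and M: "lmod i M" and N: "lmod i N"
  and f: "f : lin_maps (D_level R p a b i) L M" and g: "g : lin_maps (D_level R p a b i) M N"
  and h: "h : lin_maps (D_level R p a b i) L N" and hg: "!!x. x : car L ==> h x = g (f x)"
  and u: "u : car (Tn i j L)"
 shows "tm i j M N g (tm i j L M f u) = tm i j L N h u"
 by (rule Tn_agree[OF L Tn_group[OF N] addf_comp[OF tm_addf[OF L M f] tm_addf[OF M N g]] tm_addf[OF L N h] u])
  (simp add: tensor_map(2)[OF L M f] tensor_map(2)[OF M N g] tensor_map(2)[OF L N h] lin_mapsD(2)[OF f] hg)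

lemma tm_id:
 assumes M: "lmod i M" and f: "f : lin_maps (D_level R p a b i) M M" and i: "!!x. x : car M ==> f x = x"
  and u: "u : car (Tn i j M)"
 shows "tm i j M M f u = u"
 by (rule Tn_agree[OF M Tn_group[OF M] tm_addf[OF M M f] _ u])
  (simp_all add: addf_def tensor_map(2)[OF M M f] i)

lemma id_lin: "left_module A M ==> (\<lambda>x\<in>car M. x) : lin_maps A M M"
proof -
 assume "left_module A M"
 then interpret left_module A M .
 show ?thesis using smult_closed by (auto simp: lin_maps_def intro!: additive_mapsI)
qed

lemma tm_bij:
 assumes M: "lmod i M" and N: "lmod i N" and f: "f : lin_isos (D_level R p a b i) M N"
 shows "bij_betw (tm i j M N f) (car (Tn i j M)) (car (Tn i j N))"
proof -
 note fl = lin_isosE[OF f]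
 let ?g = "\<lambda>y\<in>car N. inv_into (car M) f y"
 have g: "?g : lin_maps (D_level R p a b i) N M" by (rule lin_isosE(1)[OF lin_isos_inv[OF M N f]])
 note b = bij_inv[OF fl(2)]
 show ?thesis
 proof (rule bij_betw_byWitness[where f' = "tm i j N M ?g"])
  show "\<forall>u\<in>car (Tn i j M). tm i j N M ?g (tm i j M N f u) = u"
  proof
   fix u assume u: "u : car (Tn i j M)"
   have "tm i j N M ?g (tm i j M N f u) = tm i j M M (\<lambda>x\<in>car M. x) u"
    by (rule tm_comp[OF M N M fl(1) g id_lin[OF M] _ u]) (simp add: b lin_mapsD(2)[OF fl(1)])
   also have "\<dots> = u" by (rule tm_id[OF M id_lin[OF M] _ u]) simp
   finally show "tm i j N M ?g (tm i j M N f u) = u" .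
  qed
  show "\<forall>u\<in>car (Tn i j N). tm i j M N f (tm i j N M ?g u) = u"
  proof
   fix u assume u: "u : car (Tn i j N)"
   have "tm i j M N f (tm i j N M ?g u) = tm i j N N (\<lambda>x\<in>car N. x) u"
    by (rule tm_comp[OF N M N g fl(1) id_lin[OF N] _ u]) (simp add: b)
   also have "\<dots> = u" by (rule tm_id[OF N id_lin[OF N] _ u]) simp
   finally show "tm i j M N f (tm i j N M ?g u) = u" .
  qed
 qed (use tm_closed[OF M N fl(1)] tm_closed[OF N M g] in auto)
qed

lemma tm_mv:
 assumes M: "lmod i M" and N: "lmod i N" and f: "f : lin_maps (D_level R p a b i) M N"
  and h: "h : H j k" and u: "u : car (Tn i j M)"
 shows "tm i k M N f (mv i j k M h u) = mv i j k N h (tm i j M N f u)"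
 by (rule Tn_agree[OF M Tn_group[OF N] addf_comp[OF mv(1)[OF M h] tm_addf[OF M N f]]
    addf_comp[OF tm_addf[OF M N f] mv(1)[OF N h]] u])
  (simp add: tensor_map(2)[OF M N f] mv(2)[OF M h] mv(2)[OF N h] H_comp[OF _ h] lin_mapsD(2)[OF f])

lemma tm_cmp:
 assumes M: "lmod i M" and N: "lmod i N" and f: "f : lin_maps (D_level R p a b i) M N"
  and g: "tm i (j + s) M N f : lin_maps (D_level R p a b j) (Tn i (j + s) M) (Tn i (j + s) N)"
  and w: "w : car (Tn j k (Tn i (j + s) M))"
 shows "tm i (k + s) M N f (cmp s i j k M w) =
  cmp s i j k N (tm j k (Tn i (j + s) M) (Tn i (j + s) N) (tm i (j + s) M N f) w)"
proof -
 have M': "lmod j (Tn i (j + s) M)" and N': "lmod j (Tn i (j + s) N)"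
  by (rule lmod_mono[OF Tn_lmod[OF M]] lmod_mono[OF Tn_lmod[OF N]], simp)+
 show ?thesis
  by (rule Tn_agree[OF M' Tn_group[OF N] addf_comp[OF additive_addf[OF cmp(1)[OF M]] tm_addf[OF M N f]]
     addf_comp[OF tm_addf[OF M' N' g] additive_addf[OF cmp(1)[OF N]]] w])
   (simp add: cmp(2)[OF M] cmp(2)[OF N] tensor_map(2)[OF M' N' g] tm_mv[OF M N f H_shift] tm_closed[OF M N f])
qed

lemma lin_mono:
 assumes "f : lin_maps (D_level R p a b k) M N" "i \<le> k"
 shows "f : lin_maps (D_level R p a b i) M N"
 by (rule lin_mapsI[OF lin_mapsE(1)[OF assms(1)]]) (rule lin_mapsE(2)[OF assms(1) H_mono[OF assms(2)]])

lemma mv_self: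
 assumes M: "lmod i M" and d: "d : H j j" and u: "u : car (Tn i j M)"
 shows "mv i j j M d u = d \<odot>\<^sub>(Tn i j M) u"
 by (rule Tn_agree[OF M Tn_group[OF M] mv(1)[OF M d] addf_Tn_smult[OF M d] u])
  (simp add: mv(2)[OF M d] Tn_smult(3)[OF M d])

lemma act_add:
 assumes M: "lmod i M" and h: "h : H j i" "h' : H j i" and u: "u : car (Tn i j M)"
 shows "act i j M (op_add R h h') u = act i j M h u \<oplus>\<^sub>M act i j M h' u"
 by (rule Tn_agree[OF M lmod_props(1)[OF M] act(1)[OF M H_add[OF h]]
    addf_plus[OF lmod_props(1)[OF M] act(1)[OF M h(1)] act(1)[OF M h(2)]] u])
  (simp add: act(2)[OF M H_add[OF h]] act(2)[OF M h(1)] act(2)[OF M h(2)] comp_add_left lmod_props(3)[OF M] H_comp[OF _ h(1)] H_comp[OF _ h(2)])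

lemma act_smult:
 assumes M: "lmod i M" and h: "h : H j i" and d: "d : H j j" and u: "u : car (Tn i j M)"
 shows "act i j M (h \<cdot> d) u = act i j M h (d \<odot>\<^sub>(Tn i j M) u)"
 by (rule Tn_agree[OF M lmod_props(1)[OF M] act(1)[OF M H_comp[OF d h]] addf_comp[OF addf_Tn_smult[OF M d] act(1)[OF M h]] u])
  (simp add: act(2)[OF M H_comp[OF d h]] act(2)[OF M h] Tn_smult(3)[OF M d] H_comp[OF _ d] comp_assoc)

lemma smult_act:
 assumes M: "lmod i M" and h: "h : H j i" and d: "d : H i i" and u: "u : car (Tn i j M)"
 shows "act i j M (d \<cdot> h) u = d \<odot>\<^sub>M act i j M h u"
 by (rule Tn_agree[OF M lmod_props(1)[OF M] act(1)[OF M H_comp[OF h d]] addf_comp[OF act(1)[OF M h] addf_smult[OF M d]] u])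
  (simp add: act(2)[OF M H_comp[OF h d]] act(2)[OF M h] comp_assoc lmod_props(5)[OF M d H_comp[OF _ h], symmetric])

lemma act_mv:
 assumes M: "lmod i M" and h: "h : H j k" and g: "g : H k i" and u: "u : car (Tn i j M)"
 shows "act i k M g (mv i j k M h u) = act i j M (g \<cdot> h) u"
 by (rule Tn_agree[OF M lmod_props(1)[OF M] addf_comp[OF mv(1)[OF M h] act(1)[OF M g]] act(1)[OF M H_comp[OF h g]] u])
  (simp add: act(2)[OF M H_comp[OF h g]] act(2)[OF M g] mv(2)[OF M h] H_comp[OF _ h] comp_assoc)

lemma pt_act:
 assumes M: "lmod i M" and h: "h : H j i" and g: "g : H i k" and u: "u : car (Tn i j M)"
 shows "pt i k M g (act i j M h u) = mv i j k M (g \<cdot> h) u"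
proof -
 have "addf M (Tn i k M) (pt i k M g)" by (simp add: addf_def pt_closed[OF M g] pt_add_right[OF M g])
 from addf_comp[OF act(1)[OF M h] this] show ?thesis
  by (rule Tn_agree[OF M Tn_group[OF M] _ mv(1)[OF M H_comp[OF h g]] u])
   (simp add: act(2)[OF M h] mv(2)[OF M H_comp[OF h g]] pt_bal[OF M g H_comp[OF _ h], symmetric] comp_assoc)
qed

lemma act_tm:
 assumes M: "lmod i M" and N: "lmod i N" and f: "f : lin_maps (D_level R p a b i) M N"
  and h: "h : H j i" and u: "u : car (Tn i j M)"
 shows "act i j N h (tm i j M N f u) = f (act i j M h u)"
 by (rule Tn_agree[OF M lmod_props(1)[OF N] addf_comp[OF tm_addf[OF M N f] act(1)[OF N h]] addf_comp[OF act(1)[OF M h] lin_mapsD(1)[OF f]] u])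
  (simp add: act(2)[OF M h] act(2)[OF N h] tensor_map(2)[OF M N f] lin_mapsD(2)[OF f] lin_mapsE(2)[OF f H_comp[OF _ h]])

lemma act_compat:
 assumes M: "lmod (Suc e) M" and h: "h : H 0 e" and u: "u : car (Tn e 0 M)"
 shows "act (Suc e) 1 M h (Cartier_compat R p a b M e u) = act e 0 M h u"
proof -
 have Me: "lmod e M" by (rule lmod_mono[OF M]) simp
 have h': "h : H 1 (Suc e)" using H_shift[OF h, of 1] by (simp add: Suc_eq_plus1)
 have S: "\<theta> : H (Suc e) 1" if "\<theta> : H e 0" for \<theta> using H_shift[OF that, of 1] by (simp add: Suc_eq_plus1)
 note c = compat[OF M]
 show ?thesis
  by (rule Tn_agree[OF Me lmod_props(1)[OF M] addf_comp[OF additive_addf[OF c(1)] act(1)[OF M h']] act(1)[OF Me h] u])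
   (simp add: c(2) act(2)[OF M h'] act(2)[OF Me h] S)
qed

lemma unit_bij:
 assumes M: "lmod i M" and L: "addf (Tn i i M) M L" "!!\<theta> m. \<theta> : H i i ==> m : car M ==> L (pt i i M \<theta> m) = \<theta> \<odot>\<^sub>M m"
 shows "bij_betw L (car (Tn i i M)) (car M)"
proof (rule bij_betw_byWitness[where f' = "pt i i M idm"])
 have a: "addf M (Tn i i M) (pt i i M idm)" by (simp add: addf_def pt_closed[OF M H_id] pt_add_right[OF M H_id])
 show "\<forall>u\<in>car (Tn i i M). pt i i M idm (L u) = u"
 proof
  fix u assume u: "u : car (Tn i i M)"
  show "pt i i M idm (L u) = u"
   by (rule Tn_agree[OF M Tn_group[OF M] addf_comp[OF L(1) a] _ u])
    (simp_all add: addf_def L(2) pt_bal[OF M H_id, symmetric] comp_id)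
 qed
 show "\<forall>m\<in>car M. L (pt i i M idm m) = m" by (simp add: L(2)[OF H_id] lmod_props(6)[OF M] del: restrict_apply')
 show "L ` car (Tn i i M) <= car M" using addfD(1)[OF L(1)] by blast
 show "pt i i M idm ` car M <= car (Tn i i M)" using addfD(1)[OF a] by blast
qed

section \<open>Phi-divided modules and the transported structure\<close>

definition divobj :: "('a, 'u) divmod_data => bool" where
 "divobj E \<longleftrightarrow> (\<forall>e. lmod 0 (fst E e) & snd E e : lin_isos (D_level R p a b 0) (Tn 0 1 (fst E (Suc e))) (fst E e))"

abbreviation ai where "ai \<equiv> alpha_iter R p a b"
abbreviation iai where "iai E e \<equiv> inv_into (car (Tn 0 e (fst E e))) (ai E e)"
abbreviation tr where "tr \<equiv> transported_smult R p a b"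

lemma divobjD:
 assumes "divobj E"
 shows "lmod 0 (fst E e)" "snd E e : lin_isos (D_level R p a b 0) (Tn 0 1 (fst E (Suc e))) (fst E e)"
  "lmod 0 (Tn 0 1 (fst E (Suc e)))" "snd E e : lin_maps (D_level R p a b 0) (Tn 0 1 (fst E (Suc e))) (fst E e)"
proof -
 show 1: "lmod 0 (fst E e)" "snd E e : lin_isos (D_level R p a b 0) (Tn 0 1 (fst E (Suc e))) (fst E e)" for e
  using assms by (simp_all add: divobj_def)
 show "lmod 0 (Tn 0 1 (fst E (Suc e)))" by (rule lmod_mono[OF Tn_lmod[OF 1(1)]]) simp
 show "snd E e : lin_maps (D_level R p a b 0) (Tn 0 1 (fst E (Suc e))) (fst E e)" by (rule lin_isosE(1)[OF 1(2)])
qed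

lemmas cmp1 = cmp[where s = 1 and i = 0 and j = 0, unfolded add_0, unfolded Suc_eq_plus1[symmetric]]

abbreviation tma where
 "tma E e \<equiv> tm 0 e (Tn 0 1 (fst E (Suc e))) (fst E e) (snd E e)"

lemma ai_zero:
 assumes E: "divobj E"
 shows "ai E 0 : additive_maps (Tn 0 0 (fst E 0)) (fst E 0)"
  "!!\<theta> m. \<theta> : H 0 0 ==> m : car (fst E 0) ==> ai E 0 (pt 0 0 (fst E 0) \<theta> m) = \<theta> \<odot>\<^sub>(fst E 0) m"
proof -
 note M = divobjD(1)[OF E, of 0]
 have bal: "balanced 0 0 (fst E 0) (fst E 0) (smult (fst E 0))"
  by (rule balancedI) (simp_all add: lmod_props[OF M])
 note l = lift[OF M lmod_props(1)[OF M] bal]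
 show "ai E 0 : additive_maps (Tn 0 0 (fst E 0)) (fst E 0)"
  "!!\<theta> m. \<theta> : H 0 0 ==> m : car (fst E 0) ==> ai E 0 (pt 0 0 (fst E 0) \<theta> m) = \<theta> \<odot>\<^sub>(fst E 0) m"
  using l by simp_all
qed

text \<open>At an image of \<open>cmp\<close> the inverse in the recursion for
  \<open>alpha_iter\<close> cancels; as \<open>cmp\<close> is bijective, this covers every
  element.\<close>

lemma ai_Suc:
 assumes E: "divobj E" and w: "w : car (Tn 0 e (Tn 0 1 (fst E (Suc e))))"
 shows "ai E (Suc e) (cmp 1 0 0 e (fst E (Suc e)) w) = ai E e (tma E e w)"
proof -
 note c = cmp1[OF divobjD(1)[OF E, of "Suc e"], where k = e]
 show ?thesis
  using w bij_inv(3)[OF c(3) w] additive_mapsE(2)[OF c(1) w]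
  by (simp add: compose_def Phi_comp_eq)
qed

lemma ai:
 assumes E: "divobj E"
 shows "ai E e : additive_maps (Tn 0 e (fst E e)) (fst E 0)" (is "?A e")
  "bij_betw (ai E e) (car (Tn 0 e (fst E e))) (car (fst E 0))" (is "?B e")
proof -
 note D = divobjD[OF E]
 have "?A e & ?B e"
 proof (induction e)
  case 0
  show ?case using ai_zero[OF E] unit_bij[OF D(1) additive_addf[OF ai_zero(1)[OF E]] ai_zero(2)[OF E]] by blast
 next
  case (Suc e)
  let ?T = "Tn 0 (Suc e) (fst E (Suc e))" and ?S = "Tn 0 e (Tn 0 1 (fst E (Suc e)))"
  let ?c = "cmp 1 0 0 e (fst E (Suc e))"
  note c = cmp1[OF D(1)[of "Suc e"], where k = e]
  have G: "abelian_group ?S" "abelian_group ?T" using Tn_group[OF D(3)] Tn_group[OF D(1)] by blast+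
  define iv where "iv = (\<lambda>y\<in>car ?T. inv_into (car ?S) ?c y)"
  have iv: "iv : additive_maps ?T ?S" unfolding iv_def by (rule inv_into_additive[OF c(1) c(3) G])
  have bi: "bij_betw iv (car ?T) (car ?S)"
   using bij_betw_inv_into[OF c(3)] unfolding iv_def by (rule bij_betw_cong[THEN iffD1, rotated]) simp
  note t = tensor_map(1)[OF D(3) D(1) D(4), of e e] and tb = tm_bij[OF D(3) D(1) D(2), of e e]
  have eq: "ai E (Suc e) = compose (car ?T) (ai E e) (compose (car ?T) (tma E e) iv)"
   by (simp add: compose_def Phi_comp_eq iv_def cong: restrict_cong)
  have 1: "compose (car ?T) (tma E e) iv : additive_maps ?T (Tn 0 e (fst E e))"
   by (rule compose_additive[OF iv t G(2)])
  have 2: "bij_betw (compose (car ?T) (tma E e) iv) (car ?T) (car (Tn 0 e (fst E e)))"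
   by (rule bij_betw_compose[OF bi tb])
  show ?case unfolding eq
   using compose_additive[OF 1 conjunct1[OF Suc] G(2)] bij_betw_compose[OF 2 conjunct2[OF Suc]] by blast
 qed
 then show "?A e" "?B e" by blast+
qed

lemma ai_addf: "divobj E ==> addf (Tn 0 e (fst E e)) (fst E 0) (ai E e)"
 by (rule additive_addf[OF ai(1)])

lemmas iai = bij_inv[OF ai(2)]

text \<open>One element \<open>w\<close> of the twofold tensor product represents \<open>m\<close>
  at the levels \<open>e\<close> and \<open>Suc e\<close> simultaneously, through \<open>tma\<close>
  and through \<open>cmp\<close>.\<close>

lemma iai_Suc:
 assumes E: "divobj E" and m: "m : car (fst E 0)"
 obtains w where "w : car (Tn 0 e (Tn 0 1 (fst E (Suc e))))" "iai E e m = tma E e w"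
  "iai E (Suc e) m = cmp 1 0 0 e (fst E (Suc e)) w"
proof -
 note D = divobjD[OF E]
 note tb = bij_inv[OF tm_bij[OF D(3) D(1) D(2), of e e]]
 note c = cmp1[OF D(1)[of "Suc e"], where k = e]
 define w where "w = inv_into (car (Tn 0 e (Tn 0 1 (fst E (Suc e))))) (tma E e) (iai E e m)"
 have w: "w : car (Tn 0 e (Tn 0 1 (fst E (Suc e))))" "tma E e w = iai E e m"
  using tb(1,2)[OF iai(1)[OF E m]] by (simp_all add: w_def)
 have "ai E (Suc e) (cmp 1 0 0 e (fst E (Suc e)) w) = m"
  unfolding ai_Suc[OF E w(1)] w(2) by (rule iai(2)[OF E m])
 then have "iai E (Suc e) m = cmp 1 0 0 e (fst E (Suc e)) w"
  using iai(3)[OF E additive_mapsE(2)[OF c(1) w(1)]] by simp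
 then show ?thesis using that w by simp
qed

text \<open>Both \<open>cmp\<close> and \<open>tma\<close> respect the action of \<open>d\<close>,
  so both sides come from the action of \<open>d\<close> on the common representative
  \<open>w\<close>.\<close>

lemma tr_step:
 assumes E: "divobj E" and d: "d : H e e" and m: "m : car (fst E 0)"
 shows "ai E (Suc e) (d \<odot>\<^sub>(Tn 0 (Suc e) (fst E (Suc e))) iai E (Suc e) m) = ai E e (d \<odot>\<^sub>(Tn 0 e (fst E e)) iai E e m)"
proof -
 note D = divobjD[OF E]
 note c = cmp1[OF D(1)[of "Suc e"], where k = e]
 obtain w where w: "w : car (Tn 0 e (Tn 0 1 (fst E (Suc e))))" "iai E e m = tma E e w"
  "iai E (Suc e) m = cmp 1 0 0 e (fst E (Suc e)) w" by (rule iai_Suc[OF E m])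
 show ?thesis
  unfolding w(2,3) c(4)[OF d w(1), symmetric] ai_Suc[OF E Tn_smult(1)[OF D(3) d w(1)]] tm_smult[OF D(3) D(1) D(4) d w(1)] ..
qed

text \<open>By \<open>tr_step\<close> the value is the same at all levels that contain
  \<open>d\<close>, so the definite description has exactly one solution.\<close>

lemma tr_eq:
 assumes E: "divobj E" and d: "d : H e e" and m: "m : car (fst E 0)"
 shows "tr E d m = ai E e (d \<odot>\<^sub>(Tn 0 e (fst E e)) iai E e m)"
proof -
 let ?F = "%e. ai E e (d \<odot>\<^sub>(Tn 0 e (fst E e)) iai E e m)"
 have mono: "?F k = ?F i" if "i \<le> k" "d : H i i" for i k
  using that(1)
 proof (induction k rule: dec_induct)
  case (step k)
  show ?case using tr_step[OF E H_mono[OF step(1) that(2)] m] step(3) by simp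
 qed simp
 have eq: "?F e = ?F k" if "d : H k k" for k
 proof (cases "e \<le> k")
  case True then show ?thesis by (rule mono[OF _ d, symmetric])
 next
  case False then show ?thesis by (intro mono[OF _ that]) simp
 qed
 show ?thesis unfolding transported_smult_def add_0
 proof (rule the_equality)
  show "\<forall>k. d : H k k \<longrightarrow> ?F e = ?F k" using eq by blast
  show "y = ?F e" if "\<forall>k. d : H k k \<longrightarrow> y = ?F k" for y using that d by blast
 qed
qed

lemma tr_ai:
 assumes E: "divobj E" and d: "d : H e e" and v: "v : car (Tn 0 e (fst E e))"
 shows "tr E d (ai E e v) = ai E e (d \<odot>\<^sub>(Tn 0 e (fst E e)) v)"
 using tr_eq[OF E d addfD(1)[OF ai_addf[OF E] v]] iai(3)[OF E v] by simp

definition FM :: "('a, 'u) divmod_data => ('a => 'a, 'u) module" where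
 "FM E = (fst E 0)\<lparr>smult := tr E\<rparr>"

lemma FM_simps [simp]:
 "car (FM E) = car (fst E 0)" "add (FM E) = add (fst E 0)" "\<zero>\<^sub>(FM E) = \<zero>\<^sub>(fst E 0)" "smult (FM E) = tr E"
 by (simp_all add: FM_def)

text \<open>Elements of the underlying group are written as \<open>ai E i v\<close>; by
  \<open>tr_ai\<close> the module laws become those of the tensor product at level
  \<open>i\<close>.\<close>

lemma FM_lmod: assumes E: "divobj E" shows "lmod i (FM E)"
proof (rule lmodI)
 note Ti = lmod_props[OF Tn_lmod[OF divobjD(1)[OF E, of i], of i]]
 have rep: "\<exists>v\<in>car (Tn 0 i (fst E i)). m = ai E i v" if "m : car (fst E 0)" for m
  by (rule bexI[where x = "iai E i m"]) (rule iai(2)[OF E that, symmetric] iai(1)[OF E that])+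
 note aa = addfD[OF ai_addf[OF E]]
 show "abelian_group (FM E)"
  using lmod_props(1)[OF divobjD(1)[OF E, of 0]]
  by (simp add: FM_def abelian_group_def abelian_monoid_def abelian_group_axioms_def)
 fix c m assume c: "c : H i i" and "m : car (FM E)"
 then obtain v where v: "v : car (Tn 0 i (fst E i))" "m = ai E i v" using rep by auto
 show "c \<odot>\<^sub>(FM E) m : car (FM E)" using v c by (simp add: tr_ai[OF E c] aa(1) Ti(2))
 { fix d assume d: "d : H i i"
  show "op_add R c d \<odot>\<^sub>(FM E) m = c \<odot>\<^sub>(FM E) m \<oplus>\<^sub>(FM E) d \<odot>\<^sub>(FM E) m"
   using v c d by (simp add: tr_ai[OF E] H_add Ti(2,3) aa(2)[symmetric])
  show "(c \<cdot> d) \<odot>\<^sub>(FM E) m = c \<odot>\<^sub>(FM E) (d \<odot>\<^sub>(FM E) m)"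
   using v c d by (simp add: tr_ai[OF E] H_comp Ti(2,5)) }
 { fix n assume "n : car (FM E)"
  then obtain w where w: "w : car (Tn 0 i (fst E i))" "n = ai E i w" using rep by auto
  show "c \<odot>\<^sub>(FM E) (m \<oplus>\<^sub>(FM E) n) = c \<odot>\<^sub>(FM E) m \<oplus>\<^sub>(FM E) c \<odot>\<^sub>(FM E) n"
   using v w c abelian_monoid.a_closed[OF abelian_group.axioms(1)[OF Ti(1)] v(1) w(1)]
   by (simp add: tr_ai[OF E c] Ti(2,4) aa(2)[symmetric]) }
next
 note Ti = lmod_props[OF Tn_lmod[OF divobjD(1)[OF E, of i], of i]]
 fix m assume "m : car (FM E)"
 then have m: "m : car (fst E 0)" by simp
 show "idm \<odot>\<^sub>(FM E) m = m" unfolding FM_simps tr_eq[OF E H_id m, of i] Ti(6)[OF iai(1)[OF E m]] by (rule iai(2)[OF E m])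
qed

end

text \<open>From here on the recursion is used only in the forms \<open>ai_zero\<close> and
  \<open>ai_Suc\<close>.\<close>

declare alpha_iter.simps [simp del]

section \<open>The two categories\<close>

lemma compose_eq_iff: "compose A f g = compose A f' g' \<longleftrightarrow> (\<forall>x\<in>A. f (g x) = f' (g' x))"
 by (auto simp: compose_def restrict_def fun_eq_iff)

lemma lin_maps_ext:
 assumes "f : lin_maps A M N" "g : lin_maps A M N" "!!x. x : car M ==> f x = g x"
 shows "f = g"
 using assms by (intro extensionalityI[of f "car M" g]) (auto simp: lin_maps_def dest: additive_mapsE(1))

lemma lin_maps_apply:
 assumes "f : lin_maps A M N"
 shows "!!x. x : car M ==> f x : car N" "f : extensional (car M)"
  "!!c x. c : car A ==> x : car M ==> f (c \<odot>\<^sub>M x) = c \<odot>\<^sub>N f x" "f : additive_maps M N"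
 using assms by (auto simp: lin_maps_def dest: additive_mapsE)

lemma lin_maps_compose:
 assumes L: "left_module A L" and f: "f : lin_maps A L M" and g: "g : lin_maps A M N"
 shows "compose (car L) g f : lin_maps A L N"
proof -
 interpret L: left_module A L by fact
 have "compose (car L) g f : additive_maps L N"
  by (rule compose_additive[OF lin_maps_apply(4)[OF f] lin_maps_apply(4)[OF g] L.M.abelian_group_axioms])
 then show ?thesis
  using L.smult_closed lin_maps_apply[OF f] lin_maps_apply[OF g] by (simp add: lin_maps_def compose_def)
qed

lemma lin_maps_compose_id:
 assumes "f : lin_maps A L M"
 shows "compose (car L) f (\<lambda>x\<in>car L. x) = f" "compose (car L) (\<lambda>x\<in>car M. x) f = f"
 using lin_maps_apply(1,2)[OF assms]
 by (auto intro!: extensionalityI[of _ "car L"] simp: compose_def)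

lemma lin_maps_compose_assoc:
 assumes "f : lin_maps A L M"
 shows "compose (car L) (compose (car M) h g) f = compose (car L) h (compose (car L) g f)"
 unfolding compose_def by (rule restrict_ext) (simp add: lin_maps_apply(1)[OF assms])

lemma left_mod_cat_simps:
 "V : obj (left_mod_cat A) \<longleftrightarrow> left_module A V" "arr (left_mod_cat A) V W = lin_maps A V W"
 "ident (left_mod_cat A) V = (\<lambda>x\<in>car V. x)" "arr_comp (left_mod_cat A) V W Z g f = compose (car V) g f"
 by (simp_all add: left_mod_cat_def)

context frob_levels
begin

lemma left_mod_cat_category: "is_category (left_mod_cat A)"
 unfolding is_category_def left_mod_cat_simps
 by (intro conjI ballI)
  (blast intro: id_lin lin_maps_compose dest: left_mod_cat_simps(1)[THEN iffD1] |
   rule lin_maps_compose_id, assumption | rule lin_maps_compose_assoc, assumption)+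

lemma left_mod_cat_iso:
 assumes V: "left_module A V" and W: "left_module A W" and f: "f : lin_isos A V W"
 shows "iso_arr (left_mod_cat A) V W f"
proof -
 have fl: "f : lin_maps A V W" and b: "bij_betw f (car V) (car W)" using f by (auto simp: lin_isos_def)
 let ?g = "\<lambda>y\<in>car W. inv_into (car V) f y"
 have g: "?g : lin_maps A W V" using lin_isos_inv[OF V W f] by (simp add: lin_isos_def)
 have "compose (car V) ?g f = (\<lambda>x\<in>car V. x)" "compose (car W) f ?g = (\<lambda>x\<in>car W. x)"
  unfolding compose_def by (rule restrict_ext, simp add: bij_inv[OF b] lin_maps_apply(1)[OF fl])+
 then show ?thesis unfolding iso_arr_def left_mod_cat_simps using fl g by blast
qed

definition divarr :: "('a, 'u) divmod_data => ('a, 'u) divmod_data => (nat => 'u => 'u) => bool" where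
 "divarr E E' \<phi> \<longleftrightarrow> (\<forall>e. \<phi> e : lin_maps (D_level R p a b 0) (fst E e) (fst E' e) &
  (\<forall>w\<in>car (Tn 0 1 (fst E (Suc e))).
   \<phi> e (snd E e w) = snd E' e (tm 0 1 (fst E (Suc e)) (fst E' (Suc e)) (\<phi> (Suc e)) w)))"

lemma divmod_cat_simps:
 "E : obj (Phi_divmod_cat R p a b) \<longleftrightarrow> divobj E"
 "\<phi> : arr (Phi_divmod_cat R p a b) E E' \<longleftrightarrow> divarr E E' \<phi>"
 "ident (Phi_divmod_cat R p a b) E = (%e. \<lambda>x\<in>car (fst E e). x)"
 "arr_comp (Phi_divmod_cat R p a b) E E' E'' \<psi> \<phi> = (%e. compose (car (fst E e)) (\<psi> e) (\<phi> e))"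
 by (cases E; cases E'; cases E''; simp add: Phi_divmod_cat_def divobj_def divarr_def compose_eq_iff)+

lemma divarrD:
 assumes "divarr E E' \<phi>"
 shows "\<phi> e : lin_maps (D_level R p a b 0) (fst E e) (fst E' e)"
  "!!w. w : car (Tn 0 1 (fst E (Suc e))) ==>
   \<phi> e (snd E e w) = snd E' e (tm 0 1 (fst E (Suc e)) (fst E' (Suc e)) (\<phi> (Suc e)) w)"
 using assms by (simp_all add: divarr_def)

lemma divmod_cat_category: "is_category (Phi_divmod_cat R p a b :: (('a, 'u) divmod_data, nat => 'u => 'u) category)"
 unfolding is_category_def divmod_cat_simps
proof (intro conjI ballI)
 fix E :: "('a, 'u) divmod_data" assume "E : obj (Phi_divmod_cat R p a b)"
 then have E: "divobj E" by (simp add: divmod_cat_simps)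
 note D = divobjD[OF E]
 show "divarr E E (%e. \<lambda>x\<in>car (fst E e). x)"
  unfolding divarr_def
  using id_lin[OF D(1)] tm_id[OF D(1) id_lin[OF D(1)]] lin_mapsD(2)[OF D(4)] by simp
next
 fix E E' E'' :: "('a, 'u) divmod_data" and \<phi> \<psi>
 assume "E : obj (Phi_divmod_cat R p a b)" "E' : obj (Phi_divmod_cat R p a b)" "E'' : obj (Phi_divmod_cat R p a b)"
  and "\<phi> : arr (Phi_divmod_cat R p a b) E E'" "\<psi> : arr (Phi_divmod_cat R p a b) E' E''"
 then have E: "divobj E" "divobj E'" "divobj E''" and f: "divarr E E' \<phi>" "divarr E' E'' \<psi>" by (simp_all add: divmod_cat_simps)
 note D = divobjD[OF E(1)] and D' = divobjD[OF E(2)] and D'' = divobjD[OF E(3)]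
 note f1 = divarrD[OF f(1)] and f2 = divarrD[OF f(2)]
 show "divarr E E'' (%e. compose (car (fst E e)) (\<psi> e) (\<phi> e))"
  unfolding divarr_def
 proof (intro allI conjI ballI)
  show c: "compose (car (fst E e)) (\<psi> e) (\<phi> e) : lin_maps (D_level R p a b 0) (fst E e) (fst E'' e)" for e
   by (rule lin_maps_compose[OF D(1) f1(1) f2(1)])
  fix e w assume w: "w : car (Tn 0 1 (fst E (Suc e)))"
  have "tm 0 1 (fst E' (Suc e)) (fst E'' (Suc e)) (\<psi> (Suc e)) (tm 0 1 (fst E (Suc e)) (fst E' (Suc e)) (\<phi> (Suc e)) w)
   = tm 0 1 (fst E (Suc e)) (fst E'' (Suc e)) (compose (car (fst E (Suc e))) (\<psi> (Suc e)) (\<phi> (Suc e))) w"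
   by (rule tm_comp[OF D(1) D'(1) D''(1) f1(1) f2(1) c _ w]) (simp add: compose_def)
  then show "compose (car (fst E e)) (\<psi> e) (\<phi> e) (snd E e w) =
    snd E'' e (tm 0 1 (fst E (Suc e)) (fst E'' (Suc e)) (compose (car (fst E (Suc e))) (\<psi> (Suc e)) (\<phi> (Suc e))) w)"
   using lin_mapsD(2)[OF D(4) w] f1(2)[OF w] f2(2)[OF tm_closed[OF D(1) D'(1) f1(1) w]] by (simp add: compose_def)
 qed
next
 fix E E' :: "('a, 'u) divmod_data" and \<phi>
 assume "\<phi> : arr (Phi_divmod_cat R p a b) E E'"
 then have "divarr E E' \<phi>" by (simp add: divmod_cat_simps)
 note f = divarrD(1)[OF this]
 show "(%e. compose (car (fst E e)) (\<phi> e) (\<lambda>x\<in>car (fst E e). x)) = \<phi>"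
  "(%e. compose (car (fst E e)) (\<lambda>x\<in>car (fst E' e). x) (\<phi> e)) = \<phi>"
  using lin_maps_compose_id[OF f] by auto
next
 fix E E' :: "('a, 'u) divmod_data" and \<phi> and \<psi> \<chi> :: "nat => 'u => 'u"
 assume "\<phi> : arr (Phi_divmod_cat R p a b) E E'"
 then have "divarr E E' \<phi>" by (simp add: divmod_cat_simps)
 note f = divarrD(1)[OF this]
 show "(%e. compose (car (fst E e)) (compose (car (fst E' e)) (\<chi> e) (\<psi> e)) (\<phi> e)) =
   (%e. compose (car (fst E e)) (\<chi> e) (compose (car (fst E e)) (\<psi> e) (\<phi> e)))"
  using lin_maps_compose_assoc[OF f] by auto
qed

text \<open>The inverses taken level by level form a morphism: the square of \<open>\<phi>\<close>
  is applied to the image of \<open>w\<close> under the inverse at level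
  \<open>Suc e\<close>.\<close>

lemma divmod_cat_iso:
 assumes E: "divobj E" and E': "divobj E'" and f: "divarr E E' \<phi>"
  and iso: "!!e. \<phi> e : lin_isos (D_level R p a b 0) (fst E e) (fst E' e)"
 shows "iso_arr (Phi_divmod_cat R p a b) E E' \<phi>"
proof -
 note D = divobjD[OF E] and D' = divobjD[OF E'] and fD = divarrD[OF f] and b = bij_inv[OF lin_isosE(2)[OF iso]]
 define \<psi> where "\<psi> e = (\<lambda>y\<in>car (fst E' e). inv_into (car (fst E e)) (\<phi> e) y)" for e
 have g: "\<psi> e : lin_maps (D_level R p a b 0) (fst E' e) (fst E e)" for e
  unfolding \<psi>_def by (rule lin_isosE(1)[OF lin_isos_inv[OF D(1) D'(1) iso]])
 have gf: "\<psi> e (\<phi> e x) = x" if "x : car (fst E e)" for e x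
  using that lin_mapsD(2)[OF fD(1)] by (simp add: \<psi>_def b(3))
 have fg: "\<phi> e (\<psi> e y) = y" if "y : car (fst E' e)" for e y using that by (simp add: \<psi>_def b(2))
 have "divarr E' E \<psi>"
  unfolding divarr_def
 proof (intro allI conjI ballI)
  fix e w assume w: "w : car (Tn 0 1 (fst E' (Suc e)))"
  let ?v = "tm 0 1 (fst E' (Suc e)) (fst E (Suc e)) (\<psi> (Suc e)) w"
  have v: "?v : car (Tn 0 1 (fst E (Suc e)))" by (rule tm_closed[OF D'(1) D(1) g w])
  have "tm 0 1 (fst E (Suc e)) (fst E' (Suc e)) (\<phi> (Suc e)) ?v
    = tm 0 1 (fst E' (Suc e)) (fst E' (Suc e)) (\<lambda>x\<in>car (fst E' (Suc e)). x) w"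
   by (rule tm_comp[OF D'(1) D(1) D'(1) g fD(1) id_lin[OF D'(1)] _ w]) (simp add: fg)
  also have "\<dots> = w" by (rule tm_id[OF D'(1) id_lin[OF D'(1)] _ w]) simp
  finally have "\<phi> e (snd E e ?v) = snd E' e w" using fD(2)[OF v] by simp
  then show "\<psi> e (snd E' e w) = snd E e ?v" using gf[OF lin_mapsD(2)[OF D(4) v]] by simp
 qed (rule g)
 moreover have "compose (car (fst E e)) (\<psi> e) (\<phi> e) = (\<lambda>x\<in>car (fst E e). x)"
  "compose (car (fst E' e)) (\<phi> e) (\<psi> e) = (\<lambda>x\<in>car (fst E' e). x)" for e
  unfolding compose_def by (rule restrict_ext, simp add: fg gf)+
 ultimately show ?thesis unfolding iso_arr_def divmod_cat_simps using f by (intro conjI bexI[of _ \<psi>]) (simp_all add: divmod_cat_simps)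
qed

section \<open>The two compositions\<close>

lemma act_additive:
 assumes "lmod i M" "h : H j i" shows "act i j M h : additive_maps (Tn i j M) M"
 by (rule additive_mapsI[OF _ addfD[OF act(1)[OF assms]]])
  (simp_all add: act_def hom_lift_def tensor_lift_def hom_tensor_def)

abbreviation TO :: "('a => 'a, 'u) module => ('a, 'u) divmod_data" where
 "TO M \<equiv> (%e. Tn e 0 M, canonical_alpha R p a b M)"

lemma TO_divobj: assumes "!!e. lmod e M" shows "divobj (TO M)"
 unfolding divobj_def using Tn_lmod[OF assms] canonical_alpha(1)[OF assms] by simp

lemmas TO_D = divobjD[OF TO_divobj, unfolded fst_conv snd_conv]

text \<open>The canonical map from the tensor product with the Cartier module back to
  \<open>M\<close>: the tensor of \<open>\<theta>\<close> with the tensor of \<open>\<psi>\<close>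
  and \<open>m\<close> goes to \<open>(\<theta> \<cdot> \<psi>) \<odot> m\<close>.\<close>

definition mu :: "nat => ('a => 'a, 'u) module => 'u => 'u" where
 "mu e M = hom_lift R p a b 0 e (Tn e 0 M) M (act e 0 M)"

lemma mu:
 assumes M: "lmod e M"
 shows "addf (Tn 0 e (Tn e 0 M)) M (mu e M)"
  "!!\<theta> y. \<theta> : H 0 e ==> y : car (Tn e 0 M) ==> mu e M (pt 0 e (Tn e 0 M) \<theta> y) = act e 0 M \<theta> y"
proof -
 have "balanced 0 e (Tn e 0 M) M (act e 0 M)"
  by (rule balancedI) (simp_all add: addfD[OF act(1)[OF M]] act_add[OF M] act_smult[OF M])
 note l = lift[OF Tn_lmod[OF M] lmod_props(1)[OF M] this]
 show "addf (Tn 0 e (Tn e 0 M)) M (mu e M)"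
  "!!\<theta> y. \<theta> : H 0 e ==> y : car (Tn e 0 M) ==> mu e M (pt 0 e (Tn e 0 M) \<theta> y) = act e 0 M \<theta> y"
  unfolding mu_def using l by (auto intro: additive_addf)
qed

text \<open>Contraction at level \<open>e\<close> equals contraction after the compatibility map,
  and there \<open>canonical_alpha\<close> turns into \<open>cmp\<close>. The result is the
  inductive step of \<open>eta_ai\<close>.\<close>

lemma act_canonical:
 assumes M: "!!e. lmod e M" and th: "\<theta> : H 0 e" and x: "x : car (Tn 0 1 (Tn (Suc e) 0 M))"
 shows "act e 0 M \<theta> (canonical_alpha R p a b M e x) = mu (Suc e) M (mv 0 1 (Suc e) (Tn (Suc e) 0 M) \<theta> x)"
proof -
 let ?T = "Tn (Suc e) 0 M"
 have T: "lmod 0 ?T" by (rule Tn_lmod[OF M])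
 have th': "\<theta> : H 1 (Suc e)" using H_shift[OF th, of 1] by (simp add: Suc_eq_plus1)
 note c = cmp[OF M[of "Suc e"], where s = 0 and j = 0 and k = 1, unfolded add_0_right]
 have "act e 0 M \<theta> (canonical_alpha R p a b M e x) = act (Suc e) 1 M \<theta> (cmp 0 (Suc e) 0 1 M x)"
  using act_compat[OF M th lin_mapsD(2)[OF lin_isosE(1)[OF canonical_alpha(1)[OF M]] x]]
  unfolding canonical_alpha(2)[OF M x] by simp
 also have "\<dots> = mu (Suc e) M (mv 0 1 (Suc e) ?T \<theta> x)"
  by (rule Tn_agree[OF T lmod_props(1)[OF M[of 0]] addf_comp[OF additive_addf[OF c(1)] act(1)[OF M th']]
     addf_comp[OF mv(1)[OF T th'] mu(1)[OF M]] x])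
   (simp add: c(2) mv(2)[OF T th'] mu(2)[OF M] act_mv[OF M _ th'] H_comp[OF _ th'])
 finally show ?thesis .
qed

text \<open>Turns the iterated maps of the object built from \<open>M\<close> into the explicit
  \<open>mu\<close>. In \<open>eta\<close>, the linearity of \<open>mu\<close> over the operators of
  level \<open>e\<close> shows that the transported structure is the original one.\<close>

lemma eta_ai:
 assumes M: "!!e. lmod e M" and u: "u : car (Tn 0 e (Tn e 0 M))"
 shows "act 0 0 M idm (ai (TO M) e u) = mu e M u"
 using u
proof (induction e arbitrary: u)
 case 0
 note E = TO_divobj[OF M]
 show ?case
  by (rule Tn_agree[OF TO_D(1)[OF M] lmod_props(1)[OF M[of 0]]
     addf_comp[OF ai_addf[OF E, of 0, unfolded fst_conv] act(1)[OF M H_id]] mu(1)[OF M] 0])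
   (simp add: ai_zero(2)[OF E, unfolded fst_conv] act_smult[OF M H_id, symmetric] comp_id(1) mu(2)[OF M])
next
 case (Suc e)
 note E = TO_divobj[OF M]
 note D = TO_D[OF M]
 let ?T = "Tn (Suc e) 0 M"
 let ?al = "canonical_alpha R p a b M e" and ?t = "tm 0 e (Tn 0 1 ?T) (Tn e 0 M) (canonical_alpha R p a b M e)"
 note c = cmp1[OF D(1)[of "Suc e"], where k = e]
 obtain w where w: "w : car (Tn 0 e (Tn 0 1 ?T))" "u = cmp 1 0 0 e ?T w"
  using bij_inv(1,2)[OF c(3) Suc.prems] by metis
 have "act 0 0 M idm (ai (TO M) (Suc e) u) = act 0 0 M idm (ai (TO M) e (?t w))"
  unfolding w(2) using ai_Suc[OF E, unfolded fst_conv snd_conv, OF w(1)] by simp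
 also have "\<dots> = mu e M (?t w)" by (rule Suc.IH[OF tm_closed[OF D(3) D(1) D(4) w(1)]])
 also have "\<dots> = mu (Suc e) M (cmp 1 0 0 e ?T w)"
  by (rule Tn_agree[OF D(3) lmod_props(1)[OF M[of 0]] addf_comp[OF tm_addf[OF D(3) D(1) D(4)] mu(1)[OF M]]
     addf_comp[OF additive_addf[OF c(1)] mu(1)[OF M]] w(1)])
   (simp add: tensor_map(2)[OF D(3) D(1) D(4)] mu(2)[OF M] lin_mapsD(2)[OF D(4)] act_canonical[OF M] c(2))
 finally show ?case unfolding w(2) .
qed

lemma eta:
 assumes M: "!!e. lmod e M"
 shows "act 0 0 M idm : additive_maps (FM (TO M)) M"
  "bij_betw (act 0 0 M idm) (car (FM (TO M))) (car M)"
  "!!d x. d : H e e ==> x : car (FM (TO M)) ==> act 0 0 M idm (d \<odot>\<^sub>(FM (TO M)) x) = d \<odot>\<^sub>M act 0 0 M idm x"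
proof -
 note E = TO_divobj[OF M]
 show "act 0 0 M idm : additive_maps (FM (TO M)) M"
  using act_additive[OF M H_id] by (simp add: additive_maps_def)
 have "bij_betw (act 0 0 M idm) (car (Tn 0 0 M)) (car M)"
  by (rule unit_bij[OF M act(1)[OF M H_id]]) (simp add: act(2)[OF M H_id] comp_id(1))
 then show "bij_betw (act 0 0 M idm) (car (FM (TO M))) (car M)" by simp
 fix d x assume d: "d : H e e" and "x : car (FM (TO M))"
 then have x: "x : car (fst (TO M) 0)" by simp
 define v where "v = iai (TO M) e x"
 have v: "v : car (Tn 0 e (Tn e 0 M))" "ai (TO M) e v = x"
  using iai(1,2)[OF E x, of e] by (simp_all only: v_def fst_conv)
 have T: "lmod 0 (Tn e 0 M)" by (rule Tn_lmod[OF M])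
 have "mu e M (d \<odot>\<^sub>(Tn 0 e (Tn e 0 M)) v) = d \<odot>\<^sub>M mu e M v"
  by (rule Tn_agree[OF T lmod_props(1)[OF M[of 0]] addf_comp[OF addf_Tn_smult[OF T d] mu(1)[OF M]]
     addf_comp[OF mu(1)[OF M] addf_smult[OF M d]] v(1)])
   (simp add: Tn_smult(3)[OF T d] mu(2)[OF M] H_comp[OF _ d] smult_act[OF M _ d])
 moreover have "tr (TO M) d x = ai (TO M) e (d \<odot>\<^sub>(Tn 0 e (Tn e 0 M)) v)"
  using tr_ai[OF E d, unfolded fst_conv, OF v(1)] v(2) by simp
 ultimately show "act 0 0 M idm (d \<odot>\<^sub>(FM (TO M)) x) = d \<odot>\<^sub>M act 0 0 M idm x"
  using eta_ai[OF M v(1)] eta_ai[OF M Tn_smult(1)[OF T d v(1)]] v(2) by simp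
qed

lemma iai_add:
 assumes E: "divobj E" and m: "m : car (fst E 0)" "n : car (fst E 0)"
 shows "iai E e (m \<oplus>\<^sub>(fst E 0) n) = iai E e m \<oplus>\<^sub>(Tn 0 e (fst E e)) iai E e n"
proof -
 interpret T: abelian_group "Tn 0 e (fst E e)" by (rule Tn_group[OF divobjD(1)[OF E]])
 note i = iai[OF E]
 show ?thesis
  using i(3)[OF T.a_closed[OF i(1)[OF m(1)] i(1)[OF m(2)]]] i(2)[OF m(1)] i(2)[OF m(2)]
   addfD(2)[OF ai_addf[OF E] i(1)[OF m(1)] i(1)[OF m(2)]] by simp
qed

lemma iai_smult:
 assumes E: "divobj E" and d: "d : H e e" and m: "m : car (fst E 0)"
 shows "iai E e (tr E d m) = d \<odot>\<^sub>(Tn 0 e (fst E e)) iai E e m"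
 unfolding tr_eq[OF E d m] by (rule iai(3)[OF E Tn_smult(1)[OF divobjD(1)[OF E] d iai(1)[OF E m]]])

text \<open>Pulls \<open>m\<close> back to the tensor product at level \<open>e\<close> and
  contracts with \<open>h\<close>. This compares the Cartier module of the reconstructed module with
  the given component at \<open>e\<close>.\<close>

definition eps :: "('a, 'u) divmod_data => nat => 'u => 'u" where
 "eps E e = hom_lift R p a b e 0 (FM E) (fst E e) (%h m. act 0 e (fst E e) h (iai E e m))"

lemma eps:
 assumes E: "divobj E"
 shows "eps E e : additive_maps (Tn e 0 (FM E)) (fst E e)"
  "!!h m. h : H e 0 ==> m : car (fst E 0) ==> eps E e (pt e 0 (FM E) h m) = act 0 e (fst E e) h (iai E e m)"
  "eps E e : lin_isos (D_level R p a b 0) (Tn e 0 (FM E)) (fst E e)"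
proof -
 note N = FM_lmod[OF E] and D = divobjD[OF E]
 let ?f = "%h m. act 0 e (fst E e) h (iai E e m)"
 note i = iai[OF E]
 have bal: "balanced e 0 (FM E) (fst E e) ?f"
  by (rule balancedI)
   (simp_all add: addfD[OF act(1)[OF D(1)]] i(1) act_add[OF D(1)] iai_add[OF E] iai_smult[OF E] act_smult[OF D(1)])
 note l = lift[OF N lmod_props(1)[OF D(1)] bal, folded eps_def]
 show 1: "eps E e : additive_maps (Tn e 0 (FM E)) (fst E e)" by (rule l(1))
 show 2: "!!h m. h : H e 0 ==> m : car (fst E 0) ==> eps E e (pt e 0 (FM E) h m) = act 0 e (fst E e) h (iai E e m)"
  by (rule l(2)) simp_all
 \<comment> \<open>The map back sends \<open>x\<close> to the image under \<open>ai E e\<close> of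
   the tensor of \<open>k\<close> and \<open>x\<close>. On values of \<open>eps\<close> it is the
   transported action of \<open>k \<cdot> h\<close>.\<close>
 have inj: "inj_on (eps E e) (car (Tn e 0 (FM E)))"
  unfolding eps_def
 proof (rule morita_inj[OF N lmod_props(1)[OF D(1)] bal, where s = "%k x. ai E e (pt 0 e (fst E e) k x)"])
  fix k x y assume k: "k : H 0 e" and x: "x : car (fst E e)"
  show "ai E e (pt 0 e (fst E e) k x) : car (FM E)"
   using addfD(1)[OF ai_addf[OF E] pt_closed[OF D(1) k x]] by simp
  assume y: "y : car (fst E e)"
  show "ai E e (pt 0 e (fst E e) k (x \<oplus>\<^sub>(fst E e) y)) = ai E e (pt 0 e (fst E e) k x) \<oplus>\<^sub>(FM E) ai E e (pt 0 e (fst E e) k y)"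
   using addfD(2)[OF ai_addf[OF E] pt_closed[OF D(1) k x] pt_closed[OF D(1) k y]] pt_add_right[OF D(1) k x y] by simp
 next
  fix k h m assume k: "k : H 0 e" and h: "h : H e 0" and "m : car (FM E)"
  then have m: "m : car (fst E 0)" by simp
  note kh = H_comp[OF h k]
  show "ai E e (pt 0 e (fst E e) k (act 0 e (fst E e) h (iai E e m))) = (k \<cdot> h) \<odot>\<^sub>(FM E) m"
   unfolding pt_act[OF D(1) h k i(1)[OF m]] mv_self[OF D(1) kh i(1)[OF m]] by (simp add: tr_eq[OF E kh m])
 qed
 have "eps E e ` car (Tn e 0 (FM E)) = car (fst E e)"
 proof (intro equalityI subsetI)
  fix x assume x: "x : car (fst E e)"
  interpret Me: abelian_group "fst E e" by (rule lmod_props(1)[OF D(1)])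
  \<comment> \<open>With the identity replaced by \<open>g \<cdot> h\<close>, the result is the
    value of \<open>eps\<close> at the tensor of \<open>g\<close> with the image under
    \<open>ai E e\<close> of the tensor of \<open>h\<close> and \<open>x\<close>.\<close>
  have "idm \<odot>\<^sub>(fst E e) x : eps E e ` car (Tn e 0 (FM E))"
  proof (rule trace_image[OF 1 Tn_group[OF N] lmod_props(1)[OF D(1)], where F = "%t. t \<odot>\<^sub>(fst E e) x"
     and w = "%g h. pt e 0 (FM E) g (ai E e (pt 0 e (fst E e) h x))"])
   have "op_add R zero_map zero_map = zero_map" unfolding op_add_def by (rule restrict_ext) simp
   then have "zero_map \<odot>\<^sub>(fst E e) x \<oplus>\<^sub>(fst E e) zero_map \<odot>\<^sub>(fst E e) x = zero_map \<odot>\<^sub>(fst E e) x"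
    using lmod_props(3)[OF D(1) H_zero H_zero x] by simp
   then show "zero_map \<odot>\<^sub>(fst E e) x = \<zero>\<^sub>(fst E e)"
    by (rule Me.add_cancel_iff_zero[rotated 2]) (rule lmod_props(2)[OF D(1) H_zero x])+
   fix t h g assume t: "t : H 0 0" and h: "h : H 0 e" and g: "g : H e 0"
   note px = pt_closed[OF D(1) h x]
   have c: "ai E e (pt 0 e (fst E e) h x) : car (fst E 0)" by (rule addfD(1)[OF ai_addf[OF E] px])
   have "eps E e (pt e 0 (FM E) g (ai E e (pt 0 e (fst E e) h x))) = (g \<cdot> h) \<odot>\<^sub>(fst E e) x"
    unfolding 2[OF g c] i(3)[OF px] act(2)[OF D(1) g h x] ..
   then show "pt e 0 (FM E) g (ai E e (pt 0 e (fst E e) h x)) : car (Tn e 0 (FM E)) &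
     op_add R t (g \<cdot> h) \<odot>\<^sub>(fst E e) x = t \<odot>\<^sub>(fst E e) x \<oplus>\<^sub>(fst E e)
      eps E e (pt e 0 (FM E) g (ai E e (pt 0 e (fst E e) h x)))"
    using pt_closed[OF N g] c lmod_props(3)[OF D(1) t H_comp[OF h g] x] by simp
  qed
  then show "x : eps E e ` car (Tn e 0 (FM E))" unfolding lmod_props(6)[OF D(1) x] .
 qed (use additive_mapsE(2)[OF 1] in auto)
 with inj have "bij_betw (eps E e) (car (Tn e 0 (FM E))) (car (fst E e))" by (simp add: bij_betw_def)
 moreover have "eps E e : lin_maps (D_level R p a b 0) (Tn e 0 (FM E)) (fst E e)"
  by (rule lin_mapsI[OF 1], rule Tn_linear[OF N D(1) 1])
   (simp_all add: 2 H_comp smult_act[OF D(1)] i(1))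
 ultimately show "eps E e : lin_isos (D_level R p a b 0) (Tn e 0 (FM E)) (fst E e)" by (simp add: lin_isos_def)
qed

text \<open>Expresses \<open>eps E e\<close> through level \<open>e + 1\<close>, where it can be compared with the canonical isomorphism.\<close>

definition eps' :: "('a, 'u) divmod_data => nat => 'u => 'u" where
 "eps' E e = hom_lift R p a b (Suc e) 1 (FM E) (fst E e)
  (%\<theta> m. snd E e (mv 0 (Suc e) 1 (fst E (Suc e)) \<theta> (iai E (Suc e) m)))"

lemma eps':
 assumes E: "divobj E"
 shows "addf (Tn (Suc e) 1 (FM E)) (fst E e) (eps' E e)"
  "!!\<theta> m. \<theta> : H (Suc e) 1 ==> m : car (fst E 0) ==>
   eps' E e (pt (Suc e) 1 (FM E) \<theta> m) = snd E e (mv 0 (Suc e) 1 (fst E (Suc e)) \<theta> (iai E (Suc e) m))"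
  "!!z. z : car (Tn e 0 (FM E)) ==> eps' E e (Cartier_compat R p a b (FM E) e z) = eps E e z"
proof -
 note N = FM_lmod[OF E] and D = divobjD[OF E] and i = iai[OF E]
 note al = lin_mapsD[OF D(4)[of e]] and ala = addfD(2)[OF lin_mapsD(1)[OF D(4)[of e]]]
 let ?M = "fst E (Suc e)"
 let ?f = "%\<theta> m. snd E e (mv 0 (Suc e) 1 ?M \<theta> (iai E (Suc e) m))"
 note mvc = addfD[OF mv(1)[OF D(1)[of "Suc e"]]]
 have bal: "balanced (Suc e) 1 (FM E) (fst E e) ?f"
  by (rule balancedI)
   (simp_all add: al(2) mvc i(1) mv_add[OF D(1)] ala iai_add[OF E] iai_smult[OF E] mv_smult[OF D(1)])
 note l = lift[OF N lmod_props(1)[OF D(1)] bal, folded eps'_def]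
 show 1: "addf (Tn (Suc e) 1 (FM E)) (fst E e) (eps' E e)" by (rule additive_addf[OF l(1)])
 show 2: "!!\<theta> m. \<theta> : H (Suc e) 1 ==> m : car (fst E 0) ==> eps' E e (pt (Suc e) 1 (FM E) \<theta> m) = ?f \<theta> m"
  by (rule l(2)) simp_all
 have S: "\<theta> : H (Suc k) 1" if "\<theta> : H k 0" for \<theta> k using H_shift[OF that, of 1] by (simp add: Suc_eq_plus1)
 have S': "\<theta> : H 1 (Suc k)" if "\<theta> : H 0 k" for \<theta> k using H_shift[OF that, of 1] by (simp add: Suc_eq_plus1)
 note c = compat[OF N[of "Suc e"]] and c1 = cmp1[OF D(1)[of "Suc e"], where k = e]
 \<comment> \<open>The common representative \<open>w\<close> of \<open>m\<close> at both levels
   reduces the equation to the linearity of the structure map over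
   \<open>\<theta> \<cdot> h\<close>, an operator of level \<open>0\<close>.\<close>
 have key: "?f \<theta> m = act 0 e (fst E e) \<theta> (iai E e m)" if th: "\<theta> : H e 0" and m: "m : car (fst E 0)" for \<theta> m
 proof -
  obtain w where w: "w : car (Tn 0 e (Tn 0 1 ?M))" "iai E e m = tma E e w"
   "iai E (Suc e) m = cmp 1 0 0 e ?M w" by (rule iai_Suc[OF E m])
  have "snd E e (mv 0 (Suc e) 1 ?M \<theta> (cmp 1 0 0 e ?M w)) = act 0 e (fst E e) \<theta> (tma E e w)"
  proof (rule Tn_agree[OF D(3) lmod_props(1)[OF D(1)[of e]]
      addf_comp[OF additive_addf[OF c1(1)] addf_comp[OF mv(1)[OF D(1) S[OF th]] al(1)]]
      addf_comp[OF tm_addf[OF D(3) D(1) D(4)] act(1)[OF D(1) th]] w(1)])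
   fix h x assume h: "h : H 0 e" and x: "x : car (Tn 0 1 ?M)"
   show "snd E e (mv 0 (Suc e) 1 ?M \<theta> (cmp 1 0 0 e ?M (pt 0 e (Tn 0 1 ?M) h x)))
     = act 0 e (fst E e) \<theta> (tma E e (pt 0 e (Tn 0 1 ?M) h x))"
    unfolding c1(2)[OF h x] mv_mv[OF D(1) S'[OF h] S[OF th] x] tensor_map(2)[OF D(3) D(1) D(4) h x]
     act(2)[OF D(1) th h al(2)[OF x]]
    by (rule lin_mapsE(2)[OF D(4) H_comp[OF h th] x])
  qed
  then show ?thesis unfolding w(2,3) .
 qed
 show "eps' E e (Cartier_compat R p a b (FM E) e z) = eps E e z" if z: "z : car (Tn e 0 (FM E))" for z
  by (rule Tn_agree[OF N lmod_props(1)[OF D(1)[of e]] addf_comp[OF additive_addf[OF c(1)] 1] additive_addf[OF eps(1)[OF E]] z])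
   (simp add: c(2) 2 S key eps(2)[OF E])
qed

text \<open>Both sides are compared on \<open>\<phi>\<close> tensored with the tensor of
  \<open>\<psi>\<close> and \<open>m\<close>; \<open>eps'\<close> removes the inverse that is hidden
  in \<open>canonical_alpha\<close>.\<close>

lemma eps_divarr:
 assumes E: "divobj E" shows "divarr (TO (FM E)) E (eps E)"
 unfolding divarr_def fst_conv snd_conv
proof (intro allI conjI ballI)
 note N = FM_lmod[OF E] and D = divobjD[OF E]
 note el = lin_isosE(1)[OF eps(3)[OF E]]
 fix e
 show "eps E e : lin_maps (D_level R p a b 0) (Tn e 0 (FM E)) (fst E e)" by (rule el)
 let ?T = "Tn (Suc e) 0 (FM E)" and ?M = "fst E (Suc e)"
 have T: "lmod 0 ?T" by (rule Tn_lmod[OF N])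
 note can = canonical_alpha[OF N[of "Suc e"]]
 note canl = lin_mapsD[OF lin_isosE(1)[OF can(1)]]
 note c = cmp[OF N[of "Suc e"], where s = 0 and j = 0 and k = 1, unfolded add_0_right]
 note al = lin_mapsD[OF D(4)[of e]]
 fix w assume w: "w : car (Tn 0 1 ?T)"
 show "eps E e (canonical_alpha R p a b (FM E) e w) = snd E e (tm 0 1 ?T ?M (eps E (Suc e)) w)"
 proof (rule Tn_agree[OF T lmod_props(1)[OF D(1)[of e]] addf_comp[OF canl(1) lin_mapsD(1)[OF el]]
    addf_comp[OF tm_addf[OF T D(1) el] al(1)] w])
  fix \<phi> y assume ph: "\<phi> : H 0 1" and y: "y : car ?T"
  note py = pt_closed[OF T ph y]
  have "eps E e (canonical_alpha R p a b (FM E) e (pt 0 1 ?T \<phi> y)) = eps' E e (mv (Suc e) 0 1 (FM E) \<phi> y)"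
   unfolding eps'(3)[OF E canl(2)[OF py], symmetric] can(2)[OF py] c(2)[OF ph y] ..
  also have "\<dots> = snd E e (pt 0 1 ?M \<phi> (eps E (Suc e) y))"
  proof (rule Tn_agree[OF N lmod_props(1)[OF D(1)[of e]] addf_comp[OF mv(1)[OF N ph] eps'(1)[OF E]] _ y])
   have "addf ?M (Tn 0 1 ?M) (pt 0 1 ?M \<phi>)" by (simp add: addf_def pt_closed[OF D(1) ph] pt_add_right[OF D(1) ph])
   from addf_comp[OF lin_mapsD(1)[OF el] addf_comp[OF this al(1)]]
   show "addf ?T (fst E e) (%y. snd E e (pt 0 1 ?M \<phi> (eps E (Suc e) y)))" .
   fix \<psi> m assume ps: "\<psi> : H (Suc e) 0" and "m : car (FM E)"
   then have m: "m : car (fst E 0)" by simp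
   show "eps' E e (mv (Suc e) 0 1 (FM E) \<phi> (pt (Suc e) 0 (FM E) \<psi> m)) = snd E e (pt 0 1 ?M \<phi> (eps E (Suc e) (pt (Suc e) 0 (FM E) \<psi> m)))"
    using m by (simp add: mv(2)[OF N ph ps] eps'(2)[OF E H_comp[OF ps ph]] eps(2)[OF E ps] pt_act[OF D(1) ps ph iai(1)[OF E m]])
  qed
  finally show "eps E e (canonical_alpha R p a b (FM E) e (pt 0 1 ?T \<phi> y)) = snd E e (tm 0 1 ?T ?M (eps E (Suc e)) (pt 0 1 ?T \<phi> y))"
   unfolding tensor_map(2)[OF T D(1) el ph y] .
 qed
qed

text \<open>Induction along the iterated maps: the square of the morphism at level \<open>e\<close>
  is tensored up and joined to those below. This naturality makes the component at \<open>0\<close>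
  linear over all operators.\<close>

lemma morph_ai:
 assumes E: "divobj E" and E': "divobj E'" and f: "divarr E E' \<phi>" and v: "v : car (Tn 0 e (fst E e))"
 shows "ai E' e (tm 0 e (fst E e) (fst E' e) (\<phi> e) v) = \<phi> 0 (ai E e v)"
 using v
proof (induction e arbitrary: v)
 note D = divobjD[OF E] and D' = divobjD[OF E'] and fD = divarrD[OF f]
 {
  case 0
  show ?case
   by (rule Tn_agree[OF D(1) lmod_props(1)[OF D'(1)[of 0]] addf_comp[OF tm_addf[OF D(1) D'(1) fD(1)] ai_addf[OF E']]
      addf_comp[OF ai_addf[OF E] lin_mapsD(1)[OF fD(1)]] 0])
    (simp add: tensor_map(2)[OF D(1) D'(1) fD(1)] ai_zero(2)[OF E] ai_zero(2)[OF E'] lin_mapsD(2)[OF fD(1)]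
     lin_mapsE(2)[OF fD(1)])
 next
  case (Suc e)
  let ?M = "fst E (Suc e)" and ?M' = "fst E' (Suc e)"
  let ?t = "tm 0 1 ?M ?M' (\<phi> (Suc e))"
  note c = cmp1[OF D(1)[of "Suc e"], where k = e]
  obtain w where w: "w : car (Tn 0 e (Tn 0 1 ?M))" "v = cmp 1 0 0 e ?M w"
   using bij_inv(1,2)[OF c(3) Suc.prems] by metis
  have t: "?t : lin_maps (D_level R p a b 0) (Tn 0 1 ?M) (Tn 0 1 ?M')"
   by (rule lin_mono[OF tm_lin[OF D(1) D'(1) fD(1)]]) simp
  note w' = tm_closed[OF D(3) D'(3) t w(1)]
  have "tm 0 (Suc e) ?M ?M' (\<phi> (Suc e)) v = cmp 1 0 0 e ?M' (tm 0 e (Tn 0 1 ?M) (Tn 0 1 ?M') ?t w)"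
   unfolding w(2)
   by (rule tm_cmp[OF D(1) D'(1) fD(1), where s = 1 and j = 0 and k = e, unfolded add_0, unfolded Suc_eq_plus1[symmetric], OF t w(1)])
  then have "ai E' (Suc e) (tm 0 (Suc e) ?M ?M' (\<phi> (Suc e)) v) = ai E' e (tma E' e (tm 0 e (Tn 0 1 ?M) (Tn 0 1 ?M') ?t w))"
   using ai_Suc[OF E' w'] by simp
  also have "tma E' e (tm 0 e (Tn 0 1 ?M) (Tn 0 1 ?M') ?t w) = tm 0 e (fst E e) (fst E' e) (\<phi> e) (tma E e w)"
   by (rule Tn_agree[OF D(3) Tn_group[OF D'(1)] addf_comp[OF tm_addf[OF D(3) D'(3) t] tm_addf[OF D'(3) D'(1) D'(4)]]
      addf_comp[OF tm_addf[OF D(3) D(1) D(4)] tm_addf[OF D(1) D'(1) fD(1)]] w(1)])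
    (simp add: tensor_map(2)[OF D(3) D'(3) t] tensor_map(2)[OF D'(3) D'(1) D'(4)] tensor_map(2)[OF D(3) D(1) D(4)]
     tensor_map(2)[OF D(1) D'(1) fD(1)] lin_mapsD(2)[OF t] lin_mapsD(2)[OF D(4)] fD(2))
  also have "ai E' e \<dots> = \<phi> 0 (ai E e (tma E e w))" by (rule Suc.IH[OF tm_closed[OF D(3) D(1) D(4) w(1)]])
  also have "ai E e (tma E e w) = ai E (Suc e) v" unfolding w(2) using ai_Suc[OF E w(1)] by simp
  finally show ?case .
 }
qed

lemma morph_iai:
 assumes E: "divobj E" and E': "divobj E'" and f: "divarr E E' \<phi>" and m: "m : car (fst E 0)"
 shows "iai E' e (\<phi> 0 m) = tm 0 e (fst E e) (fst E' e) (\<phi> e) (iai E e m)"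
proof -
 note i = iai[OF E]
 have 1: "ai E' e (tm 0 e (fst E e) (fst E' e) (\<phi> e) (iai E e m)) = \<phi> 0 m"
  unfolding morph_ai[OF E E' f i(1)[OF m]] i(2)[OF m] ..
 have "iai E' e (ai E' e (tm 0 e (fst E e) (fst E' e) (\<phi> e) (iai E e m))) = tm 0 e (fst E e) (fst E' e) (\<phi> e) (iai E e m)"
  by (rule iai(3)[OF E' tm_closed[OF divobjD(1)[OF E] divobjD(1)[OF E'] divarrD(1)[OF f] i(1)[OF m]]])
 then show ?thesis unfolding 1 .
qed

lemma FM_lin:
 assumes E: "divobj E" and E': "divobj E'" and f: "divarr E E' \<phi>"
 shows "\<phi> 0 : lin_maps (D_level R p a b i) (FM E) (FM E')"
proof (rule lin_mapsI)
 note D = divobjD[OF E] and D' = divobjD[OF E'] and fD = divarrD[OF f]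
 show "\<phi> 0 : additive_maps (FM E) (FM E')" using lin_mapsE(1)[OF fD(1)[of 0]] by (simp add: additive_maps_def)
 fix d m assume d: "d : H i i" and "m : car (FM E)"
 then have m: "m : car (fst E 0)" by simp
 note im = iai(1)[OF E m, of i]
 show "\<phi> 0 (d \<odot>\<^sub>(FM E) m) = d \<odot>\<^sub>(FM E') \<phi> 0 m"
  unfolding FM_simps tr_eq[OF E d m] tr_eq[OF E' d lin_mapsD(2)[OF fD(1) m]] morph_iai[OF E E' f m]
   morph_ai[OF E E' f Tn_smult(1)[OF D(1) d im], symmetric] tm_smult[OF D(1) D'(1) fD(1) d im] ..
qed

lemma eps_natural:
 assumes E: "divobj E" and E': "divobj E'" and f: "divarr E E' \<phi>" and u: "u : car (Tn e 0 (FM E))"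
 shows "eps E' e (tm e 0 (FM E) (FM E') (\<phi> 0) u) = \<phi> e (eps E e u)"
proof -
 note D = divobjD[OF E] and D' = divobjD[OF E'] and fD = divarrD[OF f]
 note N = FM_lmod[OF E] and N' = FM_lmod[OF E'] and fl = FM_lin[OF E E' f]
 show ?thesis
  by (rule Tn_agree[OF N lmod_props(1)[OF D'(1)[of e]] addf_comp[OF tm_addf[OF N N' fl] additive_addf[OF eps(1)[OF E']]]
     addf_comp[OF additive_addf[OF eps(1)[OF E]] lin_mapsD(1)[OF fD(1)]] u])
   (simp add: tensor_map(2)[OF N N' fl] eps(2)[OF E] eps(2)[OF E'] lin_mapsD(2)[OF fD(1)] morph_iai[OF E E' f]
    act_tm[OF D(1) D'(1) fD(1)] iai(1)[OF E])
qed

text \<open>The square is checked after the injective compatibility map, where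
  \<open>canonical_alpha\<close> turns into \<open>cmp\<close>, which is natural by
  \<open>tm_cmp\<close>.\<close>

lemma TO_divarr:
 assumes M: "!!e. lmod e M" and N: "!!e. lmod e N" and f: "!!e. f : lin_maps (D_level R p a b e) M N"
 shows "divarr (TO M) (TO N) (%e. tm e 0 M N f)"
 unfolding divarr_def fst_conv snd_conv
proof (intro allI conjI ballI)
 fix e
 show l: "tm e 0 M N f : lin_maps (D_level R p a b 0) (Tn e 0 M) (Tn e 0 N)" for e by (rule tm_lin[OF M N f])
 note can = canonical_alpha[OF M[of "Suc e"]] and can' = canonical_alpha[OF N[of "Suc e"]]
 note cl = lin_mapsD(2)[OF lin_isosE(1)[OF can(1)]] and cl' = lin_mapsD(2)[OF lin_isosE(1)[OF can'(1)]]
 have S: "\<theta> : H (Suc k) 1" if "\<theta> : H k 0" for \<theta> k using H_shift[OF that, of 1] by (simp add: Suc_eq_plus1)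
 note c = compat[OF M[of "Suc e"]] and c' = compat[OF N[of "Suc e"]]
 have nat: "Cartier_compat R p a b N e (tm e 0 M N f z) = tm (Suc e) 1 M N f (Cartier_compat R p a b M e z)"
  if z: "z : car (Tn e 0 M)" for z
  by (rule Tn_agree[OF M Tn_group[OF N] addf_comp[OF tm_addf[OF M N f] additive_addf[OF c'(1)]]
     addf_comp[OF additive_addf[OF c(1)] tm_addf[OF M N f]] z])
   (simp add: tensor_map(2)[OF M N f] c(2) c'(2) S lin_mapsD(2)[OF f])
 fix w assume w: "w : car (Tn 0 1 (Tn (Suc e) 0 M))"
 note T = Tn_lmod[OF M[of "Suc e"], of 0] and T' = Tn_lmod[OF N[of "Suc e"], of 0]
 note tw = tm_closed[OF T T' l w]
 show "tm e 0 M N f (canonical_alpha R p a b M e w) =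
   canonical_alpha R p a b N e (tm 0 1 (Tn (Suc e) 0 M) (Tn (Suc e) 0 N) (tm (Suc e) 0 M N f) w)"
 proof (rule bij_inv(4)[OF c'(3) tm_closed[OF M N f cl[OF w]] cl'[OF tw]])
  show "Cartier_compat R p a b N e (tm e 0 M N f (canonical_alpha R p a b M e w)) =
   Cartier_compat R p a b N e (canonical_alpha R p a b N e (tm 0 1 (Tn (Suc e) 0 M) (Tn (Suc e) 0 N) (tm (Suc e) 0 M N f) w))"
   unfolding nat[OF cl[OF w]] can(2)[OF w] can'(2)[OF tw]
   by (rule tm_cmp[OF M N f, where s = 0 and j = 0 and k = 1, unfolded add_0_right, OF l w])
 qed
qed

end

section \<open>The ring of differential operators as the union of the levels\<close>

locale frob_diff = frob_levels R p a b code
 for R :: "('a, 'k) ring_scheme" (structure) and p a b :: nat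
  and code :: "((('a => 'a) \<times> 'u) \<Rightarrow>\<^sub>0 int) => 'u" +
 assumes diff_ops: "(\<Union>n. diff_ops_upto R n) = (\<Union>i. HomF R p a b i i)"
begin

lemma D_ring_eq: "D_ring R = op_ring R (\<Union>i. H i i)" by (simp add: D_ring_def diff_ops)

lemma D_ring_carrier: "d : car (D_ring R) \<longleftrightarrow> (\<exists>i. d : H i i)"
 unfolding D_ring_eq by (simp add: op_ring_def)

lemma D_common_level:
 assumes "c : (\<Union>i. H i i)" "d : (\<Union>i. H i i)" obtains k where "c : H k k" "d : H k k"
proof -
 obtain i j where "c : H i i" "d : H j j" using assms by blast
 then show ?thesis by (intro that[of "max i j"] H_mono[of i "max i j"] H_mono[of j "max i j"]) simp_all
qed

lemma D_ring_ring: "ring (D_ring R)"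
 unfolding D_ring_eq
proof (rule op_ring_axioms)
 show "(\<Union>i. H i i) <= additive_maps R R" by (rule UN_least subsetI)+ (rule H_additive)
 show "zero_map : (\<Union>i. H i i)" by (rule UN_I[where a = "0 :: nat"]) (rule UNIV_I H_zero)+
 show "idm : (\<Union>i. H i i)" by (rule UN_I[where a = "0 :: nat"]) (rule UNIV_I H_id)+
 show "(\<lambda>x\<in>car R. \<ominus> \<delta> x) : (\<Union>i. H i i)" if "\<delta> : (\<Union>i. H i i)" for \<delta>
  using that by (elim UN_E) (rule UN_I, rule UNIV_I, rule H_neg)
 fix c d assume "c : (\<Union>i. H i i)" "d : (\<Union>i. H i i)"
 then obtain k where k: "c : H k k" "d : H k k" by (rule D_common_level)
 show "op_add R c d : (\<Union>i. H i i)" by (rule UN_I[where a = k]) (rule UNIV_I H_add[OF k])+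
 show "c \<cdot> d : (\<Union>i. H i i)" by (rule UN_I[where a = k]) (rule UNIV_I H_comp[OF k(2,1)])+
qed

text \<open>Each module law involves at most two operators, and any two operators have a common
  level.\<close>

lemma D_module_iff: "left_module (D_ring R) M \<longleftrightarrow> (\<forall>i. lmod i M)"
proof
 assume "left_module (D_ring R) M"
 then interpret left_module "D_ring R" M .
 have c: "d : car (D_ring R)" if "d : H i i" for d i using that D_ring_carrier by blast
 note s = smult_closed smult_l_distr smult_r_distr smult_assoc
 have o: "add (D_ring R) = op_add R" "monoid.mult (D_ring R) = compose (car R)" "\<one>\<^sub>(D_ring R) = idm"
  by (simp_all only: D_ring_eq op_ring_def ring_record_simps monoid.simps)
 show "\<forall>i. lmod i M"
 proof
  fix i
  show "lmod i M"
   by (rule lmodI[OF M.abelian_group_axioms s(1)[OF c] s(2)[unfolded o, OF c c] s(3)[OF c] s(4)[unfolded o, OF c c] smult_one[unfolded o]])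
 qed
next
 assume M: "\<forall>i. lmod i M"
 note P = lmod_props[OF M[rule_format]]
 have "left_module_axioms (op_ring R (\<Union>i. H i i)) M"
 proof (rule left_module_axioms.intro, unfold op_ring_def ring_record_simps monoid.simps)
  fix c x assume "c : (\<Union>i. H i i)" "x : car M"
  then show "c \<odot>\<^sub>M x : car M" by (elim UN_E) (rule P(2))
 next
  fix c d x assume c: "c : (\<Union>i. H i i)" and d: "d : (\<Union>i. H i i)" and x: "x : car M"
  obtain k where k: "c : H k k" "d : H k k" by (rule D_common_level[OF c d])
  show "op_add R c d \<odot>\<^sub>M x = c \<odot>\<^sub>M x \<oplus>\<^sub>M d \<odot>\<^sub>M x" by (rule P(3)[OF k x])
  show "(c \<cdot> d) \<odot>\<^sub>M x = c \<odot>\<^sub>M (d \<odot>\<^sub>M x)" by (rule P(5)[OF k x])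
 next
  fix c x y assume "c : (\<Union>i. H i i)" "x : car M" "y : car M"
  then show "c \<odot>\<^sub>M (x \<oplus>\<^sub>M y) = c \<odot>\<^sub>M x \<oplus>\<^sub>M c \<odot>\<^sub>M y" by (elim UN_E) (rule P(4))
 next
  fix x assume "x : car M" then show "idm \<odot>\<^sub>M x = x" by (rule P(6))
 qed
 then show "left_module (D_ring R) M"
  unfolding D_ring_eq by (intro left_module.intro D_ring_ring[unfolded D_ring_eq] P(1))
qed

lemma D_lin_maps_iff: "f : lin_maps (D_ring R) M N \<longleftrightarrow> (\<forall>i. f : lin_maps (D_level R p a b i) M N)"
proof
 assume f: "f : lin_maps (D_ring R) M N"
 have c: "d : car (D_ring R)" if "d : H i i" for d i using that D_ring_carrier by blast
 show "\<forall>i. f : lin_maps (D_level R p a b i) M N"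
  by (intro allI lin_mapsI lin_maps_apply(4)[OF f] lin_maps_apply(3)[OF f c])
next
 assume f: "\<forall>i. f : lin_maps (D_level R p a b i) M N"
 have "f (d \<odot>\<^sub>M m) = d \<odot>\<^sub>N f m" if d: "d : car (D_ring R)" and m: "m : car M" for d m
 proof -
  obtain i where "d : H i i" using d D_ring_carrier by blast
  then show ?thesis by (rule lin_mapsE(2)[OF f[rule_format]]) (rule m)
 qed
 then show "f : lin_maps (D_ring R) M N" unfolding lin_maps_def using lin_mapsE(1)[OF f[rule_format]] by blast
qed

abbreviation DMod :: "(('a => 'a, 'u) module, 'u => 'u) category" where "DMod \<equiv> left_mod_cat (D_ring R)"
abbreviation DivMod :: "(('a, 'u) divmod_data, nat => 'u => 'u) category" where "DivMod \<equiv> Phi_divmod_cat R p a b"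

lemma DMod_simps:
 "M : obj DMod \<longleftrightarrow> (\<forall>i. lmod i M)" "f : arr DMod M N \<longleftrightarrow> (\<forall>i. f : lin_maps (D_level R p a b i) M N)"
 by (simp_all add: left_mod_cat_simps D_module_iff D_lin_maps_iff)

lemma functor_simps:
 "fst (to_divmod R p a b) M = TO M" "snd (to_divmod R p a b) M N f = (%e. tm e 0 M N f)"
 "fst (from_divmod R p a b) E = FM E" "snd (from_divmod R p a b) E E' \<phi> = \<phi> 0"
 by (simp_all add: to_divmod_def from_divmod_def FM_def)

lemma to_divmod_functor: "is_functor DMod DivMod (to_divmod R p a b)"
 unfolding is_functor_def functor_simps divmod_cat_simps left_mod_cat_simps(3,4) fst_conv
proof (intro conjI ballI)
 fix M assume "M : obj DMod"
 then have M: "!!i. lmod i M" by (simp add: DMod_simps)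
 show "divobj (TO M)" by (rule TO_divobj[OF M])
 have "tm e 0 M M (\<lambda>x\<in>car M. x) = (\<lambda>x\<in>car (Tn e 0 M). x)" for e
  by (rule lin_maps_ext[OF tm_lin[OF M M id_lin[OF M]] id_lin[OF Tn_lmod[OF M]]]) (simp add: tm_id[OF M id_lin[OF M]])
 then show "(%e. tm e 0 M M (\<lambda>x\<in>car M. x)) = (%e. \<lambda>x\<in>car (Tn e 0 M). x)" by blast
next
 fix M N f assume "M : obj DMod" "N : obj DMod" "f : arr DMod M N"
 then show "divarr (TO M) (TO N) (%e. tm e 0 M N f)" by (intro TO_divarr) (simp_all add: DMod_simps)
next
 fix L M N f g assume "L : obj DMod" "M : obj DMod" "N : obj DMod" "f : arr DMod L M" "g : arr DMod M N"
 then have o: "!!i. lmod i L" "!!i. lmod i M" "!!i. lmod i N"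
  and f: "!!i. f : lin_maps (D_level R p a b i) L M" and g: "!!i. g : lin_maps (D_level R p a b i) M N" by (simp_all add: DMod_simps)
 note gf = lin_maps_compose[OF o(1) f g]
 have "tm e 0 L N (compose (car L) g f) = compose (car (Tn e 0 L)) (tm e 0 M N g) (tm e 0 L M f)" for e
 proof (rule lin_maps_ext[OF tm_lin[OF o(1,3) gf] lin_maps_compose[OF Tn_lmod[OF o(1)] tm_lin[OF o(1,2) f] tm_lin[OF o(2,3) g]]])
  fix u assume u: "u : car (Tn e 0 L)"
  have "tm e 0 M N g (tm e 0 L M f u) = tm e 0 L N (compose (car L) g f) u"
   by (rule tm_comp[OF o f g gf _ u]) (simp add: compose_def)
  then show "tm e 0 L N (compose (car L) g f) u = compose (car (Tn e 0 L)) (tm e 0 M N g) (tm e 0 L M f) u"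
   using u by (simp add: compose_def)
 qed
 then show "(%e. tm e 0 L N (compose (car L) g f)) = (%e. compose (car (Tn e 0 L)) (tm e 0 M N g) (tm e 0 L M f))" by blast
qed

lemma from_divmod_functor: "is_functor DivMod DMod (from_divmod R p a b)"
 unfolding is_functor_def functor_simps divmod_cat_simps(2-4) left_mod_cat_simps(3,4) FM_simps
 by (intro conjI ballI) (simp_all add: DMod_simps divmod_cat_simps(1,2) FM_lmod FM_lin)

lemma from_to_natural: "naturally_isomorphic DMod DMod (comp_functor (from_divmod R p a b) (to_divmod R p a b)) id_functor"
 unfolding naturally_isomorphic_def comp_functor_def id_functor_def fst_conv snd_conv functor_simps left_mod_cat_simps(4) FM_simps
proof (intro exI[of _ "%M. act 0 0 M idm"] conjI ballI)
 fix M assume "M : obj DMod"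
 then have M: "!!i. lmod i M" by (simp add: DMod_simps)
 have "act 0 0 M idm : lin_isos (D_ring R) (FM (TO M)) M"
  unfolding lin_isos_def using eta[OF M] by (auto simp: D_lin_maps_iff intro: lin_mapsI)
 moreover have "left_module (D_ring R) (FM (TO M))" "left_module (D_ring R) M"
  unfolding D_module_iff using FM_lmod[OF TO_divobj[OF M]] M by blast+
 ultimately show "iso_arr DMod (FM (TO M)) M (act 0 0 M idm)" by (intro left_mod_cat_iso)
next
 fix M N f assume "M : obj DMod" "N : obj DMod" "f : arr DMod M N"
 then have o: "!!i. lmod i M" "!!i. lmod i N" and f: "!!i. f : lin_maps (D_level R p a b i) M N" by (simp_all add: DMod_simps)
 show "compose (car (Tn 0 0 M)) (act 0 0 N idm) (tm 0 0 M N f) = compose (car (Tn 0 0 M)) f (act 0 0 M idm)"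
  unfolding compose_eq_iff using act_tm[OF o f H_id] by blast
qed

lemma to_from_natural: "naturally_isomorphic DivMod DivMod (comp_functor (to_divmod R p a b) (from_divmod R p a b)) id_functor"
 unfolding naturally_isomorphic_def comp_functor_def id_functor_def fst_conv snd_conv functor_simps divmod_cat_simps(4)
proof (intro exI[of _ eps] conjI ballI)
 fix E :: "('a, 'u) divmod_data" assume "E : obj DivMod"
 then have E: "divobj E" by (simp add: divmod_cat_simps)
 show "iso_arr DivMod (TO (FM E)) E (eps E)"
  by (rule divmod_cat_iso[OF TO_divobj[OF FM_lmod[OF E]] E eps_divarr[OF E]]) (simp add: eps(3)[OF E])
next
 fix E E' :: "('a, 'u) divmod_data" and \<phi> assume "E : obj DivMod" "E' : obj DivMod" "\<phi> : arr DivMod E E'"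
 then have E: "divobj E" "divobj E'" "divarr E E' \<phi>" by (simp_all add: divmod_cat_simps)
 have "compose (car (Tn e 0 (FM E))) (eps E' e) (tm e 0 (FM E) (FM E') (\<phi> 0)) = compose (car (Tn e 0 (FM E))) (\<phi> e) (eps E e)" for e
  unfolding compose_eq_iff using eps_natural[OF E] by blast
 then show "(%e. compose (car (Tn e 0 (FM E))) (eps E' e) (tm e 0 (FM E) (FM E') (\<phi> 0))) =
   (%e. compose (car (Tn e 0 (FM E))) (\<phi> e) (eps E e))" by blast
qed

theorem divmod_equivalence:
 "mutually_inverse DMod DivMod (to_divmod R p a b) (from_divmod R p a b)"
 "is_equivalence DMod DivMod (to_divmod R p a b)" "is_equivalence DivMod DMod (from_divmod R p a b)"
proof -
 show 1: "mutually_inverse DMod DivMod (to_divmod R p a b) (from_divmod R p a b)"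
  unfolding mutually_inverse_def using to_divmod_functor from_divmod_functor from_to_natural to_from_natural by blast
 then have 2: "mutually_inverse DivMod DMod (from_divmod R p a b) (to_divmod R p a b)"
  unfolding mutually_inverse_def by blast
 have "is_category DMod" by (rule left_mod_cat_category)
 then show "is_equivalence DMod DivMod (to_divmod R p a b)" "is_equivalence DivMod DMod (from_divmod R p a b)"
  unfolding is_equivalence_def using 1 2 divmod_cat_category by blast+
qed

end

theorem theorem4p13:
  fixes R :: "('r, 'k) ring_scheme" and p a b :: nat
  assumes prime_p: "Factorial_Ring.prime p"
    and cring: "cring R"
    and char_p: "has_characteristic R p"
    and CL_FFRT: "CL_FFRT R p"
    and b_pos: "b > 0"
    and stable: "\<And>P k. primeideal P R \<Longrightarrow>
      KS_classes (completed_local_ring R P) (frob_push (completed_local_ring R P) p (a + k * b)) =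
      KS_classes (completed_local_ring R P) (frob_push (completed_local_ring R P) p a)"
    and universe_infinite: "infinite (UNIV :: 'u set)"
    and universe_large: "(UNIV :: ('r \<Rightarrow> 'r) set) \<lesssim> (UNIV :: 'u set)"
  shows "let DMod = (left_mod_cat (D_ring R) :: (('r \<Rightarrow> 'r, 'u) module, 'u \<Rightarrow> 'u) category);
             DivMod = (Phi_divmod_cat R p a b :: (('r, 'u) divmod_data, nat \<Rightarrow> 'u \<Rightarrow> 'u) category)
    in mutually_inverse DMod DivMod (to_divmod R p a b) (from_divmod R p a b) \<and>
       is_equivalence DMod DivMod (to_divmod R p a b) \<and>
       is_equivalence DivMod DMod (from_divmod R p a b)"
proof -
  interpret cring R by (rule cring)
  have char: "char_ring R p"
    using prime_p char_p by (intro char_ring.intro char_ring_axioms.intro cring) (simp_all add: has_characteristic_def)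
  then interpret char_ring R p .
  obtain code :: "((('r \<Rightarrow> 'r) \<times> 'u) \<Rightarrow>\<^sub>0 int) \<Rightarrow> 'u" where "inj code"
    using ex_inj_frag_code[OF universe_infinite universe_large] by blast
  \<comment> \<open>For all \<open>i\<close> and \<open>j\<close> the classes at both levels equal
    those at \<open>a\<close> by \<open>stable\<close>, and maximal ideals are prime.\<close>
  moreover have "(\<lambda>x\<in>carrier R. x) \<in> comp_sums R p (a + i * b) (a + j * b)" for i j
    by (rule comp_sums_of_stable_KS[OF char CL_FFRT]) (simp add: stable maximalideal_prime)
  moreover have "(\<Union>n. diff_ops_upto R n) = (\<Union>i. HomF R p a b i i)"
    unfolding HomF_def by (rule diff_ops_eq_frob_maps) (use CL_FFRT b_pos in \<open>simp_all add: CL_FFRT_def\<close>)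
  ultimately interpret frob_diff R p a b code by unfold_locales
  show ?thesis unfolding Let_def using divmod_equivalence by blast
qed

end
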